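(* Let $l$ be a prime and let $f=f(x,y)$ be an element of $F_2^{(l)}$ satisfying $$f(x_{12},x_{23}x_{24})\,f(x_{13}x_{23},x_{34})=f(x_{23},x_{34})\,f(x_{12}x_{13},x_{24}x_{34})\,f(x_{12},x_{23})$$ in $K_4^{(l)}$. Then there exists $\lambda\in\overline{\mathbf Q}_l$ such that the pair $(\lambda,f)$ satisfies $$f(z,x)z^mf(y,z)y^mf(x,y)x^m=1\quad\text{with } xyz=1\text{ and } m=\frac{\lambda-1}{2},$$ $$f(x,y)f(y,x)=1.$$ Moreover, this $\lambda$ is equal to $\pm(24c_2(f)+1)^{1/2}$.
   Context: $F_2^{(l)}$ is the pro-$l$ completion of the free group on $x,y$. It embeds naturally in $F_2(\mathbf Q_l)$, the $\mathbf Q_l$-points of the free pro-unipotent group on $x,y$, which is identified via $x\mapsto e^X$, $y\mapsto e^Y$ with the group of group-like elements of $\mathbf Q_l\langle\langle X,Y\rangle\rangle$ (constant term $1$ and $\Delta(\varphi)=\varphi\otimes\varphi$, with $X,Y$ primitive). $c_2(f)$ is the coefficient of $XY$ in $f(e^X,e^Y)\in\mathbf Q_l\langle\langle X,Y\rangle\rangle$. Since $\lambda$ may lie in a quadratic extension of $\mathbf Q_l$, the first displayed relation of the conclusion is understood in $F_2(\overline{\mathbf Q}_l)$, where $a^m=\exp(m\log a)$. For elements $a,b$ of a pro-$l$ (or pro-unipotent) group, $f(a,b)$ is the image of $f$ under the continuous homomorphism with $x\mapsto a$, $y\mapsto b$. $K_4^{(l)}$ is the pro-$l$ completion of the pure braid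 group $K_4=\ker(B_4\to\mathfrak S_4)$ on $4$ strings ($B_4$ the Artin braid group with generators $\sigma_1,\sigma_2,\sigma_3$), with standard generators $x_{ij}=(\sigma_{j-1}\cdots\sigma_{i+1})\,\sigma_i^2\,(\sigma_{j-1}\cdots\sigma_{i+1})^{-1}$ for $1\le i<j\le4$. *)

theory Defs
  imports
    "HOL-Analysis.Function_Topology"
    "HOL-Algebra.Coset"
    "HOL-Algebra.Sym_Groups"
    "HOL-Algebra.Algebraic_Closure_Type"
    "HOL-Computational_Algebra.Fraction_Field"
    "Berlekamp_Zassenhaus.Finite_Field"
begin

section \<open>The field of \<open>l\<close>-adic numbers\<close>

text \<open>The prime \<open>l\<close> is carried by a type of cardinality \<open>l\<close>. An element of
  \<open>'l padic_int\<close> is a compatible system of representatives of residues modulo \<open>l ^ n\<close>.\<close>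

typedef (overloaded) ('l :: prime_card) padic_int =
  "{s :: nat \<Rightarrow> int. \<forall>n. s (Suc n) mod int CARD('l) ^ n = s n}"
  by (rule exI[of _ "\<lambda>_. 0"]) simp

setup_lifting type_definition_padic_int

lemma padic_residue_mod_aux:
  fixes s :: "nat \<Rightarrow> int"
  assumes "\<forall>n. s (Suc n) mod l ^ n = s n"
  shows "s (n + k) mod l ^ n = s n"
proof (induction k)
  case 0
  have "s (Suc n) mod l ^ n mod l ^ n = s (Suc n) mod l ^ n" by simp
  then show ?case using assms by simp
next
  case (Suc k)
  have "s (n + k) mod l ^ n = s (Suc (n + k)) mod l ^ (n + k) mod l ^ n"
    using assms by simp
  also have "\<dots> = s (Suc (n + k)) mod l ^ n"
    by (rule mod_mod_cancel) (simp add: le_imp_power_dvd)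
  finally show ?case using Suc by simp
qed

lemma padic_compat_aux:
  fixes l a :: int
  shows "a mod l ^ Suc n mod l ^ n = a mod l ^ n"
  by (rule mod_mod_cancel) (simp add: le_imp_power_dvd)

instantiation padic_int :: (prime_card) idom
begin

lift_definition zero_padic_int :: "'a padic_int" is "\<lambda>_. 0" by simp

lift_definition one_padic_int :: "'a padic_int" is "\<lambda>n. 1 mod int CARD('a) ^ n"
  by (intro allI padic_compat_aux)

lift_definition plus_padic_int :: "'a padic_int \<Rightarrow> 'a padic_int \<Rightarrow> 'a padic_int"
  is "\<lambda>s t n. (s n + t n) mod int CARD('a) ^ n"
  by (simp only: padic_compat_aux) (metis mod_add_eq)

lift_definition uminus_padic_int :: "'a padic_int \<Rightarrow> 'a padic_int"
  is "\<lambda>s n. (- s n) mod int CARD('a) ^ n"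
  by (simp only: padic_compat_aux) (metis mod_minus_eq)

lift_definition minus_padic_int :: "'a padic_int \<Rightarrow> 'a padic_int \<Rightarrow> 'a padic_int"
  is "\<lambda>s t n. (s n - t n) mod int CARD('a) ^ n"
  by (simp only: padic_compat_aux) (metis mod_diff_eq)

lift_definition times_padic_int :: "'a padic_int \<Rightarrow> 'a padic_int \<Rightarrow> 'a padic_int"
  is "\<lambda>s t n. (s n * t n) mod int CARD('a) ^ n"
  by (simp only: padic_compat_aux) (metis mod_mult_eq)

instance
proof
  fix a b c :: "'a padic_int"
  have reduced: "s n mod int CARD('a) ^ n = s n"
    if "\<forall>n. s (Suc n) mod int CARD('a) ^ n = s n" for s n
    using padic_residue_mod_aux[OF that, of n 0] by simp
  show "a * b * c = a * (b * c)"
    by transfer (simp add: fun_eq_iff mod_simps mult.assoc)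
  show "a * b = b * a"
    by transfer (simp add: fun_eq_iff mult.commute)
  show "1 * a = a"
    by transfer (simp add: fun_eq_iff mod_simps reduced)
  show "a + b + c = a + (b + c)"
    by transfer (simp add: fun_eq_iff mod_simps add.assoc)
  show "a + b = b + a"
    by transfer (simp add: fun_eq_iff add.commute)
  show "0 + a = a"
    by transfer (simp add: fun_eq_iff reduced)
  show "- a + a = 0"
    by transfer (simp add: fun_eq_iff mod_simps)
  show "a - b = a + - b"
    by transfer (simp add: fun_eq_iff mod_simps)
  show "(a + b) * c = a * c + b * c"
    by transfer (simp add: fun_eq_iff mod_simps distrib_right)
  show "a * (b + c) = a * b + a * c"
    by transfer (simp add: fun_eq_iff mod_simps distrib_left)
  show "0 * a = 0" "a * 0 = 0"
    by (transfer, simp)+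
  have l: "prime (int CARD('a))" by (rule prime_card_int)
  show "(0 :: 'a padic_int) \<noteq> 1"
  proof transfer
    have "(1 :: int) mod int CARD('a) ^ 1 = 1"
      using prime_gt_1_int[OF l] by simp
    then show "(\<lambda>_. 0) \<noteq> (\<lambda>n. 1 mod int CARD('a) ^ n)"
      by (metis zero_neq_one)
  qed
  show "a * b \<noteq> 0" if "a \<noteq> 0" "b \<noteq> 0"
    using that
  proof transfer
    fix s t :: "nat \<Rightarrow> int"
    assume s: "\<forall>n. s (Suc n) mod int CARD('a) ^ n = s n"
      and t: "\<forall>n. t (Suc n) mod int CARD('a) ^ n = t n"
      and "s \<noteq> (\<lambda>_. 0)" and "t \<noteq> (\<lambda>_. 0)"
    then obtain i j where ij: "s i \<noteq> 0" "t j \<noteq> 0" by blast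
    define N where "N = i + j"
    have nd: "\<not> int CARD('a) ^ i dvd s N" "\<not> int CARD('a) ^ j dvd t N"
      using padic_residue_mod_aux[OF s, of i j] padic_residue_mod_aux[OF t, of j i] ij
      by (simp_all add: N_def dvd_eq_mod_eq_0 add.commute)
    then have nz: "s N \<noteq> 0" "t N \<noteq> 0" by auto
    have "multiplicity (int CARD('a)) (s N) < i" "multiplicity (int CARD('a)) (t N) < j"
      using nd multiplicity_dvd' not_le by blast+
    then have "multiplicity (int CARD('a)) (s N * t N) < N"
      using l nz by (simp add: N_def prime_elem_multiplicity_mult_distrib)
    then have "\<not> int CARD('a) ^ N dvd s N * t N"
      using l nz by (metis mult_eq_0_iff multiplicity_geI not_le not_prime_unit
          normalization_semidom_class.prime_def)
    then show "(\<lambda>n. s n * t n mod int CARD('a) ^ n) \<noteq> (\<lambda>_. 0)"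
      by (metis dvd_eq_mod_eq_0)
  qed
qed

end

type_synonym 'l padic = "'l padic_int fract"

definition padic_topology :: "'l::prime_card padic topology" where
  "padic_topology = topology_generated_by
     {{x + of_nat CARD('l) ^ n * Fract a 1 | a. True} | x n. True}"


section \<open>Non-commutative formal power series\<close>

text \<open>A series is the family of its coefficients, indexed by the words in the variables.\<close>

typedef ('g, 'a) ncfps = "UNIV :: ('g list \<Rightarrow> 'a) set"
  morphisms nc_coeff Abs_ncfps by simp

setup_lifting type_definition_ncfps

lemma ncfps_eqI: "(\<And>w. nc_coeff f w = nc_coeff g w) \<Longrightarrow> f = g"
  by (simp add: nc_coeff_inject[symmetric] fun_eq_iff)

instantiation ncfps :: (type, ring_1) ring_1
begin

lift_definition zero_ncfps :: "('a, 'b) ncfps" is "\<lambda>_. 0" .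

lift_definition one_ncfps :: "('a, 'b) ncfps" is "\<lambda>w. if w = [] then 1 else 0" .

lift_definition plus_ncfps :: "('a, 'b) ncfps \<Rightarrow> ('a, 'b) ncfps \<Rightarrow> ('a, 'b) ncfps"
  is "\<lambda>f g w. f w + g w" .

lift_definition uminus_ncfps :: "('a, 'b) ncfps \<Rightarrow> ('a, 'b) ncfps"
  is "\<lambda>f w. - f w" .

lift_definition minus_ncfps :: "('a, 'b) ncfps \<Rightarrow> ('a, 'b) ncfps \<Rightarrow> ('a, 'b) ncfps"
  is "\<lambda>f g w. f w - g w" .

lift_definition times_ncfps :: "('a, 'b) ncfps \<Rightarrow> ('a, 'b) ncfps \<Rightarrow> ('a, 'b) ncfps"
  is "\<lambda>f g w. \<Sum>i = 0..length w. f (take i w) * g (drop i w)" .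

instance
proof
  fix f g h :: "('a, 'b) ncfps"
  show "f * g * h = f * (g * h)"
  proof (rule ncfps_eqI)
    fix w :: "'a list"
    let ?n = "length w"
    let ?F = "\<lambda>i j k. nc_coeff f (take i w) * nc_coeff g (take j (drop i w))
                        * nc_coeff h (drop (i + j) w)"
    have "nc_coeff (f * g * h) w = (\<Sum>j = 0..?n. \<Sum>i = 0..j. ?F i (j - i) (?n - j))"
      by (auto simp: times_ncfps.rep_eq sum_distrib_right min_absorb2 drop_take
          intro!: sum.cong)
    also have "\<dots> = (\<Sum>j = 0..?n. \<Sum>i = 0..?n - j. ?F j i (?n - j - i))"
      by (rule fps_mult_assoc_lemma)
    also have "\<dots> = nc_coeff (f * (g * h)) w"
      by (auto simp: times_ncfps.rep_eq sum_distrib_left mult.assoc add.commute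
          intro!: sum.cong)
    finally show "nc_coeff (f * g * h) w = nc_coeff (f * (g * h)) w" .
  qed
  show "1 * f = f"
  proof (rule ncfps_eqI)
    fix w :: "'a list"
    have "nc_coeff (1 * f) w =
        (\<Sum>i = 0..length w. if i = 0 then nc_coeff f w else 0)"
      unfolding times_ncfps.rep_eq one_ncfps.rep_eq by (rule sum.cong) auto
    then show "nc_coeff (1 * f) w = nc_coeff f w" by simp
  qed
  show "f * 1 = f"
  proof (rule ncfps_eqI)
    fix w :: "'a list"
    have "nc_coeff (f * 1) w =
        (\<Sum>i = 0..length w. if i = length w then nc_coeff f w else 0)"
      unfolding times_ncfps.rep_eq one_ncfps.rep_eq by (rule sum.cong) auto
    then show "nc_coeff (f * 1) w = nc_coeff f w" by simp
  qed
  show "(0 :: ('a, 'b) ncfps) \<noteq> 1"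
    by transfer (metis zero_neq_one)
  show "f + g + h = f + (g + h)" by transfer (simp add: add.assoc)
  show "f + g = g + f" by transfer (simp add: add.commute)
  show "0 + f = f" by transfer simp
  show "- f + f = 0" by transfer simp
  show "f - g = f + - g" by transfer simp
  show "(f + g) * h = f * h + g * h" by transfer (simp add: distrib_right sum.distrib)
  show "h * (f + g) = h * f + h * g" by transfer (simp add: distrib_left sum.distrib)
qed

end

lift_definition nc_const :: "'a::zero \<Rightarrow> ('g, 'a) ncfps"
  is "\<lambda>c w. if w = [] then c else 0" .

lift_definition nc_var :: "'g \<Rightarrow> ('g, 'a::zero_neq_one) ncfps"
  is "\<lambda>g w. if w = [g] then 1 else 0" .

lift_definition nc_map :: "('a \<Rightarrow> 'b) \<Rightarrow> ('g, 'a) ncfps \<Rightarrow> ('g, 'b) ncfps"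
  is "\<lambda>h f w. h (f w)" .

text \<open>\<open>nc_exp a\<close> and \<open>nc_log a\<close> are meant for \<open>a\<close>, respectively \<open>a - 1\<close>, without constant term. Its
  \<open>n\<close>-th power then has no terms of length less than \<open>n\<close>, so that truncating the sum at
  the length of the word loses nothing.\<close>

definition nc_exp :: "('g, 'a::field) ncfps \<Rightarrow> ('g, 'a) ncfps" where
  "nc_exp a = Abs_ncfps (\<lambda>w. \<Sum>n = 0..length w. nc_coeff (a ^ n) w / of_nat (fact n))"

definition nc_log :: "('g, 'a::field) ncfps \<Rightarrow> ('g, 'a) ncfps" where
  "nc_log a = Abs_ncfps (\<lambda>w. \<Sum>n = 1..length w.
     (- 1) ^ (n + 1) * nc_coeff ((a - 1) ^ n) w / of_nat n)"

definition nc_powr :: "('g, 'a::field) ncfps \<Rightarrow> 'a \<Rightarrow> ('g, 'a) ncfps" where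
  "nc_powr a m = nc_exp (nc_const m * nc_log a)"

text \<open>\<open>coproduct_word w u v\<close> is the coefficient of \<open>u \<otimes> v\<close> in \<open>\<Delta> w\<close>, the product of the
  \<open>g \<otimes> 1 + 1 \<otimes> g\<close> over the letters \<open>g\<close> of \<open>w\<close>.\<close>

fun coproduct_word :: "'g list \<Rightarrow> 'g list \<Rightarrow> 'g list \<Rightarrow> nat" where
  "coproduct_word [] u v = (if u = [] \<and> v = [] then 1 else 0)"
| "coproduct_word (g # w) u v =
     (if u \<noteq> [] \<and> hd u = g then coproduct_word w (tl u) v else 0) +
     (if v \<noteq> [] \<and> hd v = g then coproduct_word w u (tl v) else 0)"

text \<open>The coefficient of \<open>u \<otimes> v\<close> in \<open>\<Delta> f\<close>; \<open>\<Delta>\<close> is homogeneous, so only words of length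
  \<open>length u + length v\<close> contribute.\<close>

definition coproduct_coeff ::
  "('g::finite, 'a::ring_1) ncfps \<Rightarrow> 'g list \<Rightarrow> 'g list \<Rightarrow> 'a" where
  "coproduct_coeff f u v =
     (\<Sum>w | length w = length u + length v. nc_coeff f w * of_nat (coproduct_word w u v))"

definition group_like :: "('g::finite, 'a::ring_1) ncfps \<Rightarrow> bool" where
  "group_like f \<longleftrightarrow> nc_coeff f [] = 1 \<and>
     (\<forall>u v. coproduct_coeff f u v = nc_coeff f u * nc_coeff f v)"

definition group_like_group :: "('g::finite, 'a::ring_1) ncfps monoid" where
  "group_like_group = \<lparr>carrier = Collect group_like, mult = (*), one = 1\<rparr>"

text \<open>The topology of coefficientwise \<open>l\<close>-adic convergence.\<close>

definition group_like_topology :: "('g::finite, 'l::prime_card padic) ncfps topology" where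
  "group_like_topology = subtopology
     (pullback_topology UNIV nc_coeff (product_topology (\<lambda>_. padic_topology) UNIV))
     (carrier group_like_group)"


section \<open>Groups given by generators and relations\<close>

text \<open>In a word, \<open>(g, True)\<close> stands for the generator \<open>g\<close> and \<open>(g, False)\<close> for its inverse.\<close>

type_synonym 'g gword = "('g \<times> bool) list"

definition gword_inv :: "'g gword \<Rightarrow> 'g gword" where
  "gword_inv w = rev (map (\<lambda>(g, e). (g, \<not> e)) w)"

inductive pres_eq :: "'g set \<Rightarrow> ('g gword \<times> 'g gword) set \<Rightarrow> 'g gword \<Rightarrow> 'g gword \<Rightarrow> bool"
  for S R where
  refl: "w \<in> lists (S \<times> UNIV) \<Longrightarrow> pres_eq S R w w"
| sym: "pres_eq S R u v \<Longrightarrow> pres_eq S R v u"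
| trans: "pres_eq S R u v \<Longrightarrow> pres_eq S R v w \<Longrightarrow> pres_eq S R u w"
| cancel: "a \<in> lists (S \<times> UNIV) \<Longrightarrow> b \<in> lists (S \<times> UNIV) \<Longrightarrow> g \<in> S \<Longrightarrow>
    pres_eq S R (a @ [(g, e), (g, \<not> e)] @ b) (a @ b)"
| relation: "a \<in> lists (S \<times> UNIV) \<Longrightarrow> b \<in> lists (S \<times> UNIV) \<Longrightarrow> (u, v) \<in> R \<Longrightarrow>
    u \<in> lists (S \<times> UNIV) \<Longrightarrow> v \<in> lists (S \<times> UNIV) \<Longrightarrow>
    pres_eq S R (a @ u @ b) (a @ v @ b)"

definition pres_class ::
  "'g set \<Rightarrow> ('g gword \<times> 'g gword) set \<Rightarrow> 'g gword \<Rightarrow> 'g gword set" where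
  "pres_class S R w = {v. pres_eq S R w v}"

definition presented_group ::
  "'g set \<Rightarrow> ('g gword \<times> 'g gword) set \<Rightarrow> 'g gword set monoid" where
  "presented_group S R =
     \<lparr>carrier = pres_class S R ` lists (S \<times> UNIV),
      mult = (\<lambda>C D. \<Union>u\<in>C. \<Union>v\<in>D. pres_class S R (u @ v)),
      one = pres_class S R []\<rparr>"

datatype xy = gX | gY

instance xy :: finite
proof
  have "(UNIV :: xy set) = {gX, gY}" using xy.exhaust by auto
  then show "finite (UNIV :: xy set)" by (metis finite.emptyI finite.insertI)
qed

definition free2 :: "xy gword set monoid" where
  "free2 = presented_group UNIV {}"

definition free2_gen :: "xy \<Rightarrow> xy gword set" where
  "free2_gen g = pres_class UNIV {} [(g, True)]"


section \<open>Braid groups\<close>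

definition braid_relations :: "nat \<Rightarrow> (nat gword \<times> nat gword) set" where
  "braid_relations n =
     {([(i, True), (j, True)], [(j, True), (i, True)]) | i j.
        i \<in> {1..<n} \<and> j \<in> {1..<n} \<and> i + 2 \<le> j} \<union>
     {([(i, True), (i + 1, True), (i, True)], [(i + 1, True), (i, True), (i + 1, True)]) | i.
        i \<in> {1..<n} \<and> i + 1 \<in> {1..<n}}"

definition braid_group :: "nat \<Rightarrow> nat gword set monoid" where
  "braid_group n = presented_group {1..<n} (braid_relations n)"

definition gword_perm :: "nat gword \<Rightarrow> nat \<Rightarrow> nat" where
  "gword_perm w = foldr (\<lambda>(i, e) p. transpose i (i + 1) \<circ> p) w id"

text \<open>\<open>gword_perm\<close> is constant on each element of the braid group.\<close>

definition braid_perm :: "nat gword set \<Rightarrow> nat \<Rightarrow> nat" where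
  "braid_perm C = the_elem (gword_perm ` C)"

definition pure_braid_group :: "nat \<Rightarrow> nat gword set monoid" where
  "pure_braid_group n =
     (braid_group n)\<lparr>carrier := kernel (braid_group n) (sym_group n) braid_perm\<rparr>"

definition pure_braid_gen :: "nat \<Rightarrow> nat \<Rightarrow> nat \<Rightarrow> nat gword set" where
  "pure_braid_gen n i j = pres_class {1..<n} (braid_relations n)
     (let c = map (\<lambda>k. (k, True)) (rev [i + 1..<j])
      in c @ [(i, True), (i, True)] @ gword_inv c)"


section \<open>Pro-\<open>l\<close> completion\<close>

definition l_power_index_normal :: "nat \<Rightarrow> ('g, 'm) monoid_scheme \<Rightarrow> 'g set set" where
  "l_power_index_normal l G = {N. N \<lhd> G \<and> (\<exists>k. card (rcosets\<^bsub>G\<^esub> N) = l ^ k)}"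

text \<open>The inverse limit of the quotients of \<open>G\<close> by its normal subgroups of \<open>l\<close>-power index.\<close>

definition pro_completion ::
  "nat \<Rightarrow> ('g, 'm) monoid_scheme \<Rightarrow> ('g set \<Rightarrow> 'g set) monoid" where
  "pro_completion l G =
     \<lparr>carrier = {c \<in> (\<Pi>\<^sub>E N\<in>l_power_index_normal l G. rcosets\<^bsub>G\<^esub> N).
        \<forall>M\<in>l_power_index_normal l G. \<forall>N\<in>l_power_index_normal l G.
          N \<subseteq> M \<longrightarrow> c N \<subseteq> c M},
      mult = (\<lambda>c d. \<lambda>N\<in>l_power_index_normal l G. c N <#>\<^bsub>G\<^esub> d N),
      one = (\<lambda>N\<in>l_power_index_normal l G. N)\<rparr>"

definition pro_topology ::
  "nat \<Rightarrow> ('g, 'm) monoid_scheme \<Rightarrow> ('g set \<Rightarrow> 'g set) topology" where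
  "pro_topology l G = subtopology
     (product_topology (\<lambda>N. discrete_topology (rcosets\<^bsub>G\<^esub> N)) (l_power_index_normal l G))
     (carrier (pro_completion l G))"

definition pro_of ::
  "nat \<Rightarrow> ('g, 'm) monoid_scheme \<Rightarrow> 'g \<Rightarrow> 'g set \<Rightarrow> 'g set" where
  "pro_of l G g = (\<lambda>N\<in>l_power_index_normal l G. N #>\<^bsub>G\<^esub> g)"

type_synonym pro_free2 = "xy gword set set \<Rightarrow> xy gword set set"

abbreviation F2 :: "nat \<Rightarrow> pro_free2 monoid" where
  "F2 l \<equiv> pro_completion l free2"

abbreviation F2_x :: "nat \<Rightarrow> pro_free2" where
  "F2_x l \<equiv> pro_of l free2 (free2_gen gX)"

abbreviation F2_y :: "nat \<Rightarrow> pro_free2" where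
  "F2_y l \<equiv> pro_of l free2 (free2_gen gY)"

abbreviation K4 :: "nat \<Rightarrow> (nat gword set set \<Rightarrow> nat gword set set) monoid" where
  "K4 l \<equiv> pro_completion l (pure_braid_group 4)"

abbreviation K4_gen :: "nat \<Rightarrow> nat \<Rightarrow> nat \<Rightarrow> nat gword set set \<Rightarrow> nat gword set set" where
  "K4_gen l i j \<equiv> pro_of l (pure_braid_group 4) (pure_braid_gen 4 i j)"

text \<open>The image of \<open>f\<close> under the continuous homomorphism to the topological group \<open>G\<close> with
  topology \<open>T\<close> that sends \<open>x\<close> to \<open>a\<close> and \<open>y\<close> to \<open>b\<close>.\<close>

definition F2_eval ::
  "nat \<Rightarrow> ('h, 'm) monoid_scheme \<Rightarrow> 'h topology \<Rightarrow> 'h \<Rightarrow> 'h \<Rightarrow> pro_free2 \<Rightarrow> 'h" where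
  "F2_eval l G T a b f =
     (THE c. \<exists>\<phi>. \<phi> \<in> hom (F2 l) G \<and> continuous_map (pro_topology l free2) T \<phi> \<and>
        \<phi> (F2_x l) = a \<and> \<phi> (F2_y l) = b \<and> c = \<phi> f)"

abbreviation F2_subst :: "nat \<Rightarrow> pro_free2 \<Rightarrow> pro_free2 \<Rightarrow> pro_free2 \<Rightarrow> pro_free2" where
  "F2_subst l f a b \<equiv> F2_eval l (F2 l) (pro_topology l free2) a b f"

abbreviation K4_subst ::
  "nat \<Rightarrow> pro_free2 \<Rightarrow> (nat gword set set \<Rightarrow> nat gword set set) \<Rightarrow>
   (nat gword set set \<Rightarrow> nat gword set set) \<Rightarrow> nat gword set set \<Rightarrow> nat gword set set" where
  "K4_subst l f a b \<equiv> F2_eval l (K4 l) (pro_topology l (pure_braid_group 4)) a b f"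


section \<open>The embedding into the pro-unipotent completion\<close>

definition F2_series :: "pro_free2 \<Rightarrow> (xy, 'l::prime_card padic) ncfps" where
  "F2_series f = F2_eval CARD('l) group_like_group group_like_topology
     (nc_exp (nc_var gX)) (nc_exp (nc_var gY)) f"

definition c2 :: "pro_free2 \<Rightarrow> 'l::prime_card padic" where
  "c2 f = nc_coeff (F2_series f) [gX, gY]"

definition F2_series_ac :: "pro_free2 \<Rightarrow> (xy, 'l::prime_card padic alg_closure) ncfps" where
  "F2_series_ac f = nc_map to_ac (F2_series f)"

definition hexagon :: "'l::prime_card padic alg_closure \<Rightarrow> pro_free2 \<Rightarrow> bool" where
  "hexagon lam f \<longleftrightarrow>
     (let l = CARD('l); x = F2_x l; y = F2_y l; z = inv\<^bsub>F2 l\<^esub> (x \<otimes>\<^bsub>F2 l\<^esub> y);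
          m = (lam - 1) / 2
      in F2_series_ac (F2_subst l f z x) * nc_powr (F2_series_ac z) m *
         F2_series_ac (F2_subst l f y z) * nc_powr (F2_series_ac y) m *
         F2_series_ac (F2_subst l f x y) * nc_powr (F2_series_ac x) m = 1)"

definition two_cycle :: "nat \<Rightarrow> pro_free2 \<Rightarrow> bool" where
  "two_cycle l f \<longleftrightarrow>
     F2_subst l f (F2_x l) (F2_y l) \<otimes>\<^bsub>F2 l\<^esub> F2_subst l f (F2_y l) (F2_x l) = \<one>\<^bsub>F2 l\<^esub>"

definition pentagon :: "nat \<Rightarrow> pro_free2 \<Rightarrow> bool" where
  "pentagon l f \<longleftrightarrow>
     (let x = K4_gen l
      in K4_subst l f (x 1 2) (x 2 3 \<otimes>\<^bsub>K4 l\<^esub> x 2 4) \<otimes>\<^bsub>K4 l\<^esub>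
         K4_subst l f (x 1 3 \<otimes>\<^bsub>K4 l\<^esub> x 2 3) (x 3 4) =
         K4_subst l f (x 2 3) (x 3 4) \<otimes>\<^bsub>K4 l\<^esub>
         K4_subst l f (x 1 2 \<otimes>\<^bsub>K4 l\<^esub> x 1 3) (x 2 4 \<otimes>\<^bsub>K4 l\<^esub> x 3 4) \<otimes>\<^bsub>K4 l\<^esub>
         K4_subst l f (x 1 2) (x 2 3))"

end

theory Submission
  imports Defs "HOL-Analysis.Abstract_Topological_Spaces" "HOL-Algebra.Sylow"
begin

text \<open>Write \<open>f(a, b)\<close> for the Magnus series of \<open>f\<close> at \<open>X = a - 1\<close>, \<open>Y = b - 1\<close>. The pure braid group
  on four strings acts on the completed free algebra with three generators in four ways, one for each
  position of a distinguished strand. The four resulting forms of the pentagon relation are faces of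
  the polytope of a strand that crosses three others. Its other faces are commuting squares and four
  hexagons, which carry the defect \<open>H\<close> of the hexagon relation. Going around the polytope, one finds
  that the leading term \<open>S\<close> of \<open>H\<close> is a cocycle,
  \<open>S(A, B) + S(A + B, C) = S(B, C) + S(A, B + C)\<close>. Since \<open>S(U, U) = 0\<close> on commuting arguments, this
  gives \<open>S(2 U, 2 V) = 3 S(U, V) - S(V, U)\<close>, which for \<open>S\<close> of degree \<open>n\<close> implies
  \<open>(2\<^sup>n - 2) (2\<^sup>n - 4) S = 0\<close>. So \<open>S = 0\<close> once \<open>n \<ge> 3\<close>, and the degree two part of the hexagon relation
  reads \<open>m\<^sup>2 + m = 6 c\<^sub>2(f)\<close>. The 2-cycle relation is the image of the pentagon relation under the
  homomorphism to the free group of rank two that comes from the action of the braid group on four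
  strings on the three partitions of four points into pairs.\<close>

section \<open>Complete filtered rings\<close>

text \<open>The pentagon holds in a completed group, where \<open>f\<close> is only a limit of
  words, while the hexagon has exponents in an algebraic closure. Integral matrices bridge the two.
  The pure braid group is a semidirect product of the free group on the loops of the distinguished
  strand and the pure braids of the other three; it acts on integral series by left multiplication
  and Artin automorphisms. The matrices are unipotent, so their congruence subgroups have
  \<open>l\<close>-power index, and relations between values of \<open>f\<close> pass to
  \<open>l\<close>-adic matrices; only then are the scalars extended. The hexagon faces involve
  twists of the ordinary strands. They become relations between loops alone, because loop products
  times suitable twists are full twists, which commute with the arguments in question, and
  \<open>f\<close>, having no linear terms, ignores such factors. The doubling formula and its
  mirror image multiply the symmetric part of \<open>S\<close> by \<open>2^n - 2\<close> and the
  antisymmetric part by \<open>2^n - 4\<close>. The second exception is the commutator in degree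
  two, which the condition on \<open>m\<close> removes. With \<open>lambda = 2 m + 1\<close> that
  condition reads \<open>lambda^2 = 4 (m^2 + m) + 1\<close>, hence the constant 24.\<close>

text \<open>\<open>sg s\<close> is the sum of a series whose \<open>n\<close>-th term lies in \<open>fil n\<close>; otherwise it is junk.\<close>

class filtered_ring = ring_1 +
  fixes fil :: "nat \<Rightarrow> 'a set"
    and sg :: "(nat \<Rightarrow> 'a) \<Rightarrow> 'a"
  assumes fil_0 [simp]: "fil 0 = UNIV"
    and fil_zero [simp]: "0 \<in> fil n"
    and fil_add: "x \<in> fil n \<Longrightarrow> y \<in> fil n \<Longrightarrow> x + y \<in> fil n"
    and fil_uminus: "x \<in> fil n \<Longrightarrow> - x \<in> fil n"
    and fil_mult: "x \<in> fil m \<Longrightarrow> y \<in> fil n \<Longrightarrow> x * y \<in> fil (m + n)"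
    and fil_Suc: "x \<in> fil (Suc n) \<Longrightarrow> x \<in> fil n"
    and fil_sep: "(\<And>n. x \<in> fil n) \<Longrightarrow> x = 0"
    and sg_approx: "(\<And>n. s n \<in> fil n) \<Longrightarrow> sg s - (\<Sum>i<n. s i) \<in> fil n"

section \<open>Elementary rules for the filtration and for convergent sums\<close>

lemma fil_diff: "(x :: 'a::filtered_ring) \<in> fil n \<Longrightarrow> y \<in> fil n \<Longrightarrow> x - y \<in> fil n"
  using fil_add fil_uminus by fastforce

lemma fil_mono: "(x :: 'a::filtered_ring) \<in> fil n \<Longrightarrow> m \<le> n \<Longrightarrow> x \<in> fil m"
proof (induction n)
  case (Suc n)
  then show ?case using fil_Suc by (cases "m = Suc n") auto
qed simp

lemma fil_mult_left: "(x :: 'a::filtered_ring) \<in> fil n \<Longrightarrow> y * x \<in> fil n"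
  using fil_mult[of y 0 x n] by simp

lemma fil_mult_right: "(x :: 'a::filtered_ring) \<in> fil n \<Longrightarrow> x * y \<in> fil n"
  using fil_mult[of x n y 0] by simp

lemma fil_sum: "(\<And>i. i \<in> A \<Longrightarrow> (f i :: 'a::filtered_ring) \<in> fil n) \<Longrightarrow> sum f A \<in> fil n"
  by (induction A rule: infinite_finite_induct) (auto intro: fil_add)

lemma fil_power: "(x :: 'a::filtered_ring) \<in> fil 1 \<Longrightarrow> x ^ n \<in> fil n"
proof (induction n)
  case (Suc n)
  then show ?case using fil_mult[of x 1 "x ^ n" n] by simp
qed simp

lemma fil_eqI: "(\<And>n. (x :: 'a::filtered_ring) - y \<in> fil n) \<Longrightarrow> x = y"
  using fil_sep[of "x - y"] by simp

lemma fil_diff_trans: "(x :: 'a::filtered_ring) - y \<in> fil n \<Longrightarrow> y - z \<in> fil n \<Longrightarrow> x - z \<in> fil n"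
  using fil_add[of "x - y" n "y - z"] by simp

lemma fil_diff_sym: "(x :: 'a::filtered_ring) - y \<in> fil n \<Longrightarrow> y - x \<in> fil n"
  using fil_uminus[of "x - y" n] by simp

lemma fil_diff_cong:
  "(x :: 'a::filtered_ring) - x' \<in> fil n \<Longrightarrow> y - y' \<in> fil n \<Longrightarrow> x' - y' \<in> fil n \<Longrightarrow> x - y \<in> fil n"
  by (rule fil_diff_trans[OF fil_diff_trans[of x x' n y'] fil_diff_sym])

lemma fil_diff_add: "(x :: 'a::filtered_ring) - x' \<in> fil n \<Longrightarrow> y - y' \<in> fil n \<Longrightarrow> (x + y) - (x' + y') \<in> fil n"
  using fil_add[of "x - x'" n "y - y'"] by (simp add: algebra_simps)

lemma fil_diff_mult:
  assumes "(x :: 'a::filtered_ring) - x' \<in> fil n" "y - y' \<in> fil n"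
  shows "x * y - x' * y' \<in> fil n"
proof -
  have "x * y - x' * y' = x * (y - y') + (x - x') * y'" by (simp add: algebra_simps)
  then show ?thesis using assms by (simp add: fil_add fil_mult_left fil_mult_right)
qed

lemma sg_eqI:
  fixes s :: "nat \<Rightarrow> 'a::filtered_ring"
  assumes "\<And>n. s n \<in> fil n" "\<And>n. y - (\<Sum>i<n. s i) \<in> fil n"
  shows "sg s = y"
  by (rule fil_eqI) (rule fil_diff_trans[OF sg_approx[OF assms(1)] fil_diff_sym[OF assms(2)]])

lemma sg_fil:
  fixes s :: "nat \<Rightarrow> 'a::filtered_ring"
  assumes "\<And>n. s n \<in> fil n" "\<And>i. i < n \<Longrightarrow> s i = 0"
  shows "sg s \<in> fil n"
  using sg_approx[OF assms(1), of n] assms(2) by simp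

lemma sg_add:
  fixes s :: "nat \<Rightarrow> 'a::filtered_ring"
  assumes "\<And>n. s n \<in> fil n" "\<And>n. t n \<in> fil n"
  shows "sg (\<lambda>n. s n + t n) = sg s + sg t"
  using assms by (intro sg_eqI) (auto simp: sum.distrib intro: fil_add fil_diff_add sg_approx)

lemma sg_mult_left:
  fixes s :: "nat \<Rightarrow> 'a::filtered_ring"
  assumes "\<And>n. s n \<in> fil n"
  shows "sg (\<lambda>n. c * s n) = c * sg s"
proof (intro sg_eqI)
  fix n
  have "c * sg s - (\<Sum>i<n. c * s i) = c * (sg s - (\<Sum>i<n. s i))"
    by (simp add: sum_distrib_left algebra_simps)
  then show "c * sg s - (\<Sum>i<n. c * s i) \<in> fil n"
    using assms by (simp add: fil_mult_left sg_approx)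
qed (use assms in \<open>auto intro: fil_mult_left\<close>)

lemma sg_mult_right:
  fixes s :: "nat \<Rightarrow> 'a::filtered_ring"
  assumes "\<And>n. s n \<in> fil n"
  shows "sg (\<lambda>n. s n * c) = sg s * c"
proof (intro sg_eqI)
  fix n
  have "sg s * c - (\<Sum>i<n. s i * c) = (sg s - (\<Sum>i<n. s i)) * c"
    by (simp add: sum_distrib_right algebra_simps)
  then show "sg s * c - (\<Sum>i<n. s i * c) \<in> fil n"
    using assms by (simp add: fil_mult_right sg_approx)
qed (use assms in \<open>auto intro: fil_mult_right\<close>)

text \<open>Cauchy product: outside the triangle \<open>i + j < n\<close> the terms of the product
  of two partial sums have \<open>n \<le> i + j\<close> and so lie in \<open>fil n\<close>. This
  takes the place of absolute convergence.\<close>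

lemma sg_mult:
  fixes s t :: "nat \<Rightarrow> 'a::filtered_ring"
  assumes s: "\<And>n. s n \<in> fil n" and t: "\<And>n. t n \<in> fil n"
  shows "sg (\<lambda>n. \<Sum>i\<le>n. s i * t (n - i)) = sg s * sg t"
proof (rule sg_eqI)
  have st: "s i * t j \<in> fil n" if "n \<le> i + j" for i j n
    using fil_mono[OF fil_mult[OF s t] that] .
  then show "(\<Sum>i\<le>n. s i * t (n - i)) \<in> fil n" for n
    by (intro fil_sum) auto
  fix n
  have tri: "(\<Sum>k<n. \<Sum>i\<le>k. s i * t (k - i)) = (\<Sum>(i, j) \<in> {(i, j). i + j < n}. s i * t j)"
    by (simp add: sum.triangle_reindex)
  have sub: "{(i, j). i + j < n} \<subseteq> {..<n} \<times> {..<n}" by auto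
  have "(\<Sum>i<n. s i) * (\<Sum>j<n. t j) = (\<Sum>(i, j) \<in> {..<n} \<times> {..<n}. s i * t j)"
    by (simp add: sum_product sum.cartesian_product)
  also have "\<dots> = (\<Sum>(i, j) \<in> {..<n} \<times> {..<n} - {(i, j). i + j < n}. s i * t j)
      + (\<Sum>(i, j) \<in> {(i, j). i + j < n}. s i * t j)"
    by (rule sum.subset_diff[OF sub]) simp
  finally have "(\<Sum>i<n. s i) * (\<Sum>j<n. t j) - (\<Sum>k<n. \<Sum>i\<le>k. s i * t (k - i))
      = (\<Sum>(i, j) \<in> {..<n} \<times> {..<n} - {(i, j). i + j < n}. s i * t j)"
    using tri by simp
  also have "\<dots> \<in> fil n" by (intro fil_sum) (auto intro: st)
  finally show "sg s * sg t - (\<Sum>k<n. \<Sum>i\<le>k. s i * t (k - i)) \<in> fil n"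
    using fil_diff_trans[OF fil_diff_mult[OF sg_approx[OF s] sg_approx[OF t]]] by blast
qed

lemma sg_single:
  assumes "(x :: 'a::filtered_ring) \<in> fil k"
  shows "sg (\<lambda>n. if n = k then x else 0) = x"
proof (rule sg_eqI)
  fix n
  show "x - (\<Sum>i<n. if i = k then x else 0) \<in> fil n"
    using assms fil_mono[of x k n] by (auto simp: sum.delta')
qed (use assms in auto)

section \<open>Homomorphisms of filtered rings\<close>

definition filtered_hom :: "('a::filtered_ring \<Rightarrow> 'b::filtered_ring) \<Rightarrow> bool" where
  "filtered_hom h \<longleftrightarrow> h 1 = 1 \<and> (\<forall>x y. h (x + y) = h x + h y) \<and> (\<forall>x y. h (x * y) = h x * h y) \<and>
     (\<forall>n x. x \<in> fil n \<longrightarrow> h x \<in> fil n)"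

lemma filtered_homD:
  assumes "filtered_hom h"
  shows "h 0 = 0" "h 1 = 1" "h (x + y) = h x + h y" "h (x * y) = h x * h y"
    "h (x - y) = h x - h y" "h (- x) = - h x" "h (x ^ n) = h x ^ n" "h (sum f A) = (\<Sum>i\<in>A. h (f i))"
    "h (prod_list xs) = prod_list (map h xs)"
    "x \<in> fil m \<Longrightarrow> h x \<in> fil m"
proof -
  show add: "h (x + y) = h x + h y" for x y using assms by (simp add: filtered_hom_def)
  show zero: "h 0 = 0" using add[of 0 0] by simp
  show one: "h 1 = 1" and mult: "h (x * y) = h x * h y" for x y using assms by (simp_all add: filtered_hom_def)
  show um: "h (- x) = - h x" for x using add[of x "- x"] zero by (simp add: eq_neg_iff_add_eq_0 add.commute)
  show "h (x - y) = h x - h y" using add[of x "- y"] um by simp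
  show "h (x ^ n) = h x ^ n" by (induction n) (simp_all add: one mult)
  show "h (sum f A) = (\<Sum>i\<in>A. h (f i))"
    by (induction A rule: infinite_finite_induct) (simp_all add: zero add)
  show "h (prod_list xs) = prod_list (map h xs)" by (induction xs) (simp_all add: one mult)
  show "x \<in> fil m \<Longrightarrow> h x \<in> fil m" using assms by (simp add: filtered_hom_def)
qed

text \<open>Preserving the filtration amounts to continuity: the error of a partial sum is mapped to
  an error in the same \<open>fil n\<close>.\<close>

lemma filtered_hom_sg:
  assumes "filtered_hom h" "\<And>n. s n \<in> fil n"
  shows "h (sg s) = sg (\<lambda>n. h (s n))"
proof (rule sg_eqI[symmetric])
  fix n
  show "h (s n) \<in> fil n" using assms filtered_homD(10) by blast
  show "h (sg s) - (\<Sum>i<n. h (s i)) \<in> fil n"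
    using filtered_homD(10)[OF assms(1) sg_approx[OF assms(2)], of n]
    by (simp add: filtered_homD(5)[OF assms(1)] filtered_homD(8)[OF assms(1)])
qed

lemma filtered_hom_comp: "filtered_hom g \<Longrightarrow> filtered_hom h \<Longrightarrow> filtered_hom (\<lambda>x. g (h x))"
  unfolding filtered_hom_def by simp

subsection \<open>Unipotent elements\<close>

definition unip :: "'a::filtered_ring \<Rightarrow> bool" where "unip a \<longleftrightarrow> a - 1 \<in> fil 1"

definition uinv :: "'a::filtered_ring \<Rightarrow> 'a" where "uinv a = sg (\<lambda>n. (1 - a) ^ n)"

lemma unip_1 [simp]: "unip 1" by (simp add: unip_def)

lemma unip_mult [intro]: "unip a \<Longrightarrow> unip b \<Longrightarrow> unip (a * b)"
  unfolding unip_def using fil_diff_mult[of a 1 1 b 1] by simp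

lemma uinv_right:
  assumes "unip a" shows "a * uinv a = 1"
proof -
  have a: "1 - a \<in> fil 1" using assms fil_diff_sym unip_def by blast
  have f: "(1 - a) ^ n \<in> fil n" for n using fil_power[OF a] .
  have "a * uinv a - 1 \<in> fil n" for n
  proof -
    have g: "a * (\<Sum>i<n. (1 - a) ^ i) = 1 - (1 - a) ^ n"
    proof (induction n)
      case (Suc n)
      have "a * (\<Sum>i<Suc n. (1 - a) ^ i) = 1 - (1 - a) ^ n + a * (1 - a) ^ n"
        using Suc by (simp add: distrib_left)
      also have "\<dots> = 1 - (1 - a) * (1 - a) ^ n" by (simp add: algebra_simps)
      finally show ?case by simp
    qed simp
    have "a * uinv a - a * (\<Sum>i<n. (1 - a) ^ i) \<in> fil n"
      unfolding uinv_def right_diff_distrib[symmetric]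
      by (intro fil_mult_left sg_approx f)
    then show ?thesis unfolding g using f[of n] fil_diff_trans[of _ "1 - (1 - a) ^ n" n 1] fil_uminus[OF f] by simp
  qed
  then show ?thesis by (rule fil_eqI)
qed

lemma unip_uinv [intro]: assumes "unip a" shows "unip (uinv a)"
proof -
  have "uinv a - 1 = (1 - a) * uinv a" using uinv_right[OF assms] by (simp add: algebra_simps)
  then show ?thesis using fil_mult_right[OF fil_diff_sym[of a 1 1]] assms by (simp add: unip_def)
qed

lemma uinv_left: assumes "unip a" shows "uinv a * a = 1"
proof -
  let ?b = "uinv a"
  have r: "?b * uinv ?b = 1" "a * ?b = 1" using uinv_right[OF unip_uinv[OF assms]] uinv_right[OF assms] .
  have "?b * a = ?b * a * (?b * uinv ?b)" using r by simp
  also have "\<dots> = ?b * (a * ?b) * uinv ?b" by (simp add: mult.assoc)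
  also have "\<dots> = 1" using r by simp
  finally show ?thesis .
qed

lemma uinv_unique:
  assumes "unip a" "a * b = 1" shows "b = uinv a"
proof -
  have "b = uinv a * a * b" by (simp add: uinv_left[OF assms(1)])
  then show ?thesis using assms(2) by (simp add: mult.assoc)
qed

lemma uinv_1 [simp]: "uinv 1 = 1" using uinv_right[OF unip_1] by simp

lemma uinv_uinv [simp]: "unip a \<Longrightarrow> uinv (uinv a) = a"
  by (metis unip_uinv uinv_left uinv_unique)

lemma uinv_cancel:
  assumes "unip a"
  shows "a * (uinv a * x) = x" "uinv a * (a * x) = x"
  using uinv_right[OF assms] uinv_left[OF assms] by (simp_all add: mult.assoc[symmetric])

lemma uinv_mult:
  assumes "unip a" "unip b" shows "uinv (a * b) = uinv b * uinv a"
proof (rule uinv_unique[symmetric])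
  show "a * b * (uinv b * uinv a) = 1"
    using assms by (simp add: mult.assoc uinv_cancel uinv_right)
qed (use assms in blast)

lemma unip_cancel_left:
  assumes "unip a" shows "a * x = a * y \<longleftrightarrow> x = y"
proof
  assume "a * x = a * y"
  then have "uinv a * (a * x) = uinv a * (a * y)" by simp
  then show "x = y" by (simp only: uinv_cancel(2)[OF assms])
qed simp

lemma uinv_commute:
  assumes "unip a" "x * a = a * x"
  shows "x * uinv a = uinv a * x"
proof -
  have "x * uinv a = uinv a * (a * x) * uinv a" using uinv_cancel(2)[OF assms(1)] by simp
  also have "\<dots> = uinv a * (x * a) * uinv a" using assms(2) by simp
  also have "\<dots> = uinv a * x" by (simp add: mult.assoc uinv_right[OF assms(1)])
  finally show ?thesis .
qed

lemma filtered_hom_unip: "filtered_hom h \<Longrightarrow> unip a \<Longrightarrow> unip (h a)"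
  unfolding unip_def using filtered_homD(10)[of h "a - 1" 1] by (simp add: filtered_homD(2,5))

lemma filtered_hom_uinv: "filtered_hom h \<Longrightarrow> unip a \<Longrightarrow> h (uinv a) = uinv (h a)"
  by (rule uinv_unique) (simp_all add: filtered_hom_unip uinv_right filtered_homD(2) flip: filtered_homD(4))

section \<open>Non-commutative series, filtered by word length\<close>

instantiation ncfps :: (type, ring_1) filtered_ring
begin

definition fil_ncfps :: "nat \<Rightarrow> ('a, 'b) ncfps set" where
  "fil_ncfps n = {s. \<forall>w. length w < n \<longrightarrow> nc_coeff s w = 0}"

text \<open>When \<open>s i\<close> lies in \<open>fil i\<close>, the terms with
  \<open>i > length w\<close> vanish at \<open>w\<close>, so the truncated sum is the full
  coefficient of the limit.\<close>

definition sg_ncfps :: "(nat \<Rightarrow> ('a, 'b) ncfps) \<Rightarrow> ('a, 'b) ncfps" where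
  "sg_ncfps s = Abs_ncfps (\<lambda>w. \<Sum>i\<le>length w. nc_coeff (s i) w)"

lemma nc_coeff_sum: "nc_coeff (sum f A) w = (\<Sum>i\<in>A. nc_coeff (f i :: ('a, 'b) ncfps) w)"
  by (induction A rule: infinite_finite_induct) (simp_all add: zero_ncfps.rep_eq plus_ncfps.rep_eq)

instance
proof
  fix x y :: "('a, 'b) ncfps" and m n :: nat and s :: "nat \<Rightarrow> ('a, 'b) ncfps"
  show "fil 0 = (UNIV :: ('a, 'b) ncfps set)" by (simp add: fil_ncfps_def)
  show "(0 :: ('a, 'b) ncfps) \<in> fil n" by (simp add: fil_ncfps_def zero_ncfps.rep_eq)
  show "x + y \<in> fil n" if "x \<in> fil n" "y \<in> fil n"
    using that by (simp add: fil_ncfps_def plus_ncfps.rep_eq)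
  show "- x \<in> fil n" if "x \<in> fil n"
    using that by (simp add: fil_ncfps_def uminus_ncfps.rep_eq)
  show "x \<in> fil n" if "x \<in> fil (Suc n)"
    using that by (simp add: fil_ncfps_def)
  show "x = 0" if "\<And>n. x \<in> fil n"
    using that by (intro ncfps_eqI) (auto simp: fil_ncfps_def zero_ncfps.rep_eq)
  show "x * y \<in> fil (m + n)" if x: "x \<in> fil m" and y: "y \<in> fil n"
  proof -
    have "nc_coeff x (take i w) * nc_coeff y (drop i w) = 0"
      if "length w < m + n" "i \<in> {0..length w}" for i and w :: "'a list"
      using x y that by (cases "i < m") (simp_all add: fil_ncfps_def)
    then show ?thesis by (simp add: fil_ncfps_def times_ncfps.rep_eq)
  qed
  show "sg s - (\<Sum>i<n. s i) \<in> fil n" if s: "\<And>n. s n \<in> fil n"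
    unfolding fil_ncfps_def
  proof (intro CollectI allI impI)
    fix w :: "'a list" assume w: "length w < n"
    have "(\<Sum>i<n. nc_coeff (s i) w) = (\<Sum>i\<le>length w. nc_coeff (s i) w)"
      using s w by (intro sum.mono_neutral_right) (auto simp: fil_ncfps_def)
    then show "nc_coeff (sg s - (\<Sum>i<n. s i)) w = 0"
      by (simp add: minus_ncfps.rep_eq sg_ncfps_def Abs_ncfps_inverse nc_coeff_sum)
  qed
qed

end

lemma fil_ncfps_iff: "s \<in> fil n \<longleftrightarrow> (\<forall>w. length w < n \<longrightarrow> nc_coeff s w = 0)"
  by (simp add: fil_ncfps_def)

lemmas nc_simps = zero_ncfps.rep_eq one_ncfps.rep_eq plus_ncfps.rep_eq uminus_ncfps.rep_eq
  minus_ncfps.rep_eq nc_const.rep_eq nc_var.rep_eq nc_map.rep_eq nc_coeff_sum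

lemma unip_ncfps_iff: "unip s \<longleftrightarrow> nc_coeff s [] = 1"
  by (simp add: unip_def fil_ncfps_iff nc_simps)

lemma nc_const_mult: "nc_coeff (nc_const c * s) w = c * nc_coeff s w"
proof -
  have "nc_coeff (nc_const c * s) w = (\<Sum>i = 0..length w. if i = 0 then c * nc_coeff s w else 0)"
    unfolding times_ncfps.rep_eq nc_const.rep_eq by (intro sum.cong) auto
  then show ?thesis by simp
qed

lemma mult_nc_const: "nc_coeff (s * nc_const c) w = nc_coeff s w * c"
proof -
  have "nc_coeff (s * nc_const c) w = (\<Sum>i = 0..length w. if i = length w then nc_coeff s w * c else 0)"
    unfolding times_ncfps.rep_eq nc_const.rep_eq by (intro sum.cong) auto
  then show ?thesis by simp
qed

lemma nc_var_mult: "nc_coeff (nc_var g * s) w = (if w \<noteq> [] \<and> hd w = g then nc_coeff s (tl w) else 0)"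
proof (cases w)
  case (Cons a v)
  have "nc_coeff (nc_var g * s) w = (\<Sum>i\<in>{0..length w}. if i = 1 then (if a = g then nc_coeff s v else 0) else 0)"
    unfolding times_ncfps.rep_eq nc_var.rep_eq
  proof (rule sum.cong[OF HOL.refl])
    fix i assume i: "i \<in> {0..length w}"
    show "(if take i w = [g] then 1 else 0) * nc_coeff s (drop i w)
        = (if i = 1 then (if a = g then nc_coeff s v else 0) else 0)"
    proof (cases i)
      case (Suc j)
      then have "take j v = [] \<longleftrightarrow> j = 0" using i Cons by auto
      then show ?thesis using Suc Cons by auto
    qed simp
  qed
  also have "\<dots> = (if a = g then nc_coeff s v else 0)"
    by (subst sum.delta) (simp_all add: Cons)
  finally show ?thesis by (simp add: Cons)
qed (simp add: times_ncfps.rep_eq nc_var.rep_eq)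

lemma nc_var_fil [simp]: "nc_var g \<in> fil 1"
  by (auto simp: fil_ncfps_iff nc_simps)

lemma nc_coeff_prod_vars:
  "nc_coeff (prod_list (map nc_var v)) w = (if w = v then 1 else 0)"
  by (induction v arbitrary: w) (auto simp: nc_simps nc_var_mult neq_Nil_conv)

section \<open>Evaluation of series\<close>

text \<open>The algebra structure is an explicit map to central elements, because several of them
  are used side by side: \<open>nc_const\<close>, \<open>fsc\<close>, and composites with changes of
  coefficients.\<close>

definition scal :: "('k::comm_ring_1 \<Rightarrow> 'r::filtered_ring) \<Rightarrow> bool" where
  "scal sc \<longleftrightarrow> sc 1 = 1 \<and> (\<forall>a b. sc (a + b) = sc a + sc b) \<and> (\<forall>a b. sc (a * b) = sc a * sc b) \<and>
     (\<forall>a r. sc a * r = r * sc a)"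

lemma scalD:
  assumes "scal sc"
  shows "sc 0 = 0" "sc 1 = 1" "sc (a + b) = sc a + sc b" "sc (a * b) = sc a * sc b"
    "sc (a - b) = sc a - sc b" "sc (- a) = - sc a" "sc (sum f A) = (\<Sum>i\<in>A. sc (f i))"
    "sc a * r = r * sc a"
proof -
  show add: "sc (x + y) = sc x + sc y" for x y using assms by (simp add: scal_def)
  show zero: "sc 0 = 0" using add[of 0 0] by simp
  show "sc 1 = 1" "sc (a * b) = sc a * sc b" "sc a * r = r * sc a" using assms unfolding scal_def by blast+
  show um: "sc (- x) = - sc x" for x using add[of x "- x"] zero by (simp add: eq_neg_iff_add_eq_0 add.commute)
  show "sc (a - b) = sc a - sc b" using add[of a "- b"] um by simp
  show "sc (sum f A) = (\<Sum>i\<in>A. sc (f i))"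
    by (induction A rule: infinite_finite_induct) (simp_all add: zero add)
qed

lemma scal_of_nat: "scal sc \<Longrightarrow> sc (of_nat n) = of_nat n"
  by (induction n) (simp_all add: scalD)

lemma scal_commute: "scal sc \<Longrightarrow> r * (sc a * x) = sc a * (r * x)"
  by (metis mult.assoc scalD(8))

lemma scal_nc_const: "scal (nc_const :: 'k::comm_ring_1 \<Rightarrow> ('g, 'k) ncfps)"
  unfolding scal_def
  by (intro conjI allI ncfps_eqI)
    (auto simp: nc_simps nc_const_mult mult_nc_const mult.commute)

definition evpart :: "('k::comm_ring_1 \<Rightarrow> 'r::filtered_ring) \<Rightarrow> ('g::finite \<Rightarrow> 'r) \<Rightarrow> ('g, 'k) ncfps \<Rightarrow> nat \<Rightarrow> 'r" where
  "evpart sc \<alpha> s n = (\<Sum>w | length w = n. sc (nc_coeff s w) * prod_list (map \<alpha> w))"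

definition ev :: "('k::comm_ring_1 \<Rightarrow> 'r::filtered_ring) \<Rightarrow> ('g::finite \<Rightarrow> 'r) \<Rightarrow> ('g, 'k) ncfps \<Rightarrow> 'r" where
  "ev sc \<alpha> s = sg (evpart sc \<alpha> s)"

lemma finite_words [simp]: "finite {w :: 'g::finite list. length w = n}"
  using finite_lists_length_eq[of "UNIV :: 'g set" n] by simp

lemma finite_words_le [simp]: "finite {w :: 'g::finite list. length w \<le> n}"
  using finite_lists_length_le[of "UNIV :: 'g set" n] by simp

lemma finite_words_less [simp]: "finite {w :: 'g::finite list. length w < n}"
  by (rule finite_subset[OF _ finite_words_le[of n]]) auto

lemma prod_list_fil: "(\<forall>g. \<alpha> g \<in> fil 1) \<Longrightarrow> prod_list (map \<alpha> w) \<in> (fil (length w) :: 'r::filtered_ring set)"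
proof (induction w)
  case (Cons a w)
  then show ?case using fil_mult[of "\<alpha> a" 1 "prod_list (map \<alpha> w)" "length w"] by simp
qed simp

lemma evpart_fil:
  assumes "\<forall>g. \<alpha> g \<in> fil 1" shows "evpart sc \<alpha> s n \<in> fil n"
  unfolding evpart_def using prod_list_fil[of \<alpha>] assms
  by (intro fil_sum fil_mult_left) auto

lemma evpart_sum:
  fixes s :: "('g::finite, 'k::comm_ring_1) ncfps"
  shows "(\<Sum>i<n. evpart sc \<alpha> s i) = (\<Sum>w | length w < n. sc (nc_coeff s w) * prod_list (map \<alpha> w))"
proof -
  have "(\<Sum>i<n. evpart sc \<alpha> s i) = (\<Sum>w\<in>(\<Union>i<n. {w. length w = i}). sc (nc_coeff s w) * prod_list (map \<alpha> w))"
    unfolding evpart_def by (rule sum.UNION_disjoint[symmetric]) auto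
  also have "(\<Union>i<n. {w. length w = i}) = {w :: 'g list. length w < n}" by auto
  finally show ?thesis .
qed

lemma ev_approx:
  assumes "\<forall>g. \<alpha> g \<in> fil 1"
  shows "ev sc \<alpha> s - (\<Sum>w | length w < n. sc (nc_coeff s w) * prod_list (map \<alpha> w)) \<in> fil n"
  using sg_approx[OF evpart_fil[OF assms, of sc s]] by (simp add: ev_def evpart_sum)

lemma ev_fil:
  assumes "\<forall>g. \<alpha> g \<in> fil 1" "scal sc" "s \<in> fil n"
  shows "ev sc \<alpha> s \<in> fil n"
  unfolding ev_def
proof (rule sg_fil)
  fix i assume "i < n"
  then show "evpart sc \<alpha> s i = 0"
    using assms(3) scalD(1)[OF assms(2)] by (auto simp: evpart_def fil_ncfps_iff intro!: sum.neutral)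
qed (use assms evpart_fil in blast)

text \<open>Cutting words of length \<open>n\<close> at position \<open>i\<close> identifies them
  with pairs of words of lengths \<open>i\<close> and \<open>n - i\<close>; centrality of the
  scalars lets the coefficients be collected in front.\<close>

lemma evpart_mult:
  assumes sc: "scal sc"
  shows "evpart sc \<alpha> (s * t) n = (\<Sum>i\<le>n. evpart sc \<alpha> s i * evpart sc \<alpha> t (n - i))"
proof -
  let ?c = "\<lambda>s w. sc (nc_coeff s w) * prod_list (map \<alpha> w)"
  have prod: "?c s u * ?c t v = sc (nc_coeff s u * nc_coeff t v) * prod_list (map \<alpha> (u @ v))" for u v
  proof -
    have "?c s u * ?c t v = sc (nc_coeff s u) * (prod_list (map \<alpha> u) * (sc (nc_coeff t v) * prod_list (map \<alpha> v)))"
      by (simp only: mult.assoc)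
    also have "\<dots> = sc (nc_coeff s u) * (sc (nc_coeff t v) * (prod_list (map \<alpha> u) * prod_list (map \<alpha> v)))"
      by (subst scal_commute[OF sc, of "prod_list (map \<alpha> u)"]) (rule HOL.refl)
    finally show ?thesis by (simp only: scalD(4)[OF sc] mult.assoc map_append prod_list.append)
  qed
  have "evpart sc \<alpha> (s * t) n = (\<Sum>w | length w = n. \<Sum>i\<le>n. ?c s (take i w) * ?c t (drop i w))"
    unfolding evpart_def times_ncfps.rep_eq prod
    by (intro sum.cong HOL.refl) (simp only: scalD(7)[OF sc] sum_distrib_right atMost_atLeast0 append_take_drop_id mem_Collect_eq)
  also have "\<dots> = (\<Sum>i\<le>n. \<Sum>w | length w = n. ?c s (take i w) * ?c t (drop i w))"
    by (rule sum.swap)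
  also have "\<dots> = (\<Sum>i\<le>n. evpart sc \<alpha> s i * evpart sc \<alpha> t (n - i))"
  proof (rule sum.cong[OF HOL.refl])
    fix i assume i: "i \<in> {..n}"
    have "evpart sc \<alpha> s i * evpart sc \<alpha> t (n - i)
        = (\<Sum>(u, v)\<in>{u. length u = i} \<times> {v. length v = n - i}. ?c s u * ?c t v)"
      by (simp add: evpart_def sum_product sum.cartesian_product)
    also have "\<dots> = (\<Sum>w | length w = n. ?c s (take i w) * ?c t (drop i w))"
      by (rule sum.reindex_bij_witness[of _ "\<lambda>w. (take i w, drop i w)" "\<lambda>(u, v). u @ v"])
        (use i in auto)
    finally show "(\<Sum>w | length w = n. ?c s (take i w) * ?c t (drop i w))
        = evpart sc \<alpha> s i * evpart sc \<alpha> t (n - i)" by simp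
  qed
  finally show ?thesis .
qed

lemma ev_mult:
  assumes "\<forall>g. \<alpha> g \<in> fil 1" "scal sc"
  shows "ev sc \<alpha> (s * t) = ev sc \<alpha> s * ev sc \<alpha> t"
proof -
  have "evpart sc \<alpha> (s * t) = (\<lambda>n. \<Sum>i\<le>n. evpart sc \<alpha> s i * evpart sc \<alpha> t (n - i))"
    using evpart_mult[OF assms(2)] by blast
  then show ?thesis unfolding ev_def
    using sg_mult[OF evpart_fil[OF assms(1), of sc s] evpart_fil[OF assms(1), of sc t]] by simp
qed

lemma ev_add:
  assumes "\<forall>g. \<alpha> g \<in> fil 1" "scal sc"
  shows "ev sc \<alpha> (s + t) = ev sc \<alpha> s + ev sc \<alpha> t"
proof -
  have "evpart sc \<alpha> (s + t) = (\<lambda>n. evpart sc \<alpha> s n + evpart sc \<alpha> t n)"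
    by (auto simp: fun_eq_iff evpart_def nc_simps scalD(3)[OF assms(2)] distrib_right sum.distrib)
  then show ?thesis unfolding ev_def
    using sg_add[OF evpart_fil[OF assms(1), of sc s] evpart_fil[OF assms(1), of sc t]] by simp
qed

lemma ev_const:
  fixes \<alpha> :: "'g::finite \<Rightarrow> 'r::filtered_ring"
  assumes sc: "scal sc"
  shows "ev sc \<alpha> (nc_const c) = sc c"
proof -
  have "evpart sc \<alpha> (nc_const c) = (\<lambda>n. if n = 0 then sc c else 0)"
  proof
    fix n
    have "evpart sc \<alpha> (nc_const c) n = (\<Sum>w\<in>{w :: 'g list. length w = n}. if w = [] then sc c else 0)"
      unfolding evpart_def by (rule sum.cong) (auto simp: nc_simps scalD(1)[OF sc] simp del: )
    then show "evpart sc \<alpha> (nc_const c) n = (if n = 0 then sc c else 0)" by (auto simp: sum.delta)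
  qed
  then show ?thesis using sg_single[of "sc c" 0] by (simp add: ev_def)
qed

lemma nc_const_1 [simp]: "nc_const 1 = 1"
  by (rule ncfps_eqI) (simp add: nc_simps)

lemma nc_const_0 [simp]: "nc_const 0 = 0"
  by (rule ncfps_eqI) (simp add: nc_simps)

lemma ev_var:
  fixes \<alpha> :: "'g::finite \<Rightarrow> 'r::filtered_ring"
  assumes "\<forall>g. \<alpha> g \<in> fil 1" and sc: "scal sc"
  shows "ev sc \<alpha> (nc_var g) = \<alpha> g"
proof -
  have "evpart sc \<alpha> (nc_var g) = (\<lambda>n. if n = 1 then \<alpha> g else 0)"
  proof
    fix n
    have "evpart sc \<alpha> (nc_var g) n = (\<Sum>w\<in>{w :: 'g list. length w = n}. if w = [g] then \<alpha> g else 0)"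
      unfolding evpart_def by (rule sum.cong) (auto simp: nc_simps scalD(1,2)[OF sc])
    then show "evpart sc \<alpha> (nc_var g) n = (if n = 1 then \<alpha> g else 0)" by (auto simp: sum.delta)
  qed
  then show ?thesis using sg_single[of "\<alpha> g" 1] assms(1) by (simp add: ev_def)
qed

lemma filtered_hom_ev:
  assumes "\<forall>g. \<alpha> g \<in> fil 1" "scal sc"
  shows "filtered_hom (ev sc \<alpha>)"
  unfolding filtered_hom_def using ev_add[OF assms] ev_mult[OF assms] ev_fil[OF assms] ev_const[OF assms(2), of \<alpha> 1]
  by (simp add: scalD(2)[OF assms(2)])

lemma filtered_hom_ev_comp:
  assumes "filtered_hom h" "\<forall>g. \<alpha> g \<in> fil 1"
  shows "h (ev sc \<alpha> s) = ev (\<lambda>c. h (sc c)) (\<lambda>g. h (\<alpha> g)) s"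
proof -
  have "h (evpart sc \<alpha> s n) = evpart (\<lambda>c. h (sc c)) (\<lambda>g. h (\<alpha> g)) s n" for n
    by (simp add: evpart_def filtered_homD[OF assms(1)] o_def)
  then show ?thesis unfolding ev_def
    using filtered_hom_sg[OF assms(1) evpart_fil[OF assms(2), of sc s]] by simp
qed

lemma ev_map: "ev (\<lambda>c. sc (h c)) \<alpha> s = ev sc \<alpha> (nc_map h s)"
  by (simp add: ev_def evpart_def[abs_def] nc_simps)

lemma ev_id: "ev nc_const nc_var s = s"
  unfolding ev_def
proof (rule sg_eqI)
  fix n
  show "evpart nc_const nc_var s n \<in> fil n" by (rule evpart_fil) (simp del: One_nat_def)
  show "s - (\<Sum>i<n. evpart nc_const nc_var s i) \<in> fil n"
    unfolding evpart_sum fil_ncfps_iff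
    by (auto simp: nc_simps nc_const_mult nc_coeff_prod_vars if_distrib[of "\<lambda>x. _ * x"] sum.delta' cong: if_cong)
qed

lemma ev_commute:
  assumes "\<forall>g. \<alpha> g \<in> fil 1" and sc: "scal sc" and x: "\<And>g. x * \<alpha> g = \<alpha> g * x"
  shows "x * ev sc \<alpha> s = ev sc \<alpha> s * x"
proof -
  have p: "x * prod_list (map \<alpha> w) = prod_list (map \<alpha> w) * x" for w
  proof (induction w)
    case (Cons g w)
    have "x * (\<alpha> g * prod_list (map \<alpha> w)) = \<alpha> g * (x * prod_list (map \<alpha> w))"
      by (simp only: mult.assoc[symmetric] x)
    then show ?case using Cons by (simp add: mult.assoc)
  qed simp
  have "x * evpart sc \<alpha> s n = evpart sc \<alpha> s n * x" for n
    unfolding evpart_def sum_distrib_left sum_distrib_right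
    by (rule sum.cong) (simp_all add: scal_commute[OF sc] p mult.assoc)
  then show ?thesis unfolding ev_def
    using sg_mult_left[OF evpart_fil[OF assms(1), of sc s], of x] sg_mult_right[OF evpart_fil[OF assms(1), of sc s], of x]
    by simp
qed

text \<open>With this rule \<open>fil 1\<close> would turn into \<open>fil (Suc 0)\<close>, and the
  facts about degree one would no longer match.\<close>

declare One_nat_def [simp del]

section \<open>Exponentials and powers with arbitrary exponents\<close>

definition pe :: "('k::comm_ring_1 \<Rightarrow> 'r::filtered_ring) \<Rightarrow> 'k fps \<Rightarrow> 'r \<Rightarrow> 'r" where
  "pe sc c a = sg (\<lambda>n. sc (fps_nth c n) * a ^ n)"

lemma pe_term_fil: "a \<in> fil 1 \<Longrightarrow> sc (fps_nth c n) * a ^ n \<in> fil n"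
  by (simp add: fil_mult_left fil_power)

lemma pe_approx:
  assumes "a \<in> fil 1"
  shows "pe sc c a - (\<Sum>i<n. sc (fps_nth c i) * a ^ i) \<in> fil n"
  unfolding pe_def by (rule sg_approx) (rule pe_term_fil[OF assms])

lemma pe_fil:
  assumes "a \<in> fil 1" "scal sc" "fps_nth c 0 = 0"
  shows "pe sc c a \<in> fil 1"
  using pe_approx[OF assms(1), of sc c 1] assms(3) scalD(1)[OF assms(2)] by simp

lemma pe_add:
  assumes "a \<in> fil 1" "scal sc"
  shows "pe sc (c + d) a = pe sc c a + pe sc d a"
  unfolding pe_def using sg_add[OF pe_term_fil[OF assms(1), of sc c] pe_term_fil[OF assms(1), of sc d]]
  by (simp add: scalD(3)[OF assms(2)] distrib_right)

lemma pe_mult: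
  assumes "a \<in> fil 1" "scal sc"
  shows "pe sc (c * d) a = pe sc c a * pe sc d a"
proof -
  have t: "sc (fps_nth c i) * a ^ i * (sc (fps_nth d j) * a ^ j) = sc (fps_nth c i * fps_nth d j) * a ^ (i + j)" for i j
  proof -
    have "sc (fps_nth c i) * a ^ i * (sc (fps_nth d j) * a ^ j) = sc (fps_nth c i) * (a ^ i * (sc (fps_nth d j) * a ^ j))"
      by (simp only: mult.assoc)
    also have "a ^ i * (sc (fps_nth d j) * a ^ j) = sc (fps_nth d j) * (a ^ i * a ^ j)"
      by (rule scal_commute[OF assms(2)])
    finally show ?thesis by (simp add: scalD(4)[OF assms(2)] power_add mult.assoc)
  qed
  have "sc (fps_nth (c * d) n) * a ^ n = (\<Sum>i\<le>n. sc (fps_nth c i) * a ^ i * (sc (fps_nth d (n - i)) * a ^ (n - i)))" for n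
    unfolding t fps_mult_nth scalD(7)[OF assms(2)] sum_distrib_right by (rule sum.cong) auto
  then show ?thesis
    unfolding pe_def using sg_mult[OF pe_term_fil[OF assms(1), of sc c] pe_term_fil[OF assms(1), of sc d]]
    by simp
qed

lemma pe_1: "scal sc \<Longrightarrow> pe sc 1 a = 1"
  unfolding pe_def
  using sg_single[of 1 0] scalD(1,2)[of sc] by (simp add: if_distrib[of sc] if_distrib[of "\<lambda>x. x * _"] cong: if_cong)

lemma pe_X:
  assumes "a \<in> fil 1" "scal sc"
  shows "pe sc fps_X a = a"
proof -
  have "(\<lambda>n. sc (fps_nth fps_X n) * a ^ n) = (\<lambda>n. if n = 1 then a else 0)"
    using scalD(1,2)[OF assms(2)] by auto
  then show ?thesis unfolding pe_def using sg_single[OF assms(1)] by simp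
qed

lemma pe_power:
  assumes "a \<in> fil 1" "scal sc"
  shows "pe sc (c ^ k) a = pe sc c a ^ k"
  by (induction k) (simp_all add: pe_1[OF assms(2)] pe_mult[OF assms])

text \<open>Modulo \<open>fil n\<close> the outer series is cut after \<open>n\<close> powers and
  each inner power after \<open>n\<close> terms; the resulting finite double sum can be
  exchanged.\<close>

lemma pe_compose:
  assumes a: "a \<in> fil 1" and sc: "scal sc" and d: "fps_nth d 0 = 0"
  shows "pe sc c (pe sc d a) = pe sc (c oo d) a"
proof (rule fil_eqI)
  fix n
  let ?b = "pe sc d a"
  let ?f = "\<lambda>k j. sc (fps_nth c k * fps_nth (d ^ k) j) * a ^ j"
  have "(\<Sum>k<n. sc (fps_nth c k) * ?b ^ k) - (\<Sum>k<n. \<Sum>j<n. ?f k j)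
      = (\<Sum>k<n. sc (fps_nth c k) * (pe sc (d ^ k) a - (\<Sum>j<n. sc (fps_nth (d ^ k) j) * a ^ j)))"
    by (simp add: pe_power[OF a sc] right_diff_distrib sum_subtractf sum_distrib_left scalD(4)[OF sc] mult.assoc)
  also have "\<dots> \<in> fil n" by (intro fil_sum fil_mult_left pe_approx[OF a])
  finally have 1: "(\<Sum>k<n. sc (fps_nth c k) * ?b ^ k) - (\<Sum>k<n. \<Sum>j<n. ?f k j) \<in> fil n" .
  \<comment> \<open>Without constant term, \<open>d ^ k\<close> has no coefficient in a degree
    \<open>j < k\<close>, so the sum over \<open>k\<close> may run up to \<open>n\<close> for every
    \<open>j\<close>.\<close>
  have inner: "sc (fps_nth (c oo d) j) * a ^ j = (\<Sum>k<n. ?f k j)" if "j < n" for j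
  proof -
    have "(\<Sum>k<n. ?f k j) = (\<Sum>k=0..j. ?f k j)"
      using that startsby_zero_power_prefix[OF d] scalD(1)[OF sc]
      by (intro sum.mono_neutral_right) auto
    then show ?thesis by (simp add: fps_compose_nth scalD(7)[OF sc] sum_distrib_right)
  qed
  have "(\<Sum>k<n. \<Sum>j<n. ?f k j) = (\<Sum>j<n. \<Sum>k<n. ?f k j)" by (rule sum.swap)
  also have "\<dots> = (\<Sum>j<n. sc (fps_nth (c oo d) j) * a ^ j)" using inner by simp
  finally have 2: "(\<Sum>k<n. \<Sum>j<n. ?f k j) = (\<Sum>j<n. sc (fps_nth (c oo d) j) * a ^ j)" .
  show "pe sc c ?b - pe sc (c oo d) a \<in> fil n"
    using fil_diff_trans[OF fil_diff_trans[OF pe_approx[OF pe_fil[OF a sc d]] 1]]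
      fil_diff_sym[OF pe_approx[OF a, of sc "c oo d" n]] unfolding 2 by blast
qed

lemma commute_sg:
  fixes x :: "'r::filtered_ring"
  assumes "\<And>n. s n \<in> fil n" "\<And>n. x * s n = s n * x"
  shows "x * sg s = sg s * x"
  using sg_mult_left[OF assms(1), of x] sg_mult_right[OF assms(1), of x] assms(2) by simp

lemma commute_power: "x * a = a * x \<Longrightarrow> x * a ^ n = a ^ n * (x :: 'r::monoid_mult)"
  by (metis power_commuting_commutes)

lemma pe_commute:
  assumes "a \<in> fil 1" "scal sc" "x * a = a * x"
  shows "x * pe sc c a = pe sc c a * x"
  unfolding pe_def
  by (rule commute_sg[OF pe_term_fil[OF assms(1)]])
    (simp add: scal_commute[OF assms(2)] commute_power[OF assms(3)] mult.assoc)

lemma filtered_hom_pe: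
  assumes "filtered_hom h" "a \<in> fil 1"
  shows "h (pe sc c a) = pe (\<lambda>c. h (sc c)) c (h a)"
  unfolding pe_def using filtered_hom_sg[OF assms(1) pe_term_fil[OF assms(2), of sc c]]
  by (simp add: filtered_homD(4,7)[OF assms(1)])

section \<open>Exponential, logarithm and powers\<close>

definition ex :: "('k::field_char_0 \<Rightarrow> 'r::filtered_ring) \<Rightarrow> 'r \<Rightarrow> 'r" where
  "ex sc a = pe sc (fps_exp 1) a"

definition lg :: "('k::field_char_0 \<Rightarrow> 'r::filtered_ring) \<Rightarrow> 'r \<Rightarrow> 'r" where
  "lg sc a = pe sc (fps_ln 1) (a - 1)"

definition pw :: "('k::field_char_0 \<Rightarrow> 'r::filtered_ring) \<Rightarrow> 'k \<Rightarrow> 'r \<Rightarrow> 'r" where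
  "pw sc m a = ex sc (sc m * lg sc a)"

lemma fps_exp_ln: "fps_exp 1 oo fps_ln 1 = 1 + (fps_X :: 'k::field_char_0 fps)"
proof -
  have "(fps_exp 1 - 1) oo fps_ln (1 :: 'k) = fps_X"
    unfolding fps_ln_fps_exp_inv[OF one_neq_zero] by (rule fps_inv_right) auto
  then show ?thesis by (simp add: fps_compose_sub_distrib algebra_simps)
qed

lemma fps_ln_exp: "fps_ln 1 oo (fps_exp 1 - 1) = (fps_X :: 'k::field_char_0 fps)"
  unfolding fps_ln_fps_exp_inv[OF one_neq_zero] by (rule fps_inv) auto

context
  fixes sc :: "'k::field_char_0 \<Rightarrow> 'r::filtered_ring"
  assumes sc: "scal sc"
begin

lemma pe_minus_1: "a \<in> fil 1 \<Longrightarrow> pe sc (c - 1) a = pe sc c a - 1"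
  using pe_add[OF _ sc, of a "c - 1" 1] by (simp add: pe_1[OF sc])

lemma lg_fil: "unip a \<Longrightarrow> lg sc a \<in> fil 1"
  unfolding lg_def unip_def by (rule pe_fil[OF _ sc]) auto

lemma ex_unip: "a \<in> fil 1 \<Longrightarrow> unip (ex sc a)"
  unfolding ex_def unip_def by (subst pe_minus_1[symmetric]) (auto intro: pe_fil[OF _ sc])

lemma ex_lg: "unip a \<Longrightarrow> ex sc (lg sc a) = a"
  unfolding ex_def lg_def unip_def
  by (subst pe_compose[OF _ sc]) (simp_all add: fps_exp_ln pe_add[OF _ sc] pe_1[OF sc] pe_X[OF _ sc])

lemma lg_ex: "a \<in> fil 1 \<Longrightarrow> lg sc (ex sc a) = a"
  unfolding ex_def lg_def
  by (subst pe_minus_1[symmetric], assumption, subst pe_compose[OF _ sc])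
    (simp_all add: fps_ln_exp pe_X[OF _ sc])

lemma ex_0: "ex sc 0 = 1"
proof -
  have "(\<lambda>n. sc (1 ^ n / fact n) * 0 ^ n) = (\<lambda>n. if n = 0 then 1 else 0)"
    by (auto simp: fun_eq_iff scalD(2)[OF sc] zero_power)
  then show ?thesis unfolding ex_def pe_def using sg_single[of "1 :: 'r" 0] by simp
qed

text \<open>Binomial theorem for the divided powers \<open>x ^ n / n!\<close>. The recursion
  \<open>x * S x n = (n + 1) * S x (n + 1)\<close> allows an induction without binomial
  coefficients: the weights \<open>i\<close> and \<open>n + 1 - i\<close> of the two sums add up to
  the common factor \<open>n + 1\<close>.\<close>

lemma ex_term_add:
  fixes x y :: 'r
  defines S_def: "S \<equiv> \<lambda>x n. sc (1 / fact n) * x ^ n"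
  assumes comm: "x * y = y * x"
  shows "S (x + y) n = (\<Sum>i\<le>n. S x i * S y (n - i))"
proof (induction n)
  case 0
  then show ?case by (simp add: S_def scalD(2)[OF sc])
next
  case (Suc n)
  let ?N = "of_nat :: nat \<Rightarrow> 'r"
  have fct: "sc (1 / fact n) = ?N (Suc n) * sc (1 / fact (Suc n))" for n
    unfolding scal_of_nat[OF sc, symmetric] scalD(4)[OF sc, symmetric] by (simp add: field_simps del: of_nat_Suc)
  have times_S: "x * S x n = ?N (Suc n) * S x (Suc n)" for x n
  proof -
    have "x * S x n = sc (1 / fact n) * x ^ Suc n" by (simp add: S_def scal_commute[OF sc])
    then show ?thesis unfolding fct[of n] by (simp only: S_def mult.assoc)
  qed
  have S_comm: "S x n * y = y * S x n" for n
    using commute_power[OF comm[symmetric]] by (simp add: S_def mult.assoc scal_commute[OF sc])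
  have N_comm: "a * (?N k * b) = ?N k * (a * b)" for a b k
    by (metis mult.assoc mult_of_nat_commute)
  have "?N (Suc n) * S (x + y) (Suc n) = (x + y) * (\<Sum>i\<le>n. S x i * S y (n - i))"
    by (metis Suc times_S)
  also have "\<dots> = (\<Sum>i\<le>n. x * S x i * S y (n - i)) + (\<Sum>i\<le>n. y * S x i * S y (n - i))"
    by (simp only: distrib_right sum_distrib_left mult.assoc sum.distrib)
  also have "(\<Sum>i\<le>n. y * S x i * S y (n - i)) = (\<Sum>i\<le>n. S x i * (y * S y (n - i)))"
    by (simp only: S_comm[symmetric] mult.assoc)
  also have "\<dots> = (\<Sum>i\<le>n. ?N (Suc n - i) * (S x i * S y (Suc n - i)))"
    unfolding times_S N_comm by (rule sum.cong) (auto simp: Suc_diff_le)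
  also have "\<dots> = (\<Sum>i\<le>Suc n. ?N (Suc n - i) * (S x i * S y (Suc n - i)))" by simp
  also have "(\<Sum>i\<le>n. x * S x i * S y (n - i)) = (\<Sum>i\<le>n. ?N (Suc i) * (S x (Suc i) * S y (n - i)))"
    unfolding times_S mult.assoc ..
  also have "\<dots> = (\<Sum>i\<le>Suc n. ?N i * (S x i * S y (Suc n - i)))"
    by (subst sum.atMost_Suc_shift) simp
  also have "\<dots> + (\<Sum>i\<le>Suc n. ?N (Suc n - i) * (S x i * S y (Suc n - i)))
      = (\<Sum>i\<le>Suc n. ?N (Suc n) * (S x i * S y (Suc n - i)))"
    unfolding sum.distrib[symmetric] distrib_right[symmetric] of_nat_add[symmetric]
    by (rule sum.cong) (auto simp del: of_nat_Suc)
  finally have "?N (Suc n) * S (x + y) (Suc n) = ?N (Suc n) * (\<Sum>i\<le>Suc n. S x i * S y (Suc n - i))"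
    by (simp only: sum_distrib_left)
  then have "sc (1 / of_nat (Suc n)) * (?N (Suc n) * S (x + y) (Suc n))
      = sc (1 / of_nat (Suc n)) * (?N (Suc n) * (\<Sum>i\<le>Suc n. S x i * S y (Suc n - i)))" by simp
  \<comment> \<open>The division by \<open>Suc n\<close> is carried out inside the scalars.\<close>
  moreover have "sc (1 / of_nat (Suc n)) * (?N (Suc n) * z) = z" for z
    unfolding mult.assoc[symmetric] scal_of_nat[OF sc, symmetric] scalD(4)[OF sc, symmetric]
    by (simp add: scalD(2)[OF sc] del: of_nat_Suc)
  ultimately show ?case by simp
qed

lemma ex_add:
  assumes "a \<in> fil 1" "b \<in> fil 1" "a * b = b * a"
  shows "ex sc (a + b) = ex sc a * ex sc b"
proof -
  have e: "ex sc x = sg (\<lambda>n. sc (1 / fact n) * x ^ n)" for x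
    by (simp add: ex_def pe_def)
  have f: "sc (1 / fact n) * x ^ n \<in> fil n" if "x \<in> fil 1" for x n
    using that by (simp add: fil_mult_left fil_power)
  show ?thesis unfolding e ex_term_add[OF assms(3)]
    by (rule sg_mult) (use f assms in auto)
qed

text \<open>The logarithms commute, so by \<open>ex_add\<close> their sum has exponential
  \<open>a * b\<close>, and \<open>lg_ex\<close> undoes the exponential.\<close>

lemma lg_mult:
  assumes "unip a" "unip b" "a * b = b * a"
  shows "lg sc (a * b) = lg sc a + lg sc b"
proof -
  have a1: "a - 1 \<in> fil 1" "b - 1 \<in> fil 1" using assms by (simp_all add: unip_def)
  have "a * lg sc b = lg sc b * a"
    unfolding lg_def by (rule pe_commute[OF a1(2) sc]) (simp add: algebra_simps assms(3))
  then have "lg sc b * lg sc a = lg sc a * lg sc b"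
    unfolding lg_def[of sc a] by (intro pe_commute[OF a1(1) sc]) (simp add: algebra_simps)
  then have "ex sc (lg sc a + lg sc b) = a * b"
    using ex_add[OF lg_fil lg_fil] assms by (simp add: ex_lg)
  then show ?thesis using lg_ex[OF fil_add[OF lg_fil lg_fil]] assms by metis
qed

lemma pw_unip [intro]: "unip a \<Longrightarrow> unip (pw sc m a)"
  unfolding pw_def by (intro ex_unip fil_mult_left lg_fil)

lemma pw_commute:
  assumes "unip a" "x * a = a * x"
  shows "x * pw sc m a = pw sc m a * x"
proof -
  have "x * lg sc a = lg sc a * x"
    unfolding lg_def using assms by (intro pe_commute[OF _ sc]) (simp_all add: unip_def algebra_simps)
  then have "x * (sc m * lg sc a) = sc m * lg sc a * x"
    by (simp add: scal_commute[OF sc] mult.assoc)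
  then show ?thesis unfolding pw_def ex_def
    using lg_fil[OF assms(1)] by (intro pe_commute[OF _ sc] fil_mult_left)
qed

lemma pw_mult:
  assumes "unip a" "unip b" "a * b = b * a"
  shows "pw sc m (a * b) = pw sc m a * pw sc m b"
proof -
  have c: "lg sc a * lg sc b = lg sc b * lg sc a"
    using lg_mult[OF assms] lg_mult[OF assms(2,1) assms(3)[symmetric]] assms
    unfolding lg_def by (intro pe_commute[OF _ sc] pe_commute[OF _ sc, symmetric])
      (simp_all add: unip_def algebra_simps)
  have "sc m * lg sc a * (sc m * lg sc b) = sc m * (sc m * (lg sc a * lg sc b))"
    by (metis mult.assoc scalD(8)[OF sc])
  moreover have "sc m * lg sc b * (sc m * lg sc a) = sc m * (sc m * (lg sc b * lg sc a))"
    by (metis mult.assoc scalD(8)[OF sc])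
  ultimately show ?thesis
    unfolding pw_def lg_mult[OF assms] distrib_left
    using lg_fil assms c by (intro ex_add fil_mult_left) auto
qed

lemma pw_1 [simp]: "pw sc m 1 = 1"
proof -
  have "lg sc 1 = 0" using lg_ex[of 0] ex_0 by simp
  then show ?thesis by (simp add: pw_def ex_0)
qed

lemma pw_uinv: "unip a \<Longrightarrow> pw sc m (uinv a) = uinv (pw sc m a)"
  using pw_mult[of a "uinv a" m] by (intro uinv_unique) (auto simp: uinv_right uinv_left)

text \<open>Binomial series up to degree two. As powers are defined by exponentials, it comes from
  \<open>log (1 + t) = t - t^2 / 2\<close> and \<open>exp u = 1 + u + u^2 / 2\<close>, which give
  the coefficient \<open>m^2 / 2 - m / 2\<close> of \<open>t^2\<close>.\<close>

lemma pw_quadratic: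
  assumes "unip a"
  shows "pw sc m a - (1 + sc m * (a - 1) + sc (m * (m - 1) / 2) * ((a - 1) * (a - 1))) \<in> fil 3"
proof -
  define t where "t = a - 1"
  define u where "u = sc m * lg sc a"
  have t: "t \<in> fil 1" using assms by (simp add: unip_def t_def)
  have u1: "u \<in> fil 1" unfolding u_def by (intro fil_mult_left lg_fil assms)
  have "lg sc a - (t - sc (1 / 2) * (t * t)) \<in> fil 3"
    using pe_approx[OF t, of sc "fps_ln 1" 3]
    by (simp add: lg_def t_def numeral_3_eq_3 fps_ln_nth scalD[OF sc] power2_eq_square)
  then have "u - sc m * (t - sc (1 / 2) * (t * t)) \<in> fil 3"
    unfolding u_def right_diff_distrib[symmetric] by (rule fil_mult_left)
  then have u: "u - (sc m * t - sc (m / 2) * (t * t)) \<in> fil 3"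
    by (simp add: right_diff_distrib mult.assoc[symmetric] scalD(4)[OF sc, symmetric])
  have "sc m * t - u \<in> fil 2"
    using fil_add[OF fil_mono[OF fil_diff_sym[OF u]], of 2 "sc (m / 2) * (t * t)"] fil_mult[OF t t]
    by (simp add: fil_mult_left numeral_2_eq_2)
  then have u2: "u - sc m * t \<in> fil 2" by (rule fil_diff_sym)
  have uu: "u * u - sc (m * m) * (t * t) \<in> fil 3"
  proof -
    have "u * u - sc m * t * (sc m * t) = u * (u - sc m * t) + (u - sc m * t) * (sc m * t)"
      by (simp add: algebra_simps)
    moreover have "u * (u - sc m * t) \<in> fil 3" using fil_mult[OF u1 u2] by (simp add: numeral_3_eq_3 numeral_2_eq_2 One_nat_def)
    moreover have "(u - sc m * t) * (sc m * t) \<in> fil 3" using fil_mult[OF u2 fil_mult_left[OF t]] by (simp add: numeral_3_eq_3 numeral_2_eq_2 One_nat_def)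
    ultimately have "u * u - sc m * t * (sc m * t) \<in> fil 3" by (simp add: fil_add)
    moreover have "sc m * t * (sc m * t) = sc (m * m) * (t * t)"
      by (metis mult.assoc scalD(4,8)[OF sc])
    ultimately show ?thesis by simp
  qed
  have "ex sc u - (1 + u + sc (1 / 2) * (u * u)) \<in> fil 3"
    using pe_approx[OF u1, of sc "fps_exp 1" 3]
    by (simp add: ex_def numeral_3_eq_3 scalD[OF sc] power2_eq_square)
  moreover have "(1 + u + sc (1 / 2) * (u * u)) - (1 + (sc m * t - sc (m / 2) * (t * t)) + sc (1 / 2) * (sc (m * m) * (t * t))) \<in> fil 3"
  proof (intro fil_diff_add)
    show "u - (sc m * t - sc (m / 2) * (t * t)) \<in> fil 3" by (rule u)
    show "sc (1 / 2) * (u * u) - sc (1 / 2) * (sc (m * m) * (t * t)) \<in> fil 3"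
      unfolding right_diff_distrib[symmetric] by (intro fil_mult_left uu)
  qed simp
  ultimately have "ex sc u - (1 + (sc m * t - sc (m / 2) * (t * t)) + sc (1 / 2) * (sc (m * m) * (t * t))) \<in> fil 3"
    by (rule fil_diff_trans)
  moreover have "sc (m * (m - 1) / 2) = sc (1 / 2) * sc (m * m) - sc (m / 2)"
    unfolding scalD(4)[OF sc, symmetric] scalD(5)[OF sc, symmetric] by (simp add: algebra_simps diff_divide_distrib)
  moreover have "1 + (sc m * t - sc (m / 2) * (t * t)) + sc (1 / 2) * (sc (m * m) * (t * t))
      = 1 + sc m * t + (sc (1 / 2) * sc (m * m) - sc (m / 2)) * (t * t)"
    by (simp add: algebra_simps)
  ultimately show ?thesis
    by (simp only: pw_def u_def t_def)
qed

end

lemma filtered_hom_pw: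
  assumes "filtered_hom h" "unip a" "scal sc"
  shows "h (pw sc m a) = pw (\<lambda>c. h (sc c)) m (h a)"
  unfolding pw_def ex_def
  using filtered_hom_pe[OF assms(1) fil_mult_left[OF lg_fil[OF assms(3,2)]]] assms
  by (simp add: lg_def filtered_hom_pe filtered_homD unip_def)

text \<open>Cutting the sum at the length of the word, as \<open>nc_exp\<close> and
  \<open>nc_log\<close> do, is exactly how \<open>sg\<close> sums series.\<close>

lemma nc_exp_eq_ex: "nc_exp a = ex nc_const a"
proof (rule ncfps_eqI)
  fix w
  show "nc_coeff (nc_exp a) w = nc_coeff (ex nc_const a) w"
    by (simp add: nc_exp_def ex_def pe_def sg_ncfps_def Abs_ncfps_inverse nc_const_mult atMost_atLeast0)
qed

lemma nc_log_eq_lg: "nc_log a = lg nc_const a"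
proof (rule ncfps_eqI)
  fix w
  have "(\<Sum>i\<le>length w. nc_coeff (nc_const (fps_ln 1 $ i) * (a - 1) ^ i) w)
      = (\<Sum>i=1..length w. (- 1) ^ (i + 1) * nc_coeff ((a - 1) ^ i) w / of_nat i)"
  proof (rule sum.mono_neutral_cong_right)
    fix i assume "i \<in> {1..length w}"
    then obtain j where "i = Suc j" by (cases i) auto
    then show "nc_coeff (nc_const (fps_ln 1 $ i) * (a - 1) ^ i) w
        = (- 1) ^ (i + 1) * nc_coeff ((a - 1) ^ i) w / of_nat i"
      by (simp add: nc_const_mult fps_ln_nth One_nat_def)
  qed (auto simp: nc_const_mult not_less_eq_eq)
  then show "nc_coeff (nc_log a) w = nc_coeff (lg nc_const a) w"
    by (simp add: nc_log_def lg_def pe_def sg_ncfps_def Abs_ncfps_inverse)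
qed

lemma nc_powr_eq_pw: "nc_powr a m = pw nc_const m a"
  by (simp add: nc_powr_def pw_def nc_exp_eq_ex nc_log_eq_lg)

section \<open>Filtered matrices indexed by words\<close>

text \<open>Linear maps between series that do not lower the degree; \<open>entry M u v\<close> is the coefficient of \<open>u\<close>
  in the image of the word \<open>v\<close>.\<close>

typedef (overloaded) ('g, 'a::zero) fmat =
  "{M :: 'g list \<Rightarrow> 'g list \<Rightarrow> 'a. \<forall>u v. length u < length v \<longrightarrow> M u v = 0}"
  morphisms entry Abs_fmat
  by (rule exI[of _ "\<lambda>_ _. 0"]) simp

setup_lifting type_definition_fmat

lemma entry_eq_0: "length u < length v \<Longrightarrow> entry M u v = 0"
  using entry[of M] by simp

lemma fmat_eqI: "(\<And>u v. entry M u v = entry N u v) \<Longrightarrow> M = N"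
  by (simp add: entry_inject[symmetric] fun_eq_iff)

instantiation fmat :: (finite, ring_1) ring_1
begin

lift_definition zero_fmat :: "('a, 'b) fmat" is "\<lambda>_ _. 0" by simp

lift_definition one_fmat :: "('a, 'b) fmat" is "\<lambda>u v. if u = v then 1 else 0" by auto

lift_definition plus_fmat :: "('a, 'b) fmat \<Rightarrow> ('a, 'b) fmat \<Rightarrow> ('a, 'b) fmat"
  is "\<lambda>M N u v. M u v + N u v" by simp

lift_definition uminus_fmat :: "('a, 'b) fmat \<Rightarrow> ('a, 'b) fmat"
  is "\<lambda>M u v. - M u v" by simp

lift_definition minus_fmat :: "('a, 'b) fmat \<Rightarrow> ('a, 'b) fmat \<Rightarrow> ('a, 'b) fmat"
  is "\<lambda>M N u v. M u v - N u v" by simp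

lift_definition times_fmat :: "('a, 'b) fmat \<Rightarrow> ('a, 'b) fmat \<Rightarrow> ('a, 'b) fmat"
  is "\<lambda>M N u w. \<Sum>v | length v \<le> length u. M u v * N v w"
  by (auto intro!: sum.neutral)

instance
proof
  fix M N P :: "('a, 'b) fmat"
  show "M * N * P = M * (N * P)"
  proof (rule fmat_eqI)
    fix u x :: "'a list"
    let ?S = "{v :: 'a list. length v \<le> length u}"
    have "entry (M * (N * P)) u x = (\<Sum>v\<in>?S. \<Sum>w | length w \<le> length v. entry M u v * (entry N v w * entry P w x))"
      by (simp add: times_fmat.rep_eq sum_distrib_left)
    \<comment> \<open>Entries whose column word is longer than the row word vanish, so the range of
      \<open>w\<close> can be made independent of \<open>v\<close>.\<close>
    also have "\<dots> = (\<Sum>v\<in>?S. \<Sum>w\<in>?S. entry M u v * (entry N v w * entry P w x))"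
      by (intro sum.cong HOL.refl sum.mono_neutral_left) (auto simp: entry_eq_0)
    also have "\<dots> = (\<Sum>w\<in>?S. \<Sum>v\<in>?S. entry M u v * (entry N v w * entry P w x))"
      by (rule sum.swap)
    also have "\<dots> = entry (M * N * P) u x"
      by (simp add: times_fmat.rep_eq sum_distrib_right mult.assoc)
    finally show "entry (M * N * P) u x = entry (M * (N * P)) u x" by simp
  qed
  show "1 * M = M"
    by (rule fmat_eqI) (simp add: times_fmat.rep_eq one_fmat.rep_eq if_distrib[of "\<lambda>x. x * _"] sum.delta cong: if_cong)
  show "M * 1 = M"
  proof (rule fmat_eqI)
    fix u v show "entry (M * 1) u v = entry M u v"
      using entry_eq_0[of u v M]
      by (auto simp: times_fmat.rep_eq one_fmat.rep_eq if_distrib[of "\<lambda>x. _ * x"] sum.delta' cong: if_cong)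
  qed
  have "entry (0 :: ('a, 'b) fmat) [] [] \<noteq> entry 1 [] []"
    by (simp add: zero_fmat.rep_eq one_fmat.rep_eq)
  then show "(0 :: ('a, 'b) fmat) \<noteq> 1" by auto
  show "M + N + P = M + (N + P)" by transfer (simp add: add.assoc)
  show "M + N = N + M" by transfer (simp add: add.commute)
  show "0 + M = M" by transfer simp
  show "- M + M = 0" by transfer simp
  show "M - N = M + - N" by transfer simp
  show "(M + N) * P = M * P + N * P" by transfer (simp add: distrib_right sum.distrib)
  show "M * (N + P) = M * N + M * P" by transfer (simp add: distrib_left sum.distrib)
qed

end

lemma entry_sum: "entry (sum f A) u v = (\<Sum>i\<in>A. entry (f i :: ('g::finite, 'a::ring_1) fmat) u v)"
  by (induction A rule: infinite_finite_induct) (simp_all add: zero_fmat.rep_eq plus_fmat.rep_eq)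

lemmas fmat_simps = zero_fmat.rep_eq one_fmat.rep_eq plus_fmat.rep_eq uminus_fmat.rep_eq
  minus_fmat.rep_eq entry_sum

instantiation fmat :: (finite, ring_1) filtered_ring
begin

definition fil_fmat :: "nat \<Rightarrow> ('a, 'b) fmat set" where
  "fil_fmat n = {M. \<forall>u v. length u < length v + n \<longrightarrow> entry M u v = 0}"

lift_definition sg_fmat :: "(nat \<Rightarrow> ('a, 'b) fmat) \<Rightarrow> ('a, 'b) fmat"
  is "\<lambda>s u v. \<Sum>i\<le>length u. s i u v" by simp

instance
proof
  fix x y :: "('a, 'b) fmat" and m n :: nat and s :: "nat \<Rightarrow> ('a, 'b) fmat"
  show "fil 0 = (UNIV :: ('a, 'b) fmat set)" by (simp add: fil_fmat_def entry_eq_0)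
  show "(0 :: ('a, 'b) fmat) \<in> fil n" by (simp add: fil_fmat_def fmat_simps)
  show "x + y \<in> fil n" if "x \<in> fil n" "y \<in> fil n"
    using that by (simp add: fil_fmat_def fmat_simps)
  show "- x \<in> fil n" if "x \<in> fil n"
    using that by (simp add: fil_fmat_def fmat_simps)
  show "x \<in> fil n" if "x \<in> fil (Suc n)"
    using that by (simp add: fil_fmat_def)
  show "x = 0" if "\<And>n. x \<in> fil n"
  proof (rule fmat_eqI)
    fix u v show "entry x u v = entry 0 u v"
      using that[of "Suc (length u)"] by (simp add: fil_fmat_def fmat_simps)
  qed
  show "x * y \<in> fil (m + n)" if x: "x \<in> fil m" and y: "y \<in> fil n"
  proof -
    have "entry x u v * entry y v w = 0" if "length u < length w + (m + n)" for u v w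
      using x y that by (cases "length u < length v + m") (simp_all add: fil_fmat_def)
    then show ?thesis by (simp add: fil_fmat_def times_fmat.rep_eq)
  qed
  show "sg s - (\<Sum>i<n. s i) \<in> fil n" if s: "\<And>n. s n \<in> fil n"
    unfolding fil_fmat_def
  proof (intro CollectI allI impI)
    fix u v :: "'a list" assume uv: "length u < length v + n"
    have s0: "entry (s i) u v = 0" if "length u < length v + i" for i
      using s[of i] that by (simp add: fil_fmat_def)
    have "(\<Sum>i\<le>length u. entry (s i) u v) = (\<Sum>i\<in>{..length u} \<inter> {..<n}. entry (s i) u v)"
      using uv by (intro sum.mono_neutral_right) (auto intro: s0)
    moreover have "(\<Sum>i<n. entry (s i) u v) = (\<Sum>i\<in>{..length u} \<inter> {..<n}. entry (s i) u v)"
      using uv by (intro sum.mono_neutral_right) (auto intro: s0)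
    ultimately show "entry (sg s - (\<Sum>i<n. s i)) u v = 0"
      by (simp add: fmat_simps sg_fmat.rep_eq)
  qed
qed

end

lemma fil_fmat_iff: "M \<in> fil n \<longleftrightarrow> (\<forall>u v. length u < length v + n \<longrightarrow> entry M u v = 0)"
  by (simp add: fil_fmat_def)

lift_definition fsc :: "'a::comm_ring_1 \<Rightarrow> ('g::finite, 'a) fmat"
  is "\<lambda>c u v. if u = v then c else 0" by auto

lemma fsc_mult: "entry (fsc c * M) u v = c * entry M u v"
  by (simp add: times_fmat.rep_eq fsc.rep_eq if_distrib[of "\<lambda>x. x * _"] sum.delta cong: if_cong)

lemma mult_fsc: "entry (M * fsc c) u v = entry M u v * c"
  using entry_eq_0[of u v M]
  by (auto simp: times_fmat.rep_eq fsc.rep_eq if_distrib[of "\<lambda>x. _ * x"] sum.delta' cong: if_cong)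

lemma scal_fsc: "scal fsc"
  unfolding scal_def
  by (intro conjI allI fmat_eqI) (auto simp: fsc_mult mult_fsc mult.commute fmat_simps fsc.rep_eq)

subsection \<open>Action on series\<close>

definition fapp :: "('g::finite, 'a::comm_ring_1) fmat \<Rightarrow> ('g, 'a) ncfps \<Rightarrow> ('g, 'a) ncfps" where
  "fapp M s = Abs_ncfps (\<lambda>u. \<Sum>v | length v \<le> length u. entry M u v * nc_coeff s v)"

lemma nc_coeff_fapp: "nc_coeff (fapp M s) u = (\<Sum>v | length v \<le> length u. entry M u v * nc_coeff s v)"
  by (simp add: fapp_def Abs_ncfps_inverse)

lemma fapp_mult: "fapp (M * N) s = fapp M (fapp N s)"
proof (rule ncfps_eqI)
  fix u :: "'a list"
  let ?S = "{v :: 'a list. length v \<le> length u}"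
  have "nc_coeff (fapp M (fapp N s)) u
      = (\<Sum>v\<in>?S. \<Sum>w | length w \<le> length v. entry M u v * (entry N v w * nc_coeff s w))"
    by (simp add: nc_coeff_fapp sum_distrib_left)
  also have "\<dots> = (\<Sum>v\<in>?S. \<Sum>w\<in>?S. entry M u v * (entry N v w * nc_coeff s w))"
    by (intro sum.cong HOL.refl sum.mono_neutral_left) (auto simp: entry_eq_0)
  also have "\<dots> = (\<Sum>w\<in>?S. \<Sum>v\<in>?S. entry M u v * (entry N v w * nc_coeff s w))"
    by (rule sum.swap)
  also have "\<dots> = nc_coeff (fapp (M * N) s) u"
    by (simp add: nc_coeff_fapp times_fmat.rep_eq sum_distrib_right mult.assoc)
  finally show "nc_coeff (fapp (M * N) s) u = nc_coeff (fapp M (fapp N s)) u" by simp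
qed

lemma fapp_add: "fapp (M + N) s = fapp M s + fapp N s"
  by (rule ncfps_eqI) (simp add: nc_coeff_fapp fmat_simps nc_simps distrib_right sum.distrib)

lemma fapp_1 [simp]: "fapp 1 s = s"
  by (rule ncfps_eqI) (simp add: nc_coeff_fapp fmat_simps if_distrib[of "\<lambda>x. x * _"] sum.delta cong: if_cong)

definition word :: "'g list \<Rightarrow> ('g, 'a::comm_ring_1) ncfps" where
  "word v = prod_list (map nc_var v)"

lemma nc_coeff_word: "nc_coeff (word v) w = (if w = v then 1 else 0)"
  by (simp add: word_def nc_coeff_prod_vars)

lemma word_Nil [simp]: "word [] = 1" and word_Cons: "word (g # v) = nc_var g * word v"
  by (simp_all add: word_def)

lemma entry_fapp: "entry M u v = nc_coeff (fapp M (word v)) u"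
  using entry_eq_0[of u v M]
  by (auto simp: nc_coeff_fapp nc_coeff_word if_distrib[of "\<lambda>x. _ * x"] sum.delta' cong: if_cong)

lemma fapp_word_eqI: "(\<And>v. fapp M (word v) = fapp N (word v)) \<Longrightarrow> M = N"
  by (rule fmat_eqI) (simp add: entry_fapp)

text \<open>Left multiplication by \<open>s\<close>: the word \<open>u\<close> can occur in
  \<open>s\<close> times the word \<open>v\<close> only if \<open>v\<close> is a suffix of
  \<open>u\<close>, and then with the coefficient of \<open>s\<close> at the remaining
  prefix.\<close>

definition lmul :: "('g::finite, 'a::comm_ring_1) ncfps \<Rightarrow> ('g, 'a) fmat" where
  "lmul s = Abs_fmat (\<lambda>u v. if length v \<le> length u \<and> drop (length u - length v) u = v
     then nc_coeff s (take (length u - length v) u) else 0)"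

lemma entry_lmul: "entry (lmul s) u v = (if length v \<le> length u \<and> drop (length u - length v) u = v
     then nc_coeff s (take (length u - length v) u) else 0)"
  unfolding lmul_def by (subst Abs_fmat_inverse) auto

lemma fapp_lmul: "fapp (lmul s) t = s * t"
proof (rule ncfps_eqI)
  fix u :: "'a list"
  have inj: "inj_on (\<lambda>i. drop i u) {0..length u}"
    by (rule inj_on_inverseI[of _ "\<lambda>v. length u - length v"]) auto
  have "nc_coeff (fapp (lmul s) t) u
      = (\<Sum>v\<in>(\<lambda>i. drop i u) ` {0..length u}. nc_coeff s (take (length u - length v) u) * nc_coeff t v)"
    unfolding nc_coeff_fapp
  proof (rule sum.mono_neutral_cong_right)
    show "\<forall>v\<in>{v. length v \<le> length u} - (\<lambda>i. drop i u) ` {0..length u}. entry (lmul s) u v * nc_coeff t v = 0"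
    proof
      fix v assume v: "v \<in> {v. length v \<le> length u} - (\<lambda>i. drop i u) ` {0..length u}"
      have "drop (length u - length v) u \<noteq> v"
        using v by (metis (no_types, lifting) DiffD2 atLeastAtMost_iff diff_le_self imageI le0)
      then show "entry (lmul s) u v * nc_coeff t v = 0" by (simp add: entry_lmul)
    qed
  qed (auto simp: entry_lmul)
  also have "\<dots> = (\<Sum>i=0..length u. nc_coeff s (take i u) * nc_coeff t (drop i u))"
    by (subst sum.reindex[OF inj]) (auto intro!: sum.cong)
  finally show "nc_coeff (fapp (lmul s) t) u = nc_coeff (s * t) u"
    by (simp add: times_ncfps.rep_eq)
qed

lemma lmul_mult: "lmul (s * t) = lmul s * lmul t"
  by (rule fapp_word_eqI) (simp add: fapp_mult fapp_lmul mult.assoc)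

lemma lmul_add: "lmul (s + t) = lmul s + lmul t"
  by (rule fapp_word_eqI) (simp add: fapp_add fapp_lmul distrib_right)

lemma lmul_1 [simp]: "lmul 1 = 1"
  by (rule fapp_word_eqI) (simp add: fapp_lmul)

lemma lmul_fil: "s \<in> fil n \<Longrightarrow> lmul s \<in> fil n"
  by (auto simp: fil_fmat_iff fil_ncfps_iff entry_lmul)

lemma filtered_hom_lmul: "filtered_hom lmul"
  by (simp add: filtered_hom_def lmul_mult lmul_add lmul_fil)

text \<open>Left multiplication is faithful, as its value at 1 shows. Identities of series can
  therefore be proved between matrices, where the Artin automorphisms live as well.\<close>

lemma lmul_inject: "lmul s = lmul t \<longleftrightarrow> s = t"
  by (metis fapp_lmul mult_1_right)

lemma lmul_const: "lmul (nc_const c) = fsc c"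
  by (rule fmat_eqI) (auto simp: entry_lmul nc_simps fsc.rep_eq)

subsection \<open>Substitutions as matrices\<close>

text \<open>Matrix of the algebra endomorphism that substitutes \<open>\<phi>\<close>. The case
  distinction makes it triangular by definition and changes nothing when all \<open>\<phi> g\<close>
  lie in \<open>fil 1\<close>.\<close>

definition submat :: "('g::finite \<Rightarrow> ('g, 'a::comm_ring_1) ncfps) \<Rightarrow> ('g, 'a) fmat" where
  "submat \<phi> = Abs_fmat (\<lambda>u v. if length u < length v then 0 else nc_coeff (prod_list (map \<phi> v)) u)"

lemma fapp_submat:
  assumes "\<forall>g. \<phi> g \<in> fil 1"
  shows "fapp (submat \<phi>) (word v) = prod_list (map \<phi> v)"
proof (rule ncfps_eqI)
  fix u
  have "entry (submat \<phi>) u v = (if length u < length v then 0 else nc_coeff (prod_list (map \<phi> v)) u)"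
    unfolding submat_def by (subst Abs_fmat_inverse) auto
  then show "nc_coeff (fapp (submat \<phi>) (word v)) u = nc_coeff (prod_list (map \<phi> v)) u"
    using prod_list_fil[OF assms, of v] by (simp add: entry_fapp[symmetric] fil_ncfps_iff)
qed

lemma submat_var:
  assumes "\<forall>g. \<phi> g \<in> fil 1"
  shows "submat \<phi> * lmul (nc_var g) = lmul (\<phi> g) * submat \<phi>"
  by (rule fapp_word_eqI) (simp add: fapp_mult fapp_lmul fapp_submat[OF assms] flip: word_Cons)

text \<open>A word is a product of variables applied to 1, so the intertwining relations determine a
  matrix from its value at 1. Equality of automorphisms is checked on generators in this
  way.\<close>

lemma intertwiner_unique:
  assumes "fapp M 1 = fapp N 1"
    and "\<And>g. M * lmul (nc_var g) = lmul (c g) * M" "\<And>g. N * lmul (nc_var g) = lmul (c g) * N"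
  shows "M = N"
proof (rule fapp_word_eqI)
  fix v
  have *: "fapp P (word (g # v)) = c g * fapp P (word v)"
    if "\<And>g. P * lmul (nc_var g) = lmul (c g) * P" for P g v
    using arg_cong[OF that[of g], of "\<lambda>Q. fapp Q (word v)"] by (simp add: fapp_mult fapp_lmul word_Cons)
  show "fapp M (word v) = fapp N (word v)"
    by (induction v) (simp_all add: assms(1) *[OF assms(2)] *[OF assms(3)])
qed

subsection \<open>Change of coefficients\<close>

definition rhom :: "('a::ring_1 \<Rightarrow> 'b::ring_1) \<Rightarrow> bool" where
  "rhom h \<longleftrightarrow> h 1 = 1 \<and> (\<forall>a b. h (a + b) = h a + h b) \<and> (\<forall>a b. h (a * b) = h a * h b)"

lemma rhomD:
  assumes "rhom h"
  shows "h 0 = 0" "h 1 = 1" "h (a + b) = h a + h b" "h (a * b) = h a * h b" "h (sum f A) = (\<Sum>i\<in>A. h (f i))"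
proof -
  show add: "h (x + y) = h x + h y" for x y using assms by (simp add: rhom_def)
  show zero: "h 0 = 0" using add[of 0 0] by simp
  show "h 1 = 1" "h (a * b) = h a * h b" using assms by (simp_all add: rhom_def)
  show "h (sum f A) = (\<Sum>i\<in>A. h (f i))"
    by (induction A rule: infinite_finite_induct) (simp_all add: zero add)
qed

text \<open>The case distinction keeps the matrix triangular for an arbitrary \<open>h\<close>; for
  ring homomorphisms, which fix 0, it disappears in \<open>entry_fmap\<close>.\<close>

definition fmap :: "('a::zero \<Rightarrow> 'b::zero) \<Rightarrow> ('g, 'a) fmat \<Rightarrow> ('g, 'b) fmat" where
  "fmap h M = Abs_fmat (\<lambda>u v. if length u < length v then 0 else h (entry M u v))"

lemma entry_fmap:
  assumes "rhom h" shows "entry (fmap h M) u v = h (entry M u v)"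
  unfolding fmap_def
  by (subst Abs_fmat_inverse) (auto simp: rhomD(1)[OF assms] entry_eq_0)

lemma filtered_hom_fmap: "rhom h \<Longrightarrow> filtered_hom (fmap h)"
  unfolding filtered_hom_def
  by (auto intro!: fmat_eqI simp: entry_fmap fmat_simps fil_fmat_iff rhomD times_fmat.rep_eq)

lemma fmap_fsc: "rhom h \<Longrightarrow> fmap h (fsc c) = fsc (h c)"
  by (rule fmat_eqI) (simp add: entry_fmap fsc.rep_eq rhomD)

lemma fmap_lmul: "rhom h \<Longrightarrow> fmap h (lmul s) = lmul (nc_map h s)"
  by (rule fmat_eqI) (simp add: entry_fmap entry_lmul rhomD nc_simps)

lemma filtered_hom_nc_map: "rhom h \<Longrightarrow> filtered_hom (nc_map h)"
  unfolding filtered_hom_def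
  by (auto intro!: ncfps_eqI simp: nc_simps fil_ncfps_iff rhomD times_ncfps.rep_eq)

lemma nc_map_const: "rhom h \<Longrightarrow> nc_map h (nc_const c) = nc_const (h c)"
  by (rule ncfps_eqI) (simp add: nc_simps rhomD)

lemma nc_map_var: "rhom h \<Longrightarrow> nc_map h (nc_var g) = nc_var g"
  by (rule ncfps_eqI) (simp add: nc_simps rhomD)

section \<open>The hexagon defect\<close>

definition fe :: "('k::comm_ring_1 \<Rightarrow> 'r::filtered_ring) \<Rightarrow> (xy, 'k) ncfps \<Rightarrow> 'r \<Rightarrow> 'r \<Rightarrow> 'r" where
  "fe sc F a b = ev sc (case_xy (a - 1) (b - 1)) F"

definition hx :: "('k::field_char_0 \<Rightarrow> 'r::filtered_ring) \<Rightarrow> (xy, 'k) ncfps \<Rightarrow> 'k \<Rightarrow> 'r \<Rightarrow> 'r \<Rightarrow> 'r" where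
  "hx sc F m a b = (let z = uinv (a * b) in
     fe sc F z a * pw sc m z * fe sc F b z * pw sc m b * fe sc F a b * pw sc m a)"

lemma case_xy_fil: "A \<in> fil n \<Longrightarrow> B \<in> fil n \<Longrightarrow> \<forall>g. case_xy A B g \<in> fil n"
  by (auto split: xy.split)

lemma unip_fil: "unip a \<Longrightarrow> a - 1 \<in> fil 1"
  by (simp add: unip_def)

lemma fe_unip:
  assumes "scal sc" "nc_coeff F [] = 1" "unip a" "unip b"
  shows "unip (fe sc F a b)"
  unfolding fe_def
  by (rule filtered_hom_unip[OF filtered_hom_ev[OF case_xy_fil assms(1)]]) (use assms in \<open>auto simp: unip_fil unip_ncfps_iff\<close>)

lemma fe_commute:
  assumes "scal sc" "unip a" "unip b" "x * a = a * x" "x * b = b * x"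
  shows "x * fe sc F a b = fe sc F a b * x"
  unfolding fe_def
  by (rule ev_commute[OF case_xy_fil assms(1)])
    (use assms in \<open>auto simp: unip_fil algebra_simps split: xy.split\<close>)

lemma filtered_hom_fe:
  assumes "filtered_hom h" "unip a" "unip b"
  shows "h (fe sc F a b) = fe (\<lambda>c. h (sc c)) F (h a) (h b)"
proof -
  have "(\<lambda>g. h (case_xy (a - 1) (b - 1) g)) = case_xy (h a - 1) (h b - 1)"
    using filtered_homD[OF assms(1)] by (auto simp: fun_eq_iff split: xy.split)
  then show ?thesis unfolding fe_def
    using filtered_hom_ev_comp[OF assms(1) case_xy_fil[OF unip_fil[OF assms(2)] unip_fil[OF assms(3)]], of sc F]
    by simp
qed

lemma filtered_hom_hx:
  assumes "filtered_hom h" "unip a" "unip b" "scal sc"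
  shows "h (hx sc F m a b) = hx (\<lambda>c. h (sc c)) F m (h a) (h b)"
  using assms(2,3)
  by (simp add: hx_def Let_def filtered_homD(4)[OF assms(1)] filtered_hom_fe[OF assms(1)] filtered_hom_pw[OF assms(1) _ assms(4)]
      filtered_hom_uinv[OF assms(1)] unip_uinv unip_mult)

abbreviation mx :: "(xy, 'k::ring_1) ncfps" where "mx \<equiv> 1 + nc_var gX"

abbreviation my :: "(xy, 'k::ring_1) ncfps" where "my \<equiv> 1 + nc_var gY"

lemma unip_var [simp]: "unip (1 + nc_var g)"
  by (simp add: unip_def)

lemma ev_mxy:
  assumes "scal sc" "unip a" "unip b"
  shows "ev sc (case_xy (a - 1) (b - 1)) mx = a" "ev sc (case_xy (a - 1) (b - 1)) my = b"
  using filtered_homD(2,3)[OF filtered_hom_ev[OF case_xy_fil assms(1)], of "a - 1" "b - 1"] ev_var[OF case_xy_fil assms(1), of "a - 1" "b - 1"]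
    assms(2,3) by (simp_all add: unip_fil)

text \<open>The defect has to be studied only for the universal pair \<open>mx\<close>,
  \<open>my\<close>; all other values are substitutions.\<close>

lemma hx_universal:
  assumes "scal sc" "unip a" "unip b"
  shows "hx sc F m a b = ev sc (case_xy (a - 1) (b - 1)) (hx nc_const F m mx my)"
  by (subst filtered_hom_hx[OF filtered_hom_ev[OF case_xy_fil assms(1)]])
    (use assms in \<open>simp_all add: unip_fil scal_nc_const ev_mxy ev_const\<close>)

text \<open>The two sides are the ways around the polytope of a strand crossing three others.\<close>

lemma crossing_polytope:
  fixes p1 :: "'r::filtered_ring"
  assumes e12: "p2 * a3 * p1 = b1 * q12 * b2 * h12"
    and e123: "p3 * b4 * q12 = b5 * q * b6 * h123"
    and e1_23: "q23 * b13 * p1 = b8 * q * b10 * h1_23"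
    and e23: "p3 * a1 * p2 = b7 * q23 * b12 * h23"
    and P1: "b10 * b11 = b9 * b6 * b2" and P2: "b13 * b11 = b12 * a2 * a3"
    and P3: "b3 * b4 = a1 * a2 * b1" and P4: "b3 * b5 = b7 * b8 * b9"
    and comm: "p3 * b3 = b3 * p3" "q * b9 = b9 * q" "p1 * b11 = b11 * p1" "p2 * a2 = a2 * p2"
    and u: "unip b2" "unip b11" "unip a2" "unip a3" "unip p1" "unip b7" "unip b8" "unip q" "unip b10"
  shows "uinv b2 * h123 * b2 * h12
    = uinv b11 * h1_23 * b11 * (uinv (a2 * a3 * p1) * h23 * (a2 * a3 * p1))"
proof -
  let ?v = "a2 * a3 * p1"
  \<comment> \<open>Multiplied by this path, one side is rewritten into the other, one face at a
    time; each of the four pentagons, four hexagons and four squares is used once. Conjugation moves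
    the four defects to a common vertex.\<close>
  let ?L = "b7 * b8 * q * b10 * b11"
  have uv: "unip ?v" using u by blast
  have "?L * (uinv b2 * h123 * b2 * h12) = b7 * b8 * q * (b10 * b11) * (uinv b2 * h123 * b2 * h12)"
    by (simp only: mult.assoc)
  also have "\<dots> = b7 * b8 * (q * b9) * b6 * (b2 * (uinv b2 * (h123 * b2 * h12)))"
    unfolding P1 by (simp only: mult.assoc)
  also have "\<dots> = (b7 * b8 * b9) * q * b6 * (h123 * b2 * h12)"
    unfolding uinv_cancel[OF u(1)] comm(2) by (simp only: mult.assoc)
  also have "\<dots> = b3 * (b5 * q * b6 * h123) * b2 * h12" unfolding P4[symmetric] by (simp only: mult.assoc)
  also have "\<dots> = (b3 * p3) * b4 * q12 * b2 * h12" unfolding e123[symmetric] by (simp only: mult.assoc)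
  also have "\<dots> = p3 * (b3 * b4) * q12 * b2 * h12" unfolding comm(1)[symmetric] by (simp only: mult.assoc)
  also have "\<dots> = p3 * a1 * a2 * (b1 * q12 * b2 * h12)" unfolding P3 by (simp only: mult.assoc)
  also have "\<dots> = p3 * a1 * (a2 * p2) * a3 * p1" unfolding e12[symmetric] by (simp only: mult.assoc)
  also have "\<dots> = (p3 * a1 * p2) * ?v" unfolding comm(4)[symmetric] by (simp only: mult.assoc)
  also have "\<dots> = b7 * q23 * b12 * h23 * ?v" unfolding e23 ..
  also have "\<dots> = b7 * q23 * b12 * (?v * (uinv ?v * (h23 * ?v)))"
    unfolding uinv_cancel[OF uv] by (simp only: mult.assoc)
  also have "\<dots> = b7 * q23 * (b12 * a2 * a3) * p1 * (uinv ?v * h23 * ?v)" by (simp only: mult.assoc)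
  also have "\<dots> = b7 * q23 * b13 * (b11 * p1) * (uinv ?v * h23 * ?v)"
    unfolding P2[symmetric] by (simp only: mult.assoc)
  also have "\<dots> = b7 * (q23 * b13 * p1) * b11 * (uinv ?v * h23 * ?v)"
    unfolding comm(3)[symmetric] by (simp only: mult.assoc)
  also have "\<dots> = b7 * b8 * q * b10 * h1_23 * b11 * (uinv ?v * h23 * ?v)"
    unfolding e1_23 by (simp only: mult.assoc)
  also have "\<dots> = b7 * b8 * q * b10 * (b11 * (uinv b11 * (h1_23 * b11 * (uinv ?v * h23 * ?v))))"
    unfolding uinv_cancel[OF u(2)] by (simp only: mult.assoc)
  also have "\<dots> = ?L * (uinv b11 * h1_23 * b11 * (uinv ?v * h23 * ?v))"
    by (simp only: mult.assoc)
  finally show ?thesis using u unip_cancel_left[of ?L] by blast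
qed

section \<open>Leading terms under conjugation, multiplication and substitution\<close>

lemma conj_fil:
  assumes "unip u" "h - 1 \<in> fil n"
  shows "(uinv u * h * u) - h \<in> fil (n + 1)"
proof -
  have "uinv u * h * u - h = uinv u * (h * u - u * h)"
    by (simp add: right_diff_distrib mult.assoc uinv_cancel[OF assms(1)])
  \<comment> \<open>The commutator of \<open>h\<close> and \<open>u\<close> is that of
    \<open>h - 1\<close> and \<open>u - 1\<close>, which have degrees \<open>n\<close> and
    1.\<close>
  also have "h * u - u * h = (h - 1) * (u - 1) - (u - 1) * (h - 1)" by (simp add: algebra_simps)
  also have "(h - 1) * (u - 1) - (u - 1) * (h - 1) \<in> fil (n + 1)"
    using fil_mult[OF assms(2) unip_fil[OF assms(1)]] fil_mult[OF unip_fil[OF assms(1)] assms(2)]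
    by (intro fil_diff) (simp_all add: add.commute)
  then have "uinv u * ((h - 1) * (u - 1) - (u - 1) * (h - 1)) \<in> fil (n + 1)" by (rule fil_mult_left)
  finally show ?thesis .
qed

lemma fil_cancel: "h - 1 - s \<in> fil n \<Longrightarrow> h - 1 - s' \<in> fil n \<Longrightarrow> s' - s \<in> (fil n :: 'r::filtered_ring set)"
  using fil_diff[of "h - 1 - s" n "h - 1 - s'"] by simp

text \<open>Leading terms add under multiplication: the extra product \<open>x * y\<close> has
  degree \<open>2 * n\<close>, which is at least \<open>n + 1\<close>.\<close>

lemma prod_fil:
  assumes "h - 1 - x \<in> fil (n + 1)" "k - 1 - y \<in> fil (n + 1)" "x \<in> fil n" "y \<in> fil n" "n \<ge> 1"
  shows "h * k - 1 - (x + y) \<in> fil (n + 1)"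
proof -
  have xy: "x * y \<in> fil (n + 1)" using fil_mono[OF fil_mult[OF assms(3,4)]] assms(5) by simp
  have "h - (1 + x) \<in> fil (n + 1)" "k - (1 + y) \<in> fil (n + 1)" using assms(1,2) by (simp_all add: algebra_simps)
  then have "h * k - (1 + x) * (1 + y) \<in> fil (n + 1)" by (rule fil_diff_mult)
  moreover have "(1 + x) * (1 + y) = 1 + (x + y) + x * y" by (simp add: algebra_simps)
  ultimately have "h * k - (1 + (x + y) + x * y) \<in> fil (n + 1)" by simp
  from fil_add[OF this xy] show ?thesis by (simp add: algebra_simps)
qed

lemma prod_list_fil_diff:
  assumes "\<forall>g. \<alpha> g \<in> fil 1" "\<forall>g. \<beta> g \<in> fil 1" "\<forall>g. \<alpha> g - \<beta> g \<in> fil 2"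
  shows "prod_list (map \<alpha> w) - prod_list (map \<beta> w) \<in> (fil (length w + 1) :: 'r::filtered_ring set)"
proof (induction w)
  case (Cons g w)
  have "prod_list (map \<alpha> (g # w)) - prod_list (map \<beta> (g # w))
    = (\<alpha> g - \<beta> g) * prod_list (map \<alpha> w) + \<beta> g * (prod_list (map \<alpha> w) - prod_list (map \<beta> w))"
    by (simp add: algebra_simps)
  moreover have "(\<alpha> g - \<beta> g) * prod_list (map \<alpha> w) \<in> fil (length (g # w) + 1)"
    using fil_mult[OF assms(3)[rule_format, of g] prod_list_fil[OF assms(1), of w]]
    by (simp add: numeral_2_eq_2 One_nat_def)
  moreover have "\<beta> g * (prod_list (map \<alpha> w) - prod_list (map \<beta> w)) \<in> fil (length (g # w) + 1)"
    using fil_mult[OF assms(2)[rule_format, of g] Cons] by (simp add: One_nat_def)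
  ultimately show ?case by (simp add: fil_add)
qed simp

text \<open>The leading part of a series sees its arguments only to first order: words shorter than
  \<open>n\<close> do not occur, and in a word of length at least \<open>n\<close> the error of a
  letter gains one degree.\<close>

lemma ev_fil_diff:
  fixes s :: "('g::finite, 'k::comm_ring_1) ncfps"
  assumes "\<forall>g. \<alpha> g \<in> fil 1" "\<forall>g. \<beta> g \<in> fil 1" "\<forall>g. \<alpha> g - \<beta> g \<in> fil 2" "scal sc" "s \<in> fil n"
  shows "ev sc \<alpha> s - ev sc \<beta> s \<in> fil (n + 1)"
proof -
  let ?W = "{w :: 'g list. length w < n + 1}"
  have "(\<Sum>w\<in>?W. sc (nc_coeff s w) * prod_list (map \<alpha> w)) - (\<Sum>w\<in>?W. sc (nc_coeff s w) * prod_list (map \<beta> w))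
    = (\<Sum>w\<in>?W. sc (nc_coeff s w) * (prod_list (map \<alpha> w) - prod_list (map \<beta> w)))"
    by (simp add: right_diff_distrib sum_subtractf)
  also have "\<dots> \<in> fil (n + 1)"
  proof (intro fil_sum)
    fix w
    assume "w \<in> ?W"
    show "sc (nc_coeff s w) * (prod_list (map \<alpha> w) - prod_list (map \<beta> w)) \<in> fil (n + 1)"
    proof (cases "length w < n")
      case True
      then show ?thesis using assms(5) scalD(1)[OF assms(4)] by (simp add: fil_ncfps_iff)
    next
      case False
      then show ?thesis
        using fil_mono[OF prod_list_fil_diff[OF assms(1,2,3), of w], of "n + 1"] by (intro fil_mult_left) simp
    qed
  qed
  finally show ?thesis
    using fil_diff_cong[OF ev_approx[OF assms(1)] ev_approx[OF assms(2)]] by blast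
qed

section \<open>Series that satisfy the 2-cycle relation\<close>

lemma rhom_of_int: "rhom (of_int :: int \<Rightarrow> 'k::ring_1)"
  by (simp add: rhom_def)

text \<open>Triviality on commuting arguments is demanded for integral series only. It will be
  proved by approximating \<open>f\<close> by words in integral matrices, where
  \<open>l\<close>-power exponents tend to the identity.\<close>

locale two_cycle_series =
  fixes F :: "(xy, 'k::field_char_0) ncfps"
  assumes F_Nil: "nc_coeff F [] = 1"
    and two: "fe nc_const F mx my * fe nc_const F my mx = 1"
    and comm_int: "\<And>a b :: (xy, int) ncfps. unip a \<Longrightarrow> unip b \<Longrightarrow> a * b = b * a \<Longrightarrow>
        fe nc_const F (nc_map of_int a) (nc_map of_int b) = (1 :: (xy, 'k) ncfps)"
begin

lemma comm:
  assumes "a = nc_map of_int a'" "b = nc_map of_int b'" "unip a'" "unip b'" "a' * b' = b' * a'"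
  shows "fe nc_const F a b = (1 :: (xy, 'k) ncfps)"
  using comm_int assms by simp

lemma fe_two:
  assumes "scal sc" "unip a" "unip b"
  shows "fe sc F a b * fe sc F b a = 1"
proof -
  let ?h = "ev sc (case_xy (a - 1) (b - 1))"
  have h: "filtered_hom ?h" by (rule filtered_hom_ev[OF case_xy_fil assms(1)]) (use assms in \<open>auto simp: unip_fil\<close>)
  have "?h (fe nc_const F mx my * fe nc_const F my mx) = fe sc F a b * fe sc F b a"
    by (simp add: filtered_homD(4)[OF h] filtered_hom_fe[OF h] ev_mxy[OF assms] ev_const[OF assms(1)])
  then show ?thesis by (simp add: two filtered_homD(2)[OF h])
qed

text \<open>The hexagon solved for the passage over two strands, with the defect as last factor. By
  the 2-cycle relation \<open>f\<close> is inverted by swapping its arguments, and the power of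
  \<open>uinv (a * b)\<close> is inverted by that of \<open>a * b\<close>.\<close>

lemma hx_factor:
  assumes sc: "scal sc" and a: "unip a" and b: "unip b"
  shows "pw sc m b * fe sc F a b * pw sc m a
    = fe sc F (uinv (a * b)) b * pw sc m (a * b) * fe sc F a (uinv (a * b)) * hx sc F m a b"
proof -
  let ?z = "uinv (a * b)"
  have z: "unip ?z" using a b by blast
  have ab: "unip (a * b)" using a b by blast
  have p: "pw sc m (a * b) * pw sc m ?z = 1"
    using uinv_right[OF pw_unip[OF sc ab]] by (simp add: pw_uinv[OF sc ab])
  have "fe sc F ?z b * pw sc m (a * b) * fe sc F a ?z * hx sc F m a b
    = fe sc F ?z b * pw sc m (a * b) * (fe sc F a ?z * fe sc F ?z a) * pw sc m ?z * fe sc F b ?z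
        * (pw sc m b * fe sc F a b * pw sc m a)"
    by (simp only: hx_def Let_def mult.assoc)
  also have "\<dots> = fe sc F ?z b * (pw sc m (a * b) * pw sc m ?z) * fe sc F b ?z * (pw sc m b * fe sc F a b * pw sc m a)"
    unfolding fe_two[OF sc a z] by (simp only: mult.assoc mult_1_left mult_1_right)
  also have "\<dots> = pw sc m b * fe sc F a b * pw sc m a"
    unfolding p using fe_two[OF sc z b] by simp
  finally show ?thesis by simp
qed

definition H :: "'k \<Rightarrow> (xy, 'k) ncfps" where "H m = hx nc_const F m mx my"

text \<open>Stands for the leading term: once \<open>H m - 1\<close> lies in \<open>fil n\<close>,
  only its part of degree \<open>n\<close> is visible modulo \<open>fil (n + 1)\<close>. Evaluating
  the whole series saves the extraction of homogeneous parts.\<close>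

definition S :: "('k \<Rightarrow> 'r::filtered_ring) \<Rightarrow> 'k \<Rightarrow> 'r \<Rightarrow> 'r \<Rightarrow> 'r" where
  "S sc m A B = ev sc (case_xy A B) (H m - 1)"

lemma hx_S:
  assumes "scal sc" "unip a" "unip b"
  shows "hx sc F m a b - 1 = S sc m (a - 1) (b - 1)"
  unfolding S_def H_def hx_universal[OF assms]
  by (subst filtered_homD(5)[OF filtered_hom_ev[OF case_xy_fil assms(1)]])
    (use assms filtered_homD(2)[OF filtered_hom_ev[OF case_xy_fil assms(1)]] in \<open>auto simp: unip_fil\<close>)

lemma S_fil:
  assumes "scal sc" "H m - 1 \<in> fil n" "A \<in> fil 1" "B \<in> fil 1"
  shows "S sc m A B \<in> fil n"
  unfolding S_def by (rule ev_fil[OF case_xy_fil assms(1)]) (use assms in auto)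

lemma S_cong:
  assumes "scal sc" "H m - 1 \<in> fil n" "A \<in> fil 1" "B \<in> fil 1" "A' \<in> fil 1" "B' \<in> fil 1"
    "A - A' \<in> fil 2" "B - B' \<in> fil 2"
  shows "S sc m A B - S sc m A' B' \<in> fil (n + 1)"
  unfolding S_def
  by (rule ev_fil_diff) (use assms in \<open>auto split: xy.split\<close>)

lemma filtered_hom_S:
  assumes "filtered_hom h" "A \<in> fil 1" "B \<in> fil 1"
  shows "h (S sc m A B) = S (\<lambda>c. h (sc c)) m (h A) (h B)"
proof -
  have "(\<lambda>g. h (case_xy A B g)) = case_xy (h A) (h B)"
    by (auto simp: fun_eq_iff split: xy.split)
  then show ?thesis unfolding S_def using filtered_hom_ev_comp[OF assms(1) case_xy_fil[OF assms(2,3)], of sc "H m - 1"] by simp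
qed

definition coc :: "('k \<Rightarrow> 'r::filtered_ring) \<Rightarrow> 'k \<Rightarrow> 'r \<Rightarrow> 'r \<Rightarrow> 'r \<Rightarrow> 'r" where
  "coc sc m A B C = (S sc m A B + S sc m (A + B) C) - (S sc m B C + S sc m A (B + C))"

text \<open>The \<open>y\<close> are loops of the distinguished strand, the \<open>t\<close> twists
  of the ordinary ones. The polytope has twists where the hexagon has \<open>uinv (a * b)\<close>;
  the hypotheses \<open>central\<close> identify them, the hypotheses \<open>c\<close> give the
  squares. Conjugations do not affect leading terms, so the noncommutative identity of defects
  becomes an additive one.\<close>

lemma hexagon_cocycle:
  fixes sc :: "'k \<Rightarrow> 'r::filtered_ring"
  defines "f \<equiv> fe sc F"
  assumes sc: "scal sc" and n: "n \<ge> 1" and Hn: "H m - 1 \<in> fil n"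
    and u: "unip y1" "unip y2" "unip y3" "unip t12" "unip t13" "unip t23"
    and central:
      "f t12 y2 = f (uinv (y1 * y2)) y2" "f y1 t12 = f y1 (uinv (y1 * y2))"
      "f (t13 * t23) y3 = f (uinv (y1 * y2 * y3)) y3" "f (y1 * y2) (t13 * t23) = f (y1 * y2) (uinv (y1 * y2 * y3))"
      "f (t12 * t13) (y2 * y3) = f (uinv (y1 * y2 * y3)) (y2 * y3)" "f y1 (t12 * t13) = f y1 (uinv (y1 * y2 * y3))"
      "f t23 y3 = f (uinv (y2 * y3)) y3" "f y2 t23 = f y2 (uinv (y2 * y3))"
    and c: "y3 * t12 = t12 * y3" "y3 * (t23 * y2) = t23 * y2 * y3"
      "y1 * y2 * y3 * t12 = t12 * (y1 * y2 * y3)" "y1 * y2 * y3 * t23 = t23 * (y1 * y2 * y3)"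
      "y1 * (y2 * t12) = y2 * t12 * y1" "y1 * t23 = t23 * y1"
      "y2 * (t12 * y1) = t12 * y1 * y2" "y2 * (y3 * t23) = y3 * t23 * y2"
    and P1: "f y1 (t12 * t13) * f (y2 * t12) t23 = f t12 t23 * f (y1 * y2) (t13 * t23) * f y1 t12"
    and P2: "f y1 (y2 * y3) * f (y2 * t12) t23 = f y2 t23 * f (t12 * y1) (y3 * t23) * f y1 y2"
    and P3: "f t12 (t23 * y2) * f (y1 * y2) y3 = f y2 y3 * f (t12 * y1) (y3 * t23) * f t12 y2"
    and P4: "f t12 (t23 * y2) * f (t13 * t23) y3 = f t23 y3 * f (t12 * t13) (y2 * y3) * f t12 t23"
  shows "coc sc m (y1 - 1) (y2 - 1) (y3 - 1) \<in> fil (n + 1)"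
proof -
  note [intro] = unip_mult
  let ?p = "pw sc m" and ?h = "hx sc F m"
  have fu: "unip (f a b)" if "unip a" "unip b" for a b
    unfolding f_def using fe_unip[OF sc F_Nil that] .
  note pu = pw_unip[OF sc]
  have fac: "?p b * f a b * ?p a = f (uinv (a * b)) b * ?p (a * b) * f a (uinv (a * b)) * ?h a b"
    if "unip a" "unip b" for a b
    unfolding f_def using hx_factor[OF sc that] .
  have pf: "x * f a b = f a b * x \<Longrightarrow> unip x \<Longrightarrow> ?p x * f a b = f a b * ?p x" for x a b
    using pw_commute[OF sc, of x "f a b"] by metis
  have fc: "x * f a b = f a b * x" if "unip a" "unip b" "x * a = a * x" "x * b = b * x" for x a b
    unfolding f_def by (rule fe_commute[OF sc that])
  let ?u1 = "f y1 t12" and ?u2 = "f (y2 * t12) t23" and ?u3 = "f (t12 * y1) (y3 * t23) * f y1 y2 * ?p y1"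
  \<comment> \<open>Each square commutes because the base of the power \<open>p\<close> or
    \<open>q\<close> commutes with both arguments of the adjacent \<open>f\<close>.\<close>
  have main: "uinv ?u1 * ?h (y1 * y2) y3 * ?u1 * ?h y1 y2
    = uinv ?u2 * ?h y1 (y2 * y3) * ?u2 * (uinv ?u3 * ?h y2 y3 * ?u3)"
  proof (rule crossing_polytope[OF _ _ _ _ P1 P2 P3 P4])
    show "?p y2 * f y1 y2 * ?p y1 = f t12 y2 * ?p (y1 * y2) * f y1 t12 * ?h y1 y2"
      using fac[OF u(1,2)] by (simp only: central)
    show "?p y3 * f (y1 * y2) y3 * ?p (y1 * y2) = f (t13 * t23) y3 * ?p (y1 * y2 * y3) * f (y1 * y2) (t13 * t23) * ?h (y1 * y2) y3"
      using fac[of "y1 * y2" y3] u by (simp only: central unip_mult)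
    show "?p (y2 * y3) * f y1 (y2 * y3) * ?p y1 = f (t12 * t13) (y2 * y3) * ?p (y1 * y2 * y3) * f y1 (t12 * t13) * ?h y1 (y2 * y3)"
      using fac[of y1 "y2 * y3"] u by (simp only: central unip_mult mult.assoc)
    show "?p y3 * f y2 y3 * ?p y2 = f t23 y3 * ?p (y2 * y3) * f y2 t23 * ?h y2 y3"
      using fac[OF u(2,3)] by (simp only: central)
    show "?p y3 * f t12 (t23 * y2) = f t12 (t23 * y2) * ?p y3"
      using u c by (intro pf fc) auto
    show "?p (y1 * y2 * y3) * f t12 t23 = f t12 t23 * ?p (y1 * y2 * y3)"
      using u c by (intro pf fc) auto
    show "?p y1 * f (y2 * t12) t23 = f (y2 * t12) t23 * ?p y1"
      using u c by (intro pf fc) auto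
    show "?p y2 * f (t12 * y1) (y3 * t23) = f (t12 * y1) (y3 * t23) * ?p y2"
      using u c by (intro pf fc) auto
  qed (use u in \<open>auto intro!: fu pu\<close>)
  let ?s = "\<lambda>a b. S sc m (a - 1) (b - 1)"
  have hs: "?h a b - 1 \<in> fil n" "?s a b \<in> fil n" "?h a b - 1 - ?s a b \<in> fil (n + 1)" if "unip a" "unip b" for a b
    using hx_S[OF sc that] S_fil[OF sc Hn, of "a - 1" "b - 1"] that by (auto simp: unip_fil)
  have cj: "(uinv x * ?h a b * x) - 1 - ?s a b \<in> fil (n + 1)" if "unip a" "unip b" "unip x" for a b x
  proof -
    have "(uinv x * ?h a b * x) - 1 - ?s a b = (uinv x * ?h a b * x - ?h a b) + (?h a b - 1 - ?s a b)" by simp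
    then show ?thesis
      using fil_add[OF conj_fil[OF that(3) hs(1)[OF that(1,2)]] hs(3)[OF that(1,2)]] by metis
  qed
  have ux: "unip ?u1" "unip ?u2" "unip ?u3" "unip (y1 * y2)" "unip (y2 * y3)"
    using u by (auto intro!: fu pu)
  have "uinv ?u1 * ?h (y1 * y2) y3 * ?u1 * ?h y1 y2 - 1 - (?s (y1 * y2) y3 + ?s y1 y2) \<in> fil (n + 1)"
    by (intro prod_fil cj hs u ux n)
  moreover have "uinv ?u2 * ?h y1 (y2 * y3) * ?u2 * (uinv ?u3 * ?h y2 y3 * ?u3) - 1 - (?s y1 (y2 * y3) + ?s y2 y3) \<in> fil (n + 1)"
    by (intro prod_fil cj hs u ux n)
  ultimately have "(?s y1 (y2 * y3) + ?s y2 y3) - (?s (y1 * y2) y3 + ?s y1 y2) \<in> fil (n + 1)"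
    unfolding main by (rule fil_cancel)
  then have d: "(?s (y1 * y2) y3 + ?s y1 y2) - (?s y1 (y2 * y3) + ?s y2 y3) \<in> fil (n + 1)"
    by (rule fil_diff_sym)
  \<comment> \<open>To first order, multiplication of unipotent elements is addition; this turns the
    argument \<open>y1 * y2\<close> into a sum.\<close>
  have lin: "(a * b - 1) - ((a - 1) + (b - 1)) \<in> fil 2" if "unip a" "unip b" for a b
  proof -
    have "(a * b - 1) - ((a - 1) + (b - 1)) = (a - 1) * (b - 1)" by (simp add: algebra_simps)
    then show ?thesis using fil_mult[OF unip_fil[OF that(1)] unip_fil[OF that(2)]] by (simp add: numeral_2_eq_2 One_nat_def)
  qed
  have "?s (y1 * y2) y3 - S sc m ((y1 - 1) + (y2 - 1)) (y3 - 1) \<in> fil (n + 1)"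
    using u ux lin[of y1 y2] by (intro S_cong[OF sc Hn]) (auto simp: unip_fil fil_add)
  then have 1: "(?s (y1 * y2) y3 + ?s y1 y2) - (S sc m ((y1 - 1) + (y2 - 1)) (y3 - 1) + ?s y1 y2) \<in> fil (n + 1)"
    by simp
  have "?s y1 (y2 * y3) - S sc m (y1 - 1) ((y2 - 1) + (y3 - 1)) \<in> fil (n + 1)"
    using u ux lin[of y2 y3] by (intro S_cong[OF sc Hn]) (auto simp: unip_fil fil_add)
  then have 2: "(?s y1 (y2 * y3) + ?s y2 y3) - (S sc m (y1 - 1) ((y2 - 1) + (y3 - 1)) + ?s y2 y3) \<in> fil (n + 1)"
    by simp
  show ?thesis
    using fil_diff_trans[OF fil_diff_trans[OF fil_diff_sym[OF 1] d] 2] by (simp add: coc_def add.commute)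
qed

end

datatype strand = st1 | st2 | st3

instance strand :: finite
proof
  have "(UNIV :: strand set) = {st1, st2, st3}" using strand.exhaust by auto
  then show "finite (UNIV :: strand set)" by (metis finite.emptyI finite.insertI)
qed

section \<open>The defect up to degree two\<close>

lemma xy_words_less_3:
  "{w :: xy list. length w < 3} = {[], [gX], [gY], [gX, gX], [gX, gY], [gY, gX], [gY, gY]}" (is "?A = ?B")
proof
  show "?A \<subseteq> ?B"
  proof
    fix w assume w: "w \<in> ?A"
    show "w \<in> ?B"
    proof (cases w)
      case (Cons a v)
      show ?thesis
      proof (cases v)
        case (Cons b v')
        then have "w = [a, b]" using w \<open>w = a # v\<close> by simp
        then show ?thesis by (cases a; cases b) auto
      qed (use Cons in \<open>cases a; auto\<close>)
    qed auto
  qed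
qed auto

lemma fe_expand:
  assumes sc: "scal sc" and "unip a" "unip b"
  shows "fe sc F a b - (sc (nc_coeff F []) + sc (nc_coeff F [gX]) * (a - 1) + sc (nc_coeff F [gY]) * (b - 1)
    + sc (nc_coeff F [gX, gX]) * ((a - 1) * (a - 1)) + sc (nc_coeff F [gX, gY]) * ((a - 1) * (b - 1))
    + sc (nc_coeff F [gY, gX]) * ((b - 1) * (a - 1)) + sc (nc_coeff F [gY, gY]) * ((b - 1) * (b - 1))) \<in> fil 3"
  unfolding fe_def
  using ev_approx[OF case_xy_fil[OF unip_fil[OF assms(2)] unip_fil[OF assms(3)]], of sc F 3]
  by (simp add: xy_words_less_3 add.assoc)

lemma fil_3_eqD:
  assumes "s - t \<in> fil 3" "length w < 3" shows "nc_coeff s w = nc_coeff t w"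
  using assms by (auto simp: fil_ncfps_iff nc_simps)

lemma nc_var_word: "nc_var g * nc_var h = word [g, h]"
  by (simp_all add: word_def)

context two_cycle_series
begin

text \<open>The commuting pairs \<open>(mx, 1)\<close>, \<open>(1, my)\<close> and
  \<open>(mx, mx)\<close>, on which the value is 1, determine all coefficients up to degree two
  except one.\<close>

lemma F_coeffs:
  shows "nc_coeff F [gX] = 0" "nc_coeff F [gY] = 0" "nc_coeff F [gX, gX] = 0" "nc_coeff F [gY, gY] = 0"
    "nc_coeff F [gY, gX] = - nc_coeff F [gX, gY]"
proof -
  note e = fe_expand[OF scal_nc_const, of _ _ F]
  have x: "fe nc_const F mx 1 = 1" "fe nc_const F 1 my = 1" "fe nc_const F mx mx = 1"
  proof -
    have m: "mx = nc_map of_int (mx :: (xy, int) ncfps)" "my = nc_map of_int (my :: (xy, int) ncfps)"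
      "1 = nc_map of_int (1 :: (xy, int) ncfps)"
      by (simp_all add: filtered_homD(2,3)[OF filtered_hom_nc_map[OF rhom_of_int]] nc_map_var[OF rhom_of_int])
    show "fe nc_const F mx 1 = 1" "fe nc_const F 1 my = 1" "fe nc_const F mx mx = 1"
      by (rule comm[OF m(1,3)] comm[OF m(3,2)] comm[OF m(1,1)], simp, simp, simp)+
  qed
  note s = nc_simps nc_const_mult nc_var_word nc_coeff_word
  have 1: "1 - (nc_const (nc_coeff F []) + nc_const (nc_coeff F [gX]) * nc_var gX
    + nc_const (nc_coeff F [gX, gX]) * (nc_var gX * nc_var gX)) \<in> (fil 3 :: (xy, 'k) ncfps set)"
    using e[of mx 1] x(1) by simp
  show X: "nc_coeff F [gX] = 0" and XX: "nc_coeff F [gX, gX] = 0"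
    using fil_3_eqD[OF 1, of "[gX]"] fil_3_eqD[OF 1, of "[gX, gX]"] by (simp_all add: s)
  have 2: "1 - (nc_const (nc_coeff F []) + nc_const (nc_coeff F [gY]) * nc_var gY
    + nc_const (nc_coeff F [gY, gY]) * (nc_var gY * nc_var gY)) \<in> (fil 3 :: (xy, 'k) ncfps set)"
    using e[of 1 my] x(2) by simp
  show Y: "nc_coeff F [gY] = 0" and YY: "nc_coeff F [gY, gY] = 0"
    using fil_3_eqD[OF 2, of "[gY]"] fil_3_eqD[OF 2, of "[gY, gY]"] by (simp_all add: s)
  have 3: "1 - (nc_const (nc_coeff F []) + nc_const (nc_coeff F [gX, gY]) * (nc_var gX * nc_var gX)
    + nc_const (nc_coeff F [gY, gX]) * (nc_var gX * nc_var gX)) \<in> (fil 3 :: (xy, 'k) ncfps set)"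
    using e[of mx mx] x(3) X Y XX YY by simp
  show "nc_coeff F [gY, gX] = - nc_coeff F [gX, gY]"
    using fil_3_eqD[OF 3, of "[gX, gX]"] by (simp add: s eq_neg_iff_add_eq_0 add.commute)
qed

text \<open>Without linear and square terms only a multiple of the commutator remains, and a
  commutator modulo degree three depends on its arguments to first order only.\<close>

lemma fe_quadratic:
  assumes sc: "scal sc" and "unip a" "unip b" and A: "a - 1 - A \<in> fil 2" "A \<in> fil 1" and B: "b - 1 - B \<in> fil 2" "B \<in> fil 1"
  shows "fe sc F a b - (1 + sc (nc_coeff F [gX, gY]) * (A * B - B * A)) \<in> fil 3"
proof -
  let ?c = "nc_coeff F [gX, gY]"
  have 1: "fe sc F a b - (1 + sc ?c * ((a - 1) * (b - 1) - (b - 1) * (a - 1))) \<in> fil 3"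
  proof -
    define P where "P = (a - 1) * (b - 1)"
    define Q where "Q = (b - 1) * (a - 1)"
    have "fe sc F a b - (1 + sc ?c * P + sc (- ?c) * Q) \<in> fil 3"
      using fe_expand[OF assms(1-3), of F] unfolding P_def[symmetric] Q_def[symmetric]
      by (simp add: F_coeffs F_Nil scalD(1,2)[OF sc])
    moreover have "1 + sc ?c * P + sc (- ?c) * Q = 1 + sc ?c * (P - Q)"
      by (simp add: scalD(6)[OF sc] right_diff_distrib)
    ultimately show ?thesis by (simp only: P_def Q_def)
  qed
  have m: "p * q - p' * q' \<in> fil 3" if "p - p' \<in> fil 2" "q - q' \<in> fil 2" "q \<in> fil 1" "p' \<in> fil 1" for p q p' q'
  proof -
    have "p * q - p' * q' = (p - p') * q + p' * (q - q')" by (simp add: algebra_simps)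
    then show ?thesis using fil_mult[OF that(1,3)] fil_mult[OF that(4,2)]
      by (simp add: fil_add numeral_3_eq_3 numeral_2_eq_2 One_nat_def)
  qed
  have "(a - 1) * (b - 1) - A * B \<in> fil 3" "(b - 1) * (a - 1) - B * A \<in> fil 3"
    using assms by (auto intro!: m simp: unip_fil)
  from fil_diff[OF this] have "sc ?c * (((a - 1) * (b - 1) - (b - 1) * (a - 1)) - (A * B - B * A)) \<in> fil 3"
    by (intro fil_mult_left) (simp add: algebra_simps)
  then have "(1 + sc ?c * ((a - 1) * (b - 1) - (b - 1) * (a - 1))) - (1 + sc ?c * (A * B - B * A)) \<in> fil 3"
    by (simp add: right_diff_distrib)
  with 1 show ?thesis by (rule fil_diff_trans)
qed

text \<open>Up to second order the logarithm of \<open>b^m * a^m\<close> contains the commutator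
  \<open>[A, B]\<close> with coefficient \<open>- m^2 / 2\<close>, that of \<open>(a * b)^m\<close>
  with coefficient \<open>m / 2\<close>; the difference is the term in the statement.\<close>

lemma powers_quadratic:
  fixes sc :: "'k \<Rightarrow> 'r::filtered_ring"
  assumes sc: "scal sc" and ua: "unip a" and ub: "unip b"
  defines "A \<equiv> a - 1" and "B \<equiv> b - 1"
  shows "pw sc m (uinv (a * b)) * pw sc m b * pw sc m a - (1 - sc ((m * m + m) / 2) * (A * B - B * A)) \<in> fil 3"
proof -
  have f: "A \<in> fil 1" "B \<in> fil 1" using ua ub by (simp_all add: A_def B_def unip_fil)
  have f2: "x * y \<in> fil 2" if "x \<in> fil 1" "y \<in> fil 1" for x y :: 'r
    using fil_mult[OF that] by (simp add: numeral_2_eq_2 One_nat_def)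
  have f3: "x * y \<in> fil 3" if "x \<in> fil 1" "y \<in> fil 2" for x y :: 'r
    using fil_mult[OF that] by (simp add: numeral_2_eq_2 numeral_3_eq_3 One_nat_def)
  have f3': "x * y \<in> fil 3" if "x \<in> fil 2" "y \<in> fil 1" for x y :: 'r
    using fil_mult[OF that] by (simp add: numeral_2_eq_2 numeral_3_eq_3 One_nat_def)
  define \<mu> where "\<mu> = sc m"
  define \<beta> where "\<beta> = sc (m * (m - 1) / 2)"
  define \<kappa> where "\<kappa> = sc ((m * m + m) / 2)"
  \<comment> \<open>These are the coefficients of \<open>B * A\<close> and \<open>A * B\<close> in
    the difference of the two products; that both equal \<open>\<kappa>\<close> makes it a multiple
    of the commutator.\<close>
  have mm: "\<mu> * \<mu> - \<beta> = \<kappa>" "\<mu> + \<beta> = \<kappa>"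
    unfolding \<mu>_def \<beta>_def \<kappa>_def scalD(3,4,5)[OF sc, symmetric] by (simp_all add: field_simps)
  have cen: "x * \<mu> = \<mu> * x" "x * \<kappa> = \<kappa> * x" "x * \<beta> = \<beta> * x" for x
    unfolding \<mu>_def \<beta>_def \<kappa>_def by (simp_all add: scalD(8)[OF sc])
  have pa: "pw sc m a - (1 + \<mu> * A + \<beta> * (A * A)) \<in> fil 3"
    using pw_quadratic[OF sc ua, of m] by (simp add: \<mu>_def \<beta>_def A_def)
  have pb: "pw sc m b - (1 + \<mu> * B + \<beta> * (B * B)) \<in> fil 3"
    using pw_quadratic[OF sc ub, of m] by (simp add: \<mu>_def \<beta>_def B_def)
  have uab: "unip (a * b)" using ua ub by blast
  let ?P = "pw sc m (a * b)"
  have ab: "a * b - 1 = A + B + A * B" by (simp add: A_def B_def algebra_simps)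
  have pab: "?P - (1 + \<mu> * (A + B + A * B) + \<beta> * ((A + B) * (A + B))) \<in> fil 3"
  proof (rule fil_diff_trans)
    show "?P - (1 + \<mu> * (A + B + A * B) + \<beta> * ((A + B + A * B) * (A + B + A * B))) \<in> fil 3"
      using pw_quadratic[OF sc uab, of m] by (simp add: \<mu>_def \<beta>_def ab)
    have "(A + B + A * B) * (A + B + A * B) - (A + B) * (A + B) = (A * B) * (A + B + A * B) + (A + B) * (A * B)"
      by (simp add: algebra_simps)
    also have "\<dots> \<in> fil 3"
      using f f2 by (intro fil_add f3 f3') (auto intro: fil_add fil_mult_left)
    finally have "\<beta> * ((A + B + A * B) * (A + B + A * B) - (A + B) * (A + B)) \<in> fil 3" by (rule fil_mult_left)
    then show "1 + \<mu> * (A + B + A * B) + \<beta> * ((A + B + A * B) * (A + B + A * B))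
        - (1 + \<mu> * (A + B + A * B) + \<beta> * ((A + B) * (A + B))) \<in> fil 3"
      by (simp add: right_diff_distrib)
  qed
  have L: "pw sc m b * pw sc m a - (1 + \<mu> * A + \<mu> * B + \<beta> * (A * A) + \<beta> * (B * B) + \<mu> * \<mu> * (B * A)) \<in> fil 3"
  proof (rule fil_diff_trans[OF fil_diff_mult[OF pb pa]])
    have "(1 + \<mu> * B + \<beta> * (B * B)) * (1 + \<mu> * A + \<beta> * (A * A))
        - (1 + \<mu> * A + \<mu> * B + \<beta> * (A * A) + \<beta> * (B * B) + \<mu> * B * (\<mu> * A))
      = \<mu> * B * (\<beta> * (A * A)) + \<beta> * (B * B) * (\<mu> * A + \<beta> * (A * A))"
      by (simp add: algebra_simps)
    also have "\<dots> \<in> fil 3"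
    proof (intro fil_add)
      have AA: "\<beta> * (A * A) \<in> fil 2" "\<beta> * (B * B) \<in> fil 2"
        using f f2[of A A] f2[of B B] by (simp_all add: fil_mult_left)
      show "\<mu> * B * (\<beta> * (A * A)) \<in> fil 3" using f by (intro f3 AA fil_mult_left)
      show "\<beta> * (B * B) * (\<mu> * A + \<beta> * (A * A)) \<in> fil 3"
        using f by (intro f3' AA fil_add fil_mult_left)
    qed
    also have "\<mu> * B * (\<mu> * A) = \<mu> * \<mu> * (B * A)"
      by (metis cen(1) mult.assoc)
    finally show "(1 + \<mu> * B + \<beta> * (B * B)) * (1 + \<mu> * A + \<beta> * (A * A))
        - (1 + \<mu> * A + \<mu> * B + \<beta> * (A * A) + \<beta> * (B * B) + \<mu> * \<mu> * (B * A)) \<in> fil 3" .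
  qed
  have eq: "1 + \<mu> * A + \<mu> * B + \<beta> * (A * A) + \<beta> * (B * B) + \<mu> * \<mu> * (B * A)
    = (1 + \<mu> * (A + B + A * B) + \<beta> * ((A + B) * (A + B))) - \<kappa> * (A * B - B * A)"
  proof -
    have "\<kappa> * (A * B - B * A) = (\<mu> + \<beta>) * (A * B) - (\<mu> * \<mu> - \<beta>) * (B * A)"
      unfolding mm by (simp add: right_diff_distrib)
    then show ?thesis by (simp add: algebra_simps)
  qed
  let ?K = "\<kappa> * (A * B - B * A)"
  have K: "?K \<in> fil 2" using f by (intro fil_mult_left fil_diff f2)
  have uP: "unip ?P" by (rule pw_unip[OF sc uab])
  have "pw sc m b * pw sc m a - (?P - ?K) \<in> fil 3"
    using L fil_diff_add[OF fil_diff_sym[OF pab], of "- ?K" "- ?K"] unfolding eq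
    by (intro fil_diff_trans[OF L[unfolded eq]]) simp
  moreover have "(?P - ?K) - ?P * (1 - ?K) \<in> fil 3"
  proof -
    have "(?P - ?K) - ?P * (1 - ?K) = (?P - 1) * ?K" by (simp add: algebra_simps)
    then show ?thesis using f3[OF unip_fil[OF uP] K] by simp
  qed
  ultimately have "pw sc m b * pw sc m a - ?P * (1 - ?K) \<in> fil 3" by (rule fil_diff_trans)
  then have "uinv ?P * (pw sc m b * pw sc m a - ?P * (1 - ?K)) \<in> fil 3" by (rule fil_mult_left)
  then show ?thesis
    by (simp add: pw_uinv[OF sc uab] right_diff_distrib mult.assoc uinv_cancel[OF uP] \<kappa>_def uinv_left[OF uP])
qed

text \<open>To first order \<open>z - 1\<close> is \<open>-(A + B)\<close>, so the pairs
  \<open>(z, a)\<close>, \<open>(b, z)\<close> and \<open>(a, b)\<close> have the same commutator.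
  This accounts for the factor 3; the powers contribute the rest.\<close>

lemma hx_quadratic:
  fixes sc :: "'k \<Rightarrow> 'r::filtered_ring"
  assumes sc: "scal sc" and ua: "unip a" and ub: "unip b"
  defines "A \<equiv> a - 1" and "B \<equiv> b - 1"
  shows "hx sc F m a b - (1 + sc (3 * nc_coeff F [gX, gY] - (m * m + m) / 2) * (A * B - B * A)) \<in> fil 3"
proof -
  let ?z = "uinv (a * b)" and ?c = "nc_coeff F [gX, gY]"
  let ?C = "sc ?c * (A * B - B * A)"
  have f: "A \<in> fil 1" "B \<in> fil 1" using ua ub by (simp_all add: A_def B_def unip_fil)
  have f2: "x * y \<in> fil 2" if "x \<in> fil 1" "y \<in> fil 1" for x y :: 'r
    using fil_mult[OF that] by (simp add: numeral_2_eq_2 One_nat_def)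
  have z: "unip ?z" using ua ub by blast
  have uab: "unip (a * b)" using ua ub by blast
  have z2: "?z - 1 - (- (A + B)) \<in> fil 2"
  proof -
    have "?z - 1 + (A + B) = (?z - 1) * (1 - a * b) + (A + B - (a * b - 1)) + (?z * (a * b) - 1)"
      by (simp add: algebra_simps)
    also have "A + B - (a * b - 1) = - (A * B)" by (simp add: A_def B_def algebra_simps)
    also have "?z * (a * b) - 1 = 0" by (simp add: uinv_left[OF uab])
    finally have "?z - 1 + (A + B) = (?z - 1) * (1 - a * b) + - (A * B)" by simp
    moreover have "(?z - 1) * (1 - a * b) \<in> fil 2"
      using fil_diff_sym[OF unip_fil[OF uab]] by (intro f2 unip_fil[OF z])
    ultimately have "?z - 1 + (A + B) \<in> fil 2" using f by (simp only: fil_add fil_uminus f2)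
    then show ?thesis by (simp only: diff_minus_eq_add)
  qed
  have AB: "- (A + B) \<in> fil 1" using f by (intro fil_uminus fil_add)
  have A0: "a - 1 - A \<in> fil 2" "b - 1 - B \<in> fil 2" by (simp_all add: A_def B_def)
  have C: "?C \<in> fil 2" using f by (intro fil_mult_left fil_diff f2)
  have 1: "fe sc F ?z a - (1 + ?C) \<in> fil 3"
    using fe_quadratic[OF sc z ua z2 AB A0(1) f(1)] by (simp add: algebra_simps)
  have 2: "fe sc F b ?z - (1 + ?C) \<in> fil 3"
    using fe_quadratic[OF sc ub z A0(2) f(2) z2 AB] by (simp add: algebra_simps)
  have 3: "fe sc F a b - (1 + ?C) \<in> fil 3"
    using fe_quadratic[OF sc ua ub A0(1) f(1) A0(2) f(2)] .
  \<comment> \<open>A factor of the form 1 plus terms of degree two commutes with unipotent elements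
    modulo degree three, so the powers can be separated from the values of \<open>f\<close>.\<close>
  have move: "g * x - x * g \<in> fil 3" if "g - (1 + ?C) \<in> fil 3" "unip x" for g x
  proof -
    have "(g * x - x * g) - ((1 + ?C) * x - x * (1 + ?C)) \<in> fil 3"
      using fil_diff[OF fil_mult_right[OF that(1), of x] fil_mult_left[OF that(1), of x]] by (simp add: algebra_simps)
    moreover have "(1 + ?C) * x - x * (1 + ?C) = ?C * (x - 1) - (x - 1) * ?C" by (simp add: algebra_simps)
    moreover have "?C * (x - 1) - (x - 1) * ?C \<in> fil 3"
      using fil_mult[OF C unip_fil[OF that(2)]] fil_mult[OF unip_fil[OF that(2)] C]
      by (intro fil_diff) (simp_all add: numeral_2_eq_2 numeral_3_eq_3 One_nat_def)
    ultimately have "((g * x - x * g) - (?C * (x - 1) - (x - 1) * ?C)) + (?C * (x - 1) - (x - 1) * ?C) \<in> fil 3"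
      by (metis fil_add)
    then show ?thesis by simp
  qed
  let ?pz = "pw sc m ?z" and ?pb = "pw sc m b" and ?pa = "pw sc m a"
  let ?f1 = "fe sc F ?z a" and ?f2 = "fe sc F b ?z" and ?f3 = "fe sc F a b"
  have p: "unip ?pz" "unip ?pb" "unip ?pa" using pw_unip[OF sc] z ua ub by auto
  have fu: "unip ?f2" "unip ?f3" using fe_unip[OF sc F_Nil] z ua ub by auto
  have m0: "hx sc F m a b = ?f1 * ?pz * ?f2 * ?pb * ?f3 * ?pa" by (simp add: hx_def Let_def)
  have m1: "?f1 * ?pz * ?f2 * ?pb * ?f3 * ?pa - ?f1 * ?pz * ?f2 * ?pb * (?pa * ?f3) \<in> fil 3"
    using fil_mult_left[OF move[OF 3 p(3)], of "?f1 * ?pz * ?f2 * ?pb"] by (simp add: right_diff_distrib mult.assoc)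
  have m2: "?f1 * ?pz * ?f2 * ?pb * (?pa * ?f3) - ?f1 * ?pz * ((?pb * ?pa) * ?f2) * ?f3 \<in> fil 3"
    using fil_mult_left[OF fil_mult_right[OF move[OF 2 unip_mult[OF p(2,3)]], of ?f3], of "?f1 * ?pz"]
    by (simp add: right_diff_distrib left_diff_distrib mult.assoc)
  have m3: "?f1 * ?pz * ((?pb * ?pa) * ?f2) * ?f3 - (?pz * ?pb * ?pa * ?f1) * ?f2 * ?f3 \<in> fil 3"
    using fil_mult_right[OF move[OF 1 unip_mult[OF p(1) unip_mult[OF p(2,3)]]], of "?f2 * ?f3"]
    by (simp add: left_diff_distrib mult.assoc)
  have 4: "hx sc F m a b - ?pz * ?pb * ?pa * ?f1 * ?f2 * ?f3 \<in> fil 3"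
    unfolding m0 by (rule fil_diff_trans[OF fil_diff_trans[OF m1 m2] m3])
  let ?K = "sc ((m * m + m) / 2) * (A * B - B * A)"
  have K: "?K \<in> fil 2" using f by (intro fil_mult_left fil_diff f2)
  have 5: "?pz * ?pb * ?pa - (1 - ?K) \<in> fil 3"
    using powers_quadratic[OF sc ua ub, of m] by (simp add: A_def B_def)
  have 6: "?pz * ?pb * ?pa * ?f1 * ?f2 * ?f3 - (1 - ?K) * (1 + ?C) * (1 + ?C) * (1 + ?C) \<in> fil 3"
    by (intro fil_diff_mult 1 2 3 5)
  have s: "(1 + x) * (1 + y) - (1 + (x + y)) \<in> fil 3" if "x \<in> fil 2" "y \<in> fil 2" for x y :: 'r
  proof -
    have "(1 + x) * (1 + y) - (1 + (x + y)) = x * y" by (simp add: algebra_simps)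
    then show ?thesis using fil_mono[OF fil_mult[OF that], of 3] by simp
  qed
  have "(1 + - ?K) * (1 + ?C) - (1 + (- ?K + ?C)) \<in> fil 3" using K C by (intro s fil_uminus)
  from fil_diff_trans[OF fil_diff_mult[OF this] s[OF fil_add[OF fil_uminus[OF K] C] C], of "1 + ?C"]
  have "(1 + - ?K) * (1 + ?C) * (1 + ?C) - (1 + (- ?K + ?C + ?C)) \<in> fil 3" by simp
  from fil_diff_trans[OF fil_diff_mult[OF this] s[OF fil_add[OF fil_add[OF fil_uminus[OF K] C] C] C], of "1 + ?C"]
  have 7: "(1 - ?K) * (1 + ?C) * (1 + ?C) * (1 + ?C) - (1 + (- ?K + ?C + ?C + ?C)) \<in> fil 3" by simp
  have "- ?K + ?C + ?C + ?C = sc (3 * ?c - (m * m + m) / 2) * (A * B - B * A)"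
  proof -
    have "3 * ?c = ?c + ?c + ?c" by simp
    then show ?thesis by (simp only: scalD(3,5)[OF sc]) (simp add: algebra_simps)
  qed
  then show ?thesis using fil_diff_trans[OF fil_diff_trans[OF 4 6] 7] by simp
qed

end

section \<open>From the cocycle equation to the vanishing of the defect\<close>

lemma fil_coeff: "s \<in> fil n \<Longrightarrow> length w < n \<Longrightarrow> nc_coeff s w = 0"
  by (simp add: fil_ncfps_iff)

text \<open>Scaling the variables by \<open>c\<close> multiplies degree \<open>n\<close> by
  \<open>c ^ n\<close>; for \<open>c = 2\<close> this computes the doubled arguments in
  \<open>doubling\<close>.\<close>

lemma nc_dilate:
  fixes s :: "('g::finite, 'k::comm_ring_1) ncfps"
  shows "nc_coeff (ev nc_const (\<lambda>g. nc_const c * nc_var g) s) w = c ^ length w * nc_coeff s w"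
proof -
  have f: "\<forall>g. nc_const c * nc_var g \<in> (fil 1 :: ('g, 'k) ncfps set)" by (simp add: fil_mult_left)
  have p: "prod_list (map (\<lambda>g. nc_const c * nc_var g) v) = nc_const (c ^ length v) * (word v :: ('g, 'k) ncfps)" for v
  proof (induction v)
    case (Cons g v)
    have "nc_const c * nc_var g * (nc_const (c ^ length v) * word v)
        = nc_const c * (nc_const (c ^ length v) * (nc_var g * (word v :: ('g, 'k) ncfps)))"
      unfolding mult.assoc by (subst scal_commute[OF scal_nc_const]) (rule HOL.refl)
    then show ?case using Cons
      by (simp add: word_Cons scalD(4)[OF scal_nc_const] mult.assoc)
  qed simp
  let ?n = "Suc (length w)"
  have "ev nc_const (\<lambda>g. nc_const c * nc_var g) s
      - (\<Sum>v | length v < ?n. nc_const (nc_coeff s v) * (nc_const (c ^ length v) * word v)) \<in> fil ?n"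
    using ev_approx[OF f, of nc_const s ?n] by (simp only: p)
  then have "nc_coeff (ev nc_const (\<lambda>g. nc_const c * nc_var g) s) w
      = (\<Sum>v | length v < ?n. nc_coeff s v * (c ^ length v * (if w = v then 1 else 0)))"
    by (simp add: fil_ncfps_iff nc_simps nc_const_mult nc_coeff_word)
  also have "\<dots> = c ^ length w * nc_coeff s w"
    by (simp add: if_distrib[of "\<lambda>x. _ * x"] sum.delta' mult.commute cong: if_cong)
  finally show ?thesis .
qed

context two_cycle_series
begin

text \<open>For equal arguments \<open>a\<close> all three values of \<open>f\<close> have commuting
  arguments and are 1, and \<open>z = uinv (a * a)\<close> makes the three powers cancel.\<close>

lemma S_diag:
  assumes "p \<in> fil 1" shows "S nc_const m (nc_map of_int p) (nc_map of_int p) = (0 :: (xy, 'k) ncfps)"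
proof -
  let ?i = "nc_map of_int :: (xy, int) ncfps \<Rightarrow> (xy, 'k) ncfps"
  have i: "filtered_hom ?i" by (rule filtered_hom_nc_map[OF rhom_of_int])
  let ?a = "1 + p"
  have a: "unip ?a" using assms by (simp add: unip_def)
  let ?z = "uinv (?a * ?a)"
  have aa: "unip (?a * ?a)" and z: "unip ?z" using a by blast+
  have c: "?a * ?z = ?z * ?a" by (rule uinv_commute[OF aa]) (simp add: mult.assoc)
  let ?b = "?i ?a"
  have b: "unip ?b" "unip (?b * ?b)" using filtered_hom_unip[OF i a] by blast+
  have zb: "?i ?z = uinv (?b * ?b)" by (simp only: filtered_hom_uinv[OF i aa] filtered_homD(4)[OF i])
  have "hx nc_const F m ?b ?b = pw nc_const m (uinv (?b * ?b)) * (pw nc_const m ?b * pw nc_const m ?b)"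
    unfolding hx_def Let_def
    by (simp add: comm_int[OF z a c[symmetric]] comm_int[OF a z c] comm_int[OF a a HOL.refl] mult.assoc flip: zb)
  also have "\<dots> = 1"
    using uinv_left[OF pw_unip[OF scal_nc_const b(2), of m]]
    by (simp only: pw_uinv[OF scal_nc_const b(2)] pw_mult[OF scal_nc_const b(1) b(1) HOL.refl])
  finally have "S nc_const m (?b - 1) (?b - 1) = 0" using hx_S[OF scal_nc_const b(1) b(1), of m] by simp
  moreover have "?b - 1 = ?i p" using filtered_homD(2,3)[OF i] by simp
  ultimately show ?thesis by simp
qed

text \<open>The cocycle equation at \<open>(U, U, 2V)\<close>, \<open>(U, V, V)\<close>,
  \<open>(U, V, U + V)\<close> and \<open>(V, U, V)\<close> with signs \<open>+\<close>,
  \<open>-\<close>, \<open>-\<close>, \<open>+\<close>: the values at \<open>(U, 2V)\<close>,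
  \<open>(U, U + 2V)\<close>, \<open>(U + V, V)\<close> and \<open>(V, U + V)\<close> each occur
  twice and cancel, and diagonal values vanish.\<close>

lemma doubling:
  assumes coc: "\<And>p q r. p \<in> fil 1 \<Longrightarrow> q \<in> fil 1 \<Longrightarrow> r \<in> fil 1 \<Longrightarrow>
      coc nc_const m p q r \<in> (fil n :: (xy, 'k) ncfps set)"
    and U': "U' \<in> fil 1" and V': "V' \<in> fil 1" and UV: "U = nc_map of_int U'" "V = nc_map of_int V'"
  shows "S nc_const m (U + U) (V + V) - (S nc_const m U V + S nc_const m U V + S nc_const m U V) + S nc_const m V U
     \<in> (fil n :: (xy, 'k) ncfps set)"
proof -
  let ?S = "S nc_const m"
  have i: "filtered_hom (nc_map of_int :: (xy, int) ncfps \<Rightarrow> (xy, 'k) ncfps)" by (rule filtered_hom_nc_map[OF rhom_of_int])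
  have U: "U \<in> fil 1" and V: "V \<in> fil 1" using filtered_homD(10)[OF i] U' V' UV by auto
  have f: "U + V \<in> fil 1" "V + V \<in> fil 1" using U V by (auto intro: fil_add)
  have R: "coc nc_const m U U (V + V) \<in> fil n" "coc nc_const m U V V \<in> fil n"
    "coc nc_const m U V (U + V) \<in> fil n" "coc nc_const m V U V \<in> fil n"
    using coc U V f by blast+
  have d: "?S U U = 0" "?S V V = 0" "?S (U + V) (U + V) = 0"
    using S_diag[OF U'] S_diag[OF V'] S_diag[OF fil_add[OF U' V']] by (simp_all add: UV filtered_homD(3)[OF i])
  have a: "V + (U + V) = U + (V + V)" "V + U = U + V" by (simp_all add: add_ac)
  have "?S (U + U) (V + V) - (?S U V + ?S U V + ?S U V) + ?S V U
      = coc nc_const m U U (V + V) - coc nc_const m U V V - coc nc_const m U V (U + V) + coc nc_const m V U V"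
    unfolding coc_def d a by (simp add: algebra_simps)
  then show ?thesis using R by (simp add: fil_add fil_diff)
qed

text \<open>In degree \<open>n\<close> the doubling formulas for \<open>(U, V)\<close> and
  \<open>(V, U)\<close> form a two by two linear system with determinant
  \<open>(2^n - 2) (2^n - 4)\<close>.\<close>

lemma defect_step:
  assumes coc: "\<And>p q r. p \<in> fil 1 \<Longrightarrow> q \<in> fil 1 \<Longrightarrow> r \<in> fil 1 \<Longrightarrow>
      coc nc_const m p q r \<in> (fil (n + 1) :: (xy, 'k) ncfps set)"
    and n: "n \<ge> 3" and H: "H m - 1 \<in> fil n"
  shows "H m - 1 \<in> fil (n + 1)"
  unfolding fil_ncfps_iff
proof (intro allI impI)
  fix w :: "xy list" assume w: "length w < n + 1"
  let ?X = "nc_var gX :: (xy, 'k) ncfps" and ?Y = "nc_var gY :: (xy, 'k) ncfps"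
  define \<delta> where "\<delta> = ev nc_const (\<lambda>g. nc_const 2 * (nc_var g :: (xy, 'k) ncfps))"
  have f: "\<forall>g. nc_const 2 * nc_var g \<in> (fil 1 :: (xy, 'k) ncfps set)" by (simp add: fil_mult_left)
  have \<delta>: "filtered_hom \<delta>" unfolding \<delta>_def by (rule filtered_hom_ev[OF f scal_nc_const])
  have two: "nc_const 2 * x = x + x" for x :: "(xy, 'k) ncfps"
    by (rule ncfps_eqI) (simp add: nc_simps nc_const_mult)
  have \<delta>S: "\<delta> (S nc_const m (nc_var g) (nc_var h)) = S nc_const m (nc_var g + nc_var g) (nc_var h + nc_var h)" for g h
  proof -
    have "\<delta> (nc_var g) = nc_var g + nc_var g" for g
      unfolding \<delta>_def by (simp add: ev_var[OF f scal_nc_const]) (rule two)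
    moreover have "(\<lambda>c. \<delta> (nc_const c)) = nc_const"
      by (simp add: \<delta>_def ev_const[OF scal_nc_const])
    ultimately show ?thesis by (simp add: filtered_hom_S[OF \<delta>])
  qed
  have e: "S nc_const m ?X ?Y = H m - 1"
  proof -
    have "case_xy ?X ?Y = nc_var" by (auto simp: fun_eq_iff split: xy.split)
    then show ?thesis by (simp add: S_def ev_id)
  qed
  let ?e = "nc_coeff (S nc_const m ?X ?Y) w" and ?e' = "nc_coeff (S nc_const m ?Y ?X) w"
  show "nc_coeff (H m - 1) w = 0"
  proof (cases "length w = n")
    case True
    have c: "nc_coeff (S nc_const m (nc_var g + nc_var g) (nc_var h + nc_var h)) w
        = 2 ^ n * nc_coeff (S nc_const m (nc_var g) (nc_var h)) w" for g h
      unfolding \<delta>S[symmetric] \<delta>_def nc_dilate True ..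
    have v: "nc_var g = nc_map of_int (nc_var g :: (xy, int) ncfps)" for g
      by (simp add: nc_map_var[OF rhom_of_int])
    have 1: "2 ^ n * ?e - (?e + ?e + ?e) + ?e' = 0"
      using fil_coeff[OF doubling[OF coc nc_var_fil nc_var_fil v v] w, of gX gY]
      by (simp add: nc_simps c)
    have 2: "2 ^ n * ?e' - (?e' + ?e' + ?e') + ?e = 0"
      using fil_coeff[OF doubling[OF coc nc_var_fil nc_var_fil v v] w, of gY gX]
      by (simp add: nc_simps c)
    have "(2 ^ n - 2) * (2 ^ n - 4) * ?e = 0"
    proof -
      have "?e' = (3 - 2 ^ n) * ?e" using 1 by (simp add: algebra_simps eq_neg_iff_add_eq_0 add_eq_0_iff)
      with 2 have "(2 ^ n - 3) * ((3 - 2 ^ n) * ?e) + ?e = 0" by (simp add: algebra_simps)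
      then show ?thesis by (simp add: algebra_simps)
    qed
    moreover have "(2 :: 'k) ^ n \<noteq> 2" "(2 :: 'k) ^ n \<noteq> 4"
    proof -
      have "(8 :: nat) \<le> 2 ^ n" using power_increasing[OF n, of "2 :: nat"] by simp
      then have "(2 :: nat) ^ n \<noteq> 2" "(2 :: nat) ^ n \<noteq> 4" by auto
      then have "of_nat (2 ^ n) \<noteq> (of_nat 2 :: 'k)" "of_nat (2 ^ n) \<noteq> (of_nat 4 :: 'k)"
        using of_nat_eq_iff by blast+
      then show "(2 :: 'k) ^ n \<noteq> 2" "(2 :: 'k) ^ n \<noteq> 4" by simp_all
    qed
    ultimately show ?thesis by (simp add: e)
  next
    case False
    then show ?thesis using w H by (simp add: fil_ncfps_iff)
  qed
qed

text \<open>The induction starts in degree three, where the condition on \<open>m\<close> has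
  removed the commutator term. The cocycle equation for three free variables is specialised to
  arbitrary arguments of positive degree.\<close>

theorem defect_vanishes:
  assumes coc: "\<And>n. n \<ge> 1 \<Longrightarrow> H m - 1 \<in> fil n \<Longrightarrow>
      coc nc_const m (nc_var st1) (nc_var st2) (nc_var st3) \<in> (fil (n + 1) :: (strand, 'k) ncfps set)"
    and m: "m * m + m = 6 * nc_coeff F [gX, gY]"
  shows "H m = 1"
proof -
  have "H m - 1 \<in> fil n" if "n \<ge> 3" for n
    using that
  proof (induction n rule: nat_induct_at_least)
    case base
    have z: "3 * nc_coeff F [gX, gY] - (m * m + m) / 2 = 0" using m by simp
    show ?case using hx_quadratic[OF scal_nc_const unip_var unip_var, of m gX gY]
      by (simp only: z H_def nc_const_0 mult_zero_left add_0_right)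
  next
    case (Suc n)
    have "coc nc_const m p q r \<in> (fil (n + 1) :: (xy, 'k) ncfps set)" if "p \<in> fil 1" "q \<in> fil 1" "r \<in> fil 1" for p q r
    proof -
      let ?\<alpha> = "case_strand p q r"
      have \<alpha>: "\<forall>g. ?\<alpha> g \<in> fil 1" using that by (auto split: strand.split)
      let ?h = "ev nc_const ?\<alpha>"
      have h: "filtered_hom ?h" by (rule filtered_hom_ev[OF \<alpha> scal_nc_const])
      have "?h (coc nc_const m (nc_var st1) (nc_var st2) (nc_var st3)) = coc nc_const m p q r"
        unfolding coc_def
        by (simp add: filtered_homD(3,5)[OF h] filtered_hom_S[OF h] ev_const[OF scal_nc_const] ev_var[OF \<alpha> scal_nc_const] fil_add)
      then show ?thesis using filtered_homD(10)[OF h coc[OF _ Suc.IH]] Suc.hyps by simp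
    qed
    then show ?case using defect_step[OF _ Suc.hyps Suc.IH] by (simp only: Suc_eq_plus1)
  qed
  then have "H m - 1 \<in> fil n" for n
    using fil_mono[of "H m - 1" "max n 3" n] by simp
  then show ?thesis by (rule fil_eqI)
qed

text \<open>Any arguments that agree with \<open>mx\<close> and \<open>my\<close> to first order
  determine the degree two condition; in the theorem the hexagon is evaluated at the exponentials of
  the variables.\<close>

lemma hexagon_quadratic:
  assumes "unip a" "unip b" "a - 1 - nc_var gX \<in> (fil 2 :: (xy, 'k) ncfps set)" "b - 1 - nc_var gY \<in> fil 2"
    and hx: "hx nc_const F m a b = 1"
  shows "m * m + m = 6 * nc_coeff F [gX, gY]"
proof -
  let ?q = "3 * nc_coeff F [gX, gY] - (m * m + m) / 2"
  define A where "A = a - 1"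
  define B where "B = b - 1"
  have c0: "nc_coeff A [] = 0" "nc_coeff B [] = 0"
    using assms(1,2) by (simp_all add: A_def B_def unip_ncfps_iff nc_simps)
  have c1: "nc_coeff A [gX] = 1" "nc_coeff A [gY] = 0" "nc_coeff B [gX] = 0" "nc_coeff B [gY] = 1"
    using assms(3,4)[unfolded fil_ncfps_iff nc_simps, rule_format, of "[gX]"]
      assms(3,4)[unfolded fil_ncfps_iff nc_simps, rule_format, of "[gY]"]
    by (simp_all add: A_def B_def nc_simps)
  have "1 - (1 + nc_const ?q * (A * B - B * A)) \<in> fil 3"
    using hx_quadratic[OF scal_nc_const assms(1,2), of m] unfolding hx A_def B_def .
  then have "nc_coeff (nc_const ?q * (A * B - B * A)) [gX, gY] = 0"
    by (simp add: fil_ncfps_iff nc_simps)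
  then have "?q = 0"
    by (simp add: nc_const_mult nc_simps times_ncfps.rep_eq c0 c1 numeral_2_eq_2 One_nat_def)
  then show ?thesis by (simp add: field_simps)
qed

end

section \<open>Presented groups\<close>

definition wev :: "('m, 'b) monoid_scheme \<Rightarrow> ('g \<times> bool \<Rightarrow> 'm) \<Rightarrow> 'g gword \<Rightarrow> 'm" where
  "wev M val w = foldr (\<lambda>x acc. val x \<otimes>\<^bsub>M\<^esub> acc) w \<one>\<^bsub>M\<^esub>"

lemma wev_simps [simp]:
  "wev M val [] = \<one>\<^bsub>M\<^esub>" "wev M val (x # w) = val x \<otimes>\<^bsub>M\<^esub> wev M val w"
  by (simp_all add: wev_def)

lemma wev_closed:
  assumes "monoid M" "\<And>x. x \<in> set w \<Longrightarrow> val x \<in> carrier M"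
  shows "wev M val w \<in> carrier M"
  using assms(2) by (induction w) (auto intro: monoid.m_closed[OF assms(1)] monoid.one_closed[OF assms(1)])

lemma wev_append:
  assumes "monoid M" "\<And>x. x \<in> set u \<union> set v \<Longrightarrow> val x \<in> carrier M"
  shows "wev M val (u @ v) = wev M val u \<otimes>\<^bsub>M\<^esub> wev M val v"
  using assms(2)
proof (induction u)
  case Nil
  then show ?case using wev_closed[OF assms(1), of v val] by (simp add: monoid.l_one[OF assms(1)])
next
  case (Cons a u)
  then show ?case
    using wev_closed[OF assms(1), of v val] wev_closed[OF assms(1), of u val]
    by (simp add: monoid.m_assoc[OF assms(1)])
qed

text \<open>Target of the matrix representations. Inverses are supplied letter by letter, so that no
  group of units has to be formed.\<close>

definition mulmon :: "'r::monoid_mult monoid" where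
  "mulmon = \<lparr>carrier = UNIV, mult = (*), one = 1\<rparr>"

lemma mulmon_simps [simp]:
  "carrier mulmon = UNIV" "x \<otimes>\<^bsub>mulmon\<^esub> y = x * y" "\<one>\<^bsub>mulmon\<^esub> = 1"
  by (simp_all add: mulmon_def)

lemma monoid_mulmon [simp]: "monoid mulmon"
  by unfold_locales (auto simp: mult.assoc)

context
  fixes S :: "'g set" and R :: "('g gword \<times> 'g gword) set"
begin

abbreviation (input) "W \<equiv> lists (S \<times> (UNIV :: bool set))"

lemma pres_eq_lists: "pres_eq S R u v \<Longrightarrow> u \<in> W \<and> v \<in> W"
  by (induction rule: pres_eq.induct) auto

lemma pres_eq_ctxt:
  assumes "pres_eq S R u v" "a \<in> W" "b \<in> W"
  shows "pres_eq S R (a @ u @ b) (a @ v @ b)"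
  using assms(1)
proof (induction rule: pres_eq.induct)
  case (refl w)
  then show ?case using assms by (intro pres_eq.refl) auto
next
  case (sym u v)
  then show ?case by (blast intro: pres_eq.sym)
next
  case (trans u v w)
  then show ?case by (blast intro: pres_eq.trans)
next
  case (cancel c d g e)
  have "pres_eq S R ((a @ c) @ [(g, e), (g, \<not> e)] @ (d @ b)) ((a @ c) @ (d @ b))"
    using cancel assms by (intro pres_eq.cancel) auto
  then show ?case by simp
next
  case (relation c d u v)
  have "pres_eq S R ((a @ c) @ u @ (d @ b)) ((a @ c) @ v @ (d @ b))"
    using relation assms by (intro pres_eq.relation) auto
  then show ?case by simp
qed

lemma pres_eq_append:
  assumes "pres_eq S R u u'" "pres_eq S R v v'"
  shows "pres_eq S R (u @ v) (u' @ v')"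
proof (rule pres_eq.trans)
  show "pres_eq S R (u @ v) (u' @ v)"
    using pres_eq_ctxt[OF assms(1), of "[]" v] pres_eq_lists[OF assms(2)] by simp
  show "pres_eq S R (u' @ v) (u' @ v')"
    using pres_eq_ctxt[OF assms(2), of u' "[]"] pres_eq_lists[OF assms(1)] by simp
qed

lemma pres_class_eq_iff:
  assumes "u \<in> W"
  shows "pres_class S R u = pres_class S R v \<longleftrightarrow> pres_eq S R u v"
proof
  assume "pres_class S R u = pres_class S R v"
  moreover have "u \<in> pres_class S R u" using assms by (simp add: pres_class_def pres_eq.refl)
  ultimately have "u \<in> pres_class S R v" by simp
  then show "pres_eq S R u v" by (simp add: pres_class_def pres_eq.sym)
next
  assume "pres_eq S R u v"
  then show "pres_class S R u = pres_class S R v"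
    unfolding pres_class_def by (auto intro: pres_eq.trans pres_eq.sym)
qed

lemma pres_class_mult:
  assumes "u \<in> W" "v \<in> W"
  shows "pres_class S R u \<otimes>\<^bsub>presented_group S R\<^esub> pres_class S R v = pres_class S R (u @ v)"
proof -
  have "pres_class S R (u' @ v') = pres_class S R (u @ v)"
    if "u' \<in> pres_class S R u" "v' \<in> pres_class S R v" for u' v'
  proof -
    have "pres_eq S R (u @ v) (u' @ v')"
      using that by (intro pres_eq_append) (simp_all add: pres_class_def)
    then show ?thesis using pres_class_eq_iff pres_eq_lists by metis
  qed
  then have "(\<Union>u'\<in>pres_class S R u. \<Union>v'\<in>pres_class S R v. pres_class S R (u' @ v'))
      = (\<Union>u'\<in>pres_class S R u. \<Union>v'\<in>pres_class S R v. pres_class S R (u @ v))"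
    by (intro SUP_cong HOL.refl)
  moreover have "pres_class S R u \<noteq> {}" "pres_class S R v \<noteq> {}"
    using pres_eq.refl[OF assms(1)] pres_eq.refl[OF assms(2)] by (auto simp: pres_class_def)
  ultimately show ?thesis by (simp add: presented_group_def)
qed

lemma carrier_presented_group: "carrier (presented_group S R) = pres_class S R ` W"
  and one_presented_group: "\<one>\<^bsub>presented_group S R\<^esub> = pres_class S R []"
  by (simp_all add: presented_group_def)

lemma gword_inv_lists [simp]: "w \<in> W \<Longrightarrow> gword_inv w \<in> W"
  by (auto simp: gword_inv_def)

lemma gword_inv_right: "w \<in> W \<Longrightarrow> pres_eq S R (w @ gword_inv w) []"
proof (induction w)
  case Nil
  then show ?case by (simp add: gword_inv_def pres_eq.refl)
next
  case (Cons x w)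
  obtain g e where x: "x = (g, e)" by force
  have "pres_eq S R ([x] @ (w @ gword_inv w) @ [(g, \<not> e)]) ([x] @ [] @ [(g, \<not> e)])"
    using Cons x by (intro pres_eq_ctxt) auto
  also have "pres_eq S R ([x] @ [] @ [(g, \<not> e)]) []"
    using pres_eq.cancel[of "[]" S "[]" g R e] Cons x by simp
  finally (pres_eq.trans) show ?case by (simp add: gword_inv_def x)
qed

lemma gword_inv_inv [simp]: "gword_inv (gword_inv w) = w"
  by (simp add: gword_inv_def rev_map o_def case_prod_beta)

lemma group_presented_group: "group (presented_group S R)" (is "group ?G")
proof (rule groupI)
  fix x y z assume "x \<in> carrier ?G" "y \<in> carrier ?G" "z \<in> carrier ?G"
  then obtain u v w where uvw: "u \<in> W" "v \<in> W" "w \<in> W"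
    and x: "x = pres_class S R u" "y = pres_class S R v" "z = pres_class S R w"
    unfolding carrier_presented_group by blast
  have "u @ v \<in> W" "v @ w \<in> W" using uvw by simp_all
  then show "x \<otimes>\<^bsub>?G\<^esub> y \<otimes>\<^bsub>?G\<^esub> z = x \<otimes>\<^bsub>?G\<^esub> (y \<otimes>\<^bsub>?G\<^esub> z)"
    unfolding x using uvw by (simp only: pres_class_mult append_assoc)
next
  fix x y assume "x \<in> carrier ?G" "y \<in> carrier ?G"
  then obtain u v where uv: "u \<in> W" "v \<in> W" and x: "x = pres_class S R u" "y = pres_class S R v"
    unfolding carrier_presented_group by blast
  have "u @ v \<in> W" using uv by simp
  then show "x \<otimes>\<^bsub>?G\<^esub> y \<in> carrier ?G"
    unfolding x pres_class_mult[OF uv] carrier_presented_group by blast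
next
  show "\<one>\<^bsub>?G\<^esub> \<in> carrier ?G" unfolding carrier_presented_group one_presented_group by blast
next
  fix x assume "x \<in> carrier ?G"
  then obtain w where w: "w \<in> W" and x: "x = pres_class S R w" unfolding carrier_presented_group by blast
  have e: "[] \<in> W" by simp
  show "\<one>\<^bsub>?G\<^esub> \<otimes>\<^bsub>?G\<^esub> x = x"
    unfolding x one_presented_group pres_class_mult[OF e w] by simp
  note i = gword_inv_lists[OF w]
  have iw: "gword_inv w @ w \<in> W" using i w by simp
  have "pres_class S R (gword_inv w @ w) = pres_class S R []"
    unfolding pres_class_eq_iff[OF iw] using gword_inv_right[OF i] by simp
  then have "pres_class S R (gword_inv w) \<otimes>\<^bsub>?G\<^esub> x = \<one>\<^bsub>?G\<^esub>"
    unfolding x one_presented_group pres_class_mult[OF i w] .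
  then show "\<exists>y\<in>carrier ?G. y \<otimes>\<^bsub>?G\<^esub> x = \<one>\<^bsub>?G\<^esub>"
    using i unfolding carrier_presented_group by blast
qed

lemma wev_pres_eq:
  assumes M: "monoid M" and val: "\<And>x. x \<in> S \<times> UNIV \<Longrightarrow> val x \<in> carrier M"
    and inv: "\<And>g e. g \<in> S \<Longrightarrow> val (g, e) \<otimes>\<^bsub>M\<^esub> val (g, \<not> e) = \<one>\<^bsub>M\<^esub>"
    and rel: "\<And>u v. (u, v) \<in> R \<Longrightarrow> u \<in> W \<Longrightarrow> v \<in> W \<Longrightarrow> wev M val u = wev M val v"
    and "pres_eq S R u v"
  shows "wev M val u = wev M val v"
  using assms(5)
proof (induction rule: pres_eq.induct)
  case (cancel a b g e)
  have c: "wev M val a \<in> carrier M" "wev M val b \<in> carrier M"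
    using cancel val by (auto intro!: wev_closed[OF M])
  have g: "val (g, e) \<in> carrier M" "val (g, \<not> e) \<in> carrier M" using cancel val by auto
  have "wev M val (a @ [(g, e), (g, \<not> e)] @ b) = wev M val a \<otimes>\<^bsub>M\<^esub> wev M val ([(g, e), (g, \<not> e)] @ b)"
    using cancel val by (intro wev_append[OF M]) auto
  also have "wev M val ([(g, e), (g, \<not> e)] @ b) = wev M val b"
    using c g inv[OF cancel(3), of e] by (simp add: monoid.m_assoc[OF M, symmetric] monoid.l_one[OF M])
  also have "wev M val a \<otimes>\<^bsub>M\<^esub> wev M val b = wev M val (a @ b)"
    using cancel val by (intro wev_append[OF M, symmetric]) auto
  finally show ?case .
next
  case (relation a b u v)
  have "wev M val (a @ w @ b) = wev M val a \<otimes>\<^bsub>M\<^esub> (wev M val w \<otimes>\<^bsub>M\<^esub> wev M val b)" if "w \<in> W" for w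
    using relation val that by (subst wev_append[OF M] | force)+
  then show ?case using rel[OF relation(3,4,5)] relation by simp
qed auto

text \<open>The map induced on a presented group by values of the generators (von Dyck); all words
  of a class have the same value once the relations hold.\<close>

definition plift :: "('m, 'b) monoid_scheme \<Rightarrow> ('g \<times> bool \<Rightarrow> 'm) \<Rightarrow> 'g gword set \<Rightarrow> 'm" where
  "plift M val C = the_elem (wev M val ` C)"

lemma plift_class:
  assumes "monoid M" "\<And>x. x \<in> S \<times> UNIV \<Longrightarrow> val x \<in> carrier M"
    "\<And>g e. g \<in> S \<Longrightarrow> val (g, e) \<otimes>\<^bsub>M\<^esub> val (g, \<not> e) = \<one>\<^bsub>M\<^esub>"
    "\<And>u v. (u, v) \<in> R \<Longrightarrow> u \<in> W \<Longrightarrow> v \<in> W \<Longrightarrow> wev M val u = wev M val v"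
    and w: "w \<in> W"
  shows "plift M val (pres_class S R w) = wev M val w"
proof -
  have "wev M val ` pres_class S R w = {wev M val w}"
    using wev_pres_eq[OF assms(1-4)] pres_eq.refl[OF w] by (force simp: pres_class_def)
  then show ?thesis by (simp add: plift_def)
qed

end

section \<open>Braid groups acting on states\<close>

text \<open>The wreath product of \<open>H\<close> with the self-maps of the set of states.\<close>

definition wr :: "('h, 'b) monoid_scheme \<Rightarrow> ('s \<Rightarrow> 's \<times> 'h) monoid" where
  "wr H = \<lparr>carrier = {\<phi>. \<forall>s. snd (\<phi> s) \<in> carrier H},
     mult = (\<lambda>\<phi> \<psi> s. (fst (\<phi> (fst (\<psi> s))), snd (\<phi> (fst (\<psi> s))) \<otimes>\<^bsub>H\<^esub> snd (\<psi> s))),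
     one = (\<lambda>s. (s, \<one>\<^bsub>H\<^esub>))\<rparr>"

lemma wr_simps [simp]:
  "\<phi> \<in> carrier (wr H) \<longleftrightarrow> (\<forall>s. snd (\<phi> s) \<in> carrier H)"
  "(\<phi> \<otimes>\<^bsub>wr H\<^esub> \<psi>) s = (fst (\<phi> (fst (\<psi> s))), snd (\<phi> (fst (\<psi> s))) \<otimes>\<^bsub>H\<^esub> snd (\<psi> s))"
  "\<one>\<^bsub>wr H\<^esub> s = (s, \<one>\<^bsub>H\<^esub>)"
  by (simp_all add: wr_def)

lemma monoid_wr:
  assumes "monoid H" shows "monoid (wr H)"
  by (rule monoidI)
    (auto simp: fun_eq_iff monoid.m_assoc[OF assms] monoid.l_one[OF assms] monoid.r_one[OF assms]
      intro: monoid.m_closed[OF assms] monoid.one_closed[OF assms])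

text \<open>The inverse letter leaving state \<open>s\<close> must undo the step that ends in
  \<open>s\<close>. As \<open>\<pi> i\<close> is an involution, that step started in
  \<open>\<pi> i s\<close>, where its weight is taken.\<close>

definition wval :: "('i \<Rightarrow> 's \<Rightarrow> 's) \<Rightarrow> ('i \<Rightarrow> 's \<Rightarrow> 'h) \<Rightarrow> ('i \<Rightarrow> 's \<Rightarrow> 'h) \<Rightarrow> 'i \<times> bool \<Rightarrow> 's \<Rightarrow> 's \<times> 'h" where
  "wval \<pi> h hi = (\<lambda>(i, e) s. (\<pi> i s, if e then h i s else hi i (\<pi> i s)))"

lemma wval_cancel:
  assumes "\<And>s. \<pi> i (\<pi> i s) = s" "\<And>s. h i s \<otimes>\<^bsub>H\<^esub> hi i s = \<one>\<^bsub>H\<^esub>" "\<And>s. hi i s \<otimes>\<^bsub>H\<^esub> h i s = \<one>\<^bsub>H\<^esub>"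
  shows "wval \<pi> h hi (i, e) \<otimes>\<^bsub>wr H\<^esub> wval \<pi> h hi (i, \<not> e) = \<one>\<^bsub>wr H\<^esub>"
  using assms by (auto simp: fun_eq_iff wval_def)

lemma braid_relations_4:
  assumes "(u, v) \<in> braid_relations 4"
  shows "(u, v) \<in> {([(1, True), (3, True)], [(3, True), (1, True)]),
    ([(1, True), (2, True), (1, True)], [(2, True), (1, True), (2, True)]),
    ([(2, True), (3, True), (2, True)], [(3, True), (2, True), (3, True)])}"
proof -
  have "i = 1 \<and> j = 3" if "i \<in> {1..<4}" "j \<in> {1..<4}" "i + 2 \<le> j" for i j :: nat using that by auto
  moreover have "i = 1 \<or> i = 2" if "i \<in> {1..<4}" "i + 1 \<in> {1..<4}" for i :: nat using that by auto
  ultimately show ?thesis using assms unfolding braid_relations_def by (elim UnE CollectE exE conjE) force+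
qed

section \<open>Braids and pure braids on four strings\<close>

abbreviation B4 :: "nat gword set monoid" where "B4 \<equiv> braid_group 4"
abbreviation P4 :: "nat gword set monoid" where "P4 \<equiv> pure_braid_group 4"
abbreviation bcl :: "nat gword \<Rightarrow> nat gword set" where "bcl \<equiv> pres_class {1..<4} (braid_relations 4)"
abbreviation BW :: "nat gword set" where "BW \<equiv> lists ({1..<4} \<times> UNIV)"

definition compmon :: "('a \<Rightarrow> 'a) monoid" where
  "compmon = \<lparr>carrier = UNIV, mult = (\<circ>), one = id\<rparr>"

lemma monoid_compmon: "monoid compmon"
  by unfold_locales (auto simp: compmon_def)

lemma gword_perm_wev: "gword_perm w = wev compmon (\<lambda>(i, e). Transposition.transpose i (i + 1)) w"
  by (induction w) (auto simp: gword_perm_def compmon_def)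

lemma gword_perm_Nil [simp]: "gword_perm [] = id"
  and gword_perm_Cons: "gword_perm ((i, e) # w) = Transposition.transpose i (i + 1) \<circ> gword_perm w"
  by (simp_all add: gword_perm_def)

lemma gword_perm_append: "gword_perm (u @ v) = gword_perm u \<circ> gword_perm v"
  by (induction u) (auto simp: gword_perm_Cons o_assoc)

lemma gword_perm_eq:
  assumes "pres_eq {1..<4} (braid_relations 4) u v"
  shows "gword_perm u = gword_perm v"
  unfolding gword_perm_wev
proof (rule wev_pres_eq[OF monoid_compmon _ _ _ assms])
  fix u v :: "nat gword" assume "(u, v) \<in> braid_relations 4"
  from braid_relations_4[OF this]
  show "wev compmon (\<lambda>(i, e). Transposition.transpose i (i + 1)) u = wev compmon (\<lambda>(i, e). Transposition.transpose i (i + 1)) v"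
    by (auto simp: compmon_def fun_eq_iff Transposition.transpose_def)
qed (auto simp: compmon_def)

lemma braid_perm_class:
  assumes "w \<in> BW" shows "braid_perm (bcl w) = gword_perm w"
proof -
  have "gword_perm ` bcl w = {gword_perm w}"
    using gword_perm_eq pres_eq.refl[OF assms] by (force simp: pres_class_def)
  then show ?thesis by (simp add: braid_perm_def)
qed

lemma gword_perm_permutes: "w \<in> BW \<Longrightarrow> gword_perm w permutes {1..4}"
proof (induction w)
  case (Cons x w)
  obtain i e where x: "x = (i, e)" by force
  have "Transposition.transpose i (i + 1) permutes {1..4}"
    using Cons.prems x by (intro permutes_swap_id) auto
  moreover have "gword_perm w permutes {1..4}" using Cons by simp
  ultimately show ?case unfolding x gword_perm_Cons by (intro permutes_compose)
qed (simp add: permutes_id)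

lemma group_B4: "group B4" unfolding braid_group_def by (rule group_presented_group)

lemma carrier_B4: "carrier B4 = bcl ` BW"
  unfolding braid_group_def by (rule carrier_presented_group)

lemma mult_B4: "u \<in> BW \<Longrightarrow> v \<in> BW \<Longrightarrow> bcl u \<otimes>\<^bsub>B4\<^esub> bcl v = bcl (u @ v)"
  unfolding braid_group_def by (rule pres_class_mult)

lemma one_B4: "\<one>\<^bsub>B4\<^esub> = bcl []"
  unfolding braid_group_def by (rule one_presented_group)

lemma carrier_P4: "carrier P4 = {bcl w | w. w \<in> BW \<and> gword_perm w = id}"
proof -
  have "C \<in> carrier P4 \<longleftrightarrow> C \<in> carrier B4 \<and> braid_perm C = id" for C
    by (simp add: pure_braid_group_def kernel_def sym_group_def)
  then show ?thesis unfolding carrier_B4 using braid_perm_class by fastforce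
qed

lemma pure_class: "w \<in> BW \<Longrightarrow> gword_perm w = id \<Longrightarrow> bcl w \<in> carrier P4"
  unfolding carrier_P4 by blast

lemma mult_P4: "x \<otimes>\<^bsub>P4\<^esub> y = x \<otimes>\<^bsub>B4\<^esub> y" and one_P4: "\<one>\<^bsub>P4\<^esub> = \<one>\<^bsub>B4\<^esub>"
  by (simp_all add: pure_braid_group_def)

lemma group_P4: "group P4"
proof -
  have "group_hom B4 (sym_group 4) braid_perm"
  proof (intro group_hom.intro group_hom_axioms.intro group_B4 sym_group_is_group homI)
    fix C assume "C \<in> carrier B4"
    then obtain w where "w \<in> BW" "C = bcl w" unfolding carrier_B4 by blast
    then show "braid_perm C \<in> carrier (sym_group 4)"
      using gword_perm_permutes[of w] by (simp only: braid_perm_class sym_group_def partial_object.simps mem_Collect_eq)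
  next
    fix C D assume "C \<in> carrier B4" "D \<in> carrier B4"
    then obtain u v where uv: "u \<in> BW" "v \<in> BW" and C: "C = bcl u" "D = bcl v" unfolding carrier_B4 by blast
    have "u @ v \<in> BW" using uv by simp
    then show "braid_perm (C \<otimes>\<^bsub>B4\<^esub> D) = braid_perm C \<otimes>\<^bsub>sym_group 4\<^esub> braid_perm D"
      using uv by (simp only: C mult_B4 braid_perm_class gword_perm_append sym_group_def monoid.simps)
  qed
  then have "subgroup (kernel B4 (sym_group 4) braid_perm) B4"
    by (rule group_hom.subgroup_kernel)
  then show ?thesis
    unfolding pure_braid_group_def by (rule subgroup.subgroup_is_group[OF _ group_B4])
qed

lemma pure_gens:
  "pure_braid_gen 4 1 2 = bcl [(1, True), (1, True)]"
  "pure_braid_gen 4 2 3 = bcl [(2, True), (2, True)]"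
  "pure_braid_gen 4 3 4 = bcl [(3, True), (3, True)]"
  "pure_braid_gen 4 1 3 = bcl [(2, True), (1, True), (1, True), (2, False)]"
  "pure_braid_gen 4 2 4 = bcl [(3, True), (2, True), (2, True), (3, False)]"
  by (simp_all add: pure_braid_gen_def gword_inv_def numeral_nat upt_rec)

lemma pure_gens_closed:
  "pure_braid_gen 4 1 2 \<in> carrier P4" "pure_braid_gen 4 2 3 \<in> carrier P4" "pure_braid_gen 4 3 4 \<in> carrier P4"
  "pure_braid_gen 4 1 3 \<in> carrier P4" "pure_braid_gen 4 2 4 \<in> carrier P4"
  unfolding pure_gens
  by (rule pure_class, force, auto simp: gword_perm_Cons fun_eq_iff Transposition.transpose_def)+

text \<open>A monomial action: a braid permutes the states and multiplies by a weight. Pure braids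
  return to \<open>s0\<close>, so the weight collected from there is multiplicative on them.\<close>

locale braid_states =
  fixes H :: "('h, 'b) monoid_scheme" and \<pi> :: "nat \<Rightarrow> 's \<Rightarrow> 's" and h hi :: "nat \<Rightarrow> 's \<Rightarrow> 'h" and s0 :: 's
  assumes H: "monoid H"
    and pp: "\<And>i s. \<pi> i (\<pi> i s) = s"
    and hc: "\<And>i s. h i s \<in> carrier H" "\<And>i s. hi i s \<in> carrier H"
    and hinv: "\<And>i s. h i s \<otimes>\<^bsub>H\<^esub> hi i s = \<one>\<^bsub>H\<^esub>" "\<And>i s. hi i s \<otimes>\<^bsub>H\<^esub> h i s = \<one>\<^bsub>H\<^esub>"
    and rel: "\<And>u v. (u, v) \<in> braid_relations 4 \<Longrightarrow> wev (wr H) (wval \<pi> h hi) u = wev (wr H) (wval \<pi> h hi) v"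
    and fix0: "\<And>w. w \<in> BW \<Longrightarrow> gword_perm w = id \<Longrightarrow> fst (wev (wr H) (wval \<pi> h hi) w s0) = s0"
begin

definition \<rho> :: "nat gword set \<Rightarrow> 'h" where
  "\<rho> C = snd (plift (wr H) (wval \<pi> h hi) C s0)"

lemma wval_closed: "wval \<pi> h hi x \<in> carrier (wr H)"
  by (cases x) (auto simp: wval_def hc)

lemma \<rho>_class: "w \<in> BW \<Longrightarrow> \<rho> (bcl w) = snd (wev (wr H) (wval \<pi> h hi) w s0)"
  unfolding \<rho>_def
  by (subst plift_class[OF monoid_wr[OF H]]) (auto intro: wval_closed wval_cancel pp hinv rel simp del: wr_simps)

lemma \<rho>_closed: "C \<in> carrier P4 \<Longrightarrow> \<rho> C \<in> carrier H"
proof -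
  assume "C \<in> carrier P4"
  then obtain w where w: "w \<in> BW" "C = bcl w" unfolding carrier_P4 by blast
  have "wev (wr H) (wval \<pi> h hi) w \<in> carrier (wr H)"
    by (rule wev_closed[OF monoid_wr[OF H] wval_closed])
  then show ?thesis by (simp only: w(2) \<rho>_class[OF w(1)] wr_simps)
qed

lemma \<rho>_mult:
  assumes "C \<in> carrier P4" "D \<in> carrier P4"
  shows "\<rho> (C \<otimes>\<^bsub>P4\<^esub> D) = \<rho> C \<otimes>\<^bsub>H\<^esub> \<rho> D"
proof -
  obtain u v where u: "u \<in> BW" "gword_perm u = id" "C = bcl u" and v: "v \<in> BW" "gword_perm v = id" "D = bcl v"
    using assms unfolding carrier_P4 by blast
  have uv: "u @ v \<in> BW" using u v by simp
  have "\<rho> (C \<otimes>\<^bsub>P4\<^esub> D) = snd (wev (wr H) (wval \<pi> h hi) (u @ v) s0)"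
    unfolding u(3) v(3) mult_P4 mult_B4[OF u(1) v(1)] by (rule \<rho>_class[OF uv])
  also have "\<dots> = \<rho> C \<otimes>\<^bsub>H\<^esub> \<rho> D"
    unfolding wev_append[OF monoid_wr[OF H] wval_closed] u(3) v(3) \<rho>_class[OF u(1)] \<rho>_class[OF v(1)]
    by (simp add: fix0[OF v(1,2)])
  finally show ?thesis .
qed

lemma \<rho>_one: "\<rho> \<one>\<^bsub>P4\<^esub> = \<one>\<^bsub>H\<^esub>"
  by (simp add: one_P4 one_B4 \<rho>_class)

end

subsection \<open>The action on four copies of a free algebra\<close>

text \<open>State \<open>s\<close> means that the distinguished strand is in position \<open>s\<close>. It moves to the right
  above the other three points and to the left below them, so that going around the \<open>i\<close>-th
  point is multiplication by \<open>L i\<close>; the other strands act by the Artin automorphisms \<open>T i\<close>.\<close>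

definition h4 :: "'r::monoid_mult \<Rightarrow> 'r \<Rightarrow> 'r \<Rightarrow> 'r \<Rightarrow> 'r \<Rightarrow> nat \<Rightarrow> nat \<Rightarrow> 'r" where
  "h4 L1 L2 L3 T1 T2 i s =
     (if (i, s) = (1, 2) then L1 else if (i, s) = (2, 3) then L2 else if (i, s) = (3, 4) then L3
      else if (i, s) \<in> {(1, 3), (1, 4), (2, 1)} then T1
      else if (i, s) \<in> {(2, 4), (3, 1), (3, 2)} then T2 else 1)"

text \<open>The braid group on three strings acting on a free group: conjugation by
  \<open>T1\<close> sends \<open>L1\<close> to \<open>L2\<close> and fixes \<open>L3\<close> and, by
  the second relation, the product \<open>L1 * L2\<close>; similarly for \<open>T2\<close>.
  Everything that follows from these relations alone is proved here.\<close>

locale artin_action =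
  fixes L1 L2 L3 T1 T2 L1i L2i L3i T1i T2i :: "'r::monoid_mult"
  assumes inv: "L1 * L1i = 1" "L1i * L1 = 1" "L2 * L2i = 1" "L2i * L2 = 1" "L3 * L3i = 1" "L3i * L3 = 1"
      "T1 * T1i = 1" "T1i * T1 = 1" "T2 * T2i = 1" "T2i * T2 = 1"
    and TT: "T1 * (T2 * T1) = T2 * (T1 * T2)"
    and T1L: "T1 * L1 = L2 * T1" "L1 * (L2 * T1) = T1 * (L1 * L2)" "T1 * L3 = L3 * T1"
    and T2L: "T2 * L2 = L3 * T2" "L2 * (L3 * T2) = T2 * (L2 * L3)" "T2 * L1 = L1 * T2"
begin

abbreviation "val4 \<equiv> wval (\<lambda>i. Transposition.transpose i (i + 1)) (h4 L1 L2 L3 T1 T2) (h4 L1i L2i L3i T1i T2i)"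

lemma nat_cases_4: obtains "s = (1 :: nat)" | "s = 2" | "s = 3" | "s = 4" | "s \<notin> {1, 2, 3, 4}"
  by auto

lemma val4_True:
  "val4 (1, True) 1 = (2, 1)"
  "val4 (1, True) 2 = (1, L1)"
  "val4 (1, True) 3 = (3, T1)"
  "val4 (1, True) 4 = (4, T1)"
  "val4 (2, True) 1 = (1, T1)"
  "val4 (2, True) 2 = (3, 1)"
  "val4 (2, True) 3 = (2, L2)"
  "val4 (2, True) 4 = (4, T2)"
  "val4 (3, True) 1 = (1, T2)"
  "val4 (3, True) 2 = (2, T2)"
  "val4 (3, True) 3 = (4, 1)"
  "val4 (3, True) 4 = (3, L3)"
  by (simp_all add: wval_def Transposition.transpose_def h4_def)

lemma val4_False:
  "val4 (1, False) 2 = (1, 1)"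
  "val4 (1, False) 1 = (2, L1i)"
  "val4 (1, False) 3 = (3, T1i)"
  "val4 (1, False) 4 = (4, T1i)"
  "val4 (2, False) 1 = (1, T1i)"
  "val4 (2, False) 3 = (2, 1)"
  "val4 (2, False) 2 = (3, L2i)"
  "val4 (2, False) 4 = (4, T2i)"
  "val4 (3, False) 1 = (1, T2i)"
  "val4 (3, False) 2 = (2, T2i)"
  "val4 (3, False) 4 = (3, 1)"
  "val4 (3, False) 3 = (4, L3i)"
  by (simp_all add: wval_def Transposition.transpose_def h4_def)

lemma val4_other: "i \<in> {1, 2, 3} \<Longrightarrow> s \<notin> {1, 2, 3, 4} \<Longrightarrow> val4 (i, True) s = (s, 1)"
  by (auto simp: wval_def Transposition.transpose_def h4_def)

lemma fst_val4: "fst (wev (wr mulmon) val4 w s) = gword_perm w s"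
  by (induction w) (auto simp: wval_def gword_perm_Cons)

text \<open>The braid relations are checked position by position. Numbers outside 1 to 4 are fixed
  states, on which the generators have weight 1.\<close>

sublocale st: braid_states mulmon "\<lambda>i. Transposition.transpose i (i + 1)" "h4 L1 L2 L3 T1 T2" "h4 L1i L2i L3i T1i T2i" s for s
proof
  fix u v :: "nat gword" assume "(u, v) \<in> braid_relations 4"
  from braid_relations_4[OF this] show "wev (wr mulmon) val4 u = wev (wr mulmon) val4 v"
  proof (elim insertE emptyE Pair_inject; clarify; intro ext)
    fix s :: nat
    show "wev (wr mulmon) val4 [(1, True), (3, True)] s = wev (wr mulmon) val4 [(3, True), (1, True)] s"
      by (cases s rule: nat_cases_4) (simp_all add: val4_True val4_other T1L T2L)
    show "wev (wr mulmon) val4 [(1, True), (2, True), (1, True)] s = wev (wr mulmon) val4 [(2, True), (1, True), (2, True)] s"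
      by (cases s rule: nat_cases_4) (simp_all add: val4_True val4_other T1L TT)
    show "wev (wr mulmon) val4 [(2, True), (3, True), (2, True)] s = wev (wr mulmon) val4 [(3, True), (2, True), (3, True)] s"
      by (cases s rule: nat_cases_4) (simp_all add: val4_True val4_other T2L TT)
  qed
qed (auto simp: h4_def inv fst_val4 mult.assoc)

text \<open>A generator that involves the distinguished strand becomes a conjugate of a loop
  \<open>L\<close>; the others become conjugates of squares of \<open>T1\<close> and
  \<open>T2\<close>.\<close>

lemma \<rho>_gens:
  "st.\<rho> 1 (pure_braid_gen 4 1 2) = L1" "st.\<rho> 1 (pure_braid_gen 4 2 3) = T1 * T1"
  "st.\<rho> 1 (pure_braid_gen 4 3 4) = T2 * T2" "st.\<rho> 1 (pure_braid_gen 4 1 3) = T1 * (L1 * T1i)"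
  "st.\<rho> 1 (pure_braid_gen 4 2 4) = T2 * (T1 * (T1 * T2i))"
  "st.\<rho> 2 (pure_braid_gen 4 1 2) = L1" "st.\<rho> 2 (pure_braid_gen 4 2 3) = L2"
  "st.\<rho> 2 (pure_braid_gen 4 3 4) = T2 * T2" "st.\<rho> 2 (pure_braid_gen 4 1 3) = L2 * (T1 * (T1 * L2i))"
  "st.\<rho> 2 (pure_braid_gen 4 2 4) = T2 * (L2 * T2i)"
  "st.\<rho> 3 (pure_braid_gen 4 1 2) = T1 * T1" "st.\<rho> 3 (pure_braid_gen 4 2 3) = L2"
  "st.\<rho> 3 (pure_braid_gen 4 3 4) = L3" "st.\<rho> 3 (pure_braid_gen 4 1 3) = L1"
  "st.\<rho> 3 (pure_braid_gen 4 2 4) = L3 * (T2 * (T2 * L3i))"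
  "st.\<rho> 4 (pure_braid_gen 4 1 2) = T1 * T1" "st.\<rho> 4 (pure_braid_gen 4 2 3) = T2 * T2"
  "st.\<rho> 4 (pure_braid_gen 4 3 4) = L3" "st.\<rho> 4 (pure_braid_gen 4 1 3) = T2 * (T1 * (T1 * T2i))"
  "st.\<rho> 4 (pure_braid_gen 4 2 4) = L2"
  unfolding pure_gens
  by (subst st.\<rho>_class, force, simp add: val4_True val4_False)+

end

subsection \<open>The action of the four-strand group through three strands\<close>

datatype pairing = PA | PB | PC

text \<open>\<open>PA\<close>, \<open>PB\<close>, \<open>PC\<close> stand for the partitions of the four points into two pairs that contain
  \<open>{1, 2}\<close>, \<open>{2, 3}\<close> and \<open>{1, 3}\<close>.\<close>

fun pair_swap :: "nat \<Rightarrow> pairing \<Rightarrow> pairing" where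
  "pair_swap i PA = (if i = 2 then PC else PA)"
| "pair_swap i PB = (if i = 2 then PB else PC)"
| "pair_swap i PC = (if i = 2 then PA else PB)"

definition pairing_of :: "nat \<Rightarrow> nat \<Rightarrow> pairing" where
  "pairing_of a b = (if {a, b} \<in> {{1, 2}, {3, 4}} then PA else if {a, b} \<in> {{2, 3}, {1, 4}} then PB else PC)"

lemma pairing_of_swap:
  assumes "i \<in> {1..<4}" "a \<in> {1..4}" "b \<in> {1..4}" "a \<noteq> b"
  shows "pairing_of (Transposition.transpose i (i + 1) a) (Transposition.transpose i (i + 1) b) = pair_swap i (pairing_of a b)"
proof -
  have "i \<in> {1, 2, 3}" "a \<in> {1, 2, 3, 4}" "b \<in> {1, 2, 3, 4}" using assms by auto
  with assms(4) show ?thesis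
    by (elim insertE emptyE; hypsubst; simp add: pairing_of_def Transposition.transpose_def doubleton_eq_iff)
qed

text \<open>The generators 1 and 3 act alike, so this is the braid group on three strings, whose
  pure part modulo its centre is free on \<open>x\<close>, \<open>y\<close>. States with distinct
  entries are the six orderings of the pairings. Each generator joins them in pairs, and of the two
  directions of such an edge only one carries a weight.\<close>

definition h6 :: "('h, 'b) monoid_scheme \<Rightarrow> 'h \<Rightarrow> 'h \<Rightarrow> nat \<Rightarrow> pairing \<times> pairing \<Rightarrow> 'h" where
  "h6 G x y i s =
    (if i = 2 then
       (if s = (PC, PB) then y else if s = (PC, PA) then inv\<^bsub>G\<^esub> x \<otimes>\<^bsub>G\<^esub> inv\<^bsub>G\<^esub> y
        else if s = (PB, PA) then x else \<one>\<^bsub>G\<^esub>)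
     else
       (if s = (PA, PC) then x else if s = (PB, PC) then inv\<^bsub>G\<^esub> y \<otimes>\<^bsub>G\<^esub> inv\<^bsub>G\<^esub> x
        else if s = (PB, PA) then y else \<one>\<^bsub>G\<^esub>))"

locale two_generated = group G for G (structure) +
  fixes x y
  assumes x: "x \<in> carrier G" and y: "y \<in> carrier G"
begin

lemma cancel_simps:
  "a \<in> carrier G \<Longrightarrow> b \<in> carrier G \<Longrightarrow> a \<otimes> (inv a \<otimes> b) = b"
  "a \<in> carrier G \<Longrightarrow> b \<in> carrier G \<Longrightarrow> inv a \<otimes> (a \<otimes> b) = b"
  by (simp_all add: m_assoc[symmetric])

abbreviation "sw6 \<equiv> \<lambda>i. map_prod (pair_swap i) (pair_swap i)"
abbreviation "val6 \<equiv> wval sw6 (h6 G x y) (\<lambda>i s. inv (h6 G x y i s))"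

lemma h6_closed: "h6 G x y i s \<in> carrier G"
  using x y by (simp add: h6_def)

text \<open>The state records where the pairs \<open>{1, 2}\<close> and \<open>{2, 3}\<close> have
  gone, so a pure braid returns to \<open>(PA, PB)\<close>.\<close>

lemma fst_val6:
  "w \<in> BW \<Longrightarrow> fst (wev (wr G) val6 w (PA, PB)) = (pairing_of (gword_perm w 1) (gword_perm w 2), pairing_of (gword_perm w 2) (gword_perm w 3))"
proof (induction w)
  case Nil
  then show ?case by (simp add: pairing_of_def doubleton_eq_iff)
next
  case (Cons z w)
  obtain i e where z: "z = (i, e)" by force
  have "w \<in> BW" "z \<in> {1..<4} \<times> UNIV" using Cons.prems by simp_all
  then have w: "w \<in> BW" "i \<in> {1..<4}" unfolding z by blast+
  note p = gword_perm_permutes[OF w(1)]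
  have in4: "gword_perm w 1 \<in> {1..4}" "gword_perm w 2 \<in> {1..4}" "gword_perm w 3 \<in> {1..4}"
    using permutes_in_image[OF p] by auto
  have ne: "gword_perm w 1 \<noteq> gword_perm w 2" "gword_perm w 2 \<noteq> gword_perm w 3"
    using inj_eq[OF permutes_inj[OF p]] by auto
  have "fst (wev (wr G) val6 (z # w) (PA, PB)) = map_prod (pair_swap i) (pair_swap i) (fst (wev (wr G) val6 w (PA, PB)))"
    by (simp add: z wval_def)
  then show ?case
    unfolding Cons.IH[OF w(1)] z gword_perm_Cons o_apply
    by (simp only: map_prod_simp pairing_of_swap[OF w(2) in4(1,2) ne(1)] pairing_of_swap[OF w(2) in4(2,3) ne(2)])
qed

sublocale st: braid_states G sw6 "h6 G x y" "\<lambda>i s. inv (h6 G x y i s)" "(PA, PB)"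
proof
  fix u v :: "nat gword" assume "(u, v) \<in> braid_relations 4"
  from braid_relations_4[OF this] show "wev (wr G) val6 u = wev (wr G) val6 v"
  proof (elim insertE emptyE Pair_inject; clarify; intro ext)
    fix s :: "pairing \<times> pairing"
    obtain p q where s: "s = (p, q)" by force
    show "wev (wr G) val6 [(1, True), (3, True)] s = wev (wr G) val6 [(3, True), (1, True)] s"
      unfolding s by (cases p; cases q) (simp_all add: wval_def h6_def x y)
    show "wev (wr G) val6 [(1, True), (2, True), (1, True)] s = wev (wr G) val6 [(2, True), (1, True), (2, True)] s"
      unfolding s by (cases p; cases q) (simp_all add: wval_def h6_def x y m_assoc cancel_simps)
    show "wev (wr G) val6 [(2, True), (3, True), (2, True)] s = wev (wr G) val6 [(3, True), (2, True), (3, True)] s"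
      unfolding s by (cases p; cases q) (simp_all add: wval_def h6_def x y m_assoc cancel_simps)
  qed
next
  fix w assume "w \<in> BW" "gword_perm w = id"
  then show "fst (wev (wr G) val6 w (PA, PB)) = (PA, PB)"
    by (simp only: fst_val6) (simp add: pairing_of_def doubleton_eq_iff)
next
  fix i s
  show "sw6 i (sw6 i s) = s"
  proof (cases s)
    case (Pair p q) then show ?thesis by (cases p; cases q) auto
  qed
qed (simp_all add: h6_closed)

lemma \<rho>_gens:
  "st.\<rho> (pure_braid_gen 4 1 2) = x" "st.\<rho> (pure_braid_gen 4 2 3) = y" "st.\<rho> (pure_braid_gen 4 3 4) = x"
  "st.\<rho> (pure_braid_gen 4 1 3) = inv x \<otimes> inv y" "st.\<rho> (pure_braid_gen 4 2 4) = inv y \<otimes> inv x"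
  unfolding pure_gens
  by (subst st.\<rho>_class, force, simp add: wval_def h6_def x y m_assoc cancel_simps inv_mult_group)+

end

section \<open>Pro-\<open>l\<close> completion\<close>

text \<open>The map \<open>c\<close> separates cosets and has finite image, so the quotient is
  finite. All its elements have \<open>l\<close>-power order, hence by Sylow no other prime divides
  its order.\<close>

lemma in_l_power_index_normalI:
  assumes l: "prime l" and G: "group G" and N: "N \<lhd> G"
    and pow: "\<And>g. g \<in> carrier G \<Longrightarrow> \<exists>k. g [^]\<^bsub>G\<^esub> (l ^ k) \<in> N"
    and fin: "finite (c ` carrier G)"
    and c: "\<And>g g'. g \<in> carrier G \<Longrightarrow> g' \<in> carrier G \<Longrightarrow> c g = c g' \<Longrightarrow> g \<otimes>\<^bsub>G\<^esub> inv\<^bsub>G\<^esub> g' \<in> N"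
  shows "N \<in> l_power_index_normal l G"
proof -
  interpret G: group G by (rule G)
  interpret N: normal N G by (rule N)
  interpret Q: group "G Mod N" by (rule N.factorgroup_is_group)
  have sub: "subgroup N G" by unfold_locales
  let ?r = "\<lambda>y. N #>\<^bsub>G\<^esub> (SOME g. g \<in> carrier G \<and> c g = y)"
  have "rcosets\<^bsub>G\<^esub> N \<subseteq> ?r ` (c ` carrier G)"
  proof
    fix C assume "C \<in> rcosets\<^bsub>G\<^esub> N"
    then obtain g where g: "g \<in> carrier G" "C = N #>\<^bsub>G\<^esub> g" by (auto simp: RCOSETS_def)
    define g' where "g' = (SOME g'. g' \<in> carrier G \<and> c g' = c g)"
    have g': "g' \<in> carrier G \<and> c g' = c g" unfolding g'_def by (rule someI[of _ g]) (use g in auto)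
    then have "g \<in> N #>\<^bsub>G\<^esub> g'"
      using N.rcos_module_rev[OF G, of g' g] c[of g g'] g by simp
    then have "C = N #>\<^bsub>G\<^esub> g'" using G.repr_independence[OF _ _ sub, of g g'] g' g by simp
    then show "C \<in> ?r ` (c ` carrier G)" using g(1) by (auto simp: g'_def)
  qed
  then have fQ: "finite (carrier (G Mod N))"
    unfolding FactGroup_def using fin finite_subset by fastforce
  have ord: "Coset.order (G Mod N) = card (rcosets\<^bsub>G\<^esub> N)" by (simp add: Coset.order_def FactGroup_def)
  have n0: "Coset.order (G Mod N) \<noteq> 0" using fQ Q.order_gt_0_iff_finite by simp
  have "q = l" if q: "prime q" "q dvd Coset.order (G Mod N)" for q
  proof -
    \<comment> \<open>A subgroup of order \<open>q ^ Suc a\<close> contains a nontrivial coset,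
      whose order is a power of both \<open>q\<close> and \<open>l\<close>.\<close>
    obtain a m where "Coset.order (G Mod N) = q ^ Suc a * m"
      using q by (metis dvdE power_Suc0_right)
    from sylow_thm[OF q(1) Q.is_group this fQ] obtain K where K: "subgroup K (G Mod N)" "card K = q ^ Suc a" by auto
    interpret K: group "(G Mod N)\<lparr>carrier := K\<rparr>" by (rule subgroup.subgroup_is_group[OF K(1) Q.is_group])
    have "card K > 1" using K(2) one_less_power[OF prime_gt_1_nat[OF q(1)], of "Suc a"] by simp
    then have "\<not> K \<subseteq> {N}" using card_mono[of "{N}" K] by auto
    then obtain C where C: "C \<in> K" "C \<noteq> N" by auto
    have CQ: "C \<in> carrier (G Mod N)" using C(1) subgroup.subset[OF K(1)] by blast
    then obtain g where g: "g \<in> carrier G" "C = N #>\<^bsub>G\<^esub> g" by (auto simp: carrier_FactGroup)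
    obtain k where k: "g [^]\<^bsub>G\<^esub> (l ^ k) \<in> N" using pow[OF g(1)] by blast
    have "C [^]\<^bsub>G Mod N\<^esub> (l ^ k) = N #>\<^bsub>G\<^esub> (g [^]\<^bsub>G\<^esub> (l ^ k))"
      unfolding g(2) using N.FactGroup_pow[OF g(1)] .
    also have "\<dots> = \<one>\<^bsub>G Mod N\<^esub>" using N.rcos_const[OF G k] by simp
    finally have 1: "Q.ord C dvd l ^ k" using Q.pow_eq_id[OF CQ] by simp
    have "C [^]\<^bsub>(G Mod N)\<lparr>carrier := K\<rparr>\<^esub> card K = \<one>\<^bsub>G Mod N\<^esub>"
      using K.pow_order_eq_1[of C] C(1) by (simp add: Coset.order_def)
    then have "C [^]\<^bsub>G Mod N\<^esub> (q ^ Suc a) = \<one>\<^bsub>G Mod N\<^esub>"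
      using Q.nat_pow_consistent[of C "q ^ Suc a" K] K(2) by simp
    then have 2: "Q.ord C dvd q ^ Suc a" using Q.pow_eq_id[OF CQ] by simp
    obtain i j where ij: "Q.ord C = l ^ i" "Q.ord C = q ^ j"
      using 1 2 divides_primepow_nat[OF l] divides_primepow_nat[OF q(1)] by metis
    have "Q.ord C \<noteq> 1" using Q.ord_eq_1[OF CQ] C(2) by simp
    then have "i \<noteq> 0" using ij by (cases i) auto
    then have "l dvd q ^ j" using ij by (metis dvd_power_same dvd_refl dvd_power gr0I)
    then show "q = l" using l q(1) by (metis prime_dvd_power primes_dvd_imp_eq)
  qed
  then have "\<exists>k. Coset.order (G Mod N) = l ^ k"
  proof -
    obtain m where m: "Coset.order (G Mod N) = l ^ multiplicity l (Coset.order (G Mod N)) * m" "\<not> l dvd m"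
      using multiplicity_decompose'[of "Coset.order (G Mod N)" l] n0 l by (metis not_prime_unit)
    have "m = 1"
    proof (rule ccontr)
      assume "m \<noteq> 1"
      then obtain q where "prime q" "q dvd m" using prime_factor_nat by blast
      then have "q dvd Coset.order (G Mod N)" by (subst m(1)) simp
      with \<open>\<And>q. prime q \<Longrightarrow> q dvd Coset.order (G Mod N) \<Longrightarrow> q = l\<close> \<open>prime q\<close> \<open>q dvd m\<close> m(2) show False by blast
    qed
    then show ?thesis using m(1) by (metis mult_1_right)
  qed
  then show ?thesis
    using N unfolding l_power_index_normal_def ord by blast
qed


locale l_group = group G for G (structure) + fixes l :: nat assumes l: "prime l"
begin

abbreviation "LN \<equiv> l_power_index_normal l G"

lemma LN_normal: "N \<in> LN \<Longrightarrow> N \<lhd> G"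
  by (simp add: l_power_index_normal_def)

lemma LN_subgroup: "N \<in> LN \<Longrightarrow> subgroup N G"
  by (simp add: LN_normal normal_imp_subgroup)

lemma LN_finite: "N \<in> LN \<Longrightarrow> finite (rcosets N)"
  using prime_gt_0_nat[OF l] by (auto simp: l_power_index_normal_def intro!: card_ge_0_finite)

lemma LN_pow:
  assumes "N \<in> LN" "g \<in> carrier G"
  shows "\<exists>k. g [^] (l ^ k) \<in> N"
proof -
  interpret N: normal N G by (rule LN_normal[OF assms(1)])
  interpret Q: group "G Mod N" by (rule N.factorgroup_is_group)
  obtain k where k: "card (rcosets N) = l ^ k" using assms(1) by (auto simp: l_power_index_normal_def)
  have "N #> (g [^] (l ^ k)) = (N #> g) [^]\<^bsub>G Mod N\<^esub> (l ^ k)"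
    using N.FactGroup_pow[OF assms(2)] by simp
  also have "\<dots> = N"
  proof -
    have "Coset.order (G Mod N) = l ^ k" using k by (simp add: Coset.order_def FactGroup_def)
    moreover have "N #> g \<in> carrier (G Mod N)" using assms(2) by (simp add: FactGroup_def rcosetsI N.subset)
    ultimately show ?thesis using Q.pow_order_eq_1[of "N #> g"] by simp
  qed
  finally have "N #> (g [^] (l ^ k)) = N" .
  moreover have "g [^] (l ^ k) \<in> N #> (g [^] (l ^ k))"
    using assms(2) LN_subgroup[OF assms(1)] by (intro rcos_self) auto
  ultimately show ?thesis by auto
qed

lemma LN_pow_mono:
  assumes "N \<in> LN" "g \<in> carrier G" "g [^] (l ^ k) \<in> N" "k \<le> j"
  shows "g [^] (l ^ j) \<in> N"
proof -
  interpret N: subgroup N G by (rule LN_subgroup[OF assms(1)])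
  have "l ^ j = l ^ k * l ^ (j - k)" using assms(4) by (simp flip: power_add)
  then have "g [^] (l ^ j) = (g [^] (l ^ k)) [^] (l ^ (j - k))"
    using assms(2) by (simp add: nat_pow_pow)
  moreover have "(g [^] (l ^ k)) [^] (n :: nat) \<in> N" for n
    using assms(3) by (induction n) auto
  ultimately show ?thesis by simp
qed

lemma coset_eq_iff:
  assumes "N \<in> LN" "g \<in> carrier G" "h \<in> carrier G"
  shows "N #> g = N #> h \<longleftrightarrow> g \<otimes> inv h \<in> N"
proof -
  interpret N: subgroup N G by (rule LN_subgroup[OF assms(1)])
  show ?thesis
    using N.rcos_module[OF is_group assms(3,2)] repr_independence[OF _ _ N.subgroup_axioms, of g h] assms
      rcos_self[OF assms(2) N.subgroup_axioms] by auto
qed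

lemma LN_Int:
  assumes "M \<in> LN" "N \<in> LN"
  shows "M \<inter> N \<in> LN"
proof (rule in_l_power_index_normalI[OF l is_group, where c = "\<lambda>g. (M #> g, N #> g)"])
  show "M \<inter> N \<lhd> G" using normal_subgroup_intersect LN_normal assms by blast
  fix g assume g: "g \<in> carrier G"
  obtain i j where "g [^] (l ^ i) \<in> M" "g [^] (l ^ j) \<in> N" using LN_pow assms g by blast
  then have "g [^] (l ^ max i j) \<in> M \<inter> N" using LN_pow_mono assms g by (meson IntI max.cobounded1 max.cobounded2)
  then show "\<exists>k. g [^] (l ^ k) \<in> M \<inter> N" ..
next
  have "(\<lambda>g. (M #> g, N #> g)) ` carrier G \<subseteq> (rcosets M) \<times> (rcosets N)"
    using LN_subgroup assms by (auto intro!: rcosetsI dest: subgroup.subset)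
  then show "finite ((\<lambda>g. (M #> g, N #> g)) ` carrier G)"
    by (rule finite_subset) (simp add: LN_finite assms)
next
  fix g g' assume "g \<in> carrier G" "g' \<in> carrier G" "(M #> g, N #> g) = (M #> g', N #> g')"
  then show "g \<otimes> inv g' \<in> M \<inter> N"
    using coset_eq_iff[OF assms(1)] coset_eq_iff[OF assms(2)] by simp
qed

lemma carrier_LN: "carrier G \<in> LN"
  by (rule in_l_power_index_normalI[OF l is_group, where c = "\<lambda>_. ()"])
    (auto simp: normal_inv_iff subgroup_self)

lemma LN_Inter:
  assumes "finite A" "A \<subseteq> LN"
  shows "\<exists>N\<in>LN. \<forall>M\<in>A. N \<subseteq> M"
  using assms
proof (induction A)
  case empty
  then show ?case using carrier_LN by auto
next
  case (insert M A)
  then obtain N where "N \<in> LN" "\<forall>M\<in>A. N \<subseteq> M" by auto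
  then show ?case using LN_Int[of M N] insert.prems by (intro bexI[of _ "M \<inter> N"]) auto
qed

end

lemma LN_preimage:
  assumes "l_group G l" "l_group G' l" and h: "h \<in> hom G G'" and M: "M \<in> l_power_index_normal l G'"
  shows "{g \<in> carrier G. h g \<in> M} \<in> l_power_index_normal l G" (is "?N \<in> _")
proof -
  interpret G: l_group G l by (rule assms(1))
  interpret G': l_group G' l by (rule assms(2))
  interpret h: group_hom G G' h by unfold_locales (rule h)
  interpret M: normal M G' by (rule G'.LN_normal[OF M])
  have sub: "subgroup ?N G" by unfold_locales auto
  show ?thesis
  proof (rule in_l_power_index_normalI[OF G.l G.is_group, where c = "\<lambda>g. M #>\<^bsub>G'\<^esub> h g"])
    show "?N \<lhd> G"
      unfolding G.normal_inv_iff using sub M.inv_op_closed2 by auto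
    fix g assume g: "g \<in> carrier G"
    obtain k where "h g [^]\<^bsub>G'\<^esub> (l ^ k) \<in> M" using G'.LN_pow[OF M, of "h g"] g by auto
    then show "\<exists>k. g [^]\<^bsub>G\<^esub> (l ^ k) \<in> ?N" using g by (auto simp: h.hom_nat_pow)
  next
    have "(\<lambda>g. M #>\<^bsub>G'\<^esub> h g) ` carrier G \<subseteq> rcosets\<^bsub>G'\<^esub> M"
      by (auto intro!: G'.rcosetsI M.subset)
    then show "finite ((\<lambda>g. M #>\<^bsub>G'\<^esub> h g) ` carrier G)" 
      by (rule finite_subset) (rule G'.LN_finite[OF M])
  next
    fix g g' assume "g \<in> carrier G" "g' \<in> carrier G" "M #>\<^bsub>G'\<^esub> h g = M #>\<^bsub>G'\<^esub> h g'"
    then show "g \<otimes>\<^bsub>G\<^esub> inv\<^bsub>G\<^esub> g' \<in> ?N"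
      using G'.coset_eq_iff[OF M, of "h g" "h g'"] by simp
  qed
qed


context l_group
begin

abbreviation "Gh \<equiv> pro_completion l G"

lemma pro_mem_iff: "c \<in> carrier Gh \<longleftrightarrow> c \<in> extensional LN \<and> (\<forall>N\<in>LN. c N \<in> rcosets N) \<and>
    (\<forall>M\<in>LN. \<forall>N\<in>LN. N \<subseteq> M \<longrightarrow> c N \<subseteq> c M)"
  by (auto simp: pro_completion_def PiE_def Pi_def)

lemma pro_mult: "N \<in> LN \<Longrightarrow> (c \<otimes>\<^bsub>Gh\<^esub> d) N = c N <#> d N"
  by (simp add: pro_completion_def)

lemma pro_one: "N \<in> LN \<Longrightarrow> \<one>\<^bsub>Gh\<^esub> N = N"
  by (simp add: pro_completion_def)

lemma pro_eqI:
  assumes "c \<in> carrier Gh" "d \<in> carrier Gh" "\<And>N. N \<in> LN \<Longrightarrow> c N = d N"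
  shows "c = d"
  using assms by (auto simp: pro_mem_iff intro: extensionalityI)

lemma pro_rep: "c \<in> carrier Gh \<Longrightarrow> N \<in> LN \<Longrightarrow> \<exists>g\<in>carrier G. c N = N #> g"
  by (auto simp: pro_mem_iff RCOSETS_def)

lemma pro_rep_mono:
  assumes "c \<in> carrier Gh" "M \<in> LN" "N \<in> LN" "N \<subseteq> M" "g \<in> carrier G" "c N = N #> g"
  shows "c M = M #> g"
proof -
  obtain h where h: "h \<in> carrier G" "c M = M #> h" using pro_rep[OF assms(1,2)] by blast
  have "g \<in> c N" unfolding assms(6) by (rule rcos_self[OF assms(5) LN_subgroup[OF assms(3)]])
  moreover have "c N \<subseteq> c M" using assms(1-4) unfolding pro_mem_iff by blast
  ultimately have "g \<in> M #> h" using h(2) by blast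
  then show ?thesis using repr_independence[OF _ h(1) LN_subgroup[OF assms(2)]] h(2) by simp
qed

lemma coset_mult: "N \<in> LN \<Longrightarrow> g \<in> carrier G \<Longrightarrow> h \<in> carrier G \<Longrightarrow> (N #> g) <#> (N #> h) = N #> (g \<otimes> h)"
  using normal.rcos_sum[OF LN_normal] .

lemma pro_closed:
  assumes "c \<in> carrier Gh" "d \<in> carrier Gh"
  shows "c \<otimes>\<^bsub>Gh\<^esub> d \<in> carrier Gh"
  unfolding pro_mem_iff
proof (intro conjI ballI impI)
  show "c \<otimes>\<^bsub>Gh\<^esub> d \<in> extensional LN" by (simp add: pro_completion_def)
  show "(c \<otimes>\<^bsub>Gh\<^esub> d) N \<in> rcosets N" if "N \<in> LN" for N
    unfolding pro_mult[OF that]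
    using normal.setmult_closed[OF LN_normal[OF that]] assms that by (simp add: pro_mem_iff)
  show "(c \<otimes>\<^bsub>Gh\<^esub> d) N \<subseteq> (c \<otimes>\<^bsub>Gh\<^esub> d) M" if "M \<in> LN" "N \<in> LN" "N \<subseteq> M" for M N
    unfolding pro_mult[OF that(1)] pro_mult[OF that(2)]
    by (rule mono_set_mult) (use assms that in \<open>auto simp: pro_mem_iff\<close>)
qed

lemma pro_of_comp: "N \<in> LN \<Longrightarrow> pro_of l G g N = N #> g"
  by (simp add: pro_of_def)

lemma pro_of_closed: "g \<in> carrier G \<Longrightarrow> pro_of l G g \<in> carrier Gh"
  unfolding pro_mem_iff
  by (auto simp: pro_of_def r_coset_def dest: LN_subgroup subgroup.subset intro!: rcosetsI[unfolded r_coset_def])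

lemma pro_of_mult:
  assumes "g \<in> carrier G" "h \<in> carrier G"
  shows "pro_of l G (g \<otimes> h) = pro_of l G g \<otimes>\<^bsub>Gh\<^esub> pro_of l G h"
  by (rule pro_eqI) (use assms in \<open>auto simp: pro_of_closed pro_closed pro_mult pro_of_comp coset_mult\<close>)

lemma pro_of_one: "pro_of l G \<one> = \<one>\<^bsub>Gh\<^esub>"
  using LN_subgroup subgroup.rcos_const[OF _ is_group, of _ \<one>]
  by (auto simp: pro_of_def pro_completion_def subgroup.one_closed intro!: restrict_ext)

lemma pro_one_closed: "\<one>\<^bsub>Gh\<^esub> \<in> carrier Gh"
  using pro_of_closed[OF one_closed] by (simp add: pro_of_one)

lemma group_pro: "group Gh"
proof (rule groupI)
  show "x \<otimes>\<^bsub>Gh\<^esub> y \<otimes>\<^bsub>Gh\<^esub> z = x \<otimes>\<^bsub>Gh\<^esub> (y \<otimes>\<^bsub>Gh\<^esub> z)"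
    if "x \<in> carrier Gh" "y \<in> carrier Gh" "z \<in> carrier Gh" for x y z
  proof (rule pro_eqI)
    fix N assume N: "N \<in> LN"
    show "(x \<otimes>\<^bsub>Gh\<^esub> y \<otimes>\<^bsub>Gh\<^esub> z) N = (x \<otimes>\<^bsub>Gh\<^esub> (y \<otimes>\<^bsub>Gh\<^esub> z)) N"
      unfolding pro_mult[OF N] using normal.rcosets_assoc[OF LN_normal[OF N]] that N by (simp add: pro_mem_iff)
  qed (use that in \<open>auto intro!: pro_closed\<close>)
  show "\<one>\<^bsub>Gh\<^esub> \<otimes>\<^bsub>Gh\<^esub> x = x" if "x \<in> carrier Gh" for x
  proof (rule pro_eqI)
    fix N assume N: "N \<in> LN"
    show "(\<one>\<^bsub>Gh\<^esub> \<otimes>\<^bsub>Gh\<^esub> x) N = x N"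
      unfolding pro_mult[OF N] pro_one[OF N]
      using normal.rcosets_mult_eq[OF LN_normal[OF N]] that N by (simp add: pro_mem_iff)
  qed (use that pro_closed pro_one_closed in auto)
  show "\<exists>y\<in>carrier Gh. y \<otimes>\<^bsub>Gh\<^esub> x = \<one>\<^bsub>Gh\<^esub>" if x: "x \<in> carrier Gh" for x
  proof
    let ?y = "\<lambda>N\<in>LN. set_inv (x N)"
    show y: "?y \<in> carrier Gh"
      unfolding pro_mem_iff
      using x normal.setinv_closed[OF LN_normal] by (auto simp: pro_mem_iff SET_INV_def) blast
    show "?y \<otimes>\<^bsub>Gh\<^esub> x = \<one>\<^bsub>Gh\<^esub>"
    proof (rule pro_eqI)
      fix N assume N: "N \<in> LN"
      show "(?y \<otimes>\<^bsub>Gh\<^esub> x) N = \<one>\<^bsub>Gh\<^esub> N"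
        unfolding pro_mult[OF N] pro_one[OF N]
        using normal.rcosets_inv_mult_group_eq[OF LN_normal[OF N]] x N by (simp add: pro_mem_iff)
    qed (use x y pro_closed pro_one_closed in auto)
  qed
qed (auto intro: pro_closed pro_one_closed)

lemma topspace_pro: "topspace (pro_topology l G) = carrier Gh"
  by (auto simp: pro_topology_def pro_completion_def)

lemma Hausdorff_pro: "Hausdorff_space (pro_topology l G)"
  unfolding pro_topology_def
  by (intro Hausdorff_space_subtopology) (simp add: Hausdorff_space_product_topology)

lemma continuous_pro_comp: "N \<in> LN \<Longrightarrow> continuous_map (pro_topology l G) (discrete_topology (rcosets N)) (\<lambda>c. c N)"
  unfolding pro_topology_def
  by (intro continuous_map_from_subtopology continuous_map_product_projection)

text \<open>A basic neighbourhood restricts finitely many coordinates. Some \<open>N\<close> lies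
  below all of them, and a representative of \<open>c\<close> modulo \<open>N\<close> satisfies
  every restriction.\<close>

lemma pro_dense:
  assumes "c \<in> carrier Gh"
  shows "c \<in> pro_topology l G closure_of (pro_of l G ` carrier G)"
  unfolding in_closure_of topspace_pro
proof (intro conjI allI impI assms)
  fix T assume T: "c \<in> T \<and> openin (pro_topology l G) T"
  then obtain T' where T': "openin (product_topology (\<lambda>N. discrete_topology (rcosets N)) LN) T'" "T = T' \<inter> carrier Gh"
    by (auto simp: pro_topology_def openin_subtopology)
  then obtain U where U: "c \<in> (\<Pi>\<^sub>E N\<in>LN. U N)" "finite {N. U N \<noteq> topspace (discrete_topology (rcosets N))}"
      "(\<Pi>\<^sub>E N\<in>LN. U N) \<subseteq> T'"
    using product_topology_open_contains_basis[OF T'(1), of c] T by auto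
  let ?A = "{N. U N \<noteq> rcosets N} \<inter> LN"
  obtain N where N: "N \<in> LN" "\<forall>M\<in>?A. N \<subseteq> M" using LN_Inter[of ?A] U(2) by auto
  obtain g where g: "g \<in> carrier G" "c N = N #> g" using pro_rep[OF assms N(1)] by blast
  have "pro_of l G g M \<in> U M" if M: "M \<in> LN" for M
  proof (cases "M \<in> ?A")
    case True
    then have "pro_of l G g M = c M"
      using pro_rep_mono[OF assms M N(1) _ g] N(2) by (simp add: pro_of_comp M)
    then show ?thesis using U(1) M by auto
  next
    case False
    then show ?thesis using M pro_of_closed[OF g(1)] by (simp add: pro_mem_iff)
  qed
  then have "pro_of l G g \<in> T'" using U(3) pro_of_closed[OF g(1)] by (auto simp: pro_mem_iff PiE_def)
  then show "\<exists>y. y \<in> pro_of l G ` carrier G \<and> y \<in> T" using g(1) pro_of_closed T'(2) by blast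
qed

end

subsection \<open>Completion of homomorphisms\<close>

text \<open>The coordinate at \<open>M\<close> is computed from the coordinate at the preimage of
  \<open>M\<close>; the chosen representative does not matter modulo \<open>M\<close>, see
  \<open>pro_map_comp\<close>.\<close>

definition pro_map :: "nat \<Rightarrow> ('g, 'm) monoid_scheme \<Rightarrow> ('h, 'n) monoid_scheme \<Rightarrow> ('g \<Rightarrow> 'h) \<Rightarrow> ('g set \<Rightarrow> 'g set) \<Rightarrow> 'h set \<Rightarrow> 'h set" where
  "pro_map l G G' h c = (\<lambda>M\<in>l_power_index_normal l G'.
     M #>\<^bsub>G'\<^esub> h (SOME g. g \<in> carrier G \<and> c {g \<in> carrier G. h g \<in> M} = {g \<in> carrier G. h g \<in> M} #>\<^bsub>G\<^esub> g))"

locale l_group_hom = G: l_group G l + G': l_group G' l + hom: group_hom G G' h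
  for G (structure) and G' (structure) and h and l
begin

abbreviation pre where "pre M \<equiv> {g \<in> carrier G. h g \<in> M}"

lemma pre_LN: "M \<in> G'.LN \<Longrightarrow> pre M \<in> G.LN"
  by (rule LN_preimage[OF G.l_group_axioms G'.l_group_axioms hom.homh])

lemma pro_map_comp:
  assumes c: "c \<in> carrier G.Gh" and M: "M \<in> G'.LN" and N: "N \<in> G.LN" "N \<subseteq> pre M" and g: "g \<in> carrier G" "c N = N #> g"
  shows "pro_map l G G' h c M = M #>\<^bsub>G'\<^esub> h g"
proof -
  let ?P = "\<lambda>g. g \<in> carrier G \<and> c (pre M) = pre M #> g"
  define g' where "g' = (SOME g. ?P g)"
  have "?P g" using G.pro_rep_mono[OF c pre_LN[OF M] N g] g by simp
  then have g': "?P g'" unfolding g'_def by (rule someI)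
  then have "pre M #> g = pre M #> g'" using \<open>?P g\<close> by simp
  then have "g \<otimes> inv g' \<in> pre M" using G.coset_eq_iff[OF pre_LN[OF M]] g' g by simp
  then have "M #>\<^bsub>G'\<^esub> h g = M #>\<^bsub>G'\<^esub> h g'" using G'.coset_eq_iff[OF M] g g' by simp
  then show ?thesis using M by (simp add: pro_map_def g'_def)
qed

lemma pro_map_closed:
  assumes c: "c \<in> carrier G.Gh" shows "pro_map l G G' h c \<in> carrier G'.Gh"
  unfolding G'.pro_mem_iff
proof (intro conjI ballI impI)
  show "pro_map l G G' h c \<in> extensional G'.LN" by (simp add: pro_map_def)
  show "pro_map l G G' h c M \<in> rcosets\<^bsub>G'\<^esub> M" if M: "M \<in> G'.LN" for M
  proof -
    obtain g where "g \<in> carrier G" "c (pre M) = pre M #> g" using G.pro_rep[OF c pre_LN[OF M]] by blast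
    then show ?thesis
      using pro_map_comp[OF c M pre_LN[OF M]] G'.LN_subgroup[OF M] by (auto intro!: G'.rcosetsI dest: subgroup.subset)
  qed
  show "pro_map l G G' h c N \<subseteq> pro_map l G G' h c M" if MN: "M \<in> G'.LN" "N \<in> G'.LN" "N \<subseteq> M" for M N
  proof -
    obtain g where g: "g \<in> carrier G" "c (pre N) = pre N #> g" using G.pro_rep[OF c pre_LN[OF MN(2)]] by blast
    have "pre N \<subseteq> pre M" using MN(3) by auto
    then show ?thesis
      using pro_map_comp[OF c MN(1) pre_LN[OF MN(2)] _ g] pro_map_comp[OF c MN(2) pre_LN[OF MN(2)] subset_refl g] MN(3)
      by (auto simp: r_coset_def)
  qed
qed

lemma pro_map_hom: "pro_map l G G' h \<in> hom G.Gh G'.Gh"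
proof (rule homI)
  fix c d assume cd: "c \<in> carrier G.Gh" "d \<in> carrier G.Gh"
  show "pro_map l G G' h (c \<otimes>\<^bsub>G.Gh\<^esub> d) = pro_map l G G' h c \<otimes>\<^bsub>G'.Gh\<^esub> pro_map l G G' h d"
  proof (rule G'.pro_eqI)
    fix M assume M: "M \<in> G'.LN"
    note P = pre_LN[OF M]
    obtain g where g: "g \<in> carrier G" "c (pre M) = pre M #> g" using G.pro_rep[OF cd(1) P] by blast
    obtain k where k: "k \<in> carrier G" "d (pre M) = pre M #> k" using G.pro_rep[OF cd(2) P] by blast
    have "(c \<otimes>\<^bsub>G.Gh\<^esub> d) (pre M) = pre M #> (g \<otimes> k)"
      unfolding G.pro_mult[OF P] g(2) k(2) by (rule G.coset_mult[OF P g(1) k(1)])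
    then have "pro_map l G G' h (c \<otimes>\<^bsub>G.Gh\<^esub> d) M = M #>\<^bsub>G'\<^esub> h (g \<otimes> k)"
      using g k by (intro pro_map_comp[OF G.pro_closed[OF cd] M P subset_refl]) auto
    then show "pro_map l G G' h (c \<otimes>\<^bsub>G.Gh\<^esub> d) M = (pro_map l G G' h c \<otimes>\<^bsub>G'.Gh\<^esub> pro_map l G G' h d) M"
      unfolding G'.pro_mult[OF M] pro_map_comp[OF cd(1) M P subset_refl g] pro_map_comp[OF cd(2) M P subset_refl k]
      using G'.coset_mult[OF M] g k by simp
  qed (use cd in \<open>auto intro!: G'.pro_closed pro_map_closed G.pro_closed\<close>)
qed (rule pro_map_closed)

lemma pro_map_of:
  assumes "g \<in> carrier G" shows "pro_map l G G' h (pro_of l G g) = pro_of l G' (h g)"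
proof (rule G'.pro_eqI)
  fix M assume M: "M \<in> G'.LN"
  show "pro_map l G G' h (pro_of l G g) M = pro_of l G' (h g) M"
    using pro_map_comp[OF G.pro_of_closed[OF assms] M pre_LN[OF M] subset_refl assms]
    by (simp add: G.pro_of_comp[OF pre_LN[OF M]] G'.pro_of_comp[OF M])
qed (use assms in \<open>auto intro!: pro_map_closed G.pro_of_closed G'.pro_of_closed\<close>)

text \<open>Each coordinate of the image factors through a single discrete coordinate of the
  argument, the one at the preimage.\<close>

lemma pro_map_continuous: "continuous_map (pro_topology l G) (pro_topology l G') (pro_map l G G' h)"
  unfolding pro_topology_def[of l G'] continuous_map_in_subtopology continuous_map_componentwise
proof (intro conjI ballI)
  show "pro_map l G G' h ` topspace (pro_topology l G) \<subseteq> extensional G'.LN"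
    by (auto simp: pro_map_def)
  show "pro_map l G G' h \<in> topspace (pro_topology l G) \<rightarrow> carrier G'.Gh"
    by (auto simp: G.topspace_pro pro_map_closed)
  fix M assume M: "M \<in> G'.LN"
  let ?k = "\<lambda>C. M #>\<^bsub>G'\<^esub> h (SOME g. g \<in> carrier G \<and> C = pre M #> g)"
  have "?k ` (rcosets (pre M)) \<subseteq> rcosets\<^bsub>G'\<^esub> M"
  proof
    fix D assume "D \<in> ?k ` (rcosets (pre M))"
    then obtain C where C: "C \<in> rcosets (pre M)" "D = ?k C" by blast
    then have "\<exists>g. g \<in> carrier G \<and> C = pre M #> g" by (auto simp: RCOSETS_def)
    then have "(SOME g. g \<in> carrier G \<and> C = pre M #> g) \<in> carrier G" by (metis (mono_tags, lifting) someI_ex)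
    then show "D \<in> rcosets\<^bsub>G'\<^esub> M"
      unfolding C(2) using G'.LN_subgroup[OF M] by (auto intro!: G'.rcosetsI dest: subgroup.subset)
  qed
  then have "continuous_map (discrete_topology (rcosets (pre M))) (discrete_topology (rcosets\<^bsub>G'\<^esub> M)) ?k"
    by (auto simp: continuous_map_from_discrete_topology)
  from continuous_map_compose[OF G.continuous_pro_comp[OF pre_LN[OF M]] this]
  show "continuous_map (pro_topology l G) (discrete_topology (rcosets\<^bsub>G'\<^esub> M)) (\<lambda>x. pro_map l G G' h x M)"
    using M by (simp add: pro_map_def o_def)
qed

end

section \<open>Homomorphisms from the free group\<close>

lemma group_free2: "group free2"
  unfolding free2_def by (rule group_presented_group)

abbreviation fcl :: "xy gword \<Rightarrow> xy gword set" where "fcl \<equiv> pres_class UNIV {}"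

lemma carrier_free2: "carrier free2 = range fcl"
  unfolding free2_def carrier_presented_group by (simp add: lists_UNIV)

lemma mult_free2: "fcl u \<otimes>\<^bsub>free2\<^esub> fcl v = fcl (u @ v)"
  unfolding free2_def by (rule pres_class_mult) simp_all

lemma one_free2: "\<one>\<^bsub>free2\<^esub> = fcl []"
  unfolding free2_def by (rule one_presented_group)

lemma free2_gen_closed [simp]: "free2_gen g \<in> carrier free2"
  by (simp add: free2_gen_def carrier_free2)

lemma free2_cancel: "fcl [(g, e)] \<otimes>\<^bsub>free2\<^esub> fcl [(g, \<not> e)] = \<one>\<^bsub>free2\<^esub>"
  using pres_eq.cancel[of "[]" UNIV "[]" g "{}" e] pres_class_eq_iff[of "[(g, e), (g, \<not> e)]" UNIV "{}" "[]"]
  by (simp add: mult_free2 one_free2)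

lemma free2_induct [consumes 1, case_names one gen inv]:
  assumes "c \<in> carrier free2" "P \<one>\<^bsub>free2\<^esub>"
    and "\<And>g c. c \<in> carrier free2 \<Longrightarrow> P c \<Longrightarrow> P (free2_gen g \<otimes>\<^bsub>free2\<^esub> c)"
    and "\<And>g c. c \<in> carrier free2 \<Longrightarrow> P c \<Longrightarrow> P (inv\<^bsub>free2\<^esub> (free2_gen g) \<otimes>\<^bsub>free2\<^esub> c)"
  shows "P c"
proof -
  interpret group free2 by (rule group_free2)
  have i: "inv\<^bsub>free2\<^esub> (free2_gen g) = fcl [(g, False)]" for g
    using free2_cancel[of g False] by (intro inv_equality) (auto simp: free2_gen_def carrier_free2)
  have "P (fcl w)" for w
  proof (induction w)
    case Nil
    then show ?case using assms(2) by (simp add: one_free2)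
  next
    case (Cons x w)
    obtain g e where x: "x = (g, e)" by force
    have "fcl (x # w) = fcl [x] \<otimes>\<^bsub>free2\<^esub> fcl w" by (simp add: mult_free2)
    then show ?case
      using assms(3)[of "fcl w" g] assms(4)[of "fcl w" g] Cons unfolding i
      by (cases e) (auto simp: x free2_gen_def carrier_free2)
  qed
  then show ?thesis using assms(1) by (auto simp: carrier_free2)
qed

lemma hom_free2_eqI:
  assumes M: "monoid M" and h: "h \<in> hom free2 M" "h' \<in> hom free2 M"
    and one: "h \<one>\<^bsub>free2\<^esub> = \<one>\<^bsub>M\<^esub>" "h' \<one>\<^bsub>free2\<^esub> = \<one>\<^bsub>M\<^esub>"
    and gen: "\<And>g. h (free2_gen g) = h' (free2_gen g)"
    and c: "c \<in> carrier free2"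
  shows "h c = h' c"
proof -
  interpret F: group free2 by (rule group_free2)
  interpret M: monoid M by (rule M)
  have hc: "h d \<in> carrier M" "h' d \<in> carrier M" if "d \<in> carrier free2" for d
    using h that by (auto simp: hom_def)
  have m: "h (c \<otimes>\<^bsub>free2\<^esub> d) = h c \<otimes>\<^bsub>M\<^esub> h d" "h' (c \<otimes>\<^bsub>free2\<^esub> d) = h' c \<otimes>\<^bsub>M\<^esub> h' d"
    if "c \<in> carrier free2" "d \<in> carrier free2" for c d
    using h that by (auto simp: hom_mult)
  have i: "h (inv\<^bsub>free2\<^esub> (free2_gen g)) = h' (inv\<^bsub>free2\<^esub> (free2_gen g))" for g
  proof -
    let ?g = "free2_gen g" and ?i = "inv\<^bsub>free2\<^esub> (free2_gen g)"
    have "h ?i \<otimes>\<^bsub>M\<^esub> h ?g = \<one>\<^bsub>M\<^esub>" using m(1)[of ?i ?g] one by simp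
    moreover have "h ?g \<otimes>\<^bsub>M\<^esub> h' ?i = \<one>\<^bsub>M\<^esub>" using m(2)[of ?g ?i] one gen by simp
    ultimately show ?thesis using M.inv_unique[of "h ?i" "h ?g" "h' ?i"] hc by simp
  qed
  show ?thesis using c by (induction rule: free2_induct) (simp_all add: one gen i m)
qed

definition flift :: "('h, 'b) monoid_scheme \<Rightarrow> 'h \<Rightarrow> 'h \<Rightarrow> xy gword set \<Rightarrow> 'h" where
  "flift G a b = plift G (\<lambda>(g, e). if e then case_xy a b g else inv\<^bsub>G\<^esub> (case_xy a b g))"

lemma flift_hom:
  assumes "group G" "a \<in> carrier G" "b \<in> carrier G"
  shows "flift G a b \<in> hom free2 G" "flift G a b (free2_gen g) = case_xy a b g"
    "flift G a b \<one>\<^bsub>free2\<^esub> = \<one>\<^bsub>G\<^esub>"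
proof -
  interpret G: group G by (rule assms(1))
  let ?v = "\<lambda>(g, e). if e then case_xy a b g else inv\<^bsub>G\<^esub> (case_xy a b g)"
  have v: "?v x \<in> carrier G" for x
    using assms by (auto split: prod.split xy.split)
  have c: "flift G a b (fcl w) = wev G ?v w" for w
    unfolding flift_def
    by (rule plift_class[OF G.monoid_axioms v]) (use assms in \<open>auto split: xy.split\<close>)
  show "flift G a b (free2_gen g) = case_xy a b g"
    using assms by (auto simp: free2_gen_def c split: xy.split)
  show "flift G a b \<one>\<^bsub>free2\<^esub> = \<one>\<^bsub>G\<^esub>" by (simp add: one_free2 c)
  show "flift G a b \<in> hom free2 G"
    by (rule homI) (auto simp: carrier_free2 mult_free2 c wev_append[OF G.monoid_axioms v] wev_closed[OF G.monoid_axioms v])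
qed

lemma l_group_free2: "prime l \<Longrightarrow> l_group free2 l"
  by (intro l_group.intro l_group_axioms.intro group_free2)

text \<open>\<open>F2_eval\<close> is a definite description, so uniqueness is at stake: two
  continuous homomorphisms that agree on the generators agree on the dense image of the free group,
  and the target is Hausdorff. The hypothesis \<open>idem\<close> makes homomorphisms to a monoid
  preserve the unit.\<close>

lemma F2_eval_eqI:
  assumes l: "prime l" and M: "monoid M" and idem: "\<And>u. u \<in> carrier M \<Longrightarrow> u \<otimes>\<^bsub>M\<^esub> u = u \<Longrightarrow> u = \<one>\<^bsub>M\<^esub>"
    and T: "Hausdorff_space T"
    and \<phi>: "\<phi> \<in> hom (F2 l) M" "continuous_map (pro_topology l free2) T \<phi>" "\<phi> (F2_x l) = a" "\<phi> (F2_y l) = b"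
    and f: "f \<in> carrier (F2 l)"
  shows "F2_eval l M T a b f = \<phi> f"
proof -
  interpret F: l_group free2 l by (rule l_group_free2[OF l])
  have "\<psi> f = \<phi> f" if \<psi>: "\<psi> \<in> hom (F2 l) M" "continuous_map (pro_topology l free2) T \<psi>" "\<psi> (F2_x l) = a" "\<psi> (F2_y l) = b" for \<psi>
  proof (rule forall_in_closure_of_eq[OF F.pro_dense[OF f] T \<psi>(2) \<phi>(2)])
    have p: "(\<lambda>c. \<eta> (pro_of l free2 c)) \<in> hom free2 M" "\<eta> (pro_of l free2 \<one>\<^bsub>free2\<^esub>) = \<one>\<^bsub>M\<^esub>" if "\<eta> \<in> hom (F2 l) M" for \<eta>
    proof -
      show "(\<lambda>c. \<eta> (pro_of l free2 c)) \<in> hom free2 M"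
        using that F.pro_of_closed F.pro_of_mult by (auto simp: hom_def Pi_def)
      have "\<eta> \<one>\<^bsub>F2 l\<^esub> \<otimes>\<^bsub>M\<^esub> \<eta> \<one>\<^bsub>F2 l\<^esub> = \<eta> \<one>\<^bsub>F2 l\<^esub>"
        using hom_mult[OF that F.pro_one_closed F.pro_one_closed] group.is_monoid[OF F.group_pro]
        by (simp add: monoid.l_one F.pro_one_closed)
      then show "\<eta> (pro_of l free2 \<one>\<^bsub>free2\<^esub>) = \<one>\<^bsub>M\<^esub>"
        unfolding F.pro_of_one using idem that F.pro_one_closed by (auto simp: hom_def)
    qed
    have gen: "\<psi> (pro_of l free2 (free2_gen g)) = \<phi> (pro_of l free2 (free2_gen g))" for g
      by (cases g) (simp_all add: \<psi>(3,4) \<phi>(3,4))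
    fix y assume "y \<in> pro_of l free2 ` carrier free2"
    then obtain c where c: "c \<in> carrier free2" "y = pro_of l free2 c" by blast
    show "\<psi> y = \<phi> y"
      unfolding c(2)
      by (rule hom_free2_eqI[OF M p(1)[OF \<psi>(1)] p(1)[OF \<phi>(1)] p(2)[OF \<psi>(1)] p(2)[OF \<phi>(1)] gen c(1)])
  qed
  then show ?thesis
    unfolding F2_eval_def using \<phi> by (intro the_equality) blast+
qed

text \<open>Substituting group elements into \<open>f\<close> is the completion of the homomorphism
  from the free group, which makes it computable on cosets.\<close>

lemma F2_subst_eq:
  assumes l: "prime l" and G: "group G" and a: "a \<in> carrier G" and b: "b \<in> carrier G" and f: "f \<in> carrier (F2 l)"
  shows "F2_eval l (pro_completion l G) (pro_topology l G) (pro_of l G a) (pro_of l G b) f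
    = pro_map l free2 G (flift G a b) f"
proof -
  note h = flift_hom[OF G a b]
  interpret L: l_group_hom free2 G "flift G a b" l
    using l G h(1) group_free2
    by (simp add: l_group_hom_def l_group_def l_group_axioms_def group_hom_def group_hom_axioms_def)
  show ?thesis
    by (rule F2_eval_eqI[OF l group.is_monoid[OF L.G'.group_pro] _ L.G'.Hausdorff_pro L.pro_map_hom L.pro_map_continuous _ _ f])
      (auto simp: L.pro_map_of h(2) group.l_cancel_one[OF L.G'.group_pro])
qed

section \<open>Congruences of matrices\<close>

text \<open>Truncated at degree \<open>d\<close>, this is the \<open>i\<close>-th power of the ideal generated by \<open>l\<close> and the matrices
  that raise the degree. Unlike the matrices of \<open>JZ\<close> below, \<open>J l 1 d\<close> contains \<open>a - 1\<close> for unipotent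
  \<open>a\<close>, so that \<open>a ^ l ^ k\<close> tends to 1.\<close>

definition J :: "nat \<Rightarrow> nat \<Rightarrow> nat \<Rightarrow> ('g::finite, 'a::comm_ring_1) fmat set" where
  "J l i d = {M. \<forall>u v. length u \<le> d \<longrightarrow> of_nat l ^ (i - (length u - length v)) dvd entry M u v}"

lemma JD: "M \<in> J l i d \<Longrightarrow> length u \<le> d \<Longrightarrow> of_nat l ^ (i - (length u - length v)) dvd entry M u v"
  by (simp add: J_def)

lemma J_zero [simp]: "0 \<in> J l i d" by (simp add: J_def fmat_simps)

lemma J_0: "M \<in> J l 0 d" by (simp add: J_def)

lemma J_add: "M \<in> J l i d \<Longrightarrow> N \<in> J l i d \<Longrightarrow> M + N \<in> J l i d" by (simp add: J_def fmat_simps)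

lemma J_uminus: "M \<in> J l i d \<Longrightarrow> - M \<in> J l i d" by (simp add: J_def fmat_simps)

lemma J_mult:
  assumes M: "M \<in> J l i d" and N: "N \<in> J l j d"
  shows "M * N \<in> J l (i + j) d"
proof -
  have "of_nat l ^ (i + j - (length u - length w)) dvd entry M u v * entry N v w"
    if u: "length u \<le> d" and v: "v \<in> {v. length v \<le> length u}" for u v w
  proof (cases "length v < length w")
    case False
    have 1: "of_nat l ^ (i - (length u - length v)) * of_nat l ^ (j - (length v - length w)) dvd entry M u v * entry N v w"
      using u v by (intro mult_dvd_mono JD[OF M] JD[OF N]) auto
    have "i + j - (length u - length w) \<le> (i - (length u - length v)) + (j - (length v - length w))"
      using False v by auto
    from dvd_trans[OF le_imp_power_dvd[OF this] 1[folded power_add]] show ?thesis .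
  qed (simp add: entry_eq_0)
  then show ?thesis by (auto simp: J_def times_fmat.rep_eq intro!: dvd_sum)
qed

lemma J_mono: "M \<in> J l i d \<Longrightarrow> j \<le> i \<Longrightarrow> M \<in> J l j d"
proof -
  assume M: "M \<in> J l i d" and ji: "j \<le> i"
  have "of_nat l ^ (j - (length u - length v)) dvd entry M u v" if "length u \<le> d" for u v
    by (rule dvd_trans[OF le_imp_power_dvd JD[OF M that]]) (simp add: ji diff_le_mono)
  then show ?thesis by (simp add: J_def)
qed

lemma J_left: "M \<in> J l i d \<Longrightarrow> N * M \<in> J l i d"
  using J_mult[OF J_0] by fastforce

lemma J_right: "M \<in> J l i d \<Longrightarrow> M * N \<in> J l i d"
  using J_mult[OF _ J_0] by fastforce

lemma J_sym: "M - N \<in> J l i d \<Longrightarrow> N - M \<in> J l i d"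
  using J_uminus[of "M - N"] by simp

lemma J_mult_cong:
  assumes "M - M' \<in> J l i d" "N - N' \<in> J l i d"
  shows "M * N - M' * N' \<in> J l i d"
proof -
  have "M * N - M' * N' = M * (N - N') + (M - M') * N'" by (simp add: algebra_simps)
  then show ?thesis using assms by (simp add: J_add J_left J_right)
qed

lemma J_fil:
  assumes "M \<in> fil 1" shows "M \<in> J l 1 d"
  unfolding J_def
proof (intro CollectI allI impI)
  fix u v
  show "of_nat l ^ (1 - (length u - length v)) dvd entry M u v"
  proof (cases "length u < length v + 1")
    case True
    then have "entry M u v = 0" using assms by (simp only: fil_fmat_iff)
    then show ?thesis by simp
  qed auto
qed

lemma J_of_nat: "of_nat l \<in> J l 1 d"
proof -
  have "of_nat l = (fsc (of_nat l) :: ('a, 'b) fmat)" by (rule scal_of_nat[OF scal_fsc, symmetric])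
  then show ?thesis by (simp add: J_def fsc.rep_eq)
qed

text \<open>Factor \<open>a ^ l - 1\<close> as \<open>a - 1\<close> times the sum of the first
  \<open>l\<close> powers of \<open>a\<close>; this sum is congruent to \<open>l\<close> modulo
  \<open>J l 1 d\<close> and so lies in it.\<close>

lemma J_power_l:
  assumes "a - 1 \<in> J l (Suc i) d"
  shows "a ^ l - 1 \<in> J l (Suc (Suc i)) d"
proof -
  have geo: "a ^ n - 1 = (a - 1) * (\<Sum>k<n. a ^ k)" for n
  proof (induction n)
    case (Suc n)
    have "(a - 1) * (\<Sum>k<Suc n. a ^ k) = (a ^ n - 1) + (a - 1) * a ^ n"
      by (simp add: distrib_left Suc)
    then show ?case by (simp add: left_diff_distrib)
  qed simp
  have "(\<Sum>k<n. a ^ k) - of_nat n \<in> J l 1 d" for n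
  proof (induction n)
    case (Suc n)
    have "a ^ n - 1 \<in> J l (Suc i) d" unfolding geo by (rule J_right[OF assms])
    then have "a ^ n - 1 \<in> J l 1 d" by (rule J_mono) simp
    from J_add[OF Suc this] show ?case by (simp add: algebra_simps)
  qed simp
  from J_add[OF this[of l] J_of_nat] have "(\<Sum>k<l. a ^ k) \<in> J l 1 d" by simp
  from J_mult[OF assms this] show ?thesis by (simp add: geo One_nat_def)
qed

lemma J_power_l_power:
  assumes "unip a" shows "a ^ (l ^ k) - 1 \<in> J l (Suc k) d"
proof (induction k)
  case 0
  then show ?case using J_fil[OF unip_fil[OF assms]] by (simp add: One_nat_def)
next
  case (Suc k)
  have "a ^ (l ^ Suc k) = (a ^ (l ^ k)) ^ l" by (simp add: power_mult[symmetric] mult.commute)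
  then show ?case using J_power_l[OF Suc] by simp
qed

text \<open>Integral unipotent representations are continuous for the pro-\<open>l\<close> topology;
  this is how relations in the completion reach matrices.\<close>

locale unip_rep = l_group G l for G (structure) and l +
  fixes r :: "'a \<Rightarrow> ('g::finite, int) fmat"
  assumes r_mult: "g \<in> carrier G \<Longrightarrow> g' \<in> carrier G \<Longrightarrow> r (g \<otimes> g') = r g * r g'"
    and r_one: "r \<one> = 1"
    and r_unip: "g \<in> carrier G \<Longrightarrow> unip (r g)"
begin

definition NJ :: "nat \<Rightarrow> nat \<Rightarrow> 'a set" where
  "NJ i d = {g \<in> carrier G. r g - 1 \<in> J l i d}"

lemma r_diff:
  assumes "g \<in> carrier G" "g' \<in> carrier G"
  shows "r g - r g' \<in> J l i d \<longleftrightarrow> g \<otimes> inv g' \<in> NJ i d"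
proof -
  have e: "r (g \<otimes> inv g') - 1 = (r g - r g') * r (inv g')"
    using assms r_mult[of g' "inv g'"] by (simp add: r_mult left_diff_distrib r_one)
  have "r g - r g' = (r (g \<otimes> inv g') - 1) * r g'"
    unfolding e using assms by (simp add: mult.assoc r_one flip: r_mult)
  then show ?thesis
    using J_right[of "r g - r g'" l i d "r (inv g')"] J_right[of "r (g \<otimes> inv g') - 1" l i d "r g'"] e assms
    by (auto simp: NJ_def)
qed

text \<open>An \<open>l\<close>-power of a unipotent matrix is congruent to 1 by
  \<open>J_power_l_power\<close>. Finiteness comes from the entries in degrees up to
  \<open>d\<close> modulo \<open>l ^ i\<close>, which separate the cosets.\<close>

lemma NJ_LN: "NJ i d \<in> LN"
proof (rule in_l_power_index_normalI[OF l is_group, where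
      c = "\<lambda>g. \<lambda>(u, v)\<in>{u. length u \<le> d} \<times> {v. length v \<le> d}. entry (r g) u v mod int l ^ i"])
  have inv: "inv g \<in> NJ i d" if "g \<in> NJ i d" for g
    using that r_diff[of \<one> g i d] J_sym[of "r g" 1 l i d] by (auto simp: NJ_def r_one)
  have "subgroup (NJ i d) G"
  proof (rule subgroupI)
    show "a \<otimes> b \<in> NJ i d" if "a \<in> NJ i d" "b \<in> NJ i d" for a b
      using that J_mult_cong[of "r a" 1 l i d "r b" 1] by (auto simp: NJ_def r_mult)
    have "\<one> \<in> NJ i d" by (simp add: NJ_def r_one)
    then show "NJ i d \<noteq> {}" by blast
  qed (auto simp: NJ_def inv intro: inv[unfolded NJ_def, simplified, THEN conjunct2])
  moreover have "x \<otimes> h \<otimes> inv x \<in> NJ i d" if "x \<in> carrier G" "h \<in> NJ i d" for x h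
  proof -
    have "r (x \<otimes> h \<otimes> inv x) - 1 = r x * (r h - 1) * r (inv x)"
      using that r_mult[of x "inv x"] by (auto simp: NJ_def r_mult algebra_simps r_one)
    then show ?thesis using that by (auto simp: NJ_def intro: J_left J_right)
  qed
  ultimately show "NJ i d \<lhd> G" by (simp add: normal_inv_iff)
next
  fix g assume g: "g \<in> carrier G"
  have "r (g [^] n) = r g ^ n" for n :: nat
    by (induction n) (simp_all add: r_one r_mult g power_commutes)
  then have "g [^] (l ^ i) \<in> NJ i d"
    using J_mono[OF J_power_l_power[OF r_unip[OF g], of l i d], of i] g by (simp add: NJ_def)
  then show "\<exists>k. g [^] (l ^ k) \<in> NJ i d" ..
next
  let ?D = "{u :: 'g list. length u \<le> d} \<times> {v :: 'g list. length v \<le> d}"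
  have "(\<lambda>g. \<lambda>(u, v)\<in>?D. entry (r g) u v mod int l ^ i) ` carrier G \<subseteq> ?D \<rightarrow>\<^sub>E {0..<int l ^ i}"
    using prime_gt_0_nat[OF l] by (auto simp: PiE_def Pi_def extensional_def)
  then show "finite ((\<lambda>g. \<lambda>(u, v)\<in>?D. entry (r g) u v mod int l ^ i) ` carrier G)"
    by (rule finite_subset) (auto intro!: finite_PiE)
next
  let ?D = "{u :: 'g list. length u \<le> d} \<times> {v :: 'g list. length v \<le> d}"
  fix g g' assume g: "g \<in> carrier G" "g' \<in> carrier G"
    and eq: "(\<lambda>(u, v)\<in>?D. entry (r g) u v mod int l ^ i) = (\<lambda>(u, v)\<in>?D. entry (r g') u v mod int l ^ i)"
  have "int l ^ (i - (length u - length v)) dvd entry (r g - r g') u v" if "length u \<le> d" for u v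
  proof (cases "length v \<le> d")
    case True
    have "entry (r g) u v mod int l ^ i = entry (r g') u v mod int l ^ i"
      using fun_cong[OF eq, of "(u, v)"] that True by simp
    then have "int l ^ i dvd entry (r g) u v - entry (r g') u v" by (simp add: mod_eq_dvd_iff)
    then show ?thesis using dvd_trans[OF le_imp_power_dvd[of "i - (length u - length v)" i]]
      by (simp add: fmat_simps)
  qed (use that in \<open>simp add: entry_eq_0\<close>)
  then have "r g - r g' \<in> J l i d" by (simp add: J_def)
  then show "g \<otimes> inv g' \<in> NJ i d" using r_diff[OF g] by blast
qed

lemma NJ_coset:
  assumes "g \<in> carrier G" "g' \<in> carrier G" "NJ i d #> g = NJ i d #> g'"
  shows "r g - r g' \<in> J l i d"
  using r_diff[OF assms(1,2)] coset_eq_iff[OF NJ_LN assms(1,2)] assms(3) by blast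

end

section \<open>The Magnus series of an element of the free pro-\<open>l\<close> group\<close>

abbreviation res :: "nat \<Rightarrow> 'l::prime_card padic_int \<Rightarrow> int" where
  "res n a \<equiv> Rep_padic_int a n"

section \<open>Residues and divisibility of \<open>l\<close>-adic integers\<close>

lemma res_compat: "res (Suc n) a mod int CARD('l) ^ n = res n (a :: 'l::prime_card padic_int)"
  using Rep_padic_int[of a] by simp

lemma res_add: "res (n + k) a mod int CARD('l) ^ n = res n (a :: 'l::prime_card padic_int)"
  by (rule padic_residue_mod_aux) (simp add: res_compat)

lemma res_of_nat: "res n (of_nat m :: 'l::prime_card padic_int) = int m mod int CARD('l) ^ n"
  by (induction m) (simp_all add: zero_padic_int.rep_eq plus_padic_int.rep_eq one_padic_int.rep_eq mod_simps)

lemma padic_dvd_iff: "of_nat CARD('l) ^ n dvd (a :: 'l::prime_card padic_int) \<longleftrightarrow> res n a = 0"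
proof
  assume "of_nat CARD('l) ^ n dvd a"
  then obtain b where "a = of_nat (CARD('l) ^ n) * b" by (auto simp: dvd_def)
  then have "res n a = int (CARD('l) ^ n) mod int CARD('l) ^ n * res n b mod int CARD('l) ^ n"
    by (simp only: times_padic_int.rep_eq res_of_nat)
  then show "res n a = 0" by simp
next
  assume a: "res n a = 0"
  let ?l = "int CARD('l)"
  have l: "?l > 0" using prime_gt_0_int[OF prime_card_int] .
  have d: "?l ^ n * (res (n + k) a div ?l ^ n) = res (n + k) a" for k
    using res_add[of a n k] a by (metis dvd_eq_mod_eq_0 dvd_mult_div_cancel)
  \<comment> \<open>Division by \<open>l ^ n\<close> costs \<open>n\<close> digits, so residue
    \<open>k\<close> of the quotient is read from residue \<open>n + k\<close>.\<close>
  have "res (n + Suc k) a div ?l ^ n mod ?l ^ k = res (n + k) a div ?l ^ n" for k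
  proof -
    have "res (n + k) a = res (n + Suc k) a mod (?l ^ n * ?l ^ k)"
      using res_compat[of a "n + k"] by (simp add: power_add)
    also have "\<dots> = ?l ^ n * (res (n + Suc k) a div ?l ^ n mod ?l ^ k) + res (n + Suc k) a mod ?l ^ n"
      by (rule zmod_zmult2_eq) simp
    also have "res (n + Suc k) a mod ?l ^ n = 0" using res_add[of a n "Suc k"] a by simp
    finally show ?thesis using l by simp
  qed
  then have b: "Rep_padic_int (Abs_padic_int (\<lambda>k. res (n + k) a div ?l ^ n) :: 'l padic_int) k = res (n + k) a div ?l ^ n" for k
    by (subst Abs_padic_int_inverse) auto
  let ?b = "Abs_padic_int (\<lambda>k. res (n + k) a div ?l ^ n) :: 'l padic_int"
  have "res k (of_nat (CARD('l) ^ n) * ?b) = res k a" for k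
  proof -
    have "res k (of_nat (CARD('l) ^ n) * ?b) = int (CARD('l) ^ n) mod ?l ^ k * res k ?b mod ?l ^ k"
      by (simp only: times_padic_int.rep_eq res_of_nat)
    also have "\<dots> = ?l ^ n * res k ?b mod ?l ^ k" by (simp add: mod_simps)
    also have "\<dots> = res k a" unfolding b d using res_add[of a k n] by (simp only: add.commute[of n k])
    finally show ?thesis .
  qed
  then have "of_nat (CARD('l) ^ n) * ?b = a"
    by (subst Rep_padic_int_inject[symmetric]) (rule ext)
  then show "of_nat CARD('l) ^ n dvd a" by (metis dvd_triv_left of_nat_power)
qed

lemma padic_eq_0: "(\<And>n. of_nat CARD('l) ^ n dvd a) \<Longrightarrow> a = (0 :: 'l::prime_card padic_int)"
  unfolding padic_dvd_iff by (subst Rep_padic_int_inject[symmetric]) (simp add: fun_eq_iff zero_padic_int.rep_eq)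

lemma res_of_int: "res n (of_int z :: 'l::prime_card padic_int) = z mod int CARD('l) ^ n"
proof (cases z)
  case (nonneg m) then show ?thesis by (simp add: res_of_nat)
next
  case (neg m)
  have "res n (- of_nat (Suc m) :: 'l padic_int) = (- int (Suc m)) mod int CARD('l) ^ n"
    by (simp only: uminus_padic_int.rep_eq res_of_nat mod_minus_eq)
  then show ?thesis using neg by simp
qed

lemma padic_dvd_of_int: "of_nat CARD('l) ^ n dvd (of_int z :: 'l::prime_card padic_int) \<longleftrightarrow> int CARD('l) ^ n dvd z"
  by (simp add: padic_dvd_iff res_of_int dvd_eq_mod_eq_0)

instance padic_int :: (prime_card) ring_char_0
proof
  show "inj (of_nat :: nat \<Rightarrow> 'a padic_int)"
  proof (rule injI)
    fix m n assume eq: "(of_nat m :: 'a padic_int) = of_nat n"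
    let ?l = "CARD('a)"
    have l: "?l > 1" using prime_gt_1_nat[OF prime_card] .
    define k where "k = m + n"
    have "m < ?l ^ k" "n < ?l ^ k"
      using less_le_trans[OF less_exp[of k] power_mono[of 2 ?l k]] l by (auto simp: k_def)
    moreover have "int m mod int ?l ^ k = int n mod int ?l ^ k"
      using arg_cong[OF eq, of "res k"] by (simp only: res_of_nat)
    ultimately show "m = n" by (simp flip: of_nat_power of_nat_mod)
  qed
qed

subsection \<open>Words in unipotent elements\<close>

definition rl :: "'r::filtered_ring \<Rightarrow> 'r \<Rightarrow> xy gword set \<Rightarrow> 'r" where
  "rl a b = plift mulmon (\<lambda>(g, e). if e then case_xy a b g else uinv (case_xy a b g))"

lemma rl_hom:
  assumes "unip a" "unip b"
  shows "rl a b \<in> hom free2 mulmon" "rl a b (free2_gen g) = case_xy a b g" "rl a b \<one>\<^bsub>free2\<^esub> = 1"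
proof -
  let ?v = "\<lambda>(g, e). if e then case_xy a b g else uinv (case_xy a b g)"
  have c: "rl a b (fcl w) = wev mulmon ?v w" for w
    unfolding rl_def
    by (rule plift_class) (use assms in \<open>auto simp: uinv_left uinv_right split: xy.split\<close>)
  show "rl a b (free2_gen g) = case_xy a b g" by (simp add: free2_gen_def c)
  show "rl a b \<one>\<^bsub>free2\<^esub> = 1" by (simp add: one_free2 c)
  show "rl a b \<in> hom free2 mulmon"
    by (rule homI) (auto simp: carrier_free2 mult_free2 c wev_append)
qed

lemma rl_mult:
  assumes "unip a" "unip b" "c \<in> carrier free2" "d \<in> carrier free2"
  shows "rl a b (c \<otimes>\<^bsub>free2\<^esub> d) = rl a b c * rl a b d"
  using hom_mult[OF rl_hom(1)[OF assms(1,2)] assms(3,4)] by simp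

lemma rl_inv_gen:
  assumes "unip a" "unip b"
  shows "rl a b (inv\<^bsub>free2\<^esub> (free2_gen g)) = uinv (case_xy a b g)"
proof -
  interpret F: group free2 by (rule group_free2)
  show ?thesis
    using rl_mult[OF assms, of "free2_gen g" "inv\<^bsub>free2\<^esub> (free2_gen g)"] rl_hom(2,3)[OF assms] assms
    by (intro uinv_unique) (auto split: xy.split)
qed

lemma rl_unip:
  assumes "unip a" "unip b" "c \<in> carrier free2"
  shows "unip (rl a b c)"
  using assms(3)
proof (induction rule: free2_induct)
  case (gen g c)
  then show ?case using assms by (auto simp: rl_mult rl_hom(2) split: xy.split)
next
  case (inv g c)
  interpret F: group free2 by (rule group_free2)
  show ?case using inv assms by (auto simp: rl_mult rl_inv_gen split: xy.split)
qed (simp add: rl_hom(3)[OF assms(1,2)])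

lemma hom_rl_eqI:
  assumes "\<phi> \<in> hom free2 mulmon" "\<phi> \<one>\<^bsub>free2\<^esub> = 1" "unip a" "unip b" "\<phi> (free2_gen gX) = a" "\<phi> (free2_gen gY) = b" "c \<in> carrier free2"
  shows "\<phi> c = rl a b c"
proof (rule hom_free2_eqI[OF monoid_mulmon assms(1) rl_hom(1)[OF assms(3,4)] _ _ _ assms(7)])
  show "\<phi> (free2_gen g) = rl a b (free2_gen g)" for g
    using assms by (cases g) (simp_all add: rl_hom(2))
qed (use assms rl_hom(3) in auto)

lemma filtered_hom_rl:
  assumes "filtered_hom h" "unip a" "unip b" "c \<in> carrier free2"
  shows "h (rl a b c) = rl (h a) (h b) c"
proof (rule hom_rl_eqI[where \<phi> = "\<lambda>c. h (rl a b c)"])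
  show "(\<lambda>c. h (rl a b c)) \<in> hom free2 mulmon"
    by (rule homI) (simp_all add: rl_mult assms(2,3) filtered_homD(4)[OF assms(1)])
qed (simp_all add: rl_hom assms filtered_homD(2)[OF assms(1)] filtered_hom_unip)

text \<open>The Magnus homomorphism of the free group, with \<open>x\<close> and \<open>y\<close>
  sent to 1 plus a variable.\<close>

definition mu :: "xy gword set \<Rightarrow> (xy, int) ncfps" where "mu = rl mx my"

lemma fe_mu:
  assumes sc: "scal sc" and a: "unip a" and b: "unip b" and c: "c \<in> carrier free2"
  shows "fe sc (nc_map of_int (mu c)) a b = rl a b c"
proof -
  let ?h = "\<lambda>s. ev sc (case_xy (a - 1) (b - 1)) (nc_map of_int s)"
  have h: "filtered_hom ?h"
    by (rule filtered_hom_comp[OF filtered_hom_ev[OF case_xy_fil sc] filtered_hom_nc_map[OF rhom_of_int]]) (use a b in \<open>auto simp: unip_fil\<close>)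
  have m: "nc_map of_int mx = mx" "nc_map of_int my = my"
    by (simp_all add: filtered_homD(2,3)[OF filtered_hom_nc_map[OF rhom_of_int]] nc_map_var[OF rhom_of_int])
  show ?thesis
    unfolding fe_def mu_def using filtered_hom_rl[OF h unip_var unip_var c, of gX gY]
    by (simp add: m ev_mxy[OF sc a b])
qed

subsection \<open>Congruences modulo powers of \<open>l\<close>\<close>

definition JZ :: "nat \<Rightarrow> nat \<Rightarrow> nat \<Rightarrow> ('g::finite, 'a::comm_ring_1) fmat set" where
  "JZ l n d = {M. \<forall>u v. length u \<le> d \<longrightarrow> of_nat l ^ n dvd entry M u v}"

lemma JZ_add: "M \<in> JZ l n d \<Longrightarrow> N \<in> JZ l n d \<Longrightarrow> M + N \<in> JZ l n d" by (simp add: JZ_def fmat_simps)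

lemma JZ_uminus: "M \<in> JZ l n d \<Longrightarrow> - M \<in> JZ l n d" by (simp add: JZ_def fmat_simps)

lemma JZ_left: "M \<in> JZ l n d \<Longrightarrow> N * M \<in> JZ l n d"
  by (auto simp: JZ_def times_fmat.rep_eq intro!: dvd_sum dvd_mult)

lemma JZ_right: "M \<in> JZ l n d \<Longrightarrow> M * N \<in> JZ l n d"
  by (auto simp: JZ_def times_fmat.rep_eq intro!: dvd_sum dvd_mult2)

lemma JZ_trans: "M - N \<in> JZ l n d \<Longrightarrow> N - P \<in> JZ l n d \<Longrightarrow> M - P \<in> JZ l n d"
  using JZ_add[of "M - N" l n d "N - P"] by simp

lemma JZ_sym: "M - N \<in> JZ l n d \<Longrightarrow> N - M \<in> JZ l n d"
  using JZ_uminus[of "M - N"] by simp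

lemma JZ_mult_cong:
  assumes "M - M' \<in> JZ l n d" "N - N' \<in> JZ l n d"
  shows "M * N - M' * N' \<in> JZ l n d"
proof -
  have "M * N - M' * N' = M * (N - N') + (M - M') * N'" by (simp add: algebra_simps)
  then show ?thesis using assms by (simp add: JZ_add JZ_left JZ_right)
qed

text \<open>In row degrees up to \<open>d\<close> at most \<open>d\<close> factors \<open>l\<close>
  are traded for degree, so \<open>n\<close> of the \<open>n + d\<close> remain. This is why
  congruences are taken with index \<open>n + d\<close> throughout.\<close>

lemma J_JZ: "M \<in> J l (n + d) d \<Longrightarrow> M \<in> JZ l n d"
proof -
  assume M: "M \<in> J l (n + d) d"
  have "of_nat l ^ n dvd entry M u v" if "length u \<le> d" for u v
    by (rule dvd_trans[OF le_imp_power_dvd JD[OF M that]]) (use that in auto)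
  then show ?thesis by (simp add: JZ_def)
qed

abbreviation fZ :: "('g::finite, int) fmat \<Rightarrow> ('g, 'l::prime_card padic_int) fmat" where
  "fZ \<equiv> fmap of_int"

lemma filtered_hom_fZ: "filtered_hom (fZ :: ('g::finite, int) fmat \<Rightarrow> ('g, 'l::prime_card padic_int) fmat)"
  by (rule filtered_hom_fmap[OF rhom_of_int])

lemma fZ_JZ: "M \<in> JZ CARD('l) n d \<Longrightarrow> (fZ M :: ('g::finite, 'l::prime_card padic_int) fmat) \<in> JZ CARD('l) n d"
  by (simp add: JZ_def entry_fmap[OF rhom_of_int] padic_dvd_of_int)

lemma JZ_eqI:
  fixes M N :: "('g::finite, 'l::prime_card padic_int) fmat"
  assumes "\<And>n d. M - N \<in> JZ CARD('l) n d" shows "M = N"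
proof (rule fmat_eqI)
  fix u v
  have "of_nat CARD('l) ^ n dvd entry M u v - entry N u v" for n
    using assms[of n "length u"] by (simp add: JZ_def fmat_simps)
  then show "entry M u v = entry N u v" using padic_eq_0[of "entry M u v - entry N u v"] by simp
qed

lemma ev_JZ:
  fixes s :: "('h::finite, 'a::comm_ring_1) ncfps" and \<alpha> :: "'h \<Rightarrow> ('g::finite, 'a) fmat"
  assumes "\<forall>g. \<alpha> g \<in> fil 1" "\<And>w. length w \<le> d \<Longrightarrow> of_nat l ^ n dvd nc_coeff s w"
  shows "ev fsc \<alpha> s \<in> JZ l n d"
  unfolding JZ_def
proof (intro CollectI allI impI)
  fix u v :: "'g list" assume u: "length u \<le> d"
  let ?W = "{w :: 'h list. length w < d + 1}"
  have "entry (ev fsc \<alpha> s - (\<Sum>w\<in>?W. fsc (nc_coeff s w) * prod_list (map \<alpha> w))) u v = 0"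
    using ev_approx[OF assms(1), of fsc s "d + 1"] u by (simp add: fil_fmat_iff)
  then have "entry (ev fsc \<alpha> s) u v = (\<Sum>w\<in>?W. nc_coeff s w * entry (prod_list (map \<alpha> w)) u v)"
    by (simp add: fmat_simps fsc_mult)
  also have "of_nat l ^ n dvd \<dots>" using assms(2) by (intro dvd_sum dvd_mult2) auto
  finally show "of_nat l ^ n dvd entry (ev fsc \<alpha> s) u v" .
qed

subsection \<open>The Magnus series\<close>

text \<open>The parameter \<open>L\<close> ties the number \<open>l\<close> to the type over which
  the \<open>l\<close>-adic integers are formed.\<close>

locale free_pro =
  fixes l :: nat and L :: "'l::prime_card itself"
  assumes l_def: "l = CARD('l)"
begin

lemma prime_l: "prime l" using prime_card[where 'a = 'l] by (simp add: l_def)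

sublocale F: unip_rep free2 l "\<lambda>c. lmul (mu c)"
proof -
  interpret F: l_group free2 l by (rule l_group_free2[OF prime_l])
  show "unip_rep free2 l (\<lambda>c. lmul (mu c))"
    by unfold_locales
      (auto simp: mu_def rl_mult lmul_mult rl_hom rl_unip intro: filtered_hom_unip[OF filtered_hom_lmul])
qed

text \<open>A word whose Magnus coefficients in degrees up to \<open>d\<close> represent those of
  \<open>f\<close> modulo \<open>l ^ n\<close>.\<close>

definition mrep :: "pro_free2 \<Rightarrow> nat \<Rightarrow> nat \<Rightarrow> xy gword set" where
  "mrep f n d = (SOME g. g \<in> carrier free2 \<and> f (F.NJ (n + d) d) = F.NJ (n + d) d #>\<^bsub>free2\<^esub> g)"

text \<open>The \<open>l\<close>-adic limit of the Magnus series of words approximating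
  \<open>f\<close>. Residue \<open>n\<close> of a coefficient comes from a word that is precise in
  degrees up to the length of \<open>w\<close>.\<close>

definition mag :: "pro_free2 \<Rightarrow> (xy, 'l padic_int) ncfps" where
  "mag f = Abs_ncfps (\<lambda>w. Abs_padic_int (\<lambda>n. nc_coeff (mu (mrep f n (length w))) w mod int l ^ n))"

lemma NJ_mono: "n \<le> n' \<Longrightarrow> d \<le> d' \<Longrightarrow> F.NJ (n' + d') d' \<subseteq> F.NJ (n + d) d"
  unfolding F.NJ_def
proof (intro Collect_mono impI conjI; elim conjE)
  fix g assume "n \<le> n'" "d \<le> d'" "lmul (mu g) - 1 \<in> J l (n' + d') d'"
  then have "lmul (mu g) - 1 \<in> J l (n + d) d'" by (auto intro: J_mono)
  then show "lmul (mu g) - 1 \<in> J l (n + d) d" using \<open>d \<le> d'\<close> by (simp add: J_def)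
qed

lemma mrep:
  assumes "f \<in> carrier (F2 l)"
  shows "mrep f n d \<in> carrier free2" "f (F.NJ (n + d) d) = F.NJ (n + d) d #>\<^bsub>free2\<^esub> mrep f n d"
proof -
  have "\<exists>g. g \<in> carrier free2 \<and> f (F.NJ (n + d) d) = F.NJ (n + d) d #>\<^bsub>free2\<^esub> g"
    using F.pro_rep[OF assms F.NJ_LN] by blast
  from someI_ex[OF this] show "mrep f n d \<in> carrier free2" "f (F.NJ (n + d) d) = F.NJ (n + d) d #>\<^bsub>free2\<^esub> mrep f n d"
    unfolding mrep_def by blast+
qed

lemma mu_cong:
  assumes f: "f \<in> carrier (F2 l)" and N: "N \<in> F.LN" "N \<subseteq> F.NJ (n + d) d" and g: "g \<in> carrier free2" "f N = N #>\<^bsub>free2\<^esub> g"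
    and w: "length w \<le> d"
  shows "int l ^ n dvd nc_coeff (mu g) w - nc_coeff (mu (mrep f n (length w))) w"
proof -
  let ?d = "length w"
  have "f (F.NJ (n + ?d) ?d) = F.NJ (n + ?d) ?d #>\<^bsub>free2\<^esub> g"
    by (rule F.pro_rep_mono[OF f F.NJ_LN N(1) _ g]) (use N(2) NJ_mono[OF order_refl w, of n] in blast)
  then have "lmul (mu g) - lmul (mu (mrep f n ?d)) \<in> J l (n + ?d) ?d"
    by (intro F.NJ_coset g(1) mrep[OF f]) (simp add: mrep(2)[OF f])
  from JD[OF this, of w "[]"] show ?thesis by (simp add: fmat_simps entry_lmul)
qed

lemma mag_res:
  assumes f: "f \<in> carrier (F2 l)"
  shows "res n (nc_coeff (mag f) w) = nc_coeff (mu (mrep f n (length w))) w mod int l ^ n"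
proof -
  have "nc_coeff (mu (mrep f (Suc n) (length w))) w mod int l ^ Suc n mod int l ^ n
      = nc_coeff (mu (mrep f n (length w))) w mod int l ^ n" for n
  proof -
    have "int l ^ n dvd nc_coeff (mu (mrep f (Suc n) (length w))) w - nc_coeff (mu (mrep f n (length w))) w"
    proof -
      have "F.NJ (Suc n + length w) (length w) \<subseteq> F.NJ (n + length w) (length w)" by (rule NJ_mono) auto
      from mu_cong[OF f F.NJ_LN this mrep[OF f] order_refl] show ?thesis .
    qed
    then show ?thesis by (simp only: padic_compat_aux mod_eq_dvd_iff)
  qed
  then have "(\<lambda>n. nc_coeff (mu (mrep f n (length w))) w mod int l ^ n) \<in> {s. \<forall>n. s (Suc n) mod int CARD('l) ^ n = s n}"
    by (simp add: l_def)
  then show ?thesis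
    by (simp add: mag_def Abs_ncfps_inverse Abs_padic_int_inverse)
qed

text \<open>Every representative of \<open>f\<close> at a sufficiently small \<open>N\<close> will
  do, so one word can serve several approximations at once.\<close>

lemma mag_approx:
  assumes f: "f \<in> carrier (F2 l)" and N: "N \<in> F.LN" "N \<subseteq> F.NJ (n + d) d" and g: "g \<in> carrier free2" "f N = N #>\<^bsub>free2\<^esub> g"
    and w: "length w \<le> d"
  shows "of_nat l ^ n dvd nc_coeff (mag f) w - of_int (nc_coeff (mu g) w)"
proof -
  let ?m = "nc_coeff (mu (mrep f n (length w))) w"
  have "of_nat CARD('l) ^ n dvd nc_coeff (mag f) w - of_int ?m"
    unfolding padic_dvd_iff
    by (simp add: minus_padic_int.rep_eq mag_res[OF f] res_of_int flip: l_def)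
  moreover have "of_nat CARD('l) ^ n dvd (of_int (nc_coeff (mu g) w - ?m) :: 'l padic_int)"
    unfolding padic_dvd_of_int using mu_cong[OF f N g w] by (simp add: l_def)
  ultimately show ?thesis
    using dvd_diff[of "of_nat CARD('l) ^ n" "nc_coeff (mag f) w - of_int ?m" "of_int (nc_coeff (mu g) w - ?m)"]
    by (simp add: l_def)
qed

text \<open>Link between the two views of \<open>f\<close>: its Magnus series at
  \<open>l\<close>-adic matrices, and the value of an approximating word at the same
  matrices.\<close>

lemma fe_mag_approx:
  fixes A B :: "('g::finite, 'l padic_int) fmat"
  assumes f: "f \<in> carrier (F2 l)" and N: "N \<in> F.LN" "N \<subseteq> F.NJ (n + d) d" and g: "g \<in> carrier free2" "f N = N #>\<^bsub>free2\<^esub> g"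
    and A: "unip A" and B: "unip B"
  shows "fe fsc (mag f) A B - rl A B g \<in> JZ l n d"
proof -
  have e: "\<forall>h. case_xy (A - 1) (B - 1) h \<in> fil 1" using A B by (intro case_xy_fil) (auto simp: unip_fil)
  have "fe fsc (mag f) A B - rl A B g = ev fsc (case_xy (A - 1) (B - 1)) (mag f - nc_map of_int (mu g))"
    unfolding fe_mu[OF scal_fsc A B g(1), symmetric] fe_def by (simp add: filtered_homD(5)[OF filtered_hom_ev[OF e scal_fsc]])
  also have "\<dots> \<in> JZ l n d"
    by (rule ev_JZ[OF e]) (simp add: nc_simps mag_approx[OF f N g])
  finally show ?thesis .
qed

lemma mag_Nil:
  assumes f: "f \<in> carrier (F2 l)" shows "nc_coeff (mag f) [] = 1"
proof -
  have "nc_coeff (mu c) [] = 1" if "c \<in> carrier free2" for c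
    using rl_unip[OF unip_var unip_var that] by (simp add: mu_def unip_ncfps_iff)
  then have "nc_coeff (mag f) [] - of_int 1 = 0"
    using padic_eq_0[of "nc_coeff (mag f) [] - of_int 1"]
      mag_approx[OF f F.NJ_LN subset_refl mrep[OF f], of "[]"] mrep(1)[OF f] by (simp add: l_def)
  then show ?thesis by simp
qed

end

section \<open>Artin automorphisms as matrices\<close>

text \<open>For an automorphism \<open>T\<close> this says that \<open>T\<close> maps
  \<open>s\<close> to \<open>s'\<close>. In this form the relation can be added, multiplied,
  inverted and composed without reference to the automorphism.\<close>

definition itw :: "('g::finite, 'a::comm_ring_1) fmat \<Rightarrow> ('g, 'a) ncfps \<Rightarrow> ('g, 'a) ncfps \<Rightarrow> bool" where
  "itw T s s' \<longleftrightarrow> T * lmul s = lmul s' * T"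

lemma itw_1: "itw T 1 1" by (simp add: itw_def)

lemma itw_add: "itw T s s' \<Longrightarrow> itw T t t' \<Longrightarrow> itw T (s + t) (s' + t')"
  by (simp add: itw_def lmul_add distrib_left distrib_right)

lemma itw_mult:
  assumes "itw T s s'" "itw T t t'" shows "itw T (s * t) (s' * t')"
proof -
  have "T * (lmul s * lmul t) = (T * lmul s) * lmul t" by (simp add: mult.assoc)
  also have "\<dots> = lmul s' * (T * lmul t)" using assms(1) by (simp add: itw_def mult.assoc)
  also have "\<dots> = lmul s' * lmul t' * T" using assms(2) by (simp add: itw_def mult.assoc)
  finally show ?thesis by (simp add: itw_def lmul_mult)
qed

lemma itw_uinv:
  assumes "itw T s s'" "unip s" "unip s'" shows "itw T (uinv s) (uinv s')"
proof -
  have "lmul (uinv s') * (T * lmul s) * lmul (uinv s) = lmul (uinv s') * (lmul s' * T) * lmul (uinv s)"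
    using assms(1) by (simp add: itw_def)
  moreover have "lmul (uinv s') * (T * lmul s) * lmul (uinv s) = lmul (uinv s') * T * lmul (s * uinv s)"
    by (simp add: lmul_mult mult.assoc)
  moreover have "lmul (uinv s') * (lmul s' * T) * lmul (uinv s) = lmul (uinv s' * s') * T * lmul (uinv s)"
    by (simp add: lmul_mult mult.assoc)
  ultimately show ?thesis by (simp add: itw_def uinv_left[OF assms(3)] uinv_right[OF assms(2)])
qed

lemma itw_comp: "itw T s s' \<Longrightarrow> itw T' s' s'' \<Longrightarrow> itw (T' * T) s s''"
  unfolding itw_def by (metis mult.assoc)

lemma itw_submat: "\<forall>g. \<phi> g \<in> fil 1 \<Longrightarrow> itw (submat \<phi>) (nc_var g) (\<phi> g)"
  by (simp add: itw_def submat_var)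

lemma itw_unique:
  assumes "fapp M 1 = fapp N 1" "\<And>g. itw M (nc_var g) (c g)" "\<And>g. itw N (nc_var g) (c g)"
  shows "M = N"
  using intertwiner_unique[OF assms(1)] assms(2,3) by (simp add: itw_def)

lemma fapp_submat_1: "\<forall>g. \<phi> g \<in> fil 1 \<Longrightarrow> fapp (submat \<phi>) 1 = 1"
  using fapp_submat[of \<phi> "[]"] by simp

text \<open>\<open>M\<close> acts on the associated graded module by the permutation \<open>\<sigma>\<close> of the variables.\<close>

definition symb :: "('g::finite, 'a::comm_ring_1) fmat \<Rightarrow> ('g \<Rightarrow> 'g) \<Rightarrow> bool" where
  "symb M \<sigma> \<longleftrightarrow> M - submat (nc_var \<circ> \<sigma>) \<in> fil 1"

lemma fapp_submat_var: "fapp (submat (nc_var \<circ> \<sigma>)) (word v) = word (map \<sigma> v)"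
  by (subst fapp_submat) (simp_all add: word_def)

lemma submat_var_mult: "submat (nc_var \<circ> \<sigma>) * submat (nc_var \<circ> \<tau>) = submat (nc_var \<circ> (\<sigma> \<circ> \<tau>))"
  by (rule fapp_word_eqI) (simp add: fapp_mult fapp_submat_var)

lemma submat_var_id: "submat (nc_var \<circ> id) = 1"
  by (rule fapp_word_eqI) (simp only: fapp_submat_var list.map_id0 id_apply fapp_1)

lemma symb_mult:
  assumes "symb M \<sigma>" "symb N \<tau>" shows "symb (M * N) (\<sigma> \<circ> \<tau>)"
  using fil_diff_mult[of M _ 1 N] assms by (simp add: symb_def flip: submat_var_mult)

lemma symb_id_iff: "symb M id \<longleftrightarrow> unip M"
  by (simp only: symb_def submat_var_id unip_def)

lemma symb_submat:
  assumes "\<forall>g. \<phi> g \<in> fil 1" "\<forall>g. \<phi> g - nc_var (\<sigma> g) \<in> fil 2"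
  shows "symb (submat \<phi>) \<sigma>"
  unfolding symb_def fil_fmat_iff
proof (intro allI impI)
  fix u v :: "'a list" assume u: "length u < length v + 1"
  have "prod_list (map \<phi> v) - prod_list (map (nc_var \<circ> \<sigma>) v) \<in> fil (length v + 1)"
    by (rule prod_list_fil_diff) (use assms in auto)
  then have "nc_coeff (prod_list (map \<phi> v) - prod_list (map (nc_var \<circ> \<sigma>) v)) u = 0"
    using u by (simp only: fil_ncfps_iff)
  then show "entry (submat \<phi> - submat (nc_var \<circ> \<sigma>)) u v = 0"
    by (simp add: fmat_simps entry_fapp fapp_submat[OF assms(1)] fapp_submat nc_simps)
qed

section \<open>Artin automorphisms of the series in three variables\<close>

abbreviation Y1 :: "(strand, int) ncfps" where "Y1 \<equiv> nc_var st1"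
abbreviation Y2 :: "(strand, int) ncfps" where "Y2 \<equiv> nc_var st2"
abbreviation Y3 :: "(strand, int) ncfps" where "Y3 \<equiv> nc_var st3"
abbreviation y1 :: "(strand, int) ncfps" where "y1 \<equiv> 1 + Y1"
abbreviation y2 :: "(strand, int) ncfps" where "y2 \<equiv> 1 + Y2"
abbreviation y3 :: "(strand, int) ncfps" where "y3 \<equiv> 1 + Y3"

text \<open>\<open>T1m\<close> sends \<open>y1\<close> to \<open>y2\<close> and \<open>y2\<close> to
  \<open>uinv y2 * y1 * y2\<close>, written in terms of the variables \<open>Y = y - 1\<close>;
  \<open>T2m\<close> is the same one index higher. The letter \<open>n\<close> marks the
  inverses.\<close>

definition "T1m = submat (case_strand Y2 (uinv y2 * Y1 * y2) Y3)"
definition "T1n = submat (case_strand (y1 * Y2 * uinv y1) Y1 Y3)"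
definition "T2m = submat (case_strand Y1 Y3 (uinv y3 * Y2 * y3))"
definition "T2n = submat (case_strand Y1 (y2 * Y3 * uinv y2) Y2)"

lemma strand_fil: "a \<in> fil n \<Longrightarrow> b \<in> fil n \<Longrightarrow> c \<in> fil n \<Longrightarrow> \<forall>g. case_strand a b c g \<in> fil n"
  by (auto split: strand.split)

lemma conj_var_fil: "a * nc_var g * b \<in> fil 1"
  by (intro fil_mult_right fil_mult_left nc_var_fil)

lemmas strand_maps_fil = strand_fil[OF nc_var_fil conj_var_fil nc_var_fil] strand_fil[OF conj_var_fil nc_var_fil nc_var_fil]
  strand_fil[OF nc_var_fil nc_var_fil conj_var_fil]

lemma itw_T1m: "itw T1m Y1 Y2" "itw T1m Y2 (uinv y2 * Y1 * y2)" "itw T1m Y3 Y3"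
  and itw_T1n: "itw T1n Y1 (y1 * Y2 * uinv y1)" "itw T1n Y2 Y1" "itw T1n Y3 Y3"
  and itw_T2m: "itw T2m Y1 Y1" "itw T2m Y2 Y3" "itw T2m Y3 (uinv y3 * Y2 * y3)"
  and itw_T2n: "itw T2n Y1 Y1" "itw T2n Y2 (y2 * Y3 * uinv y2)" "itw T2n Y3 Y2"
  unfolding T1m_def T1n_def T2m_def T2n_def
  using itw_submat[OF strand_maps_fil(1)[of st2 "uinv y2" st1 y2 st3]] itw_submat[OF strand_maps_fil(2)[of y1 st2 "uinv y1" st1 st3]]
    itw_submat[OF strand_maps_fil(3)[of st1 st3 "uinv y3" st2 y3]] itw_submat[OF strand_maps_fil(1)[of st1 y2 st3 "uinv y2" st2]]
  by (metis strand.case)+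

lemma fapp_T_1: "fapp T1m 1 = 1" "fapp T1n 1 = 1" "fapp T2m 1 = 1" "fapp T2n 1 = 1"
  unfolding T1m_def T1n_def T2m_def T2n_def by (intro fapp_submat_1 strand_maps_fil)+

lemma one_plus_conj: "unip u \<Longrightarrow> 1 + uinv u * x * u = uinv u * (1 + x) * u" "unip u \<Longrightarrow> 1 + u * x * uinv u = u * (1 + x) * uinv u"
  by (simp_all add: distrib_left distrib_right uinv_left uinv_right)

lemma itw_T1m_y: "itw T1m y1 y2" "itw T1m y2 (uinv y2 * y1 * y2)" "itw T1m y3 y3"
  and itw_T1n_y: "itw T1n y1 (y1 * y2 * uinv y1)" "itw T1n y2 y1" "itw T1n y3 y3"
  and itw_T2m_y: "itw T2m y1 y1" "itw T2m y2 y3" "itw T2m y3 (uinv y3 * y2 * y3)"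
  and itw_T2n_y: "itw T2n y1 y1" "itw T2n y2 (y2 * y3 * uinv y2)" "itw T2n y3 y2"
  using itw_add[OF itw_1 itw_T1m(1)] itw_add[OF itw_1 itw_T1m(2)] itw_add[OF itw_1 itw_T1m(3)]
    itw_add[OF itw_1 itw_T1n(1)] itw_add[OF itw_1 itw_T1n(2)] itw_add[OF itw_1 itw_T1n(3)]
    itw_add[OF itw_1 itw_T2m(1)] itw_add[OF itw_1 itw_T2m(2)] itw_add[OF itw_1 itw_T2m(3)]
    itw_add[OF itw_1 itw_T2n(1)] itw_add[OF itw_1 itw_T2n(2)] itw_add[OF itw_1 itw_T2n(3)]
  by (simp_all add: one_plus_conj)

lemma T_inverse: "T1m * T1n = 1" "T1n * T1m = 1" "T2m * T2n = 1" "T2n * T2m = 1"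
proof -
  have one: "itw 1 s s" for s :: "(strand, int) ncfps" by (simp add: itw_def)
  note c = itw_comp itw_mult itw_uinv itw_T1m itw_T1n itw_T2m itw_T2n itw_T1m_y itw_T1n_y itw_T2m_y itw_T2n_y
  note s = mult.assoc uinv_cancel uinv_left uinv_right uinv_mult unip_mult unip_uinv
  have "itw (T1m * T1n) Y1 (y2 * (uinv y2 * Y1 * y2) * uinv y2)" "itw (T1m * T1n) Y2 Y2" "itw (T1m * T1n) Y3 Y3"
    by (rule itw_comp[OF itw_T1n(1)], intro itw_mult itw_uinv itw_T1m itw_T1m_y unip_var,
        rule itw_comp[OF itw_T1n(2) itw_T1m(1)], rule itw_comp[OF itw_T1n(3) itw_T1m(3)])
  then have "itw (T1m * T1n) (nc_var g) (nc_var g)" for g by (cases g) (simp_all add: s)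
  then show "T1m * T1n = 1" by (intro itw_unique[OF _ _ one]) (simp_all add: fapp_mult fapp_T_1)
  have "itw (T1n * T1m) Y1 Y1" "itw (T1n * T1m) Y2 (uinv y1 * (y1 * Y2 * uinv y1) * y1)" "itw (T1n * T1m) Y3 Y3"
    by (rule itw_comp[OF itw_T1m(1) itw_T1n(2)], rule itw_comp[OF itw_T1m(2)],
        intro itw_mult itw_uinv itw_T1n itw_T1n_y unip_var, rule itw_comp[OF itw_T1m(3) itw_T1n(3)])
  then have "itw (T1n * T1m) (nc_var g) (nc_var g)" for g by (cases g) (simp_all add: s)
  then show "T1n * T1m = 1" by (intro itw_unique[OF _ _ one]) (simp_all add: fapp_mult fapp_T_1)
  have "itw (T2m * T2n) Y1 Y1" "itw (T2m * T2n) Y2 (y3 * (uinv y3 * Y2 * y3) * uinv y3)" "itw (T2m * T2n) Y3 Y3"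
    by (rule itw_comp[OF itw_T2n(1) itw_T2m(1)], rule itw_comp[OF itw_T2n(2)],
        intro itw_mult itw_uinv itw_T2m itw_T2m_y unip_var, rule itw_comp[OF itw_T2n(3) itw_T2m(2)])
  then have "itw (T2m * T2n) (nc_var g) (nc_var g)" for g by (cases g) (simp_all add: s)
  then show "T2m * T2n = 1" by (intro itw_unique[OF _ _ one]) (simp_all add: fapp_mult fapp_T_1)
  have "itw (T2n * T2m) Y1 Y1" "itw (T2n * T2m) Y2 Y2" "itw (T2n * T2m) Y3 (uinv y2 * (y2 * Y3 * uinv y2) * y2)"
    by (rule itw_comp[OF itw_T2m(1) itw_T2n(1)], rule itw_comp[OF itw_T2m(2) itw_T2n(3)],
        rule itw_comp[OF itw_T2m(3)], intro itw_mult itw_uinv itw_T2n itw_T2n_y unip_var)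
  then have "itw (T2n * T2m) (nc_var g) (nc_var g)" for g by (cases g) (simp_all add: s)
  then show "T2n * T2m = 1" by (intro itw_unique[OF _ _ one]) (simp_all add: fapp_mult fapp_T_1)
qed

lemma T_braid: "T1m * (T2m * T1m) = T2m * (T1m * T2m)"
proof (rule itw_unique[where c = "case_strand Y3 (uinv y3 * Y2 * y3) (uinv y3 * (uinv y2 * Y1 * y2) * y3)"])
  note s = mult.assoc uinv_cancel uinv_left uinv_right uinv_mult unip_mult unip_uinv
  show "fapp (T1m * (T2m * T1m)) 1 = fapp (T2m * (T1m * T2m)) 1" by (simp add: fapp_mult fapp_T_1)
  have 1: "itw (T1m * (T2m * T1m)) Y1 Y3"
    by (rule itw_comp[OF itw_comp[OF itw_T1m(1) itw_T2m(2)] itw_T1m(3)])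
  have "itw (T2m * T1m) Y2 (uinv y3 * Y1 * y3)"
    by (rule itw_comp[OF itw_T1m(2)]) (intro itw_mult itw_uinv itw_T2m itw_T2m_y unip_var)
  then have 2: "itw (T1m * (T2m * T1m)) Y2 (uinv y3 * Y2 * y3)"
    by (rule itw_comp) (intro itw_mult itw_uinv itw_T1m itw_T1m_y unip_var)
  have 3: "itw (T1m * (T2m * T1m)) Y3 (uinv y3 * (uinv y2 * Y1 * y2) * y3)"
    by (rule itw_comp[OF itw_comp[OF itw_T1m(3) itw_T2m(3)]]) (intro itw_mult itw_uinv itw_T1m itw_T1m_y unip_var)
  show "itw (T1m * (T2m * T1m)) (nc_var g) (case_strand Y3 (uinv y3 * Y2 * y3) (uinv y3 * (uinv y2 * Y1 * y2) * y3) g)" for g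
    using 1 2 3 by (cases g) simp_all
  have 4: "itw (T2m * (T1m * T2m)) Y1 Y3"
    by (rule itw_comp[OF itw_comp[OF itw_T2m(1) itw_T1m(1)] itw_T2m(2)])
  have 5: "itw (T2m * (T1m * T2m)) Y2 (uinv y3 * Y2 * y3)"
    by (rule itw_comp[OF itw_comp[OF itw_T2m(2) itw_T1m(3)] itw_T2m(3)])
  have "itw (T1m * T2m) Y3 (uinv y3 * (uinv y2 * Y1 * y2) * y3)"
    by (rule itw_comp[OF itw_T2m(3)]) (intro itw_mult itw_uinv itw_T1m itw_T1m_y unip_var)
  then have "itw (T2m * (T1m * T2m)) Y3 (uinv (uinv y3 * y2 * y3) * (uinv y3 * Y1 * y3) * (uinv y3 * y2 * y3))"
    by (rule itw_comp) (intro itw_mult itw_uinv itw_T2m itw_T2m_y unip_var unip_mult unip_uinv)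
  then have 6: "itw (T2m * (T1m * T2m)) Y3 (uinv y3 * (uinv y2 * Y1 * y2) * y3)"
    by (simp add: s)
  show "itw (T2m * (T1m * T2m)) (nc_var g) (case_strand Y3 (uinv y3 * Y2 * y3) (uinv y3 * (uinv y2 * Y1 * y2) * y3) g)" for g
    using 4 5 6 by (cases g) simp_all
qed

lemma conj_var_diff:
  assumes "unip u" shows "uinv u * nc_var g * u - nc_var g \<in> fil 2" "u * nc_var g * uinv u - nc_var g \<in> fil 2"
proof -
  have *: "uinv v * nc_var g * v - nc_var g \<in> fil 2" if "unip v" for v :: "('a, 'b) ncfps"
  proof -
    have "uinv v * (1 + nc_var g) * v - (1 + nc_var g) \<in> fil (1 + 1)" by (rule conj_fil[OF that]) simp
    then show ?thesis by (simp add: distrib_left distrib_right uinv_left[OF that])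
  qed
  show "uinv u * nc_var g * u - nc_var g \<in> fil 2" by (rule *[OF assms])
  show "u * nc_var g * uinv u - nc_var g \<in> fil 2" using *[OF unip_uinv[OF assms]] by (simp add: uinv_uinv[OF assms])
qed

definition "sw1 = case_strand st2 st1 st3"
definition "sw2 = case_strand st1 st3 st2"

lemma symb_T: "symb T1m sw1" "symb T1n sw1" "symb T2m sw2" "symb T2n sw2"
  unfolding T1m_def T1n_def T2m_def T2n_def sw1_def sw2_def
  by (rule symb_submat, rule strand_maps_fil, simp split: strand.split add: conj_var_diff[OF unip_var])+

abbreviation "lm1 \<equiv> lmul y1" abbreviation "lm2 \<equiv> lmul y2" abbreviation "lm3 \<equiv> lmul y3"
abbreviation "ln1 \<equiv> lmul (uinv y1)" abbreviation "ln2 \<equiv> lmul (uinv y2)" abbreviation "ln3 \<equiv> lmul (uinv y3)"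

interpretation A: artin_action lm1 lm2 lm3 T1m T2m ln1 ln2 ln3 T1n T2n
proof
  have c: "lmul (uinv y) * lmul y = 1" "lmul y * lmul (uinv y) = 1" if "unip y" for y :: "(strand, int) ncfps"
    using that by (simp_all add: uinv_left uinv_right flip: lmul_mult)
  show "lm1 * ln1 = 1" "ln1 * lm1 = 1" "lm2 * ln2 = 1" "ln2 * lm2 = 1" "lm3 * ln3 = 1" "ln3 * lm3 = 1"
    by (simp_all add: c)
  show "T1m * (T2m * T1m) = T2m * (T1m * T2m)" by (rule T_braid)
  show "T1m * lm1 = lm2 * T1m" "T1m * lm3 = lm3 * T1m" "T2m * lm2 = lm3 * T2m" "T2m * lm1 = lm1 * T2m"
    using itw_T1m_y itw_T2m_y by (simp_all add: itw_def)
  have "itw T1m (y1 * y2) (y2 * (uinv y2 * y1 * y2))" by (intro itw_mult itw_T1m_y)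
  then show "lm1 * (lm2 * T1m) = T1m * (lm1 * lm2)"
    by (simp add: itw_def lmul_mult[symmetric] mult.assoc uinv_cancel) (simp add: lmul_mult mult.assoc)
  have "itw T2m (y2 * y3) (y3 * (uinv y3 * y2 * y3))" by (intro itw_mult itw_T2m_y)
  then show "lm2 * (lm3 * T2m) = T2m * (lm2 * lm3)"
    by (simp add: itw_def lmul_mult[symmetric] mult.assoc uinv_cancel) (simp add: lmul_mult mult.assoc)
qed (rule T_inverse)+

text \<open>Position of an ordinary strand when the distinguished one is in position
  \<open>s\<close>: those to the right of it are shifted by one.\<close>

fun pos :: "nat \<Rightarrow> strand \<Rightarrow> nat" where
  "pos s st1 = (if s = 1 then 2 else 1)"
| "pos s st2 = (if s \<le> 2 then 3 else 2)"
| "pos s st3 = (if s \<le> 3 then 4 else 3)"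

text \<open>To leading order a weight permutes the variables as the braid generator permutes the
  ordinary strands, up to the relabelling \<open>pos\<close>.\<close>

lemma symb_val4:
  assumes "i \<in> {1..<4}" "s \<in> {1..4}"
  shows "\<exists>\<sigma>. symb (snd (A.val4 (i, e) s)) \<sigma> \<and> (\<forall>j. pos (fst (A.val4 (i, e) s)) (\<sigma> j) = Transposition.transpose i (i + 1) (pos s j))"
proof -
  have L: "symb (lmul y) id" if "unip y" for y :: "(strand, int) ncfps"
    using filtered_hom_unip[OF filtered_hom_lmul that] by (simp only: symb_id_iff)
  have one: "symb (1 :: (strand, int) fmat) id" by (simp only: symb_id_iff unip_1)
  have L': "symb lm1 id" "symb lm2 id" "symb lm3 id" "symb ln1 id" "symb ln2 id" "symb ln3 id"
    by (intro L unip_var unip_uinv)+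
  note sy = one L' symb_T
  have i: "i = 1 \<or> i = 2 \<or> i = 3" and s: "s = 1 \<or> s = 2 \<or> s = 3 \<or> s = 4" using assms by auto
  have all: "(\<forall>j. P j) \<longleftrightarrow> P st1 \<and> P st2 \<and> P st3" for P
    using strand.exhaust by metis
  let ?\<sigma> = "if (i, s) \<in> {(1, 3), (1, 4), (2, 1)} then sw1 else if (i, s) \<in> {(2, 4), (3, 1), (3, 2)} then sw2 else id"
  have "symb (snd (A.val4 (i, e) s)) ?\<sigma>"
    using i s by (elim disjE; cases e; simp add: A.val4_True A.val4_False sy)
  moreover have "\<forall>j. pos (fst (A.val4 (i, e) s)) (?\<sigma> j) = Transposition.transpose i (i + 1) (pos s j)"
    using i s
    by (elim disjE; cases e; simp add: A.val4_True A.val4_False all Transposition.transpose_def sw1_def sw2_def)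
  ultimately show ?thesis by blast
qed

lemma symb_wev:
  assumes "w \<in> BW" "s \<in> {1..4}"
  shows "\<exists>\<sigma>. symb (snd (wev (wr mulmon) A.val4 w s)) \<sigma> \<and> (\<forall>j. pos (gword_perm w s) (\<sigma> j) = gword_perm w (pos s j))"
  using assms(1)
proof (induction w)
  case Nil
  have "symb (1 :: (strand, int) fmat) id" by (simp only: symb_id_iff unip_1)
  then show ?case by auto
next
  case (Cons x w)
  obtain i e where x: "x = (i, e)" by force
  have w: "w \<in> BW" "i \<in> {1..<4}" using Cons.hyps Cons.prems x by auto
  obtain \<sigma> where \<sigma>: "symb (snd (wev (wr mulmon) A.val4 w s)) \<sigma>" "\<forall>j. pos (gword_perm w s) (\<sigma> j) = gword_perm w (pos s j)"
    using Cons.IH w by auto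
  have s': "gword_perm w s \<in> {1..4}" using permutes_in_image[OF gword_perm_permutes[OF w(1)]] assms(2) by blast
  obtain \<tau> where \<tau>: "symb (snd (A.val4 (i, e) (gword_perm w s))) \<tau>"
    "\<forall>j. pos (fst (A.val4 (i, e) (gword_perm w s))) (\<tau> j) = Transposition.transpose i (i + 1) (pos (gword_perm w s) j)"
    using symb_val4[OF w(2) s'] by blast
  have f: "fst (A.val4 (i, e) t) = Transposition.transpose i (i + 1) t" for t by (simp add: wval_def)
  show ?case
    using symb_mult[OF \<tau>(1) \<sigma>(1)] \<tau>(2) \<sigma>(2)
    by (intro exI[of _ "\<tau> \<circ> \<sigma>"]) (auto simp: x A.fst_val4 gword_perm_Cons f o_def)
qed

lemma pos_inj: "pos s j = pos s k \<Longrightarrow> j = k"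
  by (cases j; cases k) (auto split: if_splits)

text \<open>A pure braid brings every strand back, so its symbol is the identity permutation, which
  means that the matrix is unipotent.\<close>

lemma unip_rho:
  assumes s: "s \<in> {1..4}" and C: "C \<in> carrier P4"
  shows "unip (A.st.\<rho> s C)"
proof -
  obtain w where w: "w \<in> BW" "gword_perm w = id" "C = bcl w" using C unfolding carrier_P4 by blast
  obtain \<sigma> where \<sigma>: "symb (snd (wev (wr mulmon) A.val4 w s)) \<sigma>" "\<forall>j. pos (gword_perm w s) (\<sigma> j) = gword_perm w (pos s j)"
    using symb_wev[OF w(1) s] by blast
  have "\<sigma> = id"
  proof
    fix j
    have "pos s (\<sigma> j) = pos s j" using \<sigma>(2) w(2) by simp
    then show "\<sigma> j = id j" using pos_inj by simp
  qed
  then show ?thesis using \<sigma>(1) by (simp only: w(3) A.st.\<rho>_class[OF w(1)] symb_id_iff)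
qed

lemma unip_rep_P4:
  assumes "prime l" "s \<in> {1..4}"
  shows "unip_rep P4 l (A.st.\<rho> s)"
  using assms A.st.\<rho>_mult A.st.\<rho>_one unip_rho group_P4
  by (simp add: unip_rep_def l_group_def l_group_axioms_def unip_rep_axioms_def)

section \<open>Identities among loops and twists\<close>

context artin_action
begin

lemma assoc_rule: "a * b = c * d \<Longrightarrow> a * (b * x) = c * (d * (x :: 'r))"
  by (metis mult.assoc)

lemma cancel_rule: "a * b = 1 \<Longrightarrow> a * (b * x) = (x :: 'r)"
  by (simp flip: mult.assoc)

lemma invs: "L1 * (L1i * x) = x" "L1i * (L1 * x) = x" "L2 * (L2i * x) = x" "L2i * (L2 * x) = x"
    "L3 * (L3i * x) = x" "L3i * (L3 * x) = x" "T1 * (T1i * x) = x" "T1i * (T1 * x) = x"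
    "T2 * (T2i * x) = x" "T2i * (T2 * x) = x"
  by (simp_all add: cancel_rule inv)

text \<open>These rules and their companions move every \<open>T\<close> to the right of every
  \<open>L\<close>. The identities below are proved by bringing both sides to this normal form of a
  semidirect product.\<close>

lemma push_T1: "T1 * (L1 * x) = L2 * (T1 * x)" "T1 * (L2 * x) = L2i * (L1 * (L2 * (T1 * x)))" "T1 * (L3 * x) = L3 * (T1 * x)"
proof -
  show 1: "T1 * (L1 * x) = L2 * (T1 * x)" and "T1 * (L3 * x) = L3 * (T1 * x)" for x
    using assoc_rule[OF T1L(1)] assoc_rule[OF T1L(3)] by auto
  have "L2 * (T1 * (L2 * x)) = L1 * (L2 * (T1 * x))"
    using 1[of "L2 * x"] T1L(2) by (simp flip: mult.assoc)
  then show "T1 * (L2 * x) = L2i * (L1 * (L2 * (T1 * x)))" by (metis invs(4))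
qed

lemma push_T2: "T2 * (L1 * x) = L1 * (T2 * x)" "T2 * (L2 * x) = L3 * (T2 * x)" "T2 * (L3 * x) = L3i * (L2 * (L3 * (T2 * x)))"
proof -
  show 1: "T2 * (L2 * x) = L3 * (T2 * x)" and "T2 * (L1 * x) = L1 * (T2 * x)" for x
    using assoc_rule[OF T2L(1)] assoc_rule[OF T2L(3)] by auto
  have "L3 * (T2 * (L3 * x)) = L2 * (L3 * (T2 * x))"
    using 1[of "L3 * x"] T2L(2) by (simp flip: mult.assoc)
  then show "T2 * (L3 * x) = L3i * (L2 * (L3 * (T2 * x)))" by (metis invs(6))
qed

lemma push_T1_inv: "T1 * (L1i * x) = L2i * (T1 * x)" "T1 * (L2i * x) = L2i * (L1i * (L2 * (T1 * x)))" "T1 * (L3i * x) = L3i * (T1 * x)"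
  by (metis push_T1(1) invs(1,4)) (metis push_T1(2) invs(2,3,4), metis push_T1(3) invs(5,6))

lemma push_T2_inv: "T2 * (L1i * x) = L1i * (T2 * x)" "T2 * (L2i * x) = L3i * (T2 * x)" "T2 * (L3i * x) = L3i * (L2i * (L3 * (T2 * x)))"
  by (metis push_T2(1) invs(1,2)) (metis push_T2(2) invs(3,6), metis push_T2(3) invs(4,5,6))

lemma push_T2i: "T2i * (L1 * x) = L1 * (T2i * x)" "T2i * (L2 * x) = L2 * (L3 * (L2i * (T2i * x)))" "T2i * (L3 * x) = L2 * (T2i * x)"
  by (metis push_T2(1) invs(9,10)) (metis push_T2(2,3) push_T2_inv(2) invs(5,6,9,10), metis push_T2(2) invs(9,10))

lemma push_T2i_inv: "T2i * (L1i * x) = L1i * (T2i * x)" "T2i * (L2i * x) = L2 * (L3i * (L2i * (T2i * x)))" "T2i * (L3i * x) = L2i * (T2i * x)"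
  by (metis push_T2i(1) invs(1,2)) (metis push_T2i(2) invs(3,4,5,6), metis push_T2i(3) invs(4,5))

lemma push_T1i: "T1i * (L1 * x) = L1 * (L2 * (L1i * (T1i * x)))" "T1i * (L2 * x) = L1 * (T1i * x)" "T1i * (L3 * x) = L3 * (T1i * x)"
  by (metis push_T1(1,2) push_T1_inv(1) invs(3,4,7,8)) (metis push_T1(1) invs(7,8), metis push_T1(3) invs(7,8))

lemmas push = push_T1 push_T1_inv push_T2 push_T2_inv push_T2i push_T2i_inv push_T1i
lemmas nf = mult.assoc push invs inv push[where x = 1, simplified mult_1_right]

text \<open>The pure generators of the three ordinary strands, as they appear when the distinguished
  strand is in the last position.\<close>

definition "t12 = T1 * T1"
definition "t23 = T2 * T2"
definition "t13 = T2 * (T1 * (T1 * T2i))"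

lemmas t_defs = t12_def t23_def t13_def

text \<open>The square faces of the polytope: disjoint or nested groups of strands.\<close>

lemma commutations:
  "L3 * t12 = t12 * L3" "L3 * (t23 * L2) = t23 * L2 * L3"
  "L1 * L2 * L3 * t12 = t12 * (L1 * L2 * L3)" "L1 * L2 * L3 * t23 = t23 * (L1 * L2 * L3)"
  "L1 * (L2 * t12) = L2 * t12 * L1" "L1 * t23 = t23 * L1"
  "L2 * (t12 * L1) = t12 * L1 * L2" "L2 * (L3 * t23) = L3 * t23 * L2"
  by (simp_all add: t_defs nf)

text \<open>\<open>L1 * L2 * t12\<close> is the full twist of the distinguished strand with strands
  1 and 2, and \<open>L2 * L3 * t23\<close> that with 2 and 3. The two long products are full twists
  of three cables, where strands 1, 2 or strands 2, 3 form one cable.\<close>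

lemma central:
  "L1 * L2 * t12 * L1 = L1 * (L1 * L2 * t12)" "L1 * L2 * t12 * L2 = L2 * (L1 * L2 * t12)"
  "L2 * L3 * t23 * L2 = L2 * (L2 * L3 * t23)" "L2 * L3 * t23 * L3 = L3 * (L2 * L3 * t23)"
  "L1 * L2 * L3 * (t13 * t23) * (L1 * L2) = L1 * L2 * (L1 * L2 * L3 * (t13 * t23))"
  "L1 * L2 * L3 * (t13 * t23) * L3 = L3 * (L1 * L2 * L3 * (t13 * t23))"
  "L1 * L2 * L3 * (t12 * t13) * L1 = L1 * (L1 * L2 * L3 * (t12 * t13))"
  "L1 * L2 * L3 * (t12 * t13) * (L2 * L3) = L2 * L3 * (L1 * L2 * L3 * (t12 * t13))"
  by (simp_all add: t_defs nf)

lemma pentagon_terms: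
  "T1 * (L1 * T1i) = L2" "T2 * (L2 * T2i) = L3"
  "L2 * (T1 * (T1 * L2i)) * L2 = L2 * t12" "L1 * (L2 * (T1 * (T1 * L2i))) = t12 * L1"
  "L2 * (L3 * (T2 * (T2 * L3i))) = t23 * L2" "L3 * (T2 * (T2 * L3i)) * L3 = L3 * t23"
  by (simp_all add: t_defs nf)

end

subsection \<open>Transfer to congruences\<close>

definition evG :: "nat \<Rightarrow> ('h, 'b) monoid_scheme \<Rightarrow> 'h \<Rightarrow> 'h \<Rightarrow> pro_free2 \<Rightarrow> 'h set \<Rightarrow> 'h set" where
  "evG l G a b f = F2_eval l (pro_completion l G) (pro_topology l G) (pro_of l G a) (pro_of l G b) f"

definition WL :: "('h, 'b) monoid_scheme \<Rightarrow> ('h \<times> 'h) list \<Rightarrow> xy gword set \<Rightarrow> 'h" where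
  "WL G ps g = foldr (\<lambda>(a, b) c. flift G a b g \<otimes>\<^bsub>G\<^esub> c) ps \<one>\<^bsub>G\<^esub>"

text \<open>Products of values of \<open>f\<close> are encoded by lists of argument pairs, so that
  \<open>EL_matrix\<close> transfers the pentagon and the 2-cycle relation by one argument.\<close>

definition EL :: "nat \<Rightarrow> ('h, 'b) monoid_scheme \<Rightarrow> ('h \<times> 'h) list \<Rightarrow> pro_free2 \<Rightarrow> 'h set \<Rightarrow> 'h set" where
  "EL l G ps f = foldr (\<lambda>(a, b) c. evG l G a b f \<otimes>\<^bsub>pro_completion l G\<^esub> c) ps \<one>\<^bsub>pro_completion l G\<^esub>"

lemma WL_simps [simp]:
  "WL G [] g = \<one>\<^bsub>G\<^esub>" "WL G ((a, b) # ps) g = flift G a b g \<otimes>\<^bsub>G\<^esub> WL G ps g"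
  by (simp_all add: WL_def)

lemma EL_simps [simp]:
  "EL l G [] f = \<one>\<^bsub>pro_completion l G\<^esub>"
  "EL l G ((a, b) # ps) f = evG l G a b f \<otimes>\<^bsub>pro_completion l G\<^esub> EL l G ps f"
  by (simp_all add: EL_def)

lemma flift_closed:
  "group G \<Longrightarrow> a \<in> carrier G \<Longrightarrow> b \<in> carrier G \<Longrightarrow> g \<in> carrier free2 \<Longrightarrow> flift G a b g \<in> carrier G"
  by (rule hom_in_carrier[OF flift_hom(1)])

lemma WL_closed:
  assumes "group G" "g \<in> carrier free2" "set ps \<subseteq> carrier G \<times> carrier G"
  shows "WL G ps g \<in> carrier G"
  using assms(3)
proof (induction ps)
  case Nil
  then show ?case using group.is_monoid[OF assms(1)] by (simp add: monoid.one_closed)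
next
  case (Cons p ps)
  then show ?case using group.is_monoid[OF assms(1)] flift_closed[OF assms(1) _ _ assms(2)]
    by (cases p) (auto intro: monoid.m_closed)
qed

lemma l_group_hom_flift:
  assumes "prime l" "group G" "a \<in> carrier G" "b \<in> carrier G"
  shows "l_group_hom free2 G (flift G a b) l"
  using assms flift_hom(1)[OF assms(2-4)] group_free2
  by (simp add: l_group_hom_def l_group_def l_group_axioms_def group_hom_def group_hom_axioms_def)

lemma evG_closed:
  assumes "prime l" "group G" "a \<in> carrier G" "b \<in> carrier G" "f \<in> carrier (F2 l)"
  shows "evG l G a b f \<in> carrier (pro_completion l G)"
  unfolding evG_def F2_subst_eq[OF assms]
  by (rule l_group_hom.pro_map_closed[OF l_group_hom_flift[OF assms(1-4)] assms(5)])

lemma EL_closed: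
  assumes l: "prime l" and G: "group G" and f: "f \<in> carrier (F2 l)" and ps: "set ps \<subseteq> carrier G \<times> carrier G"
  shows "EL l G ps f \<in> carrier (pro_completion l G)"
proof -
  interpret L: l_group G l using l G by (simp add: l_group_def l_group_axioms_def)
  show ?thesis using ps
  proof (induction ps)
    case Nil
    then show ?case by (simp add: L.pro_one_closed)
  next
    case (Cons p ps)
    then show ?case using evG_closed[OF l G _ _ f] by (cases p) (auto intro: L.pro_closed)
  qed
qed

text \<open>A single coordinate \<open>M\<close> sees \<open>f\<close> only modulo some
  \<open>N0\<close>, where \<open>f\<close> may be replaced by a word. Each further factor shrinks
  \<open>N0\<close> by a preimage of \<open>M\<close>.\<close>

lemma EL_coset:
  assumes l: "prime l" and G: "group G" and f: "f \<in> carrier (F2 l)" and ps: "set ps \<subseteq> carrier G \<times> carrier G"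
    and M: "M \<in> l_power_index_normal l G"
  shows "\<exists>N0\<in>l_power_index_normal l free2. \<forall>N\<in>l_power_index_normal l free2. N \<subseteq> N0 \<longrightarrow>
    (\<forall>g\<in>carrier free2. f N = N #>\<^bsub>free2\<^esub> g \<longrightarrow> EL l G ps f M = M #>\<^bsub>G\<^esub> WL G ps g)"
  using ps
proof (induction ps)
  case Nil
  interpret L: l_group G l using l G by (simp add: l_group_def l_group_axioms_def)
  interpret F: l_group free2 l by (rule l_group_free2[OF l])
  have "M #>\<^bsub>G\<^esub> \<one>\<^bsub>G\<^esub> = M"
    using subgroup.rcos_const[OF L.LN_subgroup[OF M] G] subgroup.one_closed[OF L.LN_subgroup[OF M]] by blast
  then show ?case using L.pro_one[OF M] F.carrier_LN by (intro bexI[of _ "carrier free2"]) auto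
next
  case (Cons p ps)
  obtain a b where p: "p = (a, b)" by force
  have ab: "a \<in> carrier G" "b \<in> carrier G" and ps: "set ps \<subseteq> carrier G \<times> carrier G" using Cons.prems p by auto
  interpret L: l_group_hom free2 G "flift G a b" l by (rule l_group_hom_flift[OF l G ab])
  from Cons.IH[OF ps] obtain N0 where N0: "N0 \<in> L.G.LN"
    "\<forall>N\<in>L.G.LN. N \<subseteq> N0 \<longrightarrow> (\<forall>g\<in>carrier free2. f N = N #>\<^bsub>free2\<^esub> g \<longrightarrow> EL l G ps f M = M #>\<^bsub>G\<^esub> WL G ps g)"
    by (elim bexE)
  show ?case
  proof (intro bexI[of _ "N0 \<inter> L.pre M"] ballI impI)
    show "N0 \<inter> L.pre M \<in> L.G.LN" by (rule L.G.LN_Int[OF N0(1) L.pre_LN[OF M]])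
    fix N g assume N: "N \<in> L.G.LN" "N \<subseteq> N0 \<inter> L.pre M" and g: "g \<in> carrier free2" "f N = N #>\<^bsub>free2\<^esub> g"
    have "evG l G a b f M = M #>\<^bsub>G\<^esub> flift G a b g"
      unfolding evG_def F2_subst_eq[OF l G ab f] using N by (intro L.pro_map_comp[OF f M N(1) _ g]) auto
    moreover have "EL l G ps f M = M #>\<^bsub>G\<^esub> WL G ps g" using N0(2)[rule_format, OF N(1) _ g] N(2) by simp
    ultimately show "EL l G (p # ps) f M = M #>\<^bsub>G\<^esub> WL G (p # ps) g"
      unfolding p EL_simps WL_simps L.G'.pro_mult[OF M]
      using L.G'.coset_mult[OF M flift_closed[OF G ab g(1)] WL_closed[OF G g(1) ps]] by simp
  qed
qed

context free_pro
begin

definition fm :: "pro_free2 \<Rightarrow> ('g::finite, int) fmat \<Rightarrow> ('g, int) fmat \<Rightarrow> ('g, 'l padic_int) fmat" where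
  "fm f A B = fe fsc (mag f) (fZ A) (fZ B)"

text \<open>Modulo any power of \<open>l\<close> and in any bounded degree both products are those
  of a word \<open>g\<close> close to \<open>f\<close>, and the two group elements so obtained lie
  in the same coset of a congruence subgroup.\<close>

lemma EL_matrix:
  fixes r :: "'h \<Rightarrow> ('g::finite, int) fmat" and G :: "('h, 'b) monoid_scheme"
  assumes R: "unip_rep G l r" and f: "f \<in> carrier (F2 l)"
    and ps: "set ps \<subseteq> carrier G \<times> carrier G" and qs: "set qs \<subseteq> carrier G \<times> carrier G"
    and eq: "EL l G ps f = EL l G qs f"
  shows "prod_list (map (\<lambda>(a, b). fm f (r a) (r b)) ps) = prod_list (map (\<lambda>(a, b). fm f (r a) (r b)) qs)"
proof (rule JZ_eqI)
  fix n d
  interpret R: unip_rep G l r by (rule R)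
  note G = R.is_group
  let ?M = "R.NJ (n + d) d"
  from EL_coset[OF prime_l G f ps R.NJ_LN[of "n + d" d]] obtain N1 where N1: "N1 \<in> F.LN"
    "\<forall>N\<in>F.LN. N \<subseteq> N1 \<longrightarrow> (\<forall>g\<in>carrier free2. f N = N #>\<^bsub>free2\<^esub> g \<longrightarrow> EL l G ps f ?M = ?M #>\<^bsub>G\<^esub> WL G ps g)"
    by (elim bexE)
  from EL_coset[OF prime_l G f qs R.NJ_LN[of "n + d" d]] obtain N2 where N2: "N2 \<in> F.LN"
    "\<forall>N\<in>F.LN. N \<subseteq> N2 \<longrightarrow> (\<forall>g\<in>carrier free2. f N = N #>\<^bsub>free2\<^esub> g \<longrightarrow> EL l G qs f ?M = ?M #>\<^bsub>G\<^esub> WL G qs g)"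
    by (elim bexE)
  \<comment> \<open>At this common refinement one word represents \<open>f\<close> for both products
    and for the Magnus series.\<close>
  define N where "N = N1 \<inter> N2 \<inter> F.NJ (n + d) d"
  have N: "N \<in> F.LN" "N \<subseteq> N1" "N \<subseteq> N2" "N \<subseteq> F.NJ (n + d) d"
    unfolding N_def by (auto intro: F.LN_Int F.NJ_LN N1(1) N2(1))
  obtain g where g: "g \<in> carrier free2" "f N = N #>\<^bsub>free2\<^esub> g" using F.pro_rep[OF f N(1)] by blast
  have "?M #>\<^bsub>G\<^esub> WL G ps g = ?M #>\<^bsub>G\<^esub> WL G qs g"
    using N1(2)[rule_format, OF N(1,2) g] N2(2)[rule_format, OF N(1,3) g] eq by simp
  then have "r (WL G ps g) - r (WL G qs g) \<in> J l (n + d) d"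
    by (rule R.NJ_coset[OF WL_closed[OF G g(1) ps] WL_closed[OF G g(1) qs]])
  then have "r (WL G ps g) - r (WL G qs g) \<in> JZ CARD('l) n d" by (simp add: J_JZ l_def)
  from fZ_JZ[OF this] have mid: "fZ (r (WL G ps g)) - fZ (r (WL G qs g)) \<in> (JZ CARD('l) n d :: ('g, 'l padic_int) fmat set)"
    by (simp only: filtered_homD(5)[OF filtered_hom_fZ])
  have one: "fm f (r a) (r b) - fZ (r (flift G a b g)) \<in> JZ CARD('l) n d" if ab: "a \<in> carrier G" "b \<in> carrier G" for a b
  proof -
    note u = R.r_unip[OF ab(1)] R.r_unip[OF ab(2)]
    have h: "(\<lambda>c. r (flift G a b c)) \<in> hom free2 mulmon"
      using flift_hom(1)[OF G ab] flift_closed[OF G ab] by (intro homI) (auto simp: hom_mult R.r_mult)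
    have "r (flift G a b g) = rl (r a) (r b) g"
      by (rule hom_rl_eqI[OF h _ u _ _ g(1)]) (simp_all add: flift_hom(2,3)[OF G ab] R.r_one)
    then have "fZ (r (flift G a b g)) = (rl (fZ (r a)) (fZ (r b)) g :: ('g, 'l padic_int) fmat)"
      using filtered_hom_rl[OF filtered_hom_fZ u g(1)] by simp
    then show ?thesis
      unfolding fm_def using fe_mag_approx[OF f N(1,4) g filtered_hom_unip[OF filtered_hom_fZ u(1)] filtered_hom_unip[OF filtered_hom_fZ u(2)]]
      by (simp add: l_def)
  qed
  have lst: "prod_list (map (\<lambda>(a, b). fm f (r a) (r b)) xs) - fZ (r (WL G xs g)) \<in> JZ CARD('l) n d"
    if "set xs \<subseteq> carrier G \<times> carrier G" for xs
    using that
  proof (induction xs)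
    case Nil
    then show ?case by (simp add: R.r_one filtered_homD(2)[OF filtered_hom_fZ] JZ_def fmat_simps)
  next
    case (Cons p xs)
    obtain a b where p: "p = (a, b)" by force
    have ab: "a \<in> carrier G" "b \<in> carrier G" "set xs \<subseteq> carrier G \<times> carrier G" using Cons.prems p by auto
    show ?case
      using JZ_mult_cong[OF one[OF ab(1,2)] Cons.IH[OF ab(3)]] WL_closed[OF G g(1) ab(3)] flift_closed[OF G ab(1,2) g(1)]
      by (simp add: p R.r_mult filtered_homD(4)[OF filtered_hom_fZ])
  qed
  show "prod_list (map (\<lambda>(a, b). fm f (r a) (r b)) ps) - prod_list (map (\<lambda>(a, b). fm f (r a) (r b)) qs) \<in> JZ CARD('l) n d"
    by (rule JZ_trans[OF lst[OF ps] JZ_trans[OF mid JZ_sym[OF lst[OF qs]]]])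
qed

end

subsection \<open>Commuting arguments\<close>

text \<open>The exponent sum of a letter is its linear Magnus coefficient, which makes it accessible
  from \<open>mag f\<close>.\<close>

definition expo :: "xy \<Rightarrow> xy gword set \<Rightarrow> int" where
  "expo h g = nc_coeff (mu g) [h]"

lemma mu_hom: "mu \<one>\<^bsub>free2\<^esub> = 1" "g \<in> carrier free2 \<Longrightarrow> g' \<in> carrier free2 \<Longrightarrow> mu (g \<otimes>\<^bsub>free2\<^esub> g') = mu g * mu g'"
    "g \<in> carrier free2 \<Longrightarrow> unip (mu g)" "mu (free2_gen h) = 1 + nc_var h"
  by (simp_all add: mu_def rl_hom rl_mult rl_unip split: xy.split)

lemma fe_one_one: "fe sc F 1 1 = sc (nc_coeff F [])"
proof (rule fil_eqI)
  fix n
  have e: "case_xy 0 0 = (\<lambda>_. 0 :: 'a)" by (auto simp: fun_eq_iff split: xy.split)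
  have "(\<Sum>w | length w < n. sc (nc_coeff F w) * prod_list (map (\<lambda>_. 0) w))
    = (\<Sum>w :: xy list | length w < n. if w = [] then sc (nc_coeff F []) else 0)"
    by (intro sum.cong) (auto simp: neq_Nil_conv)
  also have "\<dots> = (if n = 0 then 0 else sc (nc_coeff F []))"
    using finite_subset[of "{w :: xy list. length w < n}" "{w. length w \<le> n}"] by (auto simp: sum.delta)
  finally show "fe sc F 1 1 - sc (nc_coeff F []) \<in> fil n"
    using ev_approx[of "\<lambda>_. 0" sc F n] by (cases "n = 0") (simp_all add: fe_def e)
qed

lemma expo_one: "expo h \<one>\<^bsub>free2\<^esub> = 0"
  by (simp add: expo_def mu_hom nc_simps)

lemma expo_mult: "g \<in> carrier free2 \<Longrightarrow> g' \<in> carrier free2 \<Longrightarrow> expo h (g \<otimes>\<^bsub>free2\<^esub> g') = expo h g + expo h g'"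
  using mu_hom(3)[of g] mu_hom(3)[of g']
  by (simp add: expo_def mu_hom nc_simps times_ncfps.rep_eq unip_ncfps_iff)

lemma expo_gen: "expo h (free2_gen g) = (if g = h then 1 else 0)"
  by (simp add: expo_def mu_hom nc_simps)

lemma flift_pow:
  fixes i j :: int and G :: "('h, 'b) monoid_scheme"
  assumes G: "group G" and a: "a \<in> carrier G" and g: "g \<in> carrier free2"
  shows "flift G (a [^]\<^bsub>G\<^esub> i) (a [^]\<^bsub>G\<^esub> j) g = a [^]\<^bsub>G\<^esub> (i * expo gX g + j * expo gY g)"
proof -
  interpret G: group G by (rule G)
  note h = flift_hom[OF G G.int_pow_closed[OF a] G.int_pow_closed[OF a], of i j]
  show ?thesis
  proof (rule hom_free2_eqI[OF G.is_monoid h(1) _ h(3) _ _ g])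
    show "(\<lambda>g. a [^]\<^bsub>G\<^esub> (i * expo gX g + j * expo gY g)) \<in> hom free2 G"
    proof (rule homI)
      fix x y assume xy: "x \<in> carrier free2" "y \<in> carrier free2"
      have "i * expo gX (x \<otimes>\<^bsub>free2\<^esub> y) + j * expo gY (x \<otimes>\<^bsub>free2\<^esub> y)
        = (i * expo gX x + j * expo gY x) + (i * expo gX y + j * expo gY y)"
        by (simp add: expo_mult xy distrib_left)
      then show "a [^]\<^bsub>G\<^esub> (i * expo gX (x \<otimes>\<^bsub>free2\<^esub> y) + j * expo gY (x \<otimes>\<^bsub>free2\<^esub> y))
        = a [^]\<^bsub>G\<^esub> (i * expo gX x + j * expo gY x) \<otimes>\<^bsub>G\<^esub> a [^]\<^bsub>G\<^esub> (i * expo gX y + j * expo gY y)"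
        by (simp only: G.int_pow_mult[OF a])
    qed (use a in simp)
    show "a [^]\<^bsub>G\<^esub> (i * expo gX \<one>\<^bsub>free2\<^esub> + j * expo gY \<one>\<^bsub>free2\<^esub>) = \<one>\<^bsub>G\<^esub>"
      using a by (simp add: expo_one)
    show "flift G (a [^]\<^bsub>G\<^esub> i) (a [^]\<^bsub>G\<^esub> j) (free2_gen h) = a [^]\<^bsub>G\<^esub> (i * expo gX (free2_gen h) + j * expo gY (free2_gen h))" for h
      using a by (cases h) (simp_all add: h(2) expo_gen)
  qed
qed

definition unip_group :: "'r::filtered_ring monoid" where
  "unip_group = \<lparr>carrier = Collect unip, mult = (*), one = 1\<rparr>"

lemma unip_group_simps [simp]:
  "carrier unip_group = Collect unip" "x \<otimes>\<^bsub>unip_group\<^esub> y = x * y" "\<one>\<^bsub>unip_group\<^esub> = 1"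
  by (simp_all add: unip_group_def)

lemma group_unip_group: "group unip_group"
  by (rule groupI) (auto simp: mult.assoc intro: unip_mult unip_uinv uinv_left)

lemma pow_unip_group: "a [^]\<^bsub>unip_group\<^esub> (n :: nat) = a ^ n"
  by (induction n) (simp_all add: power_commutes)

lemma rl_flift:
  assumes "unip a" "unip b" "g \<in> carrier free2"
  shows "rl a b g = flift unip_group a b g"
proof -
  note h = flift_hom[OF group_unip_group, of a b]
  have "flift unip_group a b \<in> hom free2 mulmon"
    using h(1) assms(1,2) by (auto simp: hom_def)
  then show ?thesis
    using hom_rl_eqI[of "flift unip_group a b", OF _ _ assms(1,2) _ _ assms(3)] h(2,3) assms(1,2) by simp
qed

text \<open>A word in \<open>C\<close> and 1 is the power of \<open>C\<close> with its exponent sum,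
  so divisibility of that sum by \<open>l ^ k\<close> puts it close to 1.\<close>

lemma rl_power_J:
  fixes C :: "('g::finite, int) fmat"
  assumes C: "unip C" and g: "g \<in> carrier free2"
  shows "int l ^ k dvd expo gX g \<Longrightarrow> rl C 1 g - 1 \<in> J l (Suc k) d"
    "int l ^ k dvd expo gY g \<Longrightarrow> rl 1 C g - 1 \<in> J l (Suc k) d"
proof -
  interpret U: group unip_group by (rule group_unip_group)
  have C': "C \<in> carrier unip_group" using C by simp
  have pow: "C [^]\<^bsub>unip_group\<^esub> e - 1 \<in> J l (Suc k) d" if "int l ^ k dvd e" for e
  proof -
    from that obtain q where q: "e = q * int (l ^ k)" by (auto simp: dvd_def mult.commute)
    have "C [^]\<^bsub>unip_group\<^esub> e = (C [^]\<^bsub>unip_group\<^esub> q) ^ (l ^ k)"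
      using C' by (simp only: q U.int_pow_pow[symmetric] int_pow_int pow_unip_group)
    moreover have "unip (C [^]\<^bsub>unip_group\<^esub> q)" using U.int_pow_closed[OF C'] by simp
    ultimately show ?thesis using J_power_l_power by metis
  qed
  have "rl C 1 g = C [^]\<^bsub>unip_group\<^esub> expo gX g" "rl 1 C g = C [^]\<^bsub>unip_group\<^esub> expo gY g"
    using flift_pow[OF group_unip_group C' g, of 1 0] flift_pow[OF group_unip_group C' g, of 0 1] C g
    by (simp_all add: rl_flift U.int_pow_1[OF C'])
  then show "int l ^ k dvd expo gX g \<Longrightarrow> rl C 1 g - 1 \<in> J l (Suc k) d"
    "int l ^ k dvd expo gY g \<Longrightarrow> rl 1 C g - 1 \<in> J l (Suc k) d" using pow by simp_all
qed

text \<open>Two inductions on words: one moves a single letter past the first word, the other moves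
  the whole second word past it. The product then respects multiplication and has the right values
  on generators.\<close>

lemma rl_commuting:
  assumes u: "unip A" "unip B" "unip A'" "unip B'" and g: "g \<in> carrier free2"
    and c: "\<And>U V. U \<in> {A, B} \<Longrightarrow> V \<in> {A', B'} \<Longrightarrow> V * U = U * V"
  shows "rl (A * A') (B * B') g = rl A B g * rl A' B' g"
proof -
  have comm: "V * rl A B x = rl A B x * V" if "V \<in> {A', B'}" "x \<in> carrier free2" for V x
    using that(2)
  proof (induction x rule: free2_induct)
    case one
    then show ?case by (simp add: rl_hom u)
  next
    case (gen h x)
    have "V * case_xy A B h = case_xy A B h * V" using c[of _ V] that(1) by (cases h) auto
    then have "V * case_xy A B h * rl A B x = case_xy A B h * (V * rl A B x)" by (simp add: mult.assoc)
    then show ?case using gen by (simp add: rl_mult rl_hom u mult.assoc)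
  next
    case (inv h x)
    have "unip (case_xy A B h)" using u by (cases h) auto
    moreover have "V * case_xy A B h = case_xy A B h * V" using c[of _ V] that(1) by (cases h) auto
    ultimately have "V * uinv (case_xy A B h) = uinv (case_xy A B h) * V" using uinv_commute by metis
    then have "V * uinv (case_xy A B h) * rl A B x = uinv (case_xy A B h) * (V * rl A B x)" by (simp add: mult.assoc)
    moreover have "inv\<^bsub>free2\<^esub> free2_gen h \<in> carrier free2" using group.inv_closed[OF group_free2] by simp
    ultimately show ?case using inv by (simp add: rl_mult rl_inv_gen u mult.assoc)
  qed
  have comm': "rl A' B' y * rl A B x = rl A B x * rl A' B' y" if "x \<in> carrier free2" "y \<in> carrier free2" for x y
    using that(2)
  proof (induction y rule: free2_induct)
    case one
    then show ?case by (simp add: rl_hom u)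
  next
    case (gen h y)
    have "case_xy A' B' h * rl A B x = rl A B x * case_xy A' B' h" using comm[OF _ that(1)] by (cases h) auto
    then have "case_xy A' B' h * (rl A B x * rl A' B' y) = rl A B x * (case_xy A' B' h * rl A' B' y)"
      by (simp flip: mult.assoc)
    then show ?case using gen by (simp add: rl_mult rl_hom u mult.assoc)
  next
    case (inv h y)
    have "unip (case_xy A' B' h)" using u by (cases h) auto
    moreover have "case_xy A' B' h * rl A B x = rl A B x * case_xy A' B' h" using comm[OF _ that(1)] by (cases h) auto
    ultimately have "uinv (case_xy A' B' h) * rl A B x = rl A B x * uinv (case_xy A' B' h)" using uinv_commute by metis
    then have "uinv (case_xy A' B' h) * (rl A B x * rl A' B' y) = rl A B x * (uinv (case_xy A' B' h) * rl A' B' y)"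
      by (simp flip: mult.assoc)
    moreover have "inv\<^bsub>free2\<^esub> free2_gen h \<in> carrier free2" using group.inv_closed[OF group_free2] by simp
    ultimately show ?case using inv by (simp add: rl_mult rl_inv_gen u mult.assoc)
  qed
  have "rl A B x * rl A B y * (rl A' B' x * rl A' B' y) = rl A B x * rl A' B' x * (rl A B y * rl A' B' y)"
    if "x \<in> carrier free2" "y \<in> carrier free2" for x y
  proof -
    have "rl A B x * rl A B y * (rl A' B' x * rl A' B' y) = rl A B x * (rl A B y * rl A' B' x) * rl A' B' y"
      by (simp only: mult.assoc)
    also have "rl A B y * rl A' B' x = rl A' B' x * rl A B y" using comm'[OF that(2,1)] by simp
    finally show ?thesis by (simp only: mult.assoc)
  qed
  then have h: "(\<lambda>x. rl A B x * rl A' B' x) \<in> hom free2 mulmon"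
    by (intro homI) (simp_all add: rl_mult u)
  show ?thesis
    by (rule hom_rl_eqI[OF h _ unip_mult[OF u(1,3)] unip_mult[OF u(2,4)] _ _ g, symmetric])
      (simp_all add: rl_hom u)
qed

section \<open>The pentagon in the four representations\<close>

context free_pro
begin

lemma pentagon_EL:
  assumes p: "pentagon l f" and f: "f \<in> carrier (F2 l)"
  defines "x \<equiv> pure_braid_gen 4"
  shows "EL l P4 [(x 1 2, x 2 3 \<otimes>\<^bsub>P4\<^esub> x 2 4), (x 1 3 \<otimes>\<^bsub>P4\<^esub> x 2 3, x 3 4)] f =
    EL l P4 [(x 2 3, x 3 4), (x 1 2 \<otimes>\<^bsub>P4\<^esub> x 1 3, x 2 4 \<otimes>\<^bsub>P4\<^esub> x 3 4), (x 1 2, x 2 3)] f"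
proof -
  interpret L: l_group P4 l using prime_l group_P4 by (simp add: l_group_def l_group_axioms_def)
  interpret K: group "K4 l" by (rule L.group_pro)
  note c = evG_closed[OF prime_l group_P4 _ _ f] pure_gens_closed L.m_closed
  have "evG l P4 (x 1 2) (x 2 3 \<otimes>\<^bsub>P4\<^esub> x 2 4) f \<otimes>\<^bsub>K4 l\<^esub> evG l P4 (x 1 3 \<otimes>\<^bsub>P4\<^esub> x 2 3) (x 3 4) f
    = evG l P4 (x 2 3) (x 3 4) f \<otimes>\<^bsub>K4 l\<^esub> evG l P4 (x 1 2 \<otimes>\<^bsub>P4\<^esub> x 1 3) (x 2 4 \<otimes>\<^bsub>P4\<^esub> x 3 4) f \<otimes>\<^bsub>K4 l\<^esub> evG l P4 (x 1 2) (x 2 3) f"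
    using p by (simp add: evG_def x_def pentagon_def Let_def L.pro_of_mult pure_gens_closed)
  then show ?thesis by (simp add: x_def c K.m_assoc)
qed

lemma pentagon_rho:
  assumes p: "pentagon l f" and f: "f \<in> carrier (F2 l)" and s: "s \<in> {1..4}"
  defines "r \<equiv> \<lambda>i j. A.st.\<rho> s (pure_braid_gen 4 i j)"
  shows "fm f (r 1 2) (r 2 3 * r 2 4) * fm f (r 1 3 * r 2 3) (r 3 4) =
    fm f (r 2 3) (r 3 4) * fm f (r 1 2 * r 1 3) (r 2 4 * r 3 4) * fm f (r 1 2) (r 2 3)"
proof -
  interpret R: unip_rep P4 l "A.st.\<rho> s" by (rule unip_rep_P4[OF prime_l s])
  show ?thesis
    using EL_matrix[OF R.unip_rep_axioms f _ _ pentagon_EL[OF p f]]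
    by (simp add: r_def R.r_mult pure_gens_closed mult.assoc)
qed

text \<open>Positions one to four of the distinguished strand give, in this order, the hypotheses
  \<open>P1\<close> to \<open>P4\<close> of \<open>hexagon_cocycle\<close>.\<close>

lemma pentagon_matrices:
  assumes p: "pentagon l f" and f: "f \<in> carrier (F2 l)"
  shows "fm f lm1 (A.t12 * A.t13) * fm f (lm2 * A.t12) A.t23
      = fm f A.t12 A.t23 * fm f (lm1 * lm2) (A.t13 * A.t23) * fm f lm1 A.t12"
    and "fm f lm1 (lm2 * lm3) * fm f (lm2 * A.t12) A.t23
      = fm f lm2 A.t23 * fm f (A.t12 * lm1) (lm3 * A.t23) * fm f lm1 lm2"
    and "fm f A.t12 (A.t23 * lm2) * fm f (lm1 * lm2) lm3
      = fm f lm2 lm3 * fm f (A.t12 * lm1) (lm3 * A.t23) * fm f A.t12 lm2"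
    and "fm f A.t12 (A.t23 * lm2) * fm f (A.t13 * A.t23) lm3
      = fm f A.t23 lm3 * fm f (A.t12 * A.t13) (lm2 * lm3) * fm f A.t12 A.t23"
  using pentagon_rho[OF p f, of 1] pentagon_rho[OF p f, of 2] pentagon_rho[OF p f, of 3] pentagon_rho[OF p f, of 4]
  by (simp_all add: A.\<rho>_gens A.pentagon_terms A.t12_def[symmetric] A.t23_def[symmetric] A.t13_def[symmetric])

lemma fm_linear:
  assumes f: "f \<in> carrier (F2 l)" and u: "unip A" "unip B"
  shows "entry (fm f A B) [g] [] = nc_coeff (mag f) [gX] * of_int (entry A [g] []) + nc_coeff (mag f) [gY] * of_int (entry B [g] [])"
    and "unip (fm f A B)"
proof -
  let ?A = "fZ A :: ('a, 'l padic_int) fmat" and ?B = "fZ B :: ('a, 'l padic_int) fmat"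
  have u': "unip ?A" "unip ?B" using u by (simp_all add: filtered_hom_unip[OF filtered_hom_fZ])
  show "unip (fm f A B)" unfolding fm_def by (rule fe_unip[OF scal_fsc mag_Nil[OF f] u'])
  have q: "fsc c * (M * N) \<in> fil 2" if "M \<in> fil 1" "N \<in> fil 1" for c :: "'l padic_int" and M N :: "('a, 'l padic_int) fmat"
    using fil_mult_left[OF fil_mult[OF that]] by (simp add: numeral_2_eq_2 One_nat_def)
  let ?L = "fsc (nc_coeff (mag f) [gX]) * (?A - 1) + fsc (nc_coeff (mag f) [gY]) * (?B - 1)"
  have "fm f A B - (1 + ?L) \<in> fil 2"
  proof -
    note v = unip_fil[OF u'(1)] unip_fil[OF u'(2)]
    let ?s = "fsc (nc_coeff (mag f) [gX, gX]) * ((?A - 1) * (?A - 1)) + fsc (nc_coeff (mag f) [gX, gY]) * ((?A - 1) * (?B - 1))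
      + fsc (nc_coeff (mag f) [gY, gX]) * ((?B - 1) * (?A - 1)) + fsc (nc_coeff (mag f) [gY, gY]) * ((?B - 1) * (?B - 1))"
    have s: "?s \<in> fil 2" by (intro fil_add q v)
    have "fm f A B - (1 + ?L + ?s) \<in> fil 3"
      using fe_expand[OF scal_fsc u', of "mag f"] by (simp add: fm_def mag_Nil[OF f] scalD(1)[OF scal_fsc] scalD(2)[OF scal_fsc] add.assoc)
    then have "fm f A B - (1 + ?L + ?s) \<in> fil 2" by (rule fil_mono) simp
    from fil_add[OF this s] show ?thesis by (simp add: algebra_simps)
  qed
  then have "entry (fm f A B - (1 + ?L)) [g] [] = 0" by (simp add: fil_fmat_iff)
  then show "entry (fm f A B) [g] [] = nc_coeff (mag f) [gX] * of_int (entry A [g] []) + nc_coeff (mag f) [gY] * of_int (entry B [g] [])"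
    by (simp add: fmat_simps fsc_mult entry_fmap[OF rhom_of_int])
qed

lemma entry_unip_mult:
  assumes "unip A" "unip B" shows "entry (A * B) [g] [] = entry A [g] [] + entry B [g] []"
proof -
  have "(A - 1) * (B - 1) \<in> fil (1 + 1)" by (intro fil_mult unip_fil assms)
  then have "entry ((A - 1) * (B - 1)) [g] [] = 0" by (simp add: fil_fmat_iff)
  then show ?thesis by (simp add: algebra_simps fmat_simps(1-5))
qed

lemma t_unip: "unip A.t12" "unip A.t13" "unip A.t23"
  using unip_rho[OF _ pure_gens_closed(1), of 4] unip_rho[OF _ pure_gens_closed(4), of 4] unip_rho[OF _ pure_gens_closed(2), of 4]
  by (simp_all add: A.\<rho>_gens A.t_defs)

lemma lm_unip: "unip lm1" "unip lm2" "unip lm3"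
  by (intro filtered_hom_unip[OF filtered_hom_lmul] unip_var)+

text \<open>Twists are automorphisms and fix 1, so they contribute nothing to linear terms.\<close>

lemma t_linear: "entry A.t12 [g] [] = 0" "entry A.t13 [g] [] = 0" "entry A.t23 [g] [] = 0"
  by (simp_all add: entry_fapp word_def A.t_defs fapp_mult fapp_T_1 nc_simps)

lemma lm_linear: "entry (lmul (1 + nc_var h)) [g] [] = (if g = h then 1 else 0)"
  by (auto simp: entry_lmul nc_simps)

text \<open>If \<open>p\<close> and \<open>q\<close> are the two linear coefficients, the variable
  \<open>st1\<close> in position one yields \<open>p = 2 p\<close>, and \<open>st3\<close> in
  position four yields \<open>q = 2 q\<close>.\<close>

lemma mag_linear:
  assumes p: "pentagon l f" and f: "f \<in> carrier (F2 l)"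
  shows "nc_coeff (mag f) [gX] = 0" "nc_coeff (mag f) [gY] = 0"
proof -
  note u = t_unip lm_unip unip_mult fm_linear(2)[OF f]
  note s = entry_unip_mult fm_linear(1)[OF f] u t_linear lm_linear
  show "nc_coeff (mag f) [gX] = 0"
    using arg_cong[OF pentagon_matrices(1)[OF p f], of "\<lambda>M. entry M [st1] []"] by (simp add: s)
  show "nc_coeff (mag f) [gY] = 0"
    using arg_cong[OF pentagon_matrices(4)[OF p f], of "\<lambda>M. entry M [st3] []"] by (simp add: s)
qed

end

locale linear_free = free_pro l L for l and L :: "'l::prime_card itself" +
  fixes f :: pro_free2
  assumes f: "f \<in> carrier (F2 l)" and mag_lin: "nc_coeff (mag f) [h] = 0"
begin

text \<open>The exponent sum of an approximating word is close to the linear coefficient of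
  \<open>mag f\<close>, which is 0.\<close>

lemma expo_dvd:
  assumes N: "N \<in> F.LN" "N \<subseteq> F.NJ (k + 1) 1" and g: "g \<in> carrier free2" "f N = N #>\<^bsub>free2\<^esub> g"
  shows "int l ^ k dvd expo h g"
proof -
  have "of_nat l ^ k dvd nc_coeff (mag f) [h] - of_int (expo h g)"
    using mag_approx[OF f N g, of "[h]"] by (simp add: expo_def)
  then have "of_nat l ^ k dvd (of_int (expo h g) :: 'l padic_int)" by (simp add: mag_lin)
  then show ?thesis unfolding l_def padic_dvd_of_int .
qed

text \<open>The factor by which \<open>C\<close> changes a word is a power of \<open>C\<close> whose exponent tends to 0 because \<open>f\<close>
  has no linear terms.\<close>

lemma fm_central:
  fixes A B C :: "('g::finite, int) fmat"
  assumes u: "unip A" "unip B" "unip C" and c: "C * A = A * C" "C * B = B * C"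
  shows "fm f (A * C) B = fm f A B" "fm f A (B * C) = fm f A B"
proof -
  have key: "fm f (A * A') (B * B') = fm f A B" if AB: "(A', B') = (C, 1) \<or> (A', B') = (1, C)" for A' B'
  proof (rule JZ_eqI)
    fix n d :: nat
    \<comment> \<open>Exponents divisible by \<open>l ^ (n + d)\<close> yield
      \<open>J l (n + d + 1) d\<close>, hence a congruence modulo \<open>l ^ n\<close> in degrees up
      to \<open>d\<close>.\<close>
    define k where "k = n + d"
    have u': "unip A'" "unip B'" using AB u(3) by auto
    define N where "N = F.NJ (n + d) d \<inter> F.NJ (k + 1) 1"
    have N: "N \<in> F.LN" "N \<subseteq> F.NJ (n + d) d" "N \<subseteq> F.NJ (k + 1) 1"
      unfolding N_def by (auto intro: F.LN_Int F.NJ_LN)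
    obtain g where g: "g \<in> carrier free2" "f N = N #>\<^bsub>free2\<^esub> g" using F.pro_rep[OF f N(1)] by blast
    have "rl A' B' g - 1 \<in> J l (Suc k) d"
      using AB rl_power_J[OF u(3) g(1)] expo_dvd[OF N(1,3) g] by auto
    then have "rl A' B' g - 1 \<in> J l (n + d) d" by (rule J_mono) (simp add: k_def)
    then have "rl A B g * (rl A' B' g - 1) \<in> JZ l n d" by (intro J_JZ J_left)
    moreover have "rl (A * A') (B * B') g = rl A B g * rl A' B' g"
      by (rule rl_commuting[OF u(1,2) u' g(1)]) (use AB c in auto)
    ultimately have "rl (A * A') (B * B') g - rl A B g \<in> JZ l n d" by (simp add: right_diff_distrib)
    then have mid: "fZ (rl (A * A') (B * B') g) - fZ (rl A B g) \<in> (JZ CARD('l) n d :: ('g, 'l padic_int) fmat set)"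
      using fZ_JZ by (metis l_def filtered_homD(5)[OF filtered_hom_fZ])
    have one: "fm f P Q - fZ (rl P Q g) \<in> JZ CARD('l) n d" if "unip P" "unip Q" for P Q :: "('g, int) fmat"
      unfolding fm_def using fe_mag_approx[OF f N(1,2) g filtered_hom_unip[OF filtered_hom_fZ that(1)] filtered_hom_unip[OF filtered_hom_fZ that(2)]]
      by (simp add: l_def filtered_hom_rl[OF filtered_hom_fZ that g(1)])
    show "fm f (A * A') (B * B') - fm f A B \<in> JZ CARD('l) n d"
      by (rule JZ_trans[OF one JZ_trans[OF mid JZ_sym[OF one]]]) (intro u u' unip_mult)+
  qed
  from key[of C 1] key[of 1 C] show "fm f (A * C) B = fm f A B" "fm f A (B * C) = fm f A B" by simp_all
qed

lemma fm_commuting: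
  fixes A B :: "('g::finite, int) fmat"
  assumes u: "unip A" "unip B" and c: "A * B = B * A"
  shows "fm f A B = 1"
proof -
  have "fm f A B = fm f (1 * A) B" by simp
  also have "\<dots> = fm f 1 B" by (rule fm_central) (use assms in auto)
  also have "\<dots> = fm f 1 (1 * B)" by simp
  also have "\<dots> = fm f 1 1" by (rule fm_central) (use assms in auto)
  also have "\<dots> = fsc (nc_coeff (mag f) [])"
    by (simp add: fm_def fe_one_one filtered_homD(2)[OF filtered_hom_fZ])
  finally show ?thesis by (simp add: mag_Nil[OF f] scalD(2)[OF scal_fsc])
qed

text \<open>The same principle inside a completion: approximating words become powers of
  \<open>a\<close> whose exponents are divisible by any given power of \<open>l\<close>.\<close>

lemma evG_powers:
  fixes i j :: int and G :: "('h, 'b) monoid_scheme"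
  assumes G: "group G" and a: "a \<in> carrier G"
  shows "evG l G (a [^]\<^bsub>G\<^esub> i) (a [^]\<^bsub>G\<^esub> j) f = \<one>\<^bsub>pro_completion l G\<^esub>"
proof -
  interpret G: l_group G l using prime_l G by (simp add: l_group_def l_group_axioms_def)
  have ij: "a [^]\<^bsub>G\<^esub> i \<in> carrier G" "a [^]\<^bsub>G\<^esub> j \<in> carrier G" using a by simp_all
  show ?thesis
  proof (rule G.pro_eqI[OF evG_closed[OF prime_l G ij f] G.pro_one_closed])
    fix M assume M: "M \<in> G.LN"
    obtain k where k: "a [^]\<^bsub>G\<^esub> (l ^ k) \<in> M" using G.LN_pow[OF M a] by blast
    from EL_coset[OF prime_l G f _ M, of "[(a [^]\<^bsub>G\<^esub> i, a [^]\<^bsub>G\<^esub> j)]"]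
    obtain N0 where N0: "N0 \<in> F.LN"
      "\<forall>N\<in>F.LN. N \<subseteq> N0 \<longrightarrow> (\<forall>g\<in>carrier free2. f N = N #>\<^bsub>free2\<^esub> g \<longrightarrow>
        EL l G [(a [^]\<^bsub>G\<^esub> i, a [^]\<^bsub>G\<^esub> j)] f M = M #>\<^bsub>G\<^esub> WL G [(a [^]\<^bsub>G\<^esub> i, a [^]\<^bsub>G\<^esub> j)] g)"
      using ij by (elim meta_mp[elim_format] bexE) auto
    define N where "N = N0 \<inter> F.NJ (k + 1) 1"
    have N: "N \<in> F.LN" "N \<subseteq> N0" "N \<subseteq> F.NJ (k + 1) 1"
      unfolding N_def by (auto intro: F.LN_Int F.NJ_LN N0)
    obtain g where g: "g \<in> carrier free2" "f N = N #>\<^bsub>free2\<^esub> g" using F.pro_rep[OF f N(1)] by blast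
    have "int (l ^ k) dvd i * expo gX g + j * expo gY g"
      using expo_dvd[OF N(1,3) g] by simp
    then obtain q where q: "i * expo gX g + j * expo gY g = int (l ^ k) * q" by (auto simp: dvd_def)
    have "flift G (a [^]\<^bsub>G\<^esub> i) (a [^]\<^bsub>G\<^esub> j) g = (a [^]\<^bsub>G\<^esub> (l ^ k)) [^]\<^bsub>G\<^esub> q"
      using G.int_pow_pow[OF a, of "int (l ^ k)" q] by (simp only: flift_pow[OF G a g(1)] q int_pow_int)
    also have "\<dots> \<in> M"
      by (rule G.subgroup_int_pow_closed[OF G.LN_subgroup[OF M] k])
    finally have m: "flift G (a [^]\<^bsub>G\<^esub> i) (a [^]\<^bsub>G\<^esub> j) g \<in> M" .
    have "EL l G [(a [^]\<^bsub>G\<^esub> i, a [^]\<^bsub>G\<^esub> j)] f M = M #>\<^bsub>G\<^esub> WL G [(a [^]\<^bsub>G\<^esub> i, a [^]\<^bsub>G\<^esub> j)] g"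
      using N0(2) N(1,2) g by blast
    then have "evG l G (a [^]\<^bsub>G\<^esub> i) (a [^]\<^bsub>G\<^esub> j) f M = M #>\<^bsub>G\<^esub> flift G (a [^]\<^bsub>G\<^esub> i) (a [^]\<^bsub>G\<^esub> j) g"
      using evG_closed[OF prime_l G ij f] flift_closed[OF G ij g(1)] group.is_monoid[OF G.group_pro]
      by (simp add: monoid.r_one)
    also have "\<dots> = M" using subgroup.rcos_const[OF G.LN_subgroup[OF M] G m] .
    finally show "evG l G (a [^]\<^bsub>G\<^esub> i) (a [^]\<^bsub>G\<^esub> j) f M = \<one>\<^bsub>pro_completion l G\<^esub> M"
      by (simp add: G.pro_one[OF M])
  qed
qed

end

section \<open>The 2-cycle relation\<close>

context l_group_hom
begin

lemma pro_map_evG: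
  assumes a: "a \<in> carrier G" and b: "b \<in> carrier G" and f: "f \<in> carrier (F2 l)"
  shows "pro_map l G G' h (evG l G a b f) = evG l G' (h a) (h b) f"
proof -
  note G = G.is_group and G' = G'.is_group
  have hab: "h a \<in> carrier G'" "h b \<in> carrier G'" using a b by (simp_all add: hom.hom_closed)
  interpret L: l_group_hom free2 G "flift G a b" l by (rule l_group_hom_flift[OF G.l G a b])
  interpret L': l_group_hom free2 G' "flift G' (h a) (h b)" l by (rule l_group_hom_flift[OF G.l G' hab])
  note c = evG_closed[OF G.l G a b f] evG_closed[OF G.l G' hab f]
  show ?thesis
  proof (rule G'.pro_eqI[OF pro_map_closed[OF c(1)] c(2)])
    fix M assume M: "M \<in> G'.LN"
    define N where "N = L.pre (pre M) \<inter> L'.pre M"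
    have N: "N \<in> L.G.LN" "N \<subseteq> L.pre (pre M)" "N \<subseteq> L'.pre M"
      unfolding N_def by (rule L.G.LN_Int[OF L.pre_LN[OF pre_LN[OF M]] L'.pre_LN[OF M]]) simp_all
    obtain g where g: "g \<in> carrier free2" "f N = N #>\<^bsub>free2\<^esub> g" using L.G.pro_rep[OF f N(1)] by blast
    have e: "h (flift G a b g) = flift G' (h a) (h b) g"
    proof (rule hom_free2_eqI[OF group.is_monoid[OF G'] _ flift_hom(1)[OF G' hab] _ flift_hom(3)[OF G' hab] _ g(1)])
      show "(\<lambda>g. h (flift G a b g)) \<in> hom free2 G'"
        using hom_compose[OF flift_hom(1)[OF G a b] hom.homh] by (simp add: o_def)
      show "h (flift G a b \<one>\<^bsub>free2\<^esub>) = \<one>\<^bsub>G'\<^esub>" by (simp add: flift_hom(3)[OF G a b])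
      show "h (flift G a b (free2_gen g)) = flift G' (h a) (h b) (free2_gen g)" for g
        by (cases g) (simp_all add: flift_hom(2)[OF G a b] flift_hom(2)[OF G' hab])
    qed
    have "evG l G a b f (pre M) = pre M #> flift G a b g"
      unfolding evG_def F2_subst_eq[OF G.l G a b f] by (rule L.pro_map_comp[OF f pre_LN[OF M] N(1,2) g])
    then have "pro_map l G G' h (evG l G a b f) M = M #>\<^bsub>G'\<^esub> h (flift G a b g)"
      using flift_closed[OF G a b g(1)] by (intro pro_map_comp[OF c(1) M pre_LN[OF M]]) auto
    moreover have "evG l G' (h a) (h b) f M = M #>\<^bsub>G'\<^esub> flift G' (h a) (h b) g"
      unfolding evG_def F2_subst_eq[OF G.l G' hab f] by (rule L'.pro_map_comp[OF f M N(1,3) g])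
    ultimately show "pro_map l G G' h (evG l G a b f) M = evG l G' (h a) (h b) f M" by (simp add: e)
  qed
qed

end

context linear_free
begin

lemma two_cycle:
  assumes p: "pentagon l f"
  shows "two_cycle l f" and "EL l free2 [(free2_gen gX, free2_gen gY), (free2_gen gY, free2_gen gX)] f = EL l free2 [] f"
proof -
  let ?x = "free2_gen gX" and ?y = "free2_gen gY" and ?e = "\<lambda>a b. evG l free2 a b f"
  interpret T: two_generated free2 ?x ?y
    using group_free2 by (simp add: two_generated_def two_generated_axioms_def)
  have "T.st.\<rho> \<in> hom P4 free2"
    by (rule homI) (simp_all add: T.st.\<rho>_closed T.st.\<rho>_mult)
  then interpret \<Theta>: l_group_hom P4 free2 T.st.\<rho> l
    using prime_l group_P4 group_free2
    by (simp add: l_group_hom_def l_group_def l_group_axioms_def group_hom_def group_hom_axioms_def)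
  interpret K: group "F2 l" by (rule l_group.group_pro[OF l_group_free2[OF prime_l]])
  interpret \<Theta>': group_hom "K4 l" "F2 l" "pro_map l P4 free2 T.st.\<rho>"
    using \<Theta>.pro_map_hom \<Theta>.G.group_pro K.is_group by (simp add: group_hom_def group_hom_axioms_def)
  note cl = evG_closed[OF prime_l group_P4 _ _ f] pure_gens_closed \<Theta>.G.m_closed
  have mp: "pro_map l P4 free2 T.st.\<rho> (EL l P4 qs f) = EL l free2 (map (map_prod T.st.\<rho> T.st.\<rho>) qs) f"
    if "set qs \<subseteq> carrier P4 \<times> carrier P4" for qs
    using that
  proof (induction qs)
    case (Cons q qs)
    then show ?case
      using evG_closed[OF prime_l group_P4 _ _ f] EL_closed[OF prime_l group_P4 f]
      by (cases q) (auto simp: \<Theta>.pro_map_evG[OF _ _ f])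
  qed simp
  let ?p = "\<lambda>i j. pure_braid_gen 4 i j"
  let ?ps = "[(?p 1 2, ?p 2 3 \<otimes>\<^bsub>P4\<^esub> ?p 2 4), (?p 1 3 \<otimes>\<^bsub>P4\<^esub> ?p 2 3, ?p 3 4)]"
    and ?qs = "[(?p 2 3, ?p 3 4), (?p 1 2 \<otimes>\<^bsub>P4\<^esub> ?p 1 3, ?p 2 4 \<otimes>\<^bsub>P4\<^esub> ?p 3 4), (?p 1 2, ?p 2 3)]"
  have "EL l free2 (map (map_prod T.st.\<rho> T.st.\<rho>) ?ps) f = EL l free2 (map (map_prod T.st.\<rho> T.st.\<rho>) ?qs) f"
    using mp[of ?ps] mp[of ?qs] pentagon_EL[OF p f] pure_gens_closed
    by (simp del: EL_simps list.map)
  then have "EL l free2 [(?x, inv\<^bsub>free2\<^esub> ?x), (inv\<^bsub>free2\<^esub> ?x, ?x)] f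
    = EL l free2 [(?y, ?x), (inv\<^bsub>free2\<^esub> ?y, inv\<^bsub>free2\<^esub> ?y), (?x, ?y)] f"
    by (simp add: pure_gens_closed T.st.\<rho>_mult T.\<rho>_gens F.m_assoc T.cancel_simps)
  \<comment> \<open>Three of the five factors of the image have powers of one generator as arguments
    and are trivial; what remains is the 2-cycle relation.\<close>
  moreover have "?e ?x (inv\<^bsub>free2\<^esub> ?x) = \<one>\<^bsub>F2 l\<^esub>" "?e (inv\<^bsub>free2\<^esub> ?x) ?x = \<one>\<^bsub>F2 l\<^esub>"
    "?e (inv\<^bsub>free2\<^esub> ?y) (inv\<^bsub>free2\<^esub> ?y) = \<one>\<^bsub>F2 l\<^esub>"
    using evG_powers[OF group_free2 free2_gen_closed, of gX 1 "- 1"] evG_powers[OF group_free2 free2_gen_closed, of gX "- 1" 1]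
      evG_powers[OF group_free2 free2_gen_closed, of gY "- 1" "- 1"]
    by (simp_all add: F.int_pow_neg)
  ultimately have "?e ?y ?x \<otimes>\<^bsub>F2 l\<^esub> ?e ?x ?y = \<one>\<^bsub>F2 l\<^esub>"
    using evG_closed[OF prime_l group_free2 _ _ f] by (simp add: K.m_assoc)
  then have *: "?e ?x ?y \<otimes>\<^bsub>F2 l\<^esub> ?e ?y ?x = \<one>\<^bsub>F2 l\<^esub>"
    using evG_closed[OF prime_l group_free2 _ _ f] by (simp add: K.inv_comm)
  then show "two_cycle l f" by (simp add: two_cycle_def evG_def)
  show "EL l free2 [(?x, ?y), (?y, ?x)] f = EL l free2 [] f"
    using * evG_closed[OF prime_l group_free2 _ _ f] by simp
qed

lemma two_cycle_fm:
  assumes p: "pentagon l f"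
  shows "fm f (lmul mx) (lmul my) * fm f (lmul my) (lmul mx) = 1"
  using EL_matrix[OF F.unip_rep_axioms f _ _ two_cycle(2)[OF p]]
  by (simp add: mu_hom)

end

subsection \<open>Extension of scalars\<close>

instance fract :: ("{idom, ring_char_0}") ring_char_0
proof
  show "inj (of_nat :: nat \<Rightarrow> 'a fract)"
    by (rule injI) (simp add: of_nat_fract eq_fract)
qed

instance fract :: ("{idom, ring_char_0}") field_char_0 ..

definition qp :: "'l::prime_card padic_int \<Rightarrow> 'l padic" where "qp a = Fract a 1"

text \<open>The exponent \<open>m\<close> lives in the algebraic closure, so the integral results
  are carried there at the very end.\<close>

definition qa :: "'l::prime_card padic_int \<Rightarrow> 'l padic alg_closure" where "qa a = to_ac (qp a)"

lemma rhom_qp: "rhom qp"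
  by (simp add: rhom_def qp_def One_fract_def)

lemma rhom_to_ac: "rhom to_ac"
  by (simp add: rhom_def)

lemma rhom_qa: "rhom qa"
  by (simp add: rhom_def qa_def rhomD[OF rhom_qp])

lemma rhom_of_int_eq: "rhom h \<Longrightarrow> h (of_int z) = of_int z"
proof -
  assume h: "rhom h"
  have n: "h (of_nat n) = of_nat n" for n by (induction n) (simp_all add: rhomD[OF h])
  have m: "h (- a) = - h a" for a
    using rhomD(3)[OF h, of a "- a"] by (simp add: rhomD(1)[OF h] eq_neg_iff_add_eq_0 add.commute)
  show ?thesis by (cases z rule: int_cases2) (simp_all add: n m)
qed

abbreviation fQ :: "('g::finite, int) fmat \<Rightarrow> ('g, 'l::prime_card padic alg_closure) fmat" where
  "fQ \<equiv> fmap of_int"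

lemma fmap_qa_fZ: "fmap qa (fZ A) = fQ A"
  by (rule fmat_eqI) (simp add: entry_fmap rhom_of_int rhom_qa rhom_of_int_eq)

lemma filtered_hom_fQ: "filtered_hom (fQ :: ('g::finite, int) fmat \<Rightarrow> ('g, 'l::prime_card padic alg_closure) fmat)"
  by (rule filtered_hom_fmap[OF rhom_of_int])

lemma fQ_lmul: "fQ (lmul s) = lmul (nc_map of_int s)"
  by (rule fmap_lmul[OF rhom_of_int])

lemma lmul_eq_1: "lmul s = 1 \<longleftrightarrow> s = 1"
  using lmul_inject[of s 1] by simp

lemma lmul_fil_iff:
  fixes s :: "('b::finite, 'c::comm_ring_1) ncfps"
  shows "lmul s \<in> fil n \<longleftrightarrow> s \<in> fil n"
proof
  show "lmul s \<in> fil n \<Longrightarrow> s \<in> fil n"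
    unfolding fil_fmat_iff fil_ncfps_iff
  proof (intro allI impI)
    fix u :: "'b list" assume *: "\<forall>u v. length u < length v + n \<longrightarrow> entry (lmul s) u v = 0" and u: "length u < n"
    from *[rule_format, of u "[]"] u show "nc_coeff s u = 0" by (simp add: entry_lmul)
  qed
qed (rule lmul_fil)

section \<open>The hexagon defect of a solution of the pentagon\<close>

locale pentagon_free = free_pro l L for l and L :: "'l::prime_card itself" +
  fixes f :: pro_free2
  assumes f_closed: "f \<in> carrier (F2 l)" and pent: "pentagon l f"
begin

sublocale linear_free l L f
proof
  show "f \<in> carrier (F2 l)" by (rule f_closed)
  show "nc_coeff (mag f) [h] = 0" for h
    using mag_linear[OF pent f_closed] by (cases h) auto
qed

definition K :: "(xy, 'l padic alg_closure) ncfps" where "K = nc_map qa (mag f)"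

lemma fe_K:
  assumes "unip A" "unip B"
  shows "fe fsc K (fQ A) (fQ B) = fmap qa (fm f A B)"
proof -
  note u = filtered_hom_unip[OF filtered_hom_fZ assms(1)] filtered_hom_unip[OF filtered_hom_fZ assms(2)]
  show ?thesis
    unfolding fm_def filtered_hom_fe[OF filtered_hom_fmap[OF rhom_qa] u] fmap_fsc[OF rhom_qa] fmap_qa_fZ
    by (simp add: fe_def ev_map K_def)
qed

lemma lmul_fe:
  fixes a b :: "(xy, int) ncfps"
  assumes "unip a" "unip b"
  shows "lmul (fe nc_const K (nc_map of_int a) (nc_map of_int b)) = fmap qa (fm f (lmul a) (lmul b))"
proof -
  have u: "unip (nc_map of_int a :: (xy, 'l padic alg_closure) ncfps)" "unip (nc_map of_int b :: (xy, 'l padic alg_closure) ncfps)"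
    using assms by (auto intro: filtered_hom_unip[OF filtered_hom_nc_map[OF rhom_of_int]])
  have "lmul (fe nc_const K (nc_map of_int a) (nc_map of_int b)) = fe fsc K (fQ (lmul a)) (fQ (lmul b))"
    by (simp add: filtered_hom_fe[OF filtered_hom_lmul u] lmul_const fQ_lmul)
  then show ?thesis using assms by (simp add: fe_K filtered_hom_unip[OF filtered_hom_lmul])
qed

sublocale two_cycle_series K
proof
  note one = filtered_homD(2)[OF filtered_hom_fmap[OF rhom_qa]]
  show "nc_coeff K [] = 1" by (simp add: K_def nc_simps mag_Nil[OF f_closed] rhomD(2)[OF rhom_qa])
  show "fe nc_const K (nc_map of_int a) (nc_map of_int b) = (1 :: (xy, 'l padic alg_closure) ncfps)"
    if "unip a" "unip b" "a * b = b * a" for a b :: "(xy, int) ncfps"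
  proof -
    have "fm f (lmul a) (lmul b) = 1"
      using that by (intro fm_commuting filtered_hom_unip[OF filtered_hom_lmul]) (simp_all flip: lmul_mult)
    then show ?thesis using lmul_fe[OF that(1,2)] by (simp add: one lmul_eq_1)
  qed
  have m: "mx = nc_map of_int (mx :: (xy, int) ncfps)" "my = nc_map of_int (my :: (xy, int) ncfps)"
    by (simp_all add: filtered_homD(2,3)[OF filtered_hom_nc_map[OF rhom_of_int]] nc_map_var[OF rhom_of_int])
  have "lmul (fe nc_const K mx my * fe nc_const K my mx) = fmap qa (fm f (lmul mx) (lmul my) * fm f (lmul my) (lmul mx))"
    using lmul_fe[of mx my, folded m] lmul_fe[of my mx, folded m]
    by (simp add: lmul_mult filtered_homD(4)[OF filtered_hom_fmap[OF rhom_qa]])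
  then show "fe nc_const K mx my * fe nc_const K my mx = 1"
    by (simp add: two_cycle_fm[OF pent] one lmul_eq_1)
qed

text \<open>\<open>T\<close> is \<open>uinv A\<close> times \<open>A * T\<close>, and the factor
  \<open>A * T\<close> commutes with \<open>A\<close> and \<open>B\<close>, so
  \<open>fm_central\<close> removes it.\<close>

lemma fm_complement:
  fixes A B T :: "('g::finite, int) fmat"
  assumes u: "unip A" "unip B" "unip T" and c: "A * T * A = A * (A * T)" "A * T * B = B * (A * T)"
  shows "fm f T B = fm f (uinv A) B" "fm f B T = fm f B (uinv A)"
proof -
  have t: "uinv A * (A * T) = T" by (simp add: uinv_cancel u)
  have i: "A * T * uinv A = uinv A * (A * T)" using uinv_commute[of A "A * T"] c(1) u by simp
  show "fm f T B = fm f (uinv A) B"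
    using fm_central(1)[of "uinv A" B "A * T"] i c(2) u by (simp add: t unip_mult unip_uinv)
  show "fm f B T = fm f B (uinv A)"
    using fm_central(2)[of B "uinv A" "A * T"] i c(2) u by (simp add: t unip_mult unip_uinv)
qed

lemma central_matrices:
  "fm f A.t12 lm2 = fm f (uinv (lm1 * lm2)) lm2" "fm f lm1 A.t12 = fm f lm1 (uinv (lm1 * lm2))"
  "fm f (A.t13 * A.t23) lm3 = fm f (uinv (lm1 * lm2 * lm3)) lm3"
  "fm f (lm1 * lm2) (A.t13 * A.t23) = fm f (lm1 * lm2) (uinv (lm1 * lm2 * lm3))"
  "fm f (A.t12 * A.t13) (lm2 * lm3) = fm f (uinv (lm1 * lm2 * lm3)) (lm2 * lm3)"
  "fm f lm1 (A.t12 * A.t13) = fm f lm1 (uinv (lm1 * lm2 * lm3))"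
  "fm f A.t23 lm3 = fm f (uinv (lm2 * lm3)) lm3" "fm f lm2 A.t23 = fm f lm2 (uinv (lm2 * lm3))"
proof -
  note u = t_unip lm_unip unip_mult
  have join: "C * (P * Q) = P * Q * C" if "C * P = P * C" "C * Q = Q * C" for C P Q :: "(strand, int) fmat"
    using that by (metis mult.assoc)
  note c = A.central
  have c12: "lm1 * lm2 * A.t12 * (lm1 * lm2) = lm1 * lm2 * (lm1 * lm2 * A.t12)"
    by (rule join[OF c(1,2)])
  have c23: "lm2 * lm3 * A.t23 * (lm2 * lm3) = lm2 * lm3 * (lm2 * lm3 * A.t23)"
    by (rule join[OF c(3,4)])
  have c13: "lm1 * lm2 * lm3 * (A.t13 * A.t23) * (lm1 * lm2 * lm3) = lm1 * lm2 * lm3 * (lm1 * lm2 * lm3 * (A.t13 * A.t23))"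
    by (rule join[OF c(5,6)])
  have c13': "lm1 * lm2 * lm3 * (A.t12 * A.t13) * (lm1 * lm2 * lm3) = lm1 * lm2 * lm3 * (lm1 * lm2 * lm3 * (A.t12 * A.t13))"
    using join[OF c(7,8)] by (simp only: mult.assoc)
  note f = fm_complement
  show "fm f A.t12 lm2 = fm f (uinv (lm1 * lm2)) lm2" by (rule f(1)) (intro u c12 c)+
  show "fm f lm1 A.t12 = fm f lm1 (uinv (lm1 * lm2))" by (rule f(2)) (intro u c12 c)+
  show "fm f (A.t13 * A.t23) lm3 = fm f (uinv (lm1 * lm2 * lm3)) lm3" by (rule f(1)) (intro u c13 c)+
  show "fm f (lm1 * lm2) (A.t13 * A.t23) = fm f (lm1 * lm2) (uinv (lm1 * lm2 * lm3))" by (rule f(2)) (intro u c13 c)+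
  show "fm f (A.t12 * A.t13) (lm2 * lm3) = fm f (uinv (lm1 * lm2 * lm3)) (lm2 * lm3)" by (rule f(1)) (intro u c13' c)+
  show "fm f lm1 (A.t12 * A.t13) = fm f lm1 (uinv (lm1 * lm2 * lm3))" by (rule f(2)) (intro u c13' c)+
  show "fm f A.t23 lm3 = fm f (uinv (lm2 * lm3)) lm3" by (rule f(1)) (intro u c23 c)+
  show "fm f lm2 A.t23 = fm f lm2 (uinv (lm2 * lm3))" by (rule f(2)) (intro u c23 c)+
qed

text \<open>The polytope is applied to matrices, because twists are not series. Its conclusion
  involves only loops, which are left multiplications, and so descends to series.\<close>

lemma cocycle_K:
  assumes n: "n \<ge> 1" "H m - 1 \<in> fil n"
  shows "coc nc_const m (nc_var st1) (nc_var st2) (nc_var st3) \<in> (fil (n + 1) :: (strand, 'l padic alg_closure) ncfps set)"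
proof -
  let ?q = "fQ :: (strand, int) fmat \<Rightarrow> (strand, 'l padic alg_closure) fmat"
  note u = t_unip lm_unip unip_mult unip_uinv
  have qu: "unip (?q A)" if "unip A" for A by (rule filtered_hom_unip[OF filtered_hom_fQ that])
  have qm: "?q (A * B) = ?q A * ?q B" for A B by (rule filtered_homD(4)[OF filtered_hom_fQ])
  have qi: "?q (uinv A) = uinv (?q A)" if "unip A" for A by (rule filtered_hom_uinv[OF filtered_hom_fQ that])
  have e: "fe fsc K (?q A) (?q B) = fmap qa (fm f A B)" if "unip A" "unip B" for A B by (rule fe_K[OF that])
  have em: "fmap qa (M * N) = fmap qa M * fmap qa N" for M N :: "(strand, 'l padic_int) fmat"
    by (rule filtered_homD(4)[OF filtered_hom_fmap[OF rhom_qa]])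
  note s = qm[symmetric] qi[symmetric] e em[symmetric] u
  have "coc fsc m (?q lm1 - 1) (?q lm2 - 1) (?q lm3 - 1) \<in> fil (n + 1)"
  proof (rule hexagon_cocycle[OF scal_fsc n, of _ _ _ "?q A.t12" "?q A.t13" "?q A.t23"])
  qed (simp_all only: s central_matrices pentagon_matrices[OF pent f_closed, unfolded central_matrices] A.commutations qu)
  moreover have "?q (lmul (1 + nc_var g)) - 1 = lmul (nc_var g)" for g
    by (simp add: fQ_lmul filtered_homD(2,3)[OF filtered_hom_nc_map[OF rhom_of_int]] nc_map_var[OF rhom_of_int] lmul_add filtered_homD(2,3)[OF filtered_hom_fQ])
  ultimately have "coc fsc m (lmul (nc_var st1)) (lmul (nc_var st2)) (lmul (nc_var st3)) \<in> (fil (n + 1) :: (strand, 'l padic alg_closure) fmat set)"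
    by simp
  moreover have "lmul (coc nc_const m (nc_var st1) (nc_var st2) (nc_var st3)) = (coc fsc m (lmul (nc_var st1)) (lmul (nc_var st2)) (lmul (nc_var st3)) :: (strand, 'l padic alg_closure) fmat)"
    unfolding coc_def by (simp add: filtered_homD(3,5)[OF filtered_hom_lmul] filtered_hom_S[OF filtered_hom_lmul] lmul_const fil_add)
  ultimately show ?thesis by (metis lmul_fil_iff)
qed

end

subsection \<open>Topology of the \<open>l\<close>-adic numbers\<close>

text \<open>Inverses modulo \<open>l ^ n\<close> exist by coprimality; being unique there, they form
  a compatible system.\<close>

lemma padic_unit:
  fixes b :: "'l::prime_card padic_int"
  assumes "res 1 b \<noteq> 0" shows "\<exists>c. b * c = 1"
proof -
  let ?l = "int CARD('l)"
  have l: "prime ?l" by (rule prime_card_int)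
  have "coprime (res n b) (?l ^ n)" for n
  proof (cases n)
    case (Suc m)
    have "res n b mod ?l = res 1 b" using res_add[of b 1 m] Suc by (simp add: plus_1_eq_Suc)
    then have "\<not> ?l dvd res n b" using assms by (simp add: dvd_eq_mod_eq_0)
    then have "coprime ?l (res n b)" using l prime_imp_coprime by blast
    then show ?thesis by (simp add: coprime_commute)
  qed simp
  then have "\<exists>x. [res n b * x = 1] (mod ?l ^ n)" for n using cong_solve_coprime_int by blast
  then obtain x where x: "\<And>n. [res n b * x n = 1] (mod ?l ^ n)" by metis
  have uniq: "s mod ?l ^ n = t mod ?l ^ n" if "[res n b * s = 1] (mod ?l ^ n)" "[res n b * t = 1] (mod ?l ^ n)" for s t n
  proof -
    have "[s * (res n b * t) = s * 1] (mod ?l ^ n)" "[t * (res n b * s) = t * 1] (mod ?l ^ n)"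
      using that by (intro cong_mult cong_refl; simp)+
    moreover have "s * (res n b * t) = t * (res n b * s)" by (simp add: ac_simps)
    ultimately have "[s = t] (mod ?l ^ n)" by (simp add: cong_def)
    then show ?thesis by (simp add: cong_def)
  qed
  have compat: "x (Suc n) mod ?l ^ Suc n mod ?l ^ n = x n mod ?l ^ n" for n
  proof -
    have "[res (Suc n) b * x (Suc n) = 1] (mod ?l ^ n)"
      using x[of "Suc n"] by (rule cong_dvd_modulus) (simp add: le_imp_power_dvd)
    moreover have "[res (Suc n) b = res n b] (mod ?l ^ n)" using res_add[of b n 0] by (simp add: cong_def res_compat)
    ultimately have "[res n b * x (Suc n) = 1] (mod ?l ^ n)"
      by (simp only: cong_def mod_mult_left_eq[of "res n b", symmetric] mod_mult_left_eq[of "res (Suc n) b", symmetric])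
    then show ?thesis using uniq[OF _ x] by (simp only: padic_compat_aux)
  qed
  define c :: "'l padic_int" where "c = Abs_padic_int (\<lambda>n. x n mod ?l ^ n)"
  have "res n c = x n mod ?l ^ n" for n unfolding c_def by (subst Abs_padic_int_inverse) (use compat in auto)
  then have "res n (b * c) = res n (1 :: 'l padic_int)" for n
    using x[of n] by (simp add: times_padic_int.rep_eq one_padic_int.rep_eq mod_simps cong_def)
  then have "b * c = 1" by (subst Rep_padic_int_inject[symmetric]) (rule ext)
  then show ?thesis by blast
qed

text \<open>Splitting off the largest power of \<open>l\<close> from \<open>b\<close> leaves a
  unit.\<close>

lemma padic_dvd_power:
  fixes b :: "'l::prime_card padic_int"
  assumes "b \<noteq> 0" shows "\<exists>n. b dvd of_nat CARD('l) ^ n"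
proof -
  let ?l = "of_nat CARD('l) :: 'l padic_int"
  define n where "n = (LEAST n. \<not> ?l ^ n dvd b)"
  have ex: "\<exists>n. \<not> ?l ^ n dvd b" using padic_eq_0[of b] assms by blast
  have n: "\<not> ?l ^ n dvd b" unfolding n_def by (rule LeastI_ex[OF ex])
  then obtain m where m: "n = Suc m" by (cases n) auto
  have "?l ^ m dvd b" using not_less_Least[of m "\<lambda>n. \<not> ?l ^ n dvd b"] m n_def by auto
  then obtain u where u: "b = ?l ^ m * u" by (auto simp: dvd_def)
  have "res 1 u \<noteq> 0"
  proof
    assume "res 1 u = 0"
    then have "?l ^ 1 dvd u" by (simp only: padic_dvd_iff)
    then have "?l ^ n dvd b" by (simp add: u m mult.commute mult_dvd_mono)
    then show False using n by simp
  qed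
  then obtain c where "u * c = 1" using padic_unit by blast
  then have "?l ^ m = b * c" by (simp add: u mult.assoc)
  then show ?thesis by (intro exI[of _ m] dvdI)
qed

text \<open>The multiples of \<open>l ^ n\<close> by \<open>l\<close>-adic integers: a neighbourhood
  basis of 0.\<close>

definition pball :: "nat \<Rightarrow> 'l::prime_card padic set" where
  "pball n = {of_nat CARD('l) ^ n * qp a | a. True}"

lemma of_nat_qp: "of_nat n = qp (of_nat n)"
  by (simp add: qp_def of_nat_fract)

lemma qp_power: "qp (a ^ n) = qp a ^ n"
  by (induction n) (simp_all add: rhomD[OF rhom_qp])

lemma qp_inject: "qp a = qp b \<longleftrightarrow> a = b"
  by (simp add: qp_def eq_fract)

lemma qp_pball: "qp a \<in> pball n \<longleftrightarrow> of_nat CARD('l) ^ n dvd (a :: 'l::prime_card padic_int)"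
proof -
  have "of_nat CARD('l) ^ n * qp b = qp (of_nat CARD('l) ^ n * b)" for b :: "'l padic_int"
    by (simp add: of_nat_qp rhomD[OF rhom_qp] qp_power)
  then show ?thesis by (auto simp: pball_def qp_inject dvd_def)
qed

lemma pball_add: "x \<in> pball n \<Longrightarrow> y \<in> pball n \<Longrightarrow> x + y \<in> pball n"
  unfolding pball_def by (auto simp: distrib_left[symmetric] rhomD(3)[OF rhom_qp, symmetric])

lemma qp_minus: "qp (- a) = - qp a"
  by (simp add: qp_def)

lemma pball_uminus: "x \<in> pball n \<Longrightarrow> - x \<in> pball n"
  unfolding pball_def by (auto simp flip: qp_minus mult_minus_right)

lemma pball_diff: "x \<in> pball n \<Longrightarrow> y \<in> pball n \<Longrightarrow> x - y \<in> pball n"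
  using pball_add[OF _ pball_uminus] by fastforce

lemma pball_zero [simp]: "0 \<in> pball n"
  using qp_pball[of 0 n] by (simp add: rhomD(1)[OF rhom_qp])

lemma pball_sum: "(\<And>i. i \<in> A \<Longrightarrow> g i \<in> pball n) \<Longrightarrow> sum g A \<in> pball n"
  by (induction A rule: infinite_finite_induct) (simp_all add: pball_add)

lemma pball_mult: "x \<in> pball m \<Longrightarrow> y \<in> pball n \<Longrightarrow> x * y \<in> pball (m + n)"
proof -
  assume "x \<in> pball m" "y \<in> pball n"
  then obtain a b where "x = of_nat CARD('a) ^ m * qp a" "y = of_nat CARD('a) ^ n * qp b" by (auto simp: pball_def)
  then have "x * y = of_nat CARD('a) ^ (m + n) * qp (a * b)" by (simp add: power_add rhomD(4)[OF rhom_qp] ac_simps)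
  then show ?thesis by (auto simp: pball_def)
qed

lemma pball_mono: "m \<le> n \<Longrightarrow> x \<in> pball n \<Longrightarrow> x \<in> pball m"
proof -
  assume mn: "m \<le> n" and "x \<in> pball n"
  then obtain a where "x = of_nat CARD('a) ^ n * qp a" by (auto simp: pball_def)
  also have "\<dots> = of_nat CARD('a) ^ m * (of_nat CARD('a) ^ (n - m) * qp a)"
    using mn by (simp flip: mult.assoc power_add)
  also have "of_nat CARD('a) ^ (n - m) * qp a = qp (of_nat CARD('a) ^ (n - m) * a)"
    by (simp add: of_nat_qp rhomD(4)[OF rhom_qp] qp_power)
  finally show ?thesis by (auto simp: pball_def)
qed

text \<open>Multiplication by a fixed number loses a bounded amount \<open>c\<close> of precision,
  namely a power of \<open>l\<close> that clears the denominator.\<close>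

lemma padic_bounded:
  fixes x :: "'l::prime_card padic"
  shows "\<exists>c. \<forall>n. \<forall>y\<in>pball (n + c). y * x \<in> pball n"
proof -
  let ?l = "CARD('l)"
  obtain a b where x: "x = Fract a b" "b \<noteq> 0" by (cases x)
  obtain c d where d: "of_nat ?l ^ c = b * d" using padic_dvd_power[OF x(2)] by (auto simp: dvd_def)
  have l0: "(of_nat ?l :: 'l padic) \<noteq> 0" by simp
  have *: "of_nat ?l ^ c * x = qp (a * d)"
  proof -
    have "of_nat ?l ^ c * x = qp (b * d) * x" by (simp add: of_nat_qp flip: qp_power d)
    also have "\<dots> = qp (a * d)" using x(2) by (simp add: x(1) qp_def eq_fract)
    finally show ?thesis .
  qed
  have "y * x \<in> pball n" if y: "y \<in> pball (n + c)" for y n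
  proof -
    obtain e where "y = of_nat ?l ^ (n + c) * qp e" using y by (auto simp: pball_def)
    then have "y * x = of_nat ?l ^ n * qp e * (of_nat ?l ^ c * x)" by (simp add: power_add ac_simps)
    also have "\<dots> = of_nat ?l ^ n * qp (e * (a * d))" by (simp only: * rhomD(4)[OF rhom_qp] mult.assoc)
    finally show ?thesis by (auto simp: pball_def)
  qed
  then show ?thesis by blast
qed

lemma pball_Inter: "(\<And>n. x \<in> pball n) \<Longrightarrow> x = 0"
proof -
  fix x :: "'l::prime_card padic"
  assume *: "\<And>n. x \<in> pball n"
  from *[of 0] obtain a where "x = qp a" by (auto simp: pball_def)
  then show "x = 0" using * padic_eq_0[of a] by (simp add: qp_pball rhomD(1)[OF rhom_qp])
qed

lemma padic_topology_eq:
  "padic_topology = topology_generated_by {{y. y - x \<in> pball n} | x n. True}"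
proof -
  have "{x + of_nat CARD('a) ^ n * Fract a 1 | a. True} = {y. y - x \<in> pball n}" for x :: "'a padic" and n
    by (auto simp: pball_def qp_def algebra_simps)
  then show ?thesis by (simp only: padic_topology_def)
qed

lemma openin_pball: "openin padic_topology {y. y - x \<in> pball n}"
  unfolding padic_topology_eq by (rule topology_generated_by_Basis) blast

lemma Hausdorff_padic: "Hausdorff_space padic_topology"
  unfolding Hausdorff_space_def
proof (intro allI impI)
  fix x y :: "'a padic" assume "x \<in> topspace padic_topology \<and> y \<in> topspace padic_topology \<and> x \<noteq> y"
  then have "x - y \<noteq> 0" by simp
  then obtain n where n: "x - y \<notin> pball n" using pball_Inter by blast
  have "disjnt {z. z - x \<in> pball n} {z. z - y \<in> pball n}"
    unfolding disjnt_iff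
  proof (intro allI notI)
    fix z assume "z \<in> {z. z - x \<in> pball n} \<and> z \<in> {z. z - y \<in> pball n}"
    then have "(z - y) - (z - x) \<in> pball n" by (intro pball_diff[of "z - y" n "z - x"]) auto
    then show False using n by simp
  qed
  then show "\<exists>U V. openin padic_topology U \<and> openin padic_topology V \<and> x \<in> U \<and> y \<in> V \<and> disjnt U V"
    using openin_pball by (intro exI conjI) (auto simp del: openin_pball)
qed

lemma continuous_padicI:
  fixes h :: "'a \<Rightarrow> 'l::prime_card padic"
  assumes "\<And>x n. x \<in> topspace T \<Longrightarrow> \<exists>U. openin T U \<and> x \<in> U \<and> (\<forall>y\<in>U. h y - h x \<in> pball n)"
  shows "continuous_map T padic_topology h"
  unfolding padic_topology_eq
proof (rule continuous_on_generated_topo)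
  fix V :: "'l padic set" assume "V \<in> {{y. y - x \<in> pball n} | x n. True}"
  then obtain x n where V: "V = {y. y - x \<in> pball n}" by blast
  show "openin T (h -` V \<inter> topspace T)"
  proof (subst openin_subopen, intro ballI)
    fix z assume z: "z \<in> h -` V \<inter> topspace T"
    then obtain U where U: "openin T U" "z \<in> U" "\<forall>y\<in>U. h y - h z \<in> pball n" using assms[of z n] by blast
    have "h y - x \<in> pball n" if "y \<in> U" for y
      using pball_add[of "h y - h z" n "h z - x"] U(3) that z V by auto
    then have "U \<subseteq> h -` V \<inter> topspace T" using openin_subset[OF U(1)] V by auto
    then show "\<exists>U. openin T U \<and> z \<in> U \<and> U \<subseteq> h -` V \<inter> topspace T" using U by blast
  qed
next
  show "h ` topspace T \<subseteq> \<Union> {{y. y - x \<in> pball n} | x n. True}"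
  proof
    fix y show "y \<in> \<Union> {{y. y - x \<in> pball n} | x n. True}"
      by (rule UnionI[of "{z. z - y \<in> pball 0}"]) auto
  qed
qed

lemma inj_nc_coeff: "inj nc_coeff"
  by (rule injI) (simp add: nc_coeff_inject)

lemma Hausdorff_group_like: "Hausdorff_space group_like_topology"
  unfolding group_like_topology_def
proof (rule Hausdorff_space_subtopology, rule Hausdorff_space_injective_preimage)
  show "Hausdorff_space (product_topology (\<lambda>_. padic_topology) UNIV)"
    by (simp add: Hausdorff_space_product_topology Hausdorff_padic)
  show "continuous_map (pullback_topology UNIV nc_coeff (product_topology (\<lambda>_. padic_topology) UNIV))
      (product_topology (\<lambda>_. padic_topology) UNIV) nc_coeff"
    using continuous_map_pullback[OF continuous_map_id, of UNIV nc_coeff] by (simp add: o_def)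
  show "inj_on nc_coeff (topspace (pullback_topology UNIV nc_coeff (product_topology (\<lambda>_. padic_topology) UNIV)))"
    using inj_nc_coeff inj_on_subset by blast
qed

lemma continuous_group_likeI:
  assumes "\<And>x. x \<in> topspace T \<Longrightarrow> group_like (h x)" "\<And>w. continuous_map T padic_topology (\<lambda>x. nc_coeff (h x) w)"
  shows "continuous_map T group_like_topology h"
  unfolding group_like_topology_def continuous_map_in_subtopology
proof
  show "continuous_map T (pullback_topology UNIV nc_coeff (product_topology (\<lambda>_. padic_topology) UNIV)) h"
    by (rule continuous_map_pullback') (use assms(2) in \<open>auto simp: continuous_map_componentwise_UNIV o_def\<close>)
  show "h \<in> topspace T \<rightarrow> carrier group_like_group" using assms(1) by (auto simp: group_like_group_def)
qed

subsection \<open>Group-like series\<close>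

lemma coproduct_word_length: "coproduct_word w u v \<noteq> 0 \<Longrightarrow> length w = length u + length v"
proof (induction w arbitrary: u v)
  case Nil
  then show ?case by (auto split: if_splits)
next
  case (Cons g w)
  then consider "u \<noteq> []" "coproduct_word w (tl u) v \<noteq> 0" | "v \<noteq> []" "coproduct_word w u (tl v) \<noteq> 0"
    by (auto split: if_splits)
  then show ?case using Cons.IH[of "tl u" v] Cons.IH[of u "tl v"] by cases (cases u; cases v; simp)+
qed

text \<open>The coproduct is multiplicative: the parts of \<open>u\<close> and \<open>v\<close> that
  come from \<open>w\<close> are prefixes, and the sum runs over the possible cuts.\<close>

lemma coproduct_word_append:
  "coproduct_word (w @ w') u v = (\<Sum>i\<le>length u. \<Sum>j\<le>length v.
     coproduct_word w (take i u) (take j v) * coproduct_word w' (drop i u) (drop j v))"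
proof (induction w arbitrary: u v)
  case Nil
  have "(\<Sum>i\<le>length u. \<Sum>j\<le>length v. coproduct_word [] (take i u) (take j v) * coproduct_word w' (drop i u) (drop j v))
    = (\<Sum>i\<le>length u. \<Sum>j\<le>length v. if j = 0 then if i = 0 then coproduct_word w' u v else 0 else 0)"
    by (intro sum.cong HOL.refl) auto
  then show ?case by simp
next
  case (Cons g w)
  let ?T = "\<lambda>u v. \<Sum>i\<le>length u. \<Sum>j\<le>length v. coproduct_word w (take i u) (take j v) * coproduct_word w' (drop i u) (drop j v)"
  \<comment> \<open>At \<open>i = 0\<close> the prefix is empty and contributes nothing; for larger
    \<open>i\<close> its tail is a prefix of \<open>tl u\<close>.\<close>
  have 1: "(\<Sum>i\<le>length u. \<Sum>j\<le>length v.
      (if take i u \<noteq> [] \<and> hd (take i u) = g then coproduct_word w (tl (take i u)) (take j v) else 0) * coproduct_word w' (drop i u) (drop j v))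
    = (if u \<noteq> [] \<and> hd u = g then ?T (tl u) v else 0)"
    by (cases u) (simp_all add: sum.atMost_Suc_shift del: sum.atMost_Suc)
  have 2: "(\<Sum>i\<le>length u. \<Sum>j\<le>length v.
      (if take j v \<noteq> [] \<and> hd (take j v) = g then coproduct_word w (take i u) (tl (take j v)) else 0) * coproduct_word w' (drop i u) (drop j v))
    = (if v \<noteq> [] \<and> hd v = g then ?T u (tl v) else 0)"
    by (cases v) (simp_all add: sum.atMost_Suc_shift del: sum.atMost_Suc)
  show ?case
    unfolding append_Cons coproduct_word.simps Cons.IH distrib_right sum.distrib 1 2 ..
qed

lemma nc_coeff_times: "nc_coeff (f * g) w = (\<Sum>i\<le>length w. nc_coeff f (take i w) * nc_coeff g (drop i w))"
  by (simp add: times_ncfps.rep_eq atMost_atLeast0)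

lemma sum_rotate: "(\<Sum>k\<in>A. \<Sum>i\<in>B. \<Sum>j\<in>C. G k i j) = (\<Sum>i\<in>B. \<Sum>j\<in>C. \<Sum>k\<in>A. G k i j)"
  by (subst sum.swap) (intro sum.cong HOL.refl sum.swap)

lemma coproduct_coeff_mult:
  fixes f g :: "('g::finite, 'a::comm_ring_1) ncfps"
  shows "coproduct_coeff (f * g) u v = (\<Sum>i\<le>length u. \<Sum>j\<le>length v.
     coproduct_coeff f (take i u) (take j v) * coproduct_coeff g (drop i u) (drop j v))"
proof -
  define N where "N = length u + length v"
  define F where "F = (\<lambda>w k i j. nc_coeff f (take k w) * nc_coeff g (drop k w) *
    (of_nat (coproduct_word (take k w) (take i u) (take j v)) * of_nat (coproduct_word (drop k w) (drop i u) (drop j v))))"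
  have split: "nc_coeff (f * g) w * of_nat (coproduct_word w u v) = (\<Sum>k\<le>N. \<Sum>i\<le>length u. \<Sum>j\<le>length v. F w k i j)" if "length w = N" for w
  proof -
    have "nc_coeff f (take k w) * nc_coeff g (drop k w) * of_nat (coproduct_word w u v) = (\<Sum>i\<le>length u. \<Sum>j\<le>length v. F w k i j)" for k
      using coproduct_word_append[of "take k w" "drop k w" u v] by (simp add: F_def sum_distrib_left)
    then show ?thesis using that by (simp add: nc_coeff_times sum_distrib_right)
  qed
  \<comment> \<open>By homogeneity, the cuts of \<open>u\<close> and \<open>v\<close> determine that
    of \<open>w\<close>.\<close>
  have one: "(\<Sum>k\<le>N. F w k i j) = F w (i + j) i j" if "i \<le> length u" "j \<le> length v" "length w = N" for w i j
  proof -
    have "F w k i j = 0" if "k \<le> N" "k \<noteq> i + j" for k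
    proof -
      have "coproduct_word (take k w) (take i u) (take j v) = 0"
        using coproduct_word_length[of "take k w" "take i u" "take j v"] that \<open>length w = N\<close> \<open>i \<le> length u\<close> \<open>j \<le> length v\<close>
        by fastforce
      then show ?thesis by (simp add: F_def)
    qed
    then have "(\<Sum>k\<le>N. F w k i j) = (\<Sum>k\<in>{i + j}. F w k i j)"
      using that by (intro sum.mono_neutral_right) (auto simp: N_def)
    then show ?thesis by simp
  qed
  have prod: "(\<Sum>w | length w = N. F w (i + j) i j) = coproduct_coeff f (take i u) (take j v) * coproduct_coeff g (drop i u) (drop j v)"
    if "i \<le> length u" "j \<le> length v" for i j
  proof -
    let ?A = "{w :: 'g list. length w = i + j}" and ?B = "{w :: 'g list. length w = length u - i + (length v - j)}"
    have "(\<Sum>w | length w = N. F w (i + j) i j) = (\<Sum>(w1, w2)\<in>?A \<times> ?B. F (w1 @ w2) (i + j) i j)"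
      by (rule sum.reindex_bij_witness[of _ "\<lambda>(w1, w2). w1 @ w2" "\<lambda>w. (take (i + j) w, drop (i + j) w)"])
        (use that in \<open>auto simp: N_def\<close>)
    also have "\<dots> = (\<Sum>w1\<in>?A. \<Sum>w2\<in>?B. (nc_coeff f w1 * of_nat (coproduct_word w1 (take i u) (take j v)))
        * (nc_coeff g w2 * of_nat (coproduct_word w2 (drop i u) (drop j v))))"
      unfolding sum.cartesian_product by (intro sum.cong) (auto simp: F_def ac_simps)
    also have "\<dots> = coproduct_coeff f (take i u) (take j v) * coproduct_coeff g (drop i u) (drop j v)"
      using that by (simp add: coproduct_coeff_def sum_product)
    finally show ?thesis .
  qed
  have "coproduct_coeff (f * g) u v = (\<Sum>w | length w = N. \<Sum>k\<le>N. \<Sum>i\<le>length u. \<Sum>j\<le>length v. F w k i j)"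
    unfolding coproduct_coeff_def N_def[symmetric] by (rule sum.cong) (auto simp: split)
  also have "\<dots> = (\<Sum>w | length w = N. \<Sum>i\<le>length u. \<Sum>j\<le>length v. \<Sum>k\<le>N. F w k i j)"
    by (rule sum.cong[OF HOL.refl sum_rotate])
  also have "\<dots> = (\<Sum>w | length w = N. \<Sum>i\<le>length u. \<Sum>j\<le>length v. F w (i + j) i j)"
    by (intro sum.cong HOL.refl) (simp add: one)
  also have "\<dots> = (\<Sum>i\<le>length u. \<Sum>j\<le>length v. \<Sum>w | length w = N. F w (i + j) i j)"
    by (rule sum_rotate)
  finally show ?thesis by (simp add: prod)
qed

lemma group_likeD:
  "group_like f \<Longrightarrow> nc_coeff f [] = 1" "group_like f \<Longrightarrow> coproduct_coeff f u v = nc_coeff f u * nc_coeff f v"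
  by (simp_all add: group_like_def)

lemma group_like_mult:
  fixes f g :: "('g::finite, 'a::comm_ring_1) ncfps"
  assumes "group_like f" "group_like g" shows "group_like (f * g)"
  unfolding group_like_def
proof (intro conjI allI)
  show "nc_coeff (f * g) [] = 1" using assms by (simp add: nc_coeff_times group_likeD)
  show "coproduct_coeff (f * g) u v = nc_coeff (f * g) u * nc_coeff (f * g) v" for u v
    unfolding coproduct_coeff_mult nc_coeff_times sum_product
    by (intro sum.cong HOL.refl) (simp_all add: group_likeD[OF assms(1)] group_likeD[OF assms(2)] ac_simps)
qed

lemma group_like_1: "group_like (1 :: ('g::finite, 'a::comm_ring_1) ncfps)"
  unfolding group_like_def
proof (intro conjI allI)
  show "coproduct_coeff (1 :: ('g, 'a) ncfps) u v = nc_coeff 1 u * nc_coeff 1 v" for u v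
  proof -
    have "coproduct_coeff (1 :: ('g, 'a) ncfps) u v = (\<Sum>w :: 'g list | length w = length u + length v. if w = [] then of_nat (coproduct_word [] u v) else 0)"
      unfolding coproduct_coeff_def by (intro sum.cong) (auto simp: nc_simps)
    then show ?thesis by (simp add: nc_simps sum.delta)
  qed
qed (simp add: nc_simps)

text \<open>Compare the coefficients of \<open>u\<close>, \<open>v\<close> in the coproduct of
  \<open>f * uinv f = 1\<close>. By induction on the total length all terms agree except the one
  with \<open>i = j = 0\<close>, where the coefficients of \<open>f\<close> are 1.\<close>

lemma group_like_uinv:
  fixes f :: "('g::finite, 'a::comm_ring_1) ncfps"
  assumes f: "group_like f" shows "group_like (uinv f)"
proof -
  let ?h = "uinv f"
  have uf: "unip f" using f by (simp add: unip_ncfps_iff group_likeD)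
  have fh: "f * ?h = 1" by (rule uinv_right[OF uf])
  have "coproduct_coeff ?h u v = nc_coeff ?h u * nc_coeff ?h v" for u v
  proof (induction "length u + length v" arbitrary: u v rule: less_induct)
    case less
    let ?d = "\<lambda>i j. nc_coeff f (take i u) * nc_coeff f (take j v) *
      (coproduct_coeff ?h (drop i u) (drop j v) - nc_coeff ?h (drop i u) * nc_coeff ?h (drop j v))"
    have "(\<Sum>i\<le>length u. \<Sum>j\<le>length v. nc_coeff f (take i u) * nc_coeff f (take j v) * coproduct_coeff ?h (drop i u) (drop j v))
      = coproduct_coeff (f * ?h) u v"
      unfolding coproduct_coeff_mult by (simp add: group_likeD[OF f])
    also have "\<dots> = nc_coeff (f * ?h) u * nc_coeff (f * ?h) v" by (simp only: fh group_likeD(2)[OF group_like_1])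
    also have "\<dots> = (\<Sum>i\<le>length u. \<Sum>j\<le>length v. nc_coeff f (take i u) * nc_coeff f (take j v) * (nc_coeff ?h (drop i u) * nc_coeff ?h (drop j v)))"
      unfolding nc_coeff_times sum_product by (intro sum.cong HOL.refl) (simp_all add: ac_simps)
    finally have "(\<Sum>i\<le>length u. \<Sum>j\<le>length v. ?d i j) = 0" by (simp add: right_diff_distrib sum_subtractf)
    moreover have "?d i j = (if j = 0 then if i = 0 then coproduct_coeff ?h u v - nc_coeff ?h u * nc_coeff ?h v else 0 else 0)"
      if "i \<le> length u" "j \<le> length v" for i j
    proof (cases "i = 0 \<and> j = 0")
      case True
      then show ?thesis by (simp add: group_likeD[OF f])
    next
      case False
      then have "length (drop i u) + length (drop j v) < length u + length v" using that by auto
      from less[OF this] False show ?thesis by auto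
    qed
    ultimately have "(\<Sum>i\<le>length u. \<Sum>j\<le>length v. if j = 0 then if i = 0 then coproduct_coeff ?h u v - nc_coeff ?h u * nc_coeff ?h v else 0 else 0) = 0"
      by simp
    then show ?case by simp
  qed
  moreover have "nc_coeff ?h [] = 1" using unip_uinv[OF uf] by (simp add: unip_ncfps_iff)
  ultimately show ?thesis by (simp add: group_like_def)
qed

text \<open>The recursion for a power of one letter is Pascal's rule.\<close>

lemma coproduct_word_replicate:
  "coproduct_word (replicate n g) u v =
    (if u = replicate (length u) g \<and> v = replicate (length v) g \<and> length u + length v = n then n choose length u else 0)"
proof (induction n arbitrary: u v)
  case (Suc n)
  show ?case
    by (cases u; cases v) (auto simp: Suc.IH Suc_diff_le)
qed auto

lemma nc_coeff_var_power: "nc_coeff (nc_var g ^ n) w = (if w = replicate n g then 1 else 0)"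
  using nc_coeff_prod_vars[of "replicate n g" w] by (simp add: prod_list_replicate)

lemma nc_coeff_exp_var:
  "nc_coeff (nc_exp (nc_var g)) w = (if w = replicate (length w) g then 1 / of_nat (fact (length w)) else 0 :: 'a::field)"
proof -
  have "nc_coeff (nc_var g ^ n) w / of_nat (fact n) =
    (if n = length w then if w = replicate (length w) g then 1 / of_nat (fact (length w)) else 0 else 0 :: 'a)" for n
    by (auto simp: nc_coeff_var_power)
  then have "nc_coeff (nc_exp (nc_var g)) w =
    (\<Sum>n = 0..length w. if n = length w then if w = replicate (length w) g then 1 / of_nat (fact (length w)) else 0 else 0 :: 'a)"
    unfolding nc_exp_def by (simp add: Abs_ncfps_inverse)
  then show ?thesis by simp
qed

lemma group_like_exp: "group_like (nc_exp (nc_var g) :: ('g::finite, 'a::field_char_0) ncfps)"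
  unfolding group_like_def
proof (intro conjI allI)
  show "nc_coeff (nc_exp (nc_var g) :: ('g, 'a) ncfps) [] = 1" by (simp add: nc_coeff_exp_var)
  show "coproduct_coeff (nc_exp (nc_var g) :: ('g, 'a) ncfps) u v = nc_coeff (nc_exp (nc_var g)) u * nc_coeff (nc_exp (nc_var g)) v" for u v
  proof -
    let ?N = "length u + length v"
    have "coproduct_coeff (nc_exp (nc_var g) :: ('g, 'a) ncfps) u v
      = (\<Sum>w | length w = ?N. if w = replicate ?N g then 1 / of_nat (fact ?N) * of_nat (coproduct_word (replicate ?N g) u v) else 0)"
      unfolding coproduct_coeff_def nc_coeff_exp_var by (intro sum.cong) auto
    also have "\<dots> = 1 / of_nat (fact ?N) * of_nat (coproduct_word (replicate ?N g) u v)"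
      by (simp add: sum.delta)
    also have "of_nat (?N choose length u) = (of_nat (fact ?N) / (of_nat (fact (length u)) * of_nat (fact (length v))) :: 'a)"
      using binomial_fact[of "length u" ?N, where 'a = 'a] by simp
    then have "1 / of_nat (fact ?N) * of_nat (coproduct_word (replicate ?N g) u v)
      = (nc_coeff (nc_exp (nc_var g)) u * nc_coeff (nc_exp (nc_var g)) v :: 'a)"
      by (simp add: coproduct_word_replicate nc_coeff_exp_var)
    finally show ?thesis .
  qed
qed

lemma group_like_group_simps [simp]:
  "carrier group_like_group = Collect group_like" "x \<otimes>\<^bsub>group_like_group\<^esub> y = x * y" "\<one>\<^bsub>group_like_group\<^esub> = 1"
  by (simp_all add: group_like_group_def)

lemma monoid_group_like: "monoid (group_like_group :: ('g::finite, 'a::comm_ring_1) ncfps monoid)"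
  by (rule monoidI) (simp_all add: group_like_mult group_like_1 mult.assoc)

lemma rl_group_like:
  fixes a b :: "('g::finite, 'a::comm_ring_1) ncfps"
  assumes a: "group_like a" and b: "group_like b" and g: "g \<in> carrier free2"
  shows "group_like (rl a b g)"
proof -
  have u: "unip a" "unip b" using a b by (simp_all add: unip_ncfps_iff group_likeD)
  show ?thesis
    using g
  proof (induction g rule: free2_induct)
    case one
    then show ?case by (simp add: rl_hom u group_like_1)
  next
    case (gen h g)
    then show ?case using a b by (cases h) (simp_all add: rl_mult rl_hom u group_like_mult)
  next
    case (inv h g)
    have "group_like (rl a b (inv\<^bsub>free2\<^esub> free2_gen h))"
      using a b by (cases h) (simp_all add: rl_inv_gen u group_like_uinv)
    moreover have "inv\<^bsub>free2\<^esub> free2_gen h \<in> carrier free2" using group.inv_closed[OF group_free2] by simp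
    ultimately show ?case using inv by (simp add: rl_mult u group_like_mult)
  qed
qed

subsection \<open>The series of an element of the free pro-\<open>l\<close> group\<close>

lemma nc_coeff_ev:
  assumes "\<forall>g. \<alpha> g \<in> fil 1"
  shows "nc_coeff (ev nc_const \<alpha> s) w = (\<Sum>v | length v < length w + 1. nc_coeff s v * nc_coeff (prod_list (map \<alpha> v)) w)"
proof -
  have "nc_coeff (ev nc_const \<alpha> s - (\<Sum>v | length v < length w + 1. nc_const (nc_coeff s v) * prod_list (map \<alpha> v))) w = 0"
    using ev_approx[OF assms, of nc_const s "length w + 1"] by (simp add: fil_ncfps_iff)
  then show ?thesis by (simp add: nc_simps nc_const_mult)
qed

lemma unip_exp_var: "unip (nc_exp (nc_var g))"
  by (simp add: unip_ncfps_iff nc_coeff_exp_var)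

context free_pro
begin

lemma lmul_mag_approx:
  assumes "f \<in> carrier (F2 l)" "N \<in> F.LN" "N \<subseteq> F.NJ (n + d) d" "g \<in> carrier free2" "f N = N #>\<^bsub>free2\<^esub> g"
  shows "lmul (mag f) - fZ (lmul (mu g)) \<in> JZ CARD('l) n d"
proof -
  have "of_nat l ^ n dvd nc_coeff (mag f) w - of_int (nc_coeff (mu g) w)" if "length w \<le> d" for w
    by (rule mag_approx[OF assms that])
  then show ?thesis
    by (auto simp: JZ_def fmat_simps entry_lmul entry_fmap[OF rhom_of_int] l_def)
qed

lemma mag_mult:
  assumes f: "f \<in> carrier (F2 l)" and f': "f' \<in> carrier (F2 l)"
  shows "mag (f \<otimes>\<^bsub>F2 l\<^esub> f') = mag f * mag f'"
proof -
  have "lmul (mag (f \<otimes>\<^bsub>F2 l\<^esub> f')) = lmul (mag f) * lmul (mag f')"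
  proof (rule JZ_eqI)
    fix n d :: nat
    let ?N = "F.NJ (n + d) d"
    have N: "?N \<in> F.LN" "?N \<subseteq> F.NJ (n + d) d" by (simp_all add: F.NJ_LN)
    obtain g where g: "g \<in> carrier free2" "f ?N = ?N #>\<^bsub>free2\<^esub> g" using F.pro_rep[OF f N(1)] by blast
    obtain g' where g': "g' \<in> carrier free2" "f' ?N = ?N #>\<^bsub>free2\<^esub> g'" using F.pro_rep[OF f' N(1)] by blast
    have ff: "(f \<otimes>\<^bsub>F2 l\<^esub> f') ?N = ?N #>\<^bsub>free2\<^esub> (g \<otimes>\<^bsub>free2\<^esub> g')"
      using F.coset_mult[OF N(1) g(1) g'(1)] by (simp add: F.pro_mult[OF N(1)] g g')
    have "lmul (mag f) * lmul (mag f') - fZ (lmul (mu g)) * fZ (lmul (mu g')) \<in> JZ CARD('l) n d"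
      by (rule JZ_mult_cong[OF lmul_mag_approx[OF f N g] lmul_mag_approx[OF f' N g']])
    moreover have "fZ (lmul (mu g)) * fZ (lmul (mu g')) = (fZ (lmul (mu (g \<otimes>\<^bsub>free2\<^esub> g'))) :: (xy, 'l padic_int) fmat)"
      by (simp add: mu_hom g g' lmul_mult filtered_homD(4)[OF filtered_hom_fZ])
    ultimately show "lmul (mag (f \<otimes>\<^bsub>F2 l\<^esub> f')) - lmul (mag f) * lmul (mag f') \<in> JZ CARD('l) n d"
      using JZ_trans[OF lmul_mag_approx[OF F.pro_closed[OF f f'] N F.m_closed[OF g(1) g'(1)] ff] JZ_sym] by simp
  qed
  then show ?thesis by (simp flip: lmul_mult add: lmul_inject)
qed

lemma mag_of:
  assumes g: "g \<in> carrier free2"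
  shows "mag (pro_of l free2 g) = nc_map of_int (mu g)"
proof -
  have "lmul (mag (pro_of l free2 g)) = fZ (lmul (mu g))"
  proof (rule JZ_eqI)
    fix n d :: nat
    show "lmul (mag (pro_of l free2 g)) - fZ (lmul (mu g)) \<in> JZ CARD('l) n d"
      by (rule lmul_mag_approx[OF F.pro_of_closed[OF g] F.NJ_LN subset_refl g F.pro_of_comp[OF F.NJ_LN]])
  qed
  then show ?thesis by (simp add: fmap_lmul[OF rhom_of_int] lmul_inject)
qed

text \<open>Substituting words into \<open>f\<close> corresponds to substituting their Magnus series
  into that of \<open>f\<close>; this expresses every value of \<open>f\<close> in the hexagon
  through \<open>mag f\<close>.\<close>

lemma mag_evG:
  assumes f: "f \<in> carrier (F2 l)" and a: "a \<in> carrier free2" and b: "b \<in> carrier free2"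
  shows "mag (evG l free2 a b f) = fe nc_const (mag f) (nc_map of_int (mu a)) (nc_map of_int (mu b))"
proof -
  have u: "unip (lmul (mu a))" "unip (lmul (mu b))" using mu_hom(3) a b by (auto intro: filtered_hom_unip[OF filtered_hom_lmul])
  have u': "unip (nc_map of_int (mu a) :: (xy, 'l padic_int) ncfps)" "unip (nc_map of_int (mu b) :: (xy, 'l padic_int) ncfps)"
    using mu_hom(3) a b by (auto intro: filtered_hom_unip[OF filtered_hom_nc_map[OF rhom_of_int]])
  have "lmul (mag (evG l free2 a b f)) = fm f (lmul (mu a)) (lmul (mu b))"
  proof (rule JZ_eqI)
    fix n d :: nat
    let ?M = "F.NJ (n + d) d"
    from EL_coset[OF prime_l group_free2 f _ F.NJ_LN[of "n + d" d], of "[(a, b)]"] a b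
    obtain N0 where N0: "N0 \<in> F.LN" "\<forall>N\<in>F.LN. N \<subseteq> N0 \<longrightarrow> (\<forall>g\<in>carrier free2. f N = N #>\<^bsub>free2\<^esub> g \<longrightarrow>
        EL l free2 [(a, b)] f ?M = ?M #>\<^bsub>free2\<^esub> WL free2 [(a, b)] g)"
      by (elim meta_mp[elim_format] bexE) auto
    define N where "N = N0 \<inter> ?M"
    have N: "N \<in> F.LN" "N \<subseteq> N0" "N \<subseteq> ?M" unfolding N_def by (auto intro: F.LN_Int F.NJ_LN N0)
    obtain g where g: "g \<in> carrier free2" "f N = N #>\<^bsub>free2\<^esub> g" using F.pro_rep[OF f N(1)] by blast
    note fc = flift_closed[OF group_free2 a b g(1)]
    have "evG l free2 a b f ?M = ?M #>\<^bsub>free2\<^esub> flift free2 a b g"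
      using N0(2)[rule_format, OF N(1,2) g] fc evG_closed[OF prime_l group_free2 a b f] group.is_monoid[OF F.group_pro]
      by (simp add: monoid.r_one)
    from lmul_mag_approx[OF evG_closed[OF prime_l group_free2 a b f] F.NJ_LN subset_refl fc this]
    have 1: "lmul (mag (evG l free2 a b f)) - fZ (lmul (mu (flift free2 a b g))) \<in> JZ CARD('l) n d" .
    have h: "(\<lambda>g. lmul (mu (flift free2 a b g))) \<in> hom free2 mulmon"
      using flift_hom(1)[OF group_free2 a b] flift_closed[OF group_free2 a b]
      by (intro homI) (auto simp: hom_mult mu_hom lmul_mult)
    have "lmul (mu (flift free2 a b g)) = rl (lmul (mu a)) (lmul (mu b)) g"
      by (rule hom_rl_eqI[OF h _ u _ _ g(1)]) (simp_all add: flift_hom(2,3)[OF group_free2 a b] mu_hom)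
    then have 2: "fZ (lmul (mu (flift free2 a b g))) = (rl (fZ (lmul (mu a))) (fZ (lmul (mu b))) g :: (xy, 'l padic_int) fmat)"
      using filtered_hom_rl[OF filtered_hom_fZ u g(1)] by simp
    have 3: "fm f (lmul (mu a)) (lmul (mu b)) - rl (fZ (lmul (mu a))) (fZ (lmul (mu b))) g \<in> JZ CARD('l) n d"
      unfolding fm_def using fe_mag_approx[OF f N(1,3) g filtered_hom_unip[OF filtered_hom_fZ u(1)] filtered_hom_unip[OF filtered_hom_fZ u(2)]]
      by (simp add: l_def)
    show "lmul (mag (evG l free2 a b f)) - fm f (lmul (mu a)) (lmul (mu b)) \<in> JZ CARD('l) n d"
      by (rule JZ_trans[OF 1[unfolded 2] JZ_sym[OF 3]])
  qed
  also have "\<dots> = lmul (fe nc_const (mag f) (nc_map of_int (mu a)) (nc_map of_int (mu b)))"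
    by (simp add: fm_def filtered_hom_fe[OF filtered_hom_lmul u'] lmul_const fmap_lmul[OF rhom_of_int])
  finally show ?thesis by (simp add: lmul_inject)
qed

text \<open>Explicit form of \<open>F2_series\<close>: the Magnus series with the exponentials of
  the variables in place of \<open>x\<close> and \<open>y\<close>.\<close>

definition ser :: "pro_free2 \<Rightarrow> (xy, 'l padic) ncfps" where
  "ser f = fe nc_const (nc_map qp (mag f)) (nc_exp (nc_var gX)) (nc_exp (nc_var gY))"

lemma exp_xy_fil: "\<forall>g. case_xy (nc_exp (nc_var gX) - 1) (nc_exp (nc_var gY) - 1) g \<in> fil 1"
  by (intro case_xy_fil unip_fil unip_exp_var)

lemma ser_mult: "f \<in> carrier (F2 l) \<Longrightarrow> f' \<in> carrier (F2 l) \<Longrightarrow> ser (f \<otimes>\<^bsub>F2 l\<^esub> f') = ser f * ser f'"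
  by (simp add: ser_def fe_def mag_mult filtered_homD(4)[OF filtered_hom_nc_map[OF rhom_qp]] filtered_homD(4)[OF filtered_hom_ev[OF exp_xy_fil scal_nc_const]])

lemma ser_of:
  assumes g: "g \<in> carrier free2"
  shows "ser (pro_of l free2 g) = rl (nc_exp (nc_var gX)) (nc_exp (nc_var gY)) g"
proof -
  have "nc_map qp (nc_map of_int (mu g)) = (nc_map of_int (mu g) :: (xy, 'l padic) ncfps)"
    by (rule ncfps_eqI) (simp add: nc_simps rhom_of_int_eq[OF rhom_qp])
  then show ?thesis
    using fe_mu[OF scal_nc_const unip_exp_var unip_exp_var g] by (simp add: ser_def mag_of[OF g])
qed

text \<open>Continuity in spite of denominators: only finitely many coefficients of the exponentials
  enter up to degree \<open>d\<close>, so the loss of precision is bounded.\<close>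

lemma ser_approx:
  "\<exists>N\<in>F.LN. \<forall>f\<in>carrier (F2 l). \<forall>f'\<in>carrier (F2 l). f N = f' N \<longrightarrow>
    (\<forall>w. length w \<le> d \<longrightarrow> nc_coeff (ser f) w - nc_coeff (ser f') w \<in> pball n)"
proof -
  let ?\<alpha> = "case_xy (nc_exp (nc_var gX) - 1) (nc_exp (nc_var gY) - 1) :: xy \<Rightarrow> (xy, 'l padic) ncfps"
  let ?e = "\<lambda>v w. nc_coeff (prod_list (map ?\<alpha> v)) w"
  let ?W = "{w :: xy list. length w \<le> d}"
  obtain c where c: "\<And>v w n y. y \<in> pball (n + c v w) \<Longrightarrow> y * ?e v w \<in> pball n"
    using padic_bounded[of "?e _ _"] by metis
  \<comment> \<open>A sum of finitely many bounds serves as a common bound for all words up to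
    length \<open>d\<close>.\<close>
  define C where "C = (\<Sum>(v, w)\<in>?W \<times> ?W. c v w)"
  have C: "c v w \<le> C" if "length v \<le> d" "length w \<le> d" for v w
    unfolding C_def using that member_le_sum[of "(v, w)" "?W \<times> ?W" "\<lambda>(v, w). c v w"] by simp
  let ?N = "F.NJ ((n + C) + d) d"
  have "nc_coeff (ser f) w - nc_coeff (ser f') w \<in> pball n"
    if f: "f \<in> carrier (F2 l)" "f' \<in> carrier (F2 l)" "f ?N = f' ?N" and w: "length w \<le> d" for f f' w
  proof -
    obtain g where g: "g \<in> carrier free2" "f ?N = ?N #>\<^bsub>free2\<^esub> g" using F.pro_rep[OF f(1) F.NJ_LN] by blast
    have g': "f' ?N = ?N #>\<^bsub>free2\<^esub> g" using g f(3) by simp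
    have "(qp (nc_coeff (mag f) v) - qp (nc_coeff (mag f') v)) * ?e v w \<in> pball n" if v: "length v \<le> d" for v
    proof -
      have "of_nat l ^ (n + C) dvd (nc_coeff (mag f) v - of_int (nc_coeff (mu g) v)) - (nc_coeff (mag f') v - of_int (nc_coeff (mu g) v))"
        by (rule dvd_diff[OF mag_approx[OF f(1) F.NJ_LN subset_refl g v] mag_approx[OF f(2) F.NJ_LN subset_refl g(1) g' v]])
      then have "qp (nc_coeff (mag f) v - nc_coeff (mag f') v) \<in> pball (n + C)"
        by (simp add: qp_pball l_def)
      then have "qp (nc_coeff (mag f) v - nc_coeff (mag f') v) \<in> pball (n + c v w)"
        by (rule pball_mono[rotated]) (simp add: C[OF v w])
      then have "qp (nc_coeff (mag f) v) - qp (nc_coeff (mag f') v) \<in> pball (n + c v w)"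
        using rhomD(3)[OF rhom_qp, of "nc_coeff (mag f) v" "- nc_coeff (mag f') v"] by (simp add: qp_minus)
      then show ?thesis by (rule c)
    qed
    then have "(\<Sum>v | length v < length w + 1. (qp (nc_coeff (mag f) v) - qp (nc_coeff (mag f') v)) * ?e v w) \<in> pball n"
      using w by (intro pball_sum) auto
    then show ?thesis
      by (simp add: ser_def fe_def nc_coeff_ev[OF exp_xy_fil] nc_simps left_diff_distrib sum_subtractf)
  qed
  then show ?thesis by (intro bexI[of _ ?N]) (auto simp: F.NJ_LN)
qed

text \<open>Words have group-like series, and each group-like condition involves finitely many
  coefficients, so it passes to the limit.\<close>

lemma ser_group_like:
  assumes f: "f \<in> carrier (F2 l)" shows "group_like (ser f)"
proof -
  have approx: "\<exists>g\<in>carrier free2. \<forall>w. length w \<le> d \<longrightarrow> nc_coeff (ser f) w - nc_coeff (ser (pro_of l free2 g)) w \<in> pball n" for d n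
  proof -
    obtain N where N: "N \<in> F.LN" "\<forall>f\<in>carrier (F2 l). \<forall>f'\<in>carrier (F2 l). f N = f' N \<longrightarrow>
      (\<forall>w. length w \<le> d \<longrightarrow> nc_coeff (ser f) w - nc_coeff (ser f') w \<in> pball n)"
      using ser_approx by blast
    obtain g where g: "g \<in> carrier free2" "f N = N #>\<^bsub>free2\<^esub> g" using F.pro_rep[OF f N(1)] by blast
    then show ?thesis using N(2)[rule_format, OF f F.pro_of_closed[OF g(1)]] by (intro bexI[of _ g]) (simp_all add: F.pro_of_comp[OF N(1)])
  qed
  have gl: "group_like (ser (pro_of l free2 g))" if "g \<in> carrier free2" for g
    unfolding ser_of[OF that] by (rule rl_group_like[OF group_like_exp group_like_exp that])
  have "nc_coeff (ser f) [] = 1"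
  proof -
    have "nc_coeff (ser f) [] - 1 \<in> pball n" for n
    proof -
      obtain g where "g \<in> carrier free2" "\<forall>w. length w \<le> 0 \<longrightarrow> nc_coeff (ser f) w - nc_coeff (ser (pro_of l free2 g)) w \<in> pball n"
        using approx[of 0 n] by blast
      then show ?thesis using group_likeD(1)[OF gl] by auto
    qed
    from pball_Inter[OF this] show ?thesis by simp
  qed
  moreover have "coproduct_coeff (ser f) u v = nc_coeff (ser f) u * nc_coeff (ser f) v" for u v
  proof -
    let ?x = "nc_coeff (ser f) u" and ?y = "nc_coeff (ser f) v"
    obtain c where c: "\<And>n z. z \<in> pball (n + c) \<Longrightarrow> z * ?x \<in> pball n" using padic_bounded[of ?x] by blast
    obtain c' where c': "\<And>n z. z \<in> pball (n + c') \<Longrightarrow> z * ?y \<in> pball n" using padic_bounded[of ?y] by blast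
    have "coproduct_coeff (ser f) u v - ?x * ?y \<in> pball n" for n
    proof -
      \<comment> \<open>The extra digits pay for multiplication by the fixed coefficients at
        \<open>u\<close> and \<open>v\<close>.\<close>
      let ?n = "n + c + c'"
      obtain g where g: "g \<in> carrier free2" "\<forall>w. length w \<le> length u + length v \<longrightarrow>
          nc_coeff (ser f) w - nc_coeff (ser (pro_of l free2 g)) w \<in> pball ?n"
        using approx[of "length u + length v" ?n] by blast
      let ?s = "ser (pro_of l free2 g)"
      let ?dx = "?x - nc_coeff ?s u" and ?dy = "?y - nc_coeff ?s v"
      have 1: "coproduct_coeff (ser f) u v - coproduct_coeff ?s u v \<in> pball n"
      proof -
        have "(nc_coeff (ser f) w - nc_coeff ?s w) * of_nat k \<in> pball n" if "length w = length u + length v" for w k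
        proof -
          have "(of_nat k :: 'l padic) \<in> pball 0" by (simp add: of_nat_qp qp_pball)
          moreover have "nc_coeff (ser f) w - nc_coeff ?s w \<in> pball n"
            using g(2) that by (intro pball_mono[of n ?n]) auto
          ultimately show ?thesis using pball_mult[of _ n _ 0] by fastforce
        qed
        then have "(\<Sum>w | length w = length u + length v. (nc_coeff (ser f) w - nc_coeff ?s w) * of_nat (coproduct_word w u v)) \<in> pball n"
          by (intro pball_sum) auto
        then show ?thesis by (simp add: coproduct_coeff_def left_diff_distrib sum_subtractf)
      qed
      have d: "?dx \<in> pball ?n" "?dy \<in> pball ?n" using g(2) by auto
      have "?dx * ?y \<in> pball n" using pball_mono[of "n + c'" ?n ?dx] d(1) by (intro c') simp
      moreover have "?dy * ?x \<in> pball n" using pball_mono[of "n + c" ?n ?dy] d(2) by (intro c) simp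
      moreover have "?dx * ?dy \<in> pball n" by (rule pball_mono[OF _ pball_mult[OF d]]) simp
      ultimately have "?dx * ?y + ?dy * ?x - ?dx * ?dy \<in> pball n" by (intro pball_diff pball_add)
      then have "?x * ?y - nc_coeff ?s u * nc_coeff ?s v \<in> pball n" by (simp add: algebra_simps)
      from pball_diff[OF 1 this] show ?thesis using group_likeD(2)[OF gl[OF g(1)], of u v] by simp
    qed
    from pball_Inter[OF this] show ?thesis by simp
  qed
  ultimately show ?thesis by (simp add: group_like_def)
qed

text \<open>\<open>ser\<close> is a continuous homomorphism to the group-like series with the
  prescribed values on generators, and these properties characterise
  \<open>F2_series\<close>.\<close>

lemma F2_series_eq:
  assumes f: "f \<in> carrier (F2 l)"
  shows "F2_series f = ser f"
proof -
  have "F2_eval l group_like_group group_like_topology (nc_exp (nc_var gX)) (nc_exp (nc_var gY)) f = ser f"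
  proof (rule F2_eval_eqI[OF prime_l monoid_group_like _ Hausdorff_group_like _ _ _ _ f])
    show "u = \<one>\<^bsub>group_like_group\<^esub>" if "u \<in> carrier group_like_group" "u \<otimes>\<^bsub>group_like_group\<^esub> u = u" for u :: "(xy, 'l padic) ncfps"
    proof -
      have u: "unip u" using that(1) by (simp add: unip_ncfps_iff group_likeD)
      have "uinv u * (u * u) = uinv u * u" using that(2) by simp
      then show ?thesis using uinv_cancel[OF u] uinv_left[OF u] by simp
    qed
    show "ser \<in> hom (F2 l) group_like_group"
      by (rule homI) (simp_all add: ser_group_like ser_mult)
    show "ser (F2_x l) = nc_exp (nc_var gX)" "ser (F2_y l) = nc_exp (nc_var gY)"
      by (simp_all add: ser_of rl_hom unip_exp_var)
    show "continuous_map (pro_topology l free2) group_like_topology ser"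
    proof (rule continuous_group_likeI)
      show "group_like (ser x)" if "x \<in> topspace (pro_topology l free2)" for x
        using that by (simp add: F.topspace_pro ser_group_like)
      fix w
      show "continuous_map (pro_topology l free2) padic_topology (\<lambda>x. nc_coeff (ser x) w)"
      proof (rule continuous_padicI)
        fix x n assume "x \<in> topspace (pro_topology l free2)"
        then have x: "x \<in> carrier (F2 l)" by (simp add: F.topspace_pro)
        obtain N where N: "N \<in> F.LN" "\<forall>f\<in>carrier (F2 l). \<forall>f'\<in>carrier (F2 l). f N = f' N \<longrightarrow>
          (\<forall>v. length v \<le> length w \<longrightarrow> nc_coeff (ser f) v - nc_coeff (ser f') v \<in> pball n)"
          using ser_approx by blast
        have xN: "x N \<in> rcosets\<^bsub>free2\<^esub> N" using x N(1) by (simp add: F.pro_mem_iff)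
        let ?U = "{y \<in> topspace (pro_topology l free2). y N \<in> {x N}}"
        have "openin (pro_topology l free2) ?U"
          by (rule openin_continuous_map_preimage[OF F.continuous_pro_comp[OF N(1)]]) (simp add: xN)
        moreover have "x \<in> ?U" using x by (simp add: F.topspace_pro)
        moreover have "\<forall>y\<in>?U. nc_coeff (ser y) w - nc_coeff (ser x) w \<in> pball n"
          using N(2) x by (auto simp: F.topspace_pro)
        ultimately show "\<exists>U. openin (pro_topology l free2) U \<and> x \<in> U \<and> (\<forall>y\<in>U. nc_coeff (ser y) w - nc_coeff (ser x) w \<in> pball n)"
          by blast
      qed
    qed
  qed
  then show ?thesis by (simp add: F2_series_def l_def)
qed

end

section \<open>The hexagon relation in the algebraic closure\<close>

context pentagon_free
begin

abbreviation "eX \<equiv> nc_exp (nc_var gX) :: (xy, 'l padic alg_closure) ncfps"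
abbreviation "eY \<equiv> nc_exp (nc_var gY) :: (xy, 'l padic alg_closure) ncfps"

definition Psi :: "(xy, 'l padic alg_closure) ncfps \<Rightarrow> (xy, 'l padic alg_closure) ncfps" where
  "Psi = ev nc_const (case_xy (eX - 1) (eY - 1))"

lemma Psi_fil: "\<forall>g. case_xy (eX - 1) (eY - 1) g \<in> fil 1"
  by (intro case_xy_fil unip_fil unip_exp_var)

lemma filtered_hom_Psi: "filtered_hom Psi"
  unfolding Psi_def by (rule filtered_hom_ev[OF Psi_fil scal_nc_const])

lemma Psi_const: "Psi (nc_const c) = nc_const c"
  unfolding Psi_def by (rule ev_const[OF scal_nc_const])

lemma F2_series_ac_eq:
  assumes "g \<in> carrier (F2 l)"
  shows "F2_series_ac g = Psi (nc_map qa (mag g))"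
proof -
  have e: "nc_map to_ac (nc_exp (nc_var h)) = (nc_exp (nc_var h) :: (xy, 'l padic alg_closure) ncfps)" for h
    using to_ac_of_nat[of "fact _", where 'a = "'l padic"]
    by (intro ncfps_eqI) (simp add: nc_simps nc_coeff_exp_var)
  have m: "nc_map to_ac (nc_map qp s) = nc_map qa s" for s :: "(xy, 'l padic_int) ncfps"
    by (rule ncfps_eqI) (simp add: nc_simps qa_def)
  have "nc_map to_ac (ser g) = fe (\<lambda>c. nc_const (to_ac c)) (nc_map qp (mag g)) eX eY"
    unfolding ser_def
    by (simp add: filtered_hom_fe[OF filtered_hom_nc_map[OF rhom_to_ac] unip_exp_var unip_exp_var] nc_map_const[OF rhom_to_ac] e)
  then show ?thesis
    by (simp add: F2_series_ac_def F2_series_eq[OF assms] fe_def ev_map Psi_def m)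
qed

lemma F2_series_ac_of:
  assumes "g \<in> carrier free2"
  shows "F2_series_ac (pro_of l free2 g) = Psi (nc_map of_int (mu g))"
proof -
  have "nc_map qa (nc_map of_int (mu g)) = (nc_map of_int (mu g) :: (xy, 'l padic alg_closure) ncfps)"
    by (rule ncfps_eqI) (simp add: nc_simps rhom_of_int_eq[OF rhom_qa])
  then show ?thesis by (simp add: F2_series_ac_eq F.pro_of_closed assms mag_of)
qed

lemma F2_series_ac_subst:
  assumes "a \<in> carrier free2" "b \<in> carrier free2"
  shows "F2_series_ac (F2_subst l f (pro_of l free2 a) (pro_of l free2 b))
    = Psi (fe nc_const K (nc_map of_int (mu a)) (nc_map of_int (mu b)))"
proof -
  have u: "unip (nc_map of_int (mu c) :: (xy, 'l padic_int) ncfps)" if "c \<in> carrier free2" for c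
    using mu_hom(3)[OF that] by (rule filtered_hom_unip[OF filtered_hom_nc_map[OF rhom_of_int]])
  have i: "nc_map qa (nc_map of_int s) = (nc_map of_int s :: (xy, 'l padic alg_closure) ncfps)" for s
    by (rule ncfps_eqI) (simp add: nc_simps rhom_of_int_eq[OF rhom_qa])
  have "F2_series_ac (evG l free2 a b f) = Psi (nc_map qa (mag (evG l free2 a b f)))"
    by (rule F2_series_ac_eq[OF evG_closed[OF prime_l group_free2 assms f_closed]])
  also have "nc_map qa (mag (evG l free2 a b f)) = fe (\<lambda>c. nc_const (qa c)) (mag f) (nc_map of_int (mu a)) (nc_map of_int (mu b))"
    by (simp add: mag_evG[OF f_closed assms] filtered_hom_fe[OF filtered_hom_nc_map[OF rhom_qa] u u] assms nc_map_const[OF rhom_qa] i)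
  finally show ?thesis by (simp add: evG_def fe_def ev_map K_def)
qed

lemma nc_powr_Psi: "unip a \<Longrightarrow> nc_powr (Psi a) m = Psi (pw nc_const m a)"
  by (simp add: nc_powr_eq_pw filtered_hom_pw[OF filtered_hom_Psi _ scal_nc_const] Psi_const)

text \<open>All factors of the hexagon are images under \<open>Psi\<close> of the factors of
  \<open>H\<close>, since this substitution commutes with powers.\<close>

lemma hexagon_iff: "hexagon lam f \<longleftrightarrow> Psi (H ((lam - 1) / 2)) = 1"
proof -
  let ?x = "free2_gen gX" and ?y = "free2_gen gY"
  let ?z = "inv\<^bsub>free2\<^esub> (?x \<otimes>\<^bsub>free2\<^esub> ?y)"
  interpret P: group "F2 l" by (rule F.group_pro)
  have c: "?z \<in> carrier free2" by simp
  have z: "inv\<^bsub>F2 l\<^esub> (F2_x l \<otimes>\<^bsub>F2 l\<^esub> F2_y l) = pro_of l free2 ?z"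
    by (rule P.inv_equality) (simp_all add: F.pro_of_closed F.l_inv flip: F.pro_of_mult F.pro_of_one)
  have muz: "mu ?z = uinv (mx * my)"
  proof (rule uinv_unique)
    have "mu (?x \<otimes>\<^bsub>free2\<^esub> ?y) * mu ?z = mu \<one>\<^bsub>free2\<^esub>"
      by (simp flip: mu_hom(2))
    then show "mx * my * mu ?z = 1" by (simp add: mu_hom)
  qed (intro unip_mult unip_var)
  have u: "unip (mx :: (xy, int) ncfps)" "unip (my :: (xy, int) ncfps)" "unip (mx * my :: (xy, int) ncfps)"
    by (intro unip_mult unip_var)+
  have m: "nc_map of_int (mu ?x) = (mx :: (xy, 'l padic alg_closure) ncfps)" "nc_map of_int (mu ?y) = (my :: (xy, 'l padic alg_closure) ncfps)"
    "nc_map of_int (mu ?z) = uinv (mx * my :: (xy, 'l padic alg_closure) ncfps)"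
    using filtered_hom_uinv[OF filtered_hom_nc_map[OF rhom_of_int] u(3)]
    by (simp_all add: mu_hom muz filtered_homD[OF filtered_hom_nc_map[OF rhom_of_int]] nc_map_var[OF rhom_of_int])
  have u': "unip (mx :: (xy, 'l padic alg_closure) ncfps)" "unip (my :: (xy, 'l padic alg_closure) ncfps)"
    "unip (uinv (mx * my :: (xy, 'l padic alg_closure) ncfps))"
    by (intro unip_mult unip_var unip_uinv)+
  have "hexagon lam f \<longleftrightarrow> Psi (fe nc_const K (uinv (mx * my)) mx) * Psi (pw nc_const ((lam - 1) / 2) (uinv (mx * my))) *
      Psi (fe nc_const K my (uinv (mx * my))) * Psi (pw nc_const ((lam - 1) / 2) my) * Psi (fe nc_const K mx my) *
      Psi (pw nc_const ((lam - 1) / 2) mx) = 1"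
    unfolding hexagon_def Let_def l_def[symmetric] z
    by (simp only: F2_series_ac_subst F2_series_ac_of c free2_gen_closed m nc_powr_Psi u')
  then show ?thesis by (simp only: H_def hx_def Let_def filtered_homD(4)[OF filtered_hom_Psi])
qed

text \<open>The exponential of a variable minus 1 begins with that variable, so the coefficient of
  \<open>XY\<close> is the same in both expansions.\<close>

lemma c2_eq: "to_ac (c2 f) = nc_coeff K [gX, gY]"
proof -
  let ?F = "nc_map qp (mag f)"
  have "nc_coeff (ser f - (nc_const (nc_coeff ?F []) + nc_const (nc_coeff ?F [gX]) * (nc_exp (nc_var gX) - 1) + nc_const (nc_coeff ?F [gY]) * (nc_exp (nc_var gY) - 1)
    + nc_const (nc_coeff ?F [gX, gX]) * ((nc_exp (nc_var gX) - 1) * (nc_exp (nc_var gX) - 1)) + nc_const (nc_coeff ?F [gX, gY]) * ((nc_exp (nc_var gX) - 1) * (nc_exp (nc_var gY) - 1))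
    + nc_const (nc_coeff ?F [gY, gX]) * ((nc_exp (nc_var gY) - 1) * (nc_exp (nc_var gX) - 1)) + nc_const (nc_coeff ?F [gY, gY]) * ((nc_exp (nc_var gY) - 1) * (nc_exp (nc_var gY) - 1)))) [gX, gY] = 0"
    using fe_expand[OF scal_nc_const unip_exp_var unip_exp_var, of ?F gX gY] by (simp add: ser_def fil_ncfps_iff)
  then have "nc_coeff (ser f) [gX, gY] = qp (nc_coeff (mag f) [gX, gY])"
    by (simp add: nc_simps nc_const_mult nc_coeff_times nc_coeff_exp_var)
  then show ?thesis by (simp add: c2_def F2_series_eq[OF f_closed] K_def nc_simps qa_def)
qed

text \<open>Completing the square: \<open>(2 m + 1)^2 = 4 (m^2 + m) + 1\<close>, and four times six
  is 24.\<close>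

lemma quadratic_iff: "m * m + m = 6 * nc_coeff K [gX, gY] \<longleftrightarrow> (2 * m + 1) ^ 2 = to_ac (24 * c2 f + 1)"
proof -
  have "(2 * m + 1) ^ 2 - to_ac (24 * c2 f + 1) = 4 * ((m * m + m) - 6 * nc_coeff K [gX, gY])"
    by (simp add: c2_eq[symmetric] power2_eq_square algebra_simps)
  then show ?thesis by (metis diff_eq_eq diff_self mult_eq_0_iff right_minus_eq zero_neq_numeral)
qed

text \<open>The degree two part makes the equation necessary. Conversely it removes the only
  obstruction, so either square root solves the full hexagon.\<close>

lemma hexagon_root:
  fixes lam :: "'l padic alg_closure"
  shows "hexagon lam f \<longleftrightarrow> lam ^ 2 = to_ac (24 * c2 f + 1)"
proof -
  let ?m = "(lam - 1) / 2"
  have lam: "2 * ?m + 1 = lam" by simp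
  show ?thesis
  proof
    assume "hexagon lam f"
    then have "Psi (H ?m) = 1" by (simp only: hexagon_iff)
    then have "hx nc_const K ?m eX eY = 1"
      by (simp only: hx_universal[OF scal_nc_const unip_exp_var unip_exp_var] H_def Psi_def)
    moreover have "nc_exp (nc_var g) - 1 - nc_var g \<in> (fil 2 :: (xy, 'l padic alg_closure) ncfps set)" for g
      unfolding fil_ncfps_iff
    proof (intro allI impI)
      fix w :: "xy list" assume "length w < 2"
      then have "w = [] \<or> (\<exists>h. w = [h])" by (cases w) auto
      then show "nc_coeff (nc_exp (nc_var g) - 1 - nc_var g :: (xy, 'l padic alg_closure) ncfps) w = 0"
        by (auto simp: nc_simps nc_coeff_exp_var)
    qed
    ultimately have "?m * ?m + ?m = 6 * nc_coeff K [gX, gY]"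
      by (intro hexagon_quadratic[OF unip_exp_var unip_exp_var])
    then show "lam ^ 2 = to_ac (24 * c2 f + 1)" unfolding quadratic_iff lam .
  next
    assume "lam ^ 2 = to_ac (24 * c2 f + 1)"
    then have "?m * ?m + ?m = 6 * nc_coeff K [gX, gY]" unfolding quadratic_iff lam .
    with cocycle_K have "H ?m = 1" by (rule defect_vanishes)
    then show "hexagon lam f" by (simp add: hexagon_iff filtered_homD(2)[OF filtered_hom_Psi])
  qed
qed

end

theorem corollary12:
  fixes l :: nat and f :: pro_free2
  assumes "l = CARD('l::prime_card)"
    and "f \<in> carrier (F2 l)"
    and "pentagon l f"
  shows "(\<exists>lam :: 'l padic alg_closure. hexagon lam f \<and> two_cycle l f) \<and>
    (\<forall>lam :: 'l padic alg_closure. hexagon lam f \<and> two_cycle l f \<longrightarrow>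
       lam ^ 2 = to_ac (24 * c2 f + 1))"
proof -
  interpret pentagon_free l "TYPE('l)" f
    using assms by unfold_locales
  obtain lam :: "'l padic alg_closure" where "lam ^ 2 = to_ac (24 * c2 f + 1)"
    using nth_root_exists[of 2 "to_ac (24 * c2 f + 1)"] by auto
  then show ?thesis using hexagon_root two_cycle(1)[OF pent] by blast
qed

end
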